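(* Let $f=(f_j)_{j=1}^J$ be holomorphic functions on the unit polydisk $B^{(n)}\subset\mathbb{C}^n$, let $\delta>0$, and assume $\int_{B^{(n)}}|f(z)|^{-\delta}dV_1\cdots dV_n<\infty$. Assume one of: (a) $n=1$; (b) $n=2$; (c) $n=3$ and $\delta<4/N$, where $N$ is the lowest of the orders of vanishing at the origin of the $f_j$ (the condition being vacuous if $N=0$). Then for every $0<r<1$ the functional $$g=(g_j)_{j=1}^J\longmapsto\int_{B_r^{(n)}}|g(z)|^{-\delta}dV_1\cdots dV_n,$$ defined on $J$-vectors of holomorphic functions on $B^{(n)}$, is continuous at $f$ with respect to the norm $\|g\|=\sup_{B^{(n)}}|g(z)|$; that is, for every $\tau>0$ there is $\rho>0$ such that $\|g-f\|<\rho$ implies that $\int_{B_r^{(n)}}|g|^{-\delta}$ is finite and differs from $\int_{B_r^{(n)}}|f|^{-\delta}$ by less than $\tau$.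
   Context: $|g(z)|^2=\sum_{j=1}^J|g_j(z)|^2$. $B_r^{(n)}$ is the polydisk $\{|z_i|<r\}$ in $\mathbb{C}^n$ and $B^{(n)}=B_1^{(n)}$; $dV_1\cdots dV_n$ is Lebesgue measure on $\mathbb{C}^n$. The order of vanishing at $0$ of a holomorphic function is the degree of the lowest nonzero homogeneous term of its Taylor expansion. *)

theory Defs
  imports "HOL-Analysis.Analysis"
begin

(* Points of C^n are vectors complex^'n; the index type 'n has CARD('n) = n.
   Lebesgue measure on C^n = R^{2n} is lborel on complex^'n. *)

definition polydisk :: "real \<Rightarrow> (complex^'n) set" where
  "polydisk r = {z. \<forall>i. norm (z $ i) < r}"

definition holo_n :: "(complex^'n \<Rightarrow> complex) \<Rightarrow> (complex^'n) set \<Rightarrow> bool" where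
  "holo_n f U \<longleftrightarrow> open U \<and>
     (\<forall>z\<in>U. \<exists>L. (f has_derivative L) (at z) \<and> (\<forall>c v. L (c *s v) = c * L v))"

definition holo_vec :: "(complex^'n \<Rightarrow> complex^'j) \<Rightarrow> (complex^'n) set \<Rightarrow> bool" where
  "holo_vec g U \<longleftrightarrow> (\<forall>j. holo_n (\<lambda>z. g z $ j) U)"

definition negpow :: "real \<Rightarrow> real \<Rightarrow> ennreal" where
  "negpow \<delta> x = (if x = 0 then \<infinity> else ennreal (x powr (- \<delta>)))"

(* integral over B_r of |g|^{-delta}, |g|^2 = sum_j |g_j|^2 is the Euclidean norm on complex^'j *)
definition negint :: "real \<Rightarrow> real \<Rightarrow> (complex^'n \<Rightarrow> complex^'j) \<Rightarrow> ennreal" where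
  "negint \<delta> r g = (\<integral>\<^sup>+ z. indicator (polydisk r) z * negpow \<delta> (norm (g z)) \<partial>lborel)"

(* degree-k homogeneous term of the Taylor expansion at 0: f(tz) = sum_k t^k P_k(z) *)
definition homog_term :: "(complex^'n \<Rightarrow> complex) \<Rightarrow> nat \<Rightarrow> complex^'n \<Rightarrow> complex" where
  "homog_term f k z = (deriv ^^ k) (\<lambda>t. f (t *s z)) 0 / of_nat (fact k)"

definition vanishing_order :: "(complex^'n \<Rightarrow> complex) \<Rightarrow> nat" where
  "vanishing_order f = (LEAST k. \<exists>z. homog_term f k z \<noteq> 0)"

definition min_vanishing_order :: "(complex^'n \<Rightarrow> complex^'j) \<Rightarrow> nat" where
  "min_vanishing_order f = Min (range (\<lambda>j. vanishing_order (\<lambda>z. f z $ j)))"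

definition supdist :: "(complex^'n \<Rightarrow> complex^'j) \<Rightarrow> (complex^'n \<Rightarrow> complex^'j) \<Rightarrow> ennreal" where
  "supdist g f = (SUP z\<in>polydisk 1. ennreal (norm (g z - f z)))"

end

theory Submission
  imports Defs "HOL-Complex_Analysis.Complex_Analysis"
begin

text \<open>
  Write \<open>B\<^sub>r\<close> for the polydisk of radius \<open>r\<close>. The theorem reduces to a uniform bound: for some
  \<open>\<delta>' > \<delta>\<close> the integrals of \<open>|g|\<^sup>-\<^sup>\<delta>\<^sup>'\<close> over \<open>B\<^sub>r\<close> are bounded for all \<open>g\<close> uniformly close to \<open>f\<close>.
  Then the part of the integral of \<open>|g|\<^sup>-\<^sup>\<delta>\<close> over \<open>{|g| < \<theta>}\<close> is \<open>O(\<theta>\<^sup>\<delta>\<^sup>'\<^sup>-\<^sup>\<delta>)\<close> uniformly in \<open>g\<close>,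
  and the truncated integrands converge uniformly.

  If the bound fails, there are polynomial vectors \<open>q\<^sub>m\<close> converging to \<open>f\<close> and \<open>\<epsilon>\<^sub>m \<rightarrow> 0\<close>, \<open>d\<^sub>m \<rightarrow> \<delta>\<close>
  such that the integrals over \<open>B\<^sub>r\<close> of the densities \<open>w\<^sub>m\<close>, the powers \<open>-d\<^sub>m/2\<close> of \<open>|q\<^sub>m|\<^sup>2 + \<epsilon>\<^sub>m\<close>, are
  unbounded. Let \<open>y\<close> be the \<open>k\<close>-th root of \<open>|q\<^sub>m|\<^sup>2 + 4\<^sup>-\<^sup>k\<close> and let \<open>\<Theta>\<close> be a \<open>C\<^sup>1\<close> function vanishing on
  \<open>(-\<infinity>, 1/2]\<close> with \<open>\<Theta>(1) = 1\<close> and \<open>\<Theta>'(1) = 0\<close>. Hoermander's \<open>L\<^sup>2\<close> estimate on the whole space,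
  with the weight \<open>- log w\<^sub>m + y + \<Sum>\<^sub>i |z\<^sub>i/R|\<^sup>2\<^sup>M\<close>, gives an entire \<open>F\<close> such that the integral of
  \<open>|\<Theta>(y) - F|\<^sup>2 w\<^sub>m\<close> over \<open>B\<^sub>R\<close> is at most a constant times that of \<open>\<Theta>'(y)\<^sup>2 y w\<^sub>m\<close>, up to an error
  which is small for large \<open>M\<close>; the summand \<open>y\<close> of the weight controls the antiholomorphic gradient
  of \<open>\<Theta>(y)\<close>. Since \<open>\<Theta>'(y) = 0\<close> where \<open>|q\<^sub>m|\<^sup>2 \<le> 4\<^sup>-\<^sup>k\<close>, the right-hand side converges as \<open>m \<rightarrow> \<infinity>\<close>
  to the integral of \<open>\<Theta>'(y)\<^sup>2 y |f|\<^sup>-\<^sup>\<delta>\<close>, and this tends to \<open>0\<close> as \<open>k \<rightarrow> \<infinity>\<close> because \<open>y \<rightarrow> 1\<close> almost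
  everywhere and \<open>|f|\<^sup>-\<^sup>\<delta>\<close> is integrable. Hence \<open>F\<close> is close to \<open>1\<close> in \<open>L\<^sup>2\<close> for suitable \<open>k\<close> and large
  \<open>m\<close>, so \<open>|F| \<ge> 1/2\<close> on \<open>B\<^sub>r\<close>, and the integral of \<open>w\<^sub>m\<close> is at most four times that of
  \<open>|F|\<^sup>2 w\<^sub>m\<close>, which is bounded.
\<close>

section \<open>Square-integrable functions\<close>

text \<open>Only |f|^(-\<delta>) is known to be integrable, whereas the w_m have exponents slightly
  above \<delta>: near the zeros of f nothing is known about them. The cut-off removes that region
  from the right-hand side of the estimate, and a holomorphic F carries the information back across
  it. Openness of the exponent and semicontinuity are thus obtained in one argument by
  contradiction. The k-th root makes the cut-off cheap. With y = (x + c)^a and x a sum of squared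
  moduli, the complex Hessian of y dominates 1/y times the square of its own gradient; measured by
  it, the gradient of \<Theta>(y) costs \<Theta>'(y)^2 y, bounded independently of k, so that mere
  integrability of |f|^(-\<delta>) suffices for dominated convergence. Polynomials allow the
  estimate to be made on all of C^n, where there is no boundary and the weight has Gaussian decay.
  They are controlled only on a polydisk; the powers |z_i/R|^(2M), with M chosen last, suppress the
  rest. The L^2 theory uses test fields of bounded support, orthogonal projection onto closures of
  their spans, and mollifications, which for weakly holomorphic functions do not depend on the
  scale.\<close>

definition L2 :: "'a measure \<Rightarrow> ('a \<Rightarrow> 'b::euclidean_space) \<Rightarrow> bool" where
  "L2 M f \<longleftrightarrow> f \<in> borel_measurable M \<and> integrable M (\<lambda>x. (norm (f x))\<^sup>2)"

definition n2 :: "'a measure \<Rightarrow> ('a \<Rightarrow> 'b::euclidean_space) \<Rightarrow> real" where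
  "n2 M f = (\<integral>x. (norm (f x))\<^sup>2 \<partial>M)"

lemma n2_nonneg [simp]: "0 \<le> n2 M f"
  by (simp add: n2_def)

lemma L2_measurable [measurable_dest]: "L2 M f \<Longrightarrow> f \<in> borel_measurable M"
  by (simp add: L2_def)

lemma norm_add_sq_le: "(norm (a + b))\<^sup>2 \<le> 2 * (norm a)\<^sup>2 + 2 * (norm (b::'b::real_normed_vector))\<^sup>2"
proof -
  have "(norm (a + b))\<^sup>2 \<le> (norm a + norm b)\<^sup>2"
    by (intro power_mono norm_triangle_ineq) auto
  also have "\<dots> \<le> 2 * (norm a)\<^sup>2 + 2 * (norm b)\<^sup>2"
    using sum_squares_bound[of "norm a" "norm b"] by (simp add: power2_sum)
  finally show ?thesis .
qed

lemma L2_add: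
  assumes "L2 M f" "L2 M g"
  shows "L2 M (\<lambda>x. f x + g x)"
  unfolding L2_def
proof
  show m: "(\<lambda>x. f x + g x) \<in> borel_measurable M"
    using assms by (auto simp: L2_def)
  show "integrable M (\<lambda>x. (norm (f x + g x))\<^sup>2)"
  proof (rule Bochner_Integration.integrable_bound)
    show "integrable M (\<lambda>x. 2 * (norm (f x))\<^sup>2 + 2 * (norm (g x))\<^sup>2)"
      using assms by (auto simp: L2_def)
    show "AE x in M. norm ((norm (f x + g x))\<^sup>2) \<le> norm (2 * (norm (f x))\<^sup>2 + 2 * (norm (g x))\<^sup>2)"
      using norm_add_sq_le by (auto intro!: AE_I2 simp: abs_of_nonneg)
  qed (use m in measurable)
qed

lemma L2_scaleR: "L2 M f \<Longrightarrow> L2 M (\<lambda>x. c *\<^sub>R f x)"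
  by (auto simp: L2_def power_mult_distrib)

lemma L2_diff:
  assumes "L2 M f" "L2 M g"
  shows "L2 M (\<lambda>x. f x - g x)"
  using L2_add[OF assms(1) L2_scaleR[OF assms(2), of "-1"]] by simp

lemma L2_zero [simp]: "L2 M (\<lambda>x. 0)"
  by (simp add: L2_def)

lemma L2_bound:
  assumes "L2 M f" "g \<in> borel_measurable M" "\<And>x. norm (g x) \<le> C * norm (f x)"
  shows "L2 M g"
  unfolding L2_def
proof
  show "integrable M (\<lambda>x. (norm (g x))\<^sup>2)"
  proof (rule Bochner_Integration.integrable_bound)
    show "integrable M (\<lambda>x. C\<^sup>2 * (norm (f x))\<^sup>2)"
      using assms by (auto simp: L2_def)
    have "(norm (g x))\<^sup>2 \<le> C\<^sup>2 * (norm (f x))\<^sup>2" for x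
      using power_mono[OF assms(3)[of x], of 2] by (simp add: power_mult_distrib)
    then show "AE x in M. norm ((norm (g x))\<^sup>2) \<le> norm (C\<^sup>2 * (norm (f x))\<^sup>2)"
      by (auto intro!: AE_I2)
  qed (use assms(2) in measurable)
qed fact

lemma L2_integrable_inner:
  assumes "L2 M f" "L2 M g"
  shows "integrable M (\<lambda>x. f x \<bullet> g x)"
proof (rule Bochner_Integration.integrable_bound)
  show "integrable M (\<lambda>x. (norm (f x))\<^sup>2 + (norm (g x))\<^sup>2)"
    using assms by (auto simp: L2_def)
  have "\<bar>f x \<bullet> g x\<bar> \<le> (norm (f x))\<^sup>2 + (norm (g x))\<^sup>2" for x
  proof -
    have "\<bar>f x \<bullet> g x\<bar> \<le> norm (f x) * norm (g x)"
      by (rule Cauchy_Schwarz_ineq2)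
    also have "\<dots> \<le> 2 * norm (f x) * norm (g x)"
      by (simp)
    also have "\<dots> \<le> (norm (f x))\<^sup>2 + (norm (g x))\<^sup>2"
      by (rule sum_squares_bound)
    finally show ?thesis .
  qed
  then show "AE x in M. norm (f x \<bullet> g x) \<le> norm ((norm (f x))\<^sup>2 + (norm (g x))\<^sup>2)"
    by (auto intro!: AE_I2 simp: abs_of_nonneg)
qed (use assms in measurable)

lemma n2_add:
  assumes "L2 M f" "L2 M g"
  shows "n2 M (\<lambda>x. f x + g x) = n2 M f + 2 * (\<integral>x. f x \<bullet> g x \<partial>M) + n2 M g"
proof -
  have "(norm (f x + g x))\<^sup>2 = (norm (f x))\<^sup>2 + 2 * (f x \<bullet> g x) + (norm (g x))\<^sup>2" for x
    by (simp add: power2_norm_eq_inner inner_add_left inner_add_right inner_commute)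
  then show ?thesis
    using assms L2_integrable_inner[OF assms] by (simp add: n2_def L2_def)
qed

lemma n2_scaleR: "n2 M (\<lambda>x. c *\<^sub>R f x) = c\<^sup>2 * n2 M f"
  by (simp add: n2_def power_mult_distrib)

text \<open>The quadratic t -> n2 (f + t g) is nonnegative; it is evaluated at its minimum. If n2 g
  = 0 it is affine in t, and a nonnegative affine function has slope zero.\<close>

lemma L2_Cauchy_Schwarz:
  assumes "L2 M f" "L2 M g"
  shows "(\<integral>x. f x \<bullet> g x \<partial>M)\<^sup>2 \<le> n2 M f * n2 M g"
proof -
  define b where "b = (\<integral>x. f x \<bullet> g x \<partial>M)"
  have q: "0 \<le> n2 M f + 2 * t * b + t\<^sup>2 * n2 M g" for t
    using n2_add[OF assms(1) L2_scaleR[OF assms(2)], of t] n2_nonneg[of M "\<lambda>x. f x + t *\<^sub>R g x"]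
    by (simp add: n2_scaleR b_def)
  show ?thesis
  proof (cases "n2 M g = 0")
    case True
    have "b = 0"
    proof (rule ccontr)
      assume "b \<noteq> 0"
      then show False
        using q[of "- (n2 M f + 1) / (2 * b)"] True by (simp add: field_simps)
    qed
    then show ?thesis by (simp add: b_def)
  next
    case False
    then have p: "n2 M g > 0"
      using n2_nonneg[of M g] by linarith
    have "0 \<le> n2 M f - b\<^sup>2 / n2 M g"
      using q[of "- b / n2 M g"] p by (simp add: field_simps power2_eq_square)
    then show ?thesis
      using p by (simp add: b_def field_simps)
  qed
qed

lemma L2_Cauchy_Schwarz_abs:
  assumes "L2 M f" "L2 M g"
  shows "\<bar>\<integral>x. f x \<bullet> g x \<partial>M\<bar> \<le> sqrt (n2 M f) * sqrt (n2 M g)"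
  using real_sqrt_le_mono[OF L2_Cauchy_Schwarz[OF assms]] by (simp add: real_sqrt_mult)

lemma n2_minus_commute: "n2 M (\<lambda>x. f x - g x) = n2 M (\<lambda>x. g x - f x)"
  by (simp add: n2_def norm_minus_commute)

lemma n2_add_le:
  assumes "L2 M f" "L2 M g"
  shows "n2 M (\<lambda>x. f x + g x) \<le> 2 * n2 M f + 2 * n2 M g"
proof -
  have "n2 M (\<lambda>x. f x + g x) \<le> (\<integral>x. 2 * (norm (f x))\<^sup>2 + 2 * (norm (g x))\<^sup>2 \<partial>M)"
    unfolding n2_def using assms L2_add[OF assms]
    by (intro integral_mono norm_add_sq_le) (auto simp: L2_def)
  then show ?thesis
    using assms by (simp add: n2_def L2_def)
qed

lemma n2_mono_bound:
  assumes "L2 M f" "L2 M g" "\<And>x. norm (g x) \<le> C * norm (f x)"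
  shows "n2 M g \<le> C\<^sup>2 * n2 M f"
proof -
  have "n2 M g \<le> (\<integral>x. C\<^sup>2 * (norm (f x))\<^sup>2 \<partial>M)"
    unfolding n2_def
  proof (rule integral_mono)
    show "(norm (g x))\<^sup>2 \<le> C\<^sup>2 * (norm (f x))\<^sup>2" for x
      using power_mono[OF assms(3)[of x], of 2] by (simp add: power_mult_distrib)
  qed (use assms in \<open>auto simp: L2_def\<close>)
  then show ?thesis by (simp add: n2_def)
qed

text \<open>Both factors vary: f_n g_n - F G is split into (f_n - F)(g_n - G) + (f_n - F) G + F (g_n
  - G), and each term is estimated by Cauchy-Schwarz.\<close>

lemma inner_tendsto_L2:
  assumes "\<And>n. L2 M (f n)" "\<And>n. L2 M (g n)" "L2 M F" "L2 M G"
    and f: "(\<lambda>n. n2 M (\<lambda>x. f n x - F x)) \<longlonglongrightarrow> 0"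
    and g: "(\<lambda>n. n2 M (\<lambda>x. g n x - G x)) \<longlonglongrightarrow> 0"
  shows "(\<lambda>n. \<integral>x. f n x \<bullet> g n x \<partial>M) \<longlonglongrightarrow> (\<integral>x. F x \<bullet> G x \<partial>M)"
proof -
  have d: "(\<integral>x. f n x \<bullet> g n x \<partial>M) - (\<integral>x. F x \<bullet> G x \<partial>M) =
      (\<integral>x. (f n x - F x) \<bullet> (g n x - G x) \<partial>M) + (\<integral>x. (f n x - F x) \<bullet> G x \<partial>M) + (\<integral>x. F x \<bullet> (g n x - G x) \<partial>M)" for n
  proof -
    have "(\<integral>x. (f n x - F x) \<bullet> (g n x - G x) \<partial>M) + (\<integral>x. (f n x - F x) \<bullet> G x \<partial>M) + (\<integral>x. F x \<bullet> (g n x - G x) \<partial>M)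
       = (\<integral>x. (f n x - F x) \<bullet> (g n x - G x) + (f n x - F x) \<bullet> G x + F x \<bullet> (g n x - G x) \<partial>M)"
      using assms by (simp add: L2_integrable_inner L2_diff)
    also have "\<dots> = (\<integral>x. f n x \<bullet> g n x - F x \<bullet> G x \<partial>M)"
      by (rule Bochner_Integration.integral_cong) (auto simp: inner_diff_left inner_diff_right)
    also have "\<dots> = (\<integral>x. f n x \<bullet> g n x \<partial>M) - (\<integral>x. F x \<bullet> G x \<partial>M)"
      using assms by (simp add: L2_integrable_inner)
    finally show ?thesis by simp
  qed
  have sf: "(\<lambda>n. sqrt (n2 M (\<lambda>x. f n x - F x))) \<longlonglongrightarrow> 0" and sg: "(\<lambda>n. sqrt (n2 M (\<lambda>x. g n x - G x))) \<longlonglongrightarrow> 0"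
    using tendsto_real_sqrt[OF f] tendsto_real_sqrt[OF g] by simp_all
  have "(\<lambda>n. sqrt (n2 M (\<lambda>x. f n x - F x)) * sqrt (n2 M (\<lambda>x. g n x - G x))
      + sqrt (n2 M (\<lambda>x. f n x - F x)) * sqrt (n2 M G) + sqrt (n2 M F) * sqrt (n2 M (\<lambda>x. g n x - G x))) \<longlonglongrightarrow> 0 * 0 + 0 * sqrt (n2 M G) + sqrt (n2 M F) * 0"
    by (intro tendsto_intros sf sg)
  then have z: "(\<lambda>n. sqrt (n2 M (\<lambda>x. f n x - F x)) * sqrt (n2 M (\<lambda>x. g n x - G x))
      + sqrt (n2 M (\<lambda>x. f n x - F x)) * sqrt (n2 M G) + sqrt (n2 M F) * sqrt (n2 M (\<lambda>x. g n x - G x))) \<longlonglongrightarrow> 0"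
    by simp
  have "(\<lambda>n. (\<integral>x. f n x \<bullet> g n x \<partial>M) - (\<integral>x. F x \<bullet> G x \<partial>M)) \<longlonglongrightarrow> 0"
  proof (rule Lim_null_comparison[OF always_eventually z], rule allI)
    fix n
    note * = L2_Cauchy_Schwarz_abs
    have "\<bar>\<integral>x. (f n x - F x) \<bullet> (g n x - G x) \<partial>M\<bar> \<le> sqrt (n2 M (\<lambda>x. f n x - F x)) * sqrt (n2 M (\<lambda>x. g n x - G x))"
      "\<bar>\<integral>x. (f n x - F x) \<bullet> G x \<partial>M\<bar> \<le> sqrt (n2 M (\<lambda>x. f n x - F x)) * sqrt (n2 M G)"
      "\<bar>\<integral>x. F x \<bullet> (g n x - G x) \<partial>M\<bar> \<le> sqrt (n2 M F) * sqrt (n2 M (\<lambda>x. g n x - G x))"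
      by (intro * L2_diff assms)+
    then show "norm ((\<integral>x. f n x \<bullet> g n x \<partial>M) - (\<integral>x. F x \<bullet> G x \<partial>M)) \<le> sqrt (n2 M (\<lambda>x. f n x - F x)) * sqrt (n2 M (\<lambda>x. g n x - G x))
      + sqrt (n2 M (\<lambda>x. f n x - F x)) * sqrt (n2 M G) + sqrt (n2 M F) * sqrt (n2 M (\<lambda>x. g n x - G x))"
      unfolding d by simp
  qed
  then show ?thesis by (simp add: LIM_zero_iff)
qed

lemma n2_tendsto:
  assumes "\<And>n. L2 M (f n)" "L2 M F" "(\<lambda>n. n2 M (\<lambda>x. f n x - F x)) \<longlonglongrightarrow> 0"
  shows "(\<lambda>n. n2 M (f n)) \<longlonglongrightarrow> n2 M F"
  using inner_tendsto_L2[OF assms(1) assms(1) assms(2) assms(2) assms(3) assms(3)]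
  by (simp add: n2_def power2_norm_eq_inner)

section \<open>Completeness and orthogonal projection in L^2\<close>

lemma L2_complete:
  fixes f :: "nat \<Rightarrow> 'a \<Rightarrow> 'b::euclidean_space"
  assumes L: "\<And>n. L2 M (f n)"
    and C: "\<And>e. e > 0 \<Longrightarrow> \<exists>N. \<forall>m\<ge>N. \<forall>n\<ge>N. n2 M (\<lambda>x. f m x - f n x) < e"
  shows "\<exists>g. L2 M g \<and> (\<lambda>n. n2 M (\<lambda>x. f n x - g x)) \<longlonglongrightarrow> 0"
proof -
  note [measurable] = L2_measurable[OF L]
  \<comment> \<open>The rate (1/8)^k leaves (1/4)^k after the squares of the consecutive differences
    are multiplied by 2^k, and this weight is what turns summable squares into summable
    norms.\<close>
  have "\<exists>r. \<forall>k. (\<forall>m\<ge>r k. \<forall>n\<ge>r k. n2 M (\<lambda>x. f m x - f n x) < (1/8)^k) \<and> r k < r (Suc k)"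
  proof (rule dependent_nat_choice)
    show "\<exists>x. \<forall>m\<ge>x. \<forall>n\<ge>x. n2 M (\<lambda>xa. f m xa - f n xa) < (1/8)^0"
      using C[of 1] by simp
    show "\<exists>y. (\<forall>m\<ge>y. \<forall>n\<ge>y. n2 M (\<lambda>x. f m x - f n x) < (1/8)^Suc k) \<and> x < y" for x k
    proof -
      from C[of "(1/8)^Suc k"] obtain N where "\<forall>m\<ge>N. \<forall>n\<ge>N. n2 M (\<lambda>x. f m x - f n x) < (1/8)^Suc k"
        by auto
      then show ?thesis by (intro exI[of _ "max N (Suc x)"]) auto
    qed
  qed
  then obtain r where r: "\<And>k. r k < r (Suc k)"
    "\<And>k m n. r k \<le> m \<Longrightarrow> r k \<le> n \<Longrightarrow> n2 M (\<lambda>x. f m x - f n x) < (1/8)^k"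
    by blast
  have sm: "strict_mono r" using r(1) by (simp add: strict_mono_Suc_iff)
  define d where "d k x = f (r (Suc k)) x - f (r k) x" for k x
  have dL: "L2 M (d k)" for k
    unfolding d_def by (intro L2_diff L)
  note [measurable] = L2_measurable[OF dL]
  have dn: "n2 M (d k) \<le> (1/8)^k" for k
    using r(2)[of k "r (Suc k)" "r k"] r(1)[of k] by (simp add: d_def[abs_def] less_imp_le)
  have "(\<integral>\<^sup>+x. (\<Sum>k. ennreal (2^k * (norm (d k x))\<^sup>2)) \<partial>M) = (\<Sum>k. \<integral>\<^sup>+x. ennreal (2^k * (norm (d k x))\<^sup>2) \<partial>M)"
    by (rule nn_integral_suminf) measurable
  also have "\<dots> \<le> (\<Sum>k. ennreal ((1/4)^k))"
  proof (rule suminf_le)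
    fix k
    have "(\<integral>\<^sup>+x. ennreal (2^k * (norm (d k x))\<^sup>2) \<partial>M) = ennreal (\<integral>x. 2^k * (norm (d k x))\<^sup>2 \<partial>M)"
      using dL[of k] by (intro nn_integral_eq_integral) (auto simp: L2_def)
    also have "\<dots> = ennreal (2^k * n2 M (d k))"
      by (simp add: n2_def)
    also have "\<dots> \<le> ennreal (2^k * (1/8)^k)"
      using dn by (intro ennreal_leI mult_left_mono) auto
    also have "(2::real)^k * (1/8)^k = (1/4)^k"
      by (simp add: power_mult_distrib[symmetric])
    finally show "(\<integral>\<^sup>+x. ennreal (2^k * (norm (d k x))\<^sup>2) \<partial>M) \<le> ennreal ((1/4)^k)" .
  qed auto
  also have "\<dots> = ennreal (\<Sum>k. (1/4)^k)"
    by (rule suminf_ennreal2) (auto intro: summable_geometric)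
  also have "\<dots> < \<infinity>" by simp
  finally have "(\<integral>\<^sup>+x. (\<Sum>k. ennreal (2^k * (norm (d k x))\<^sup>2)) \<partial>M) \<noteq> \<infinity>" by simp
  then have ae: "AE x in M. (\<Sum>k. ennreal (2^k * (norm (d k x))\<^sup>2)) \<noteq> \<infinity>"
    by (intro nn_integral_PInf_AE) measurable
  have conv: "AE x in M. convergent (\<lambda>k. f (r k) x)"
    using ae
  proof eventually_elim
    case (elim x)
    have s1: "summable (\<lambda>k. 2^k * (norm (d k x))\<^sup>2)"
      by (rule summable_suminf_not_top) (use elim in auto)
    have "summable (\<lambda>k. norm (d k x))"
    proof (rule summable_comparison_test')
      show "summable (\<lambda>k. (1/2)^k + 2^k * (norm (d k x))\<^sup>2)"
        by (intro summable_add s1 summable_geometric) auto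
      \<comment> \<open>The inequality 2ab <= a^2 + b^2 for a = 2^(-k), b = |d_k|, multiplied by
        2^k.\<close>
      show "norm (norm (d k x)) \<le> (1/2)^k + 2^k * (norm (d k x))\<^sup>2" if "k \<ge> 0" for k
      proof -
        have "2^k * (((1/2)^k)\<^sup>2 + (norm (d k x))\<^sup>2) \<ge> 2^k * (2 * (1/2)^k * norm (d k x))"
          by (intro mult_left_mono sum_squares_bound) auto
        moreover have p: "(2::real)^k * (1/2)^k = 1" by (simp add: power_mult_distrib[symmetric])
        have "2^k * (2 * (1/2)^k * norm (d k x)) = 2 * (2^k * (1/2)^k) * norm (d k x)"
          "2^k * (((1/2)^k)\<^sup>2 + (norm (d k x))\<^sup>2) = (2^k * (1/2)^k) * (1/2)^k + 2^k * (norm (d k x))\<^sup>2"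
          by (simp_all only: power2_eq_square distrib_left ac_simps)
        ultimately have "(1/2)^k + 2^k * (norm (d k x))\<^sup>2 \<ge> 2 * norm (d k x)"
          unfolding p by simp
        then show ?thesis
          unfolding real_norm_def abs_norm_cancel using norm_ge_zero[of "d k x"] by linarith
      qed
    qed
    then have "summable (\<lambda>k. d k x)" by (rule summable_norm_cancel)
    then have "convergent (\<lambda>n. \<Sum>k<n. d k x)" by (simp add: summable_iff_convergent)
    moreover have "(\<Sum>k<n. d k x) = f (r n) x - f (r 0) x" for n
      unfolding d_def by (rule sum_lessThan_telescope)
    ultimately have "convergent (\<lambda>n. (f (r n) x - f (r 0) x) + f (r 0) x)"
      by (intro convergent_add) (auto simp: convergent_const)
    then show ?case by simp
  qed
  define g where "g x = lim (\<lambda>k. f (r k) x)" for x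
  have g[measurable]: "g \<in> borel_measurable M"
    unfolding g_def by measurable
  have lim: "AE x in M. (\<lambda>k. f (r k) x) \<longlonglongrightarrow> g x"
    using conv by eventually_elim (simp add: g_def convergent_LIMSEQ_iff)
  \<comment> \<open>Fatou along the subsequence with \<open>m\<close> fixed: the Cauchy bound passes
    to the limit.\<close>
  have key: "integrable M (\<lambda>x. (norm (f m x - g x))\<^sup>2) \<and> n2 M (\<lambda>x. f m x - g x) \<le> e"
    if e: "e > 0" and N: "\<forall>m\<ge>N. \<forall>n\<ge>N. n2 M (\<lambda>x. f m x - f n x) < e" and m: "m \<ge> N" for e N m
  proof -
    have "(\<integral>\<^sup>+x. ennreal ((norm (f m x - g x))\<^sup>2) \<partial>M) = (\<integral>\<^sup>+x. liminf (\<lambda>k. ennreal ((norm (f m x - f (r k) x))\<^sup>2)) \<partial>M)"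
    proof (rule nn_integral_cong_AE, use lim in eventually_elim)
      case (elim x)
      have "(\<lambda>k. ennreal ((norm (f m x - f (r k) x))\<^sup>2)) \<longlonglongrightarrow> ennreal ((norm (f m x - g x))\<^sup>2)"
        by (intro tendsto_intros elim)
      from lim_imp_Liminf[OF _ this] show ?case by simp
    qed
    also have "\<dots> \<le> liminf (\<lambda>k. \<integral>\<^sup>+x. ennreal ((norm (f m x - f (r k) x))\<^sup>2) \<partial>M)"
      by (rule nn_integral_liminf) measurable
    also have "\<dots> \<le> ennreal e"
    proof (rule Liminf_le)
      have "eventually (\<lambda>k. r k \<ge> N) sequentially"
        using filterlim_subseq[OF sm] by (simp add: filterlim_at_top)
      then show "\<forall>\<^sub>F k in sequentially. (\<integral>\<^sup>+x. ennreal ((norm (f m x - f (r k) x))\<^sup>2) \<partial>M) \<le> ennreal e"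
      proof eventually_elim
        case (elim k)
        have "(\<integral>\<^sup>+x. ennreal ((norm (f m x - f (r k) x))\<^sup>2) \<partial>M) = ennreal (n2 M (\<lambda>x. f m x - f (r k) x))"
          unfolding n2_def using L2_diff[OF L L, of m "r k"]
          by (intro nn_integral_eq_integral) (auto simp: L2_def)
        moreover have "n2 M (\<lambda>x. f m x - f (r k) x) \<le> e"
          using N m elim by (auto intro: less_imp_le)
        ultimately show ?case by (simp add: ennreal_leI)
      qed
    qed auto
    finally have le: "(\<integral>\<^sup>+x. ennreal ((norm (f m x - g x))\<^sup>2) \<partial>M) \<le> ennreal e" .
    then have "integrable M (\<lambda>x. (norm (f m x - g x))\<^sup>2)"
      by (intro integrableI_bounded) (auto intro: le_less_trans)
    moreover have "n2 M (\<lambda>x. f m x - g x) \<le> e"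
      unfolding n2_def using le e by (subst integral_eq_nn_integral) (auto intro: enn2real_leI)
    ultimately show ?thesis by simp
  qed
  obtain N where N: "\<forall>m\<ge>N. \<forall>n\<ge>N. n2 M (\<lambda>x. f m x - f n x) < 1"
    using C[of 1] by auto
  have "L2 M (\<lambda>x. f N x - g x)"
    using key[OF _ N, of N] by (auto simp: L2_def)
  from L2_diff[OF L this, of N] have "L2 M g" by simp
  moreover have "(\<lambda>n. n2 M (\<lambda>x. f n x - g x)) \<longlonglongrightarrow> 0"
  proof (rule LIMSEQ_I)
    fix e :: real assume e: "e > 0"
    then obtain N where N: "\<forall>m\<ge>N. \<forall>n\<ge>N. n2 M (\<lambda>x. f m x - f n x) < e / 2"
      using C[of "e/2"] by auto
    have "n2 M (\<lambda>x. f m x - g x) \<le> e / 2" if "m \<ge> N" for m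
      using key[OF _ N that] e by simp
    then have "norm (n2 M (\<lambda>x. f m x - g x) - 0) < e" if "m \<ge> N" for m
      using e that by fastforce
    then show "\<exists>no. \<forall>n\<ge>no. norm (n2 M (\<lambda>x. f n x - g x) - 0) < e" by blast
  qed
  ultimately show ?thesis by blast
qed

text \<open>\<open>S\<close> is a subspace that may fail to be closed; \<open>v\<close> is the
  projection of \<open>f\<close> on its closure, reached by a minimizing sequence. The sequence is
  part of the conclusion: later its members are continuous, which puts the limit into
  \<open>L2loc\<close>, and relations valid on \<open>S\<close> are carried to \<open>v\<close>
  along it.\<close>

lemma L2_projection:
  fixes f :: "'a \<Rightarrow> 'b::euclidean_space"
  assumes f: "L2 M f" and S: "\<And>s. s \<in> S \<Longrightarrow> L2 M s" and z: "(\<lambda>x. 0) \<in> S"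
    and add: "\<And>s t. s \<in> S \<Longrightarrow> t \<in> S \<Longrightarrow> (\<lambda>x. s x + t x) \<in> S"
    and scale: "\<And>s c. s \<in> S \<Longrightarrow> (\<lambda>x. c *\<^sub>R s x) \<in> S"
  shows "\<exists>v s. L2 M v \<and> (\<forall>n. s n \<in> S) \<and> (\<lambda>n. n2 M (\<lambda>x. s n x - v x)) \<longlonglongrightarrow> 0 \<and>
           (\<forall>t\<in>S. (\<integral>x. (f x - v x) \<bullet> t x \<partial>M) = 0)"
proof -
  define D where "D = (INF s\<in>S. n2 M (\<lambda>x. f x - s x))"
  have bdd: "bdd_below ((\<lambda>s. n2 M (\<lambda>x. f x - s x)) ` S)"
    by (rule bdd_belowI[of _ 0]) auto
  have Dle: "D \<le> n2 M (\<lambda>x. f x - s x)" if "s \<in> S" for s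
    unfolding D_def by (rule cINF_lower[OF bdd that])
  have "\<exists>s\<in>S. n2 M (\<lambda>x. f x - s x) < D + 1 / real (Suc n)" for n
  proof -
    have "Inf ((\<lambda>s. n2 M (\<lambda>x. f x - s x)) ` S) < D + 1 / real (Suc n)"
      by (simp add: D_def)
    from cInf_lessD[OF _ this] z show ?thesis by auto
  qed
  then obtain s where sS: "\<And>n. s n \<in> S" and sD: "\<And>n. n2 M (\<lambda>x. f x - s n x) < D + 1 / real (Suc n)"
    by metis
  note sL = S[OF sS]
  \<comment> \<open>Parallelogram identity: the midpoint of \<open>s m\<close> and
    \<open>s n\<close> lies in \<open>S\<close>, so its squared distance to \<open>f\<close> is at
    least \<open>D\<close>.\<close>
  have par: "n2 M (\<lambda>x. s m x - s n x) \<le> 2 / real (Suc m) + 2 / real (Suc n)" for m n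
  proof -
    define a b where "a x = f x - s m x" and "b x = f x - s n x" for x
    have aL: "L2 M a" and bL: "L2 M b"
      unfolding a_def b_def by (intro L2_diff f sL)+
    have e1: "n2 M (\<lambda>x. s m x - s n x) = n2 M b - 2 * (\<integral>x. b x \<bullet> a x \<partial>M) + n2 M a"
    proof -
      have "n2 M (\<lambda>x. s m x - s n x) = n2 M (\<lambda>x. b x + (-1) *\<^sub>R a x)"
        by (simp add: a_def b_def)
      also have "\<dots> = n2 M b + 2 * (\<integral>x. b x \<bullet> ((-1) *\<^sub>R a x) \<partial>M) + n2 M (\<lambda>x. (-1) *\<^sub>R a x)"
        by (rule n2_add[OF bL L2_scaleR[OF aL, of "-1"]])
      finally show ?thesis
        unfolding n2_scaleR by simp
    qed
    have e2: "n2 M (\<lambda>x. b x + a x) = n2 M b + 2 * (\<integral>x. b x \<bullet> a x \<partial>M) + n2 M a"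
      by (rule n2_add[OF bL aL])
    have "(\<lambda>x. (1/2) *\<^sub>R (s m x + s n x)) \<in> S"
      by (intro scale add sS)
    from Dle[OF this] have "D \<le> n2 M (\<lambda>x. (1/2) *\<^sub>R (b x + a x))"
    proof -
      have "f x - (1/2) *\<^sub>R (s m x + s n x) = (1/2) *\<^sub>R (b x + a x)" for x
      proof -
        have "(1/2) *\<^sub>R f x + (1/2) *\<^sub>R f x = f x" by (simp add: scaleR_left_distrib[symmetric])
        then show ?thesis by (simp add: a_def b_def algebra_simps)
      qed
      then show ?thesis using Dle[OF \<open>(\<lambda>x. (1/2) *\<^sub>R (s m x + s n x)) \<in> S\<close>] by simp
    qed
    then have "4 * D \<le> n2 M (\<lambda>x. b x + a x)"
      by (simp only: n2_scaleR) (simp add: power2_eq_square)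
    then show ?thesis
      using e1 e2 sD[of m] sD[of n] by (simp add: a_def[abs_def] b_def[abs_def])
  qed
  have "\<exists>g. L2 M g \<and> (\<lambda>n. n2 M (\<lambda>x. s n x - g x)) \<longlonglongrightarrow> 0"
  proof (rule L2_complete)
    fix e :: real assume "e > 0"
    then obtain N where N: "4 / e < real N" using reals_Archimedean2 by blast
    have "n2 M (\<lambda>x. s m x - s n x) < e" if "m \<ge> N" "n \<ge> N" for m n
    proof -
      have "0 < 4 / e" using \<open>e > 0\<close> by simp
      then have "real N > 0" using N by linarith
      then have "2 / real (Suc m) < 2 / real N" "2 / real (Suc n) < 2 / real N"
        using that by (auto intro!: divide_strict_left_mono)
      moreover have "2 / real N + 2 / real N < e"
        using N \<open>e > 0\<close> \<open>real N > 0\<close> by (simp add: field_simps)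
      ultimately show ?thesis using par[of m n] by linarith
    qed
    then show "\<exists>N. \<forall>m\<ge>N. \<forall>n\<ge>N. n2 M (\<lambda>x. s m x - s n x) < e" by blast
  qed (rule sL)
  then obtain v where v: "L2 M v" "(\<lambda>n. n2 M (\<lambda>x. s n x - v x)) \<longlonglongrightarrow> 0" by blast
  have orth: "(\<integral>x. (f x - v x) \<bullet> t x \<partial>M) = 0" if t: "t \<in> S" for t
  proof -
    have tL: "L2 M t" by (rule S[OF t])
    define u where "u x = f x - v x" for x
    have uL: "L2 M u" unfolding u_def by (intro L2_diff f v)
    have lim: "(\<lambda>n. n2 M (\<lambda>x. f x - s n x + c *\<^sub>R t x)) \<longlonglongrightarrow> n2 M (\<lambda>x. u x + c *\<^sub>R t x)" for c
    proof (rule n2_tendsto)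
      show "(\<lambda>n. n2 M (\<lambda>x. f x - s n x + c *\<^sub>R t x - (u x + c *\<^sub>R t x))) \<longlonglongrightarrow> 0"
        using v(2) by (simp add: u_def n2_minus_commute[of M v])
    qed (intro L2_add L2_diff L2_scaleR f sL uL tL)+
    have ge: "D \<le> n2 M (\<lambda>x. u x + c *\<^sub>R t x)" for c
    proof (rule LIMSEQ_le_const[OF lim])
      have "D \<le> n2 M (\<lambda>x. f x - s n x + c *\<^sub>R t x)" for n
        using Dle[OF add[OF sS[of n] scale[OF t, of "-c"]]] by (simp add: algebra_simps)
      then show "\<exists>N. \<forall>n\<ge>N. D \<le> n2 M (\<lambda>x. f x - s n x + c *\<^sub>R t x)" by blast
    qed
    have le: "n2 M u \<le> D"
    proof -
      have "n2 M (\<lambda>x. u x + 0 *\<^sub>R t x) \<le> D + 0"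
      proof (rule LIMSEQ_le[OF lim[of 0]])
        show "(\<lambda>n. D + 1 / real (Suc n)) \<longlonglongrightarrow> D + 0"
          by (intro tendsto_intros LIMSEQ_Suc[OF lim_1_over_n])
        show "\<exists>N. \<forall>n\<ge>N. n2 M (\<lambda>x. f x - s n x + 0 *\<^sub>R t x) \<le> D + 1 / real (Suc n)"
          using sD by (auto intro: less_imp_le)
      qed
      then show ?thesis by simp
    qed
    define b where "b = (\<integral>x. u x \<bullet> t x \<partial>M)"
    \<comment> \<open>First variation at the minimum: this quadratic in c is nonnegative for every
      real c, which forces the linear coefficient b to vanish.\<close>
    have q: "0 \<le> 2 * c * b + c\<^sup>2 * n2 M t" for c
      using ge[of c] le n2_add[OF uL L2_scaleR[OF tL, of c]] by (simp add: n2_scaleR b_def)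
    have "b = 0"
    proof (rule ccontr)
      assume b: "b \<noteq> 0"
      define T where "T = n2 M t + 1"
      have T: "T > 0" "n2 M t < T" using n2_nonneg[of M t] unfolding T_def by linarith+
      have "0 \<le> 2 * (- b / T) * b + (- b / T)\<^sup>2 * n2 M t" by (rule q)
      also have "\<dots> \<le> 2 * (- b / T) * b + (- b / T)\<^sup>2 * T"
        using T by (intro add_left_mono mult_left_mono) auto
      also have "\<dots> = - (b\<^sup>2 / T)"
        using T by (simp add: field_simps power2_eq_square)
      finally show False using b T by (simp add: field_simps)
    qed
    then show ?thesis by (simp add: b_def u_def)
  qed
  show ?thesis
    using v sS orth by blast
qed

section \<open>Wirtinger derivatives\<close>

text \<open>The general real-linear map C^n -> C, split into its complex-linear part with
  coefficients \<open>a\<close> and its antilinear part with coefficients \<open>b\<close>.\<close>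

definition wlin :: "('n \<Rightarrow> complex) \<Rightarrow> ('n \<Rightarrow> complex) \<Rightarrow> complex^'n \<Rightarrow> complex" where
  "wlin a b h = (\<Sum>j\<in>UNIV. a j * h $ j + b j * cnj (h $ j))"

text \<open>\<open>A j\<close> and \<open>B j\<close> are the derivatives of \<open>f\<close> with respect to \<open>z\<^sub>j\<close> and to its conjugate.\<close>

definition C1 :: "(complex^'n \<Rightarrow> complex) \<Rightarrow> ('n \<Rightarrow> complex^'n \<Rightarrow> complex) \<Rightarrow> ('n \<Rightarrow> complex^'n \<Rightarrow> complex) \<Rightarrow> bool" where
  "C1 f A B \<longleftrightarrow> (\<forall>z. (f has_derivative wlin (\<lambda>j. A j z) (\<lambda>j. B j z)) (at z)) \<and>
     (\<forall>j. continuous_on UNIV (A j)) \<and> (\<forall>j. continuous_on UNIV (B j))"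

definition bsupp :: "('a::real_normed_vector \<Rightarrow> 'b::zero) \<Rightarrow> bool" where
  "bsupp f \<longleftrightarrow> (\<exists>R. \<forall>z. norm z \<ge> R \<longrightarrow> f z = 0)"

lemma C1_deriv: "C1 f A B \<Longrightarrow> (f has_derivative wlin (\<lambda>j. A j z) (\<lambda>j. B j z)) (at z)"
  by (simp add: C1_def)

lemma C1_contA: "C1 f A B \<Longrightarrow> continuous_on UNIV (A j)"
  and C1_contB: "C1 f A B \<Longrightarrow> continuous_on UNIV (B j)"
  by (simp_all add: C1_def)

lemma C1_cont: "C1 f A B \<Longrightarrow> continuous_on UNIV f"
  by (meson C1_deriv continuous_at_imp_continuous_on has_derivative_continuous)

lemma C1_eq: "C1 f A B \<Longrightarrow> A = A' \<Longrightarrow> B = B' \<Longrightarrow> C1 f A' B'"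
  by simp

lemma bounded_linear_wlin: "bounded_linear (wlin a b)"
  unfolding wlin_def[abs_def]
  by (intro bounded_linear_sum bounded_linear_add bounded_linear_const_mult
      bounded_linear_vec_nth bounded_linear_compose[OF bounded_linear_cnj])

lemma wlin_add: "wlin a b h + wlin a' b' h = wlin (\<lambda>j. a j + a' j) (\<lambda>j. b j + b' j) h"
  by (simp add: wlin_def sum.distrib[symmetric] algebra_simps)

lemma wlin_mult: "c * wlin a b h = wlin (\<lambda>j. c * a j) (\<lambda>j. c * b j) h"
  by (simp add: wlin_def sum_distrib_left algebra_simps)

lemma wlin_cnj: "cnj (wlin a b h) = wlin (\<lambda>j. cnj (b j)) (\<lambda>j. cnj (a j)) h"
  by (simp add: wlin_def algebra_simps)

lemma wlin_axis: "wlin a b (axis j c) = a j * c + b j * cnj c"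
proof -
  have "a i * axis j c $ i + b i * cnj (axis j c $ i) = (if i = j then a j * c + b j * cnj c else 0)" for i
    by (auto simp: axis_def)
  then show ?thesis by (simp add: wlin_def)
qed

text \<open>The vectors e_j and i e_j give a_j + b_j and a_j - b_j separately; hence Wirtinger
  coefficients are unique.\<close>

lemma wlin_zero_imp: "(\<And>h. wlin a b h = 0) \<Longrightarrow> a j = 0 \<and> b j = 0"
proof -
  assume h: "\<And>h. wlin a b h = 0"
  have 1: "a j + b j = 0" using h[of "axis j 1"] by (simp add: wlin_axis)
  have "\<i> * (a j - b j) = 0" using h[of "axis j \<i>"] by (simp add: wlin_axis algebra_simps)
  then have "a j = b j" by simp
  then show ?thesis using 1 by simp
qed

lemma norm_wlin_le: "norm (wlin a b h) \<le> (\<Sum>j\<in>UNIV. norm (a j) + norm (b j)) * norm h"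
proof -
  have "norm (wlin a b h) \<le> (\<Sum>j\<in>UNIV. norm (a j * h $ j + b j * cnj (h $ j)))"
    unfolding wlin_def by (rule norm_sum)
  also have "\<dots> \<le> (\<Sum>j\<in>UNIV. (norm (a j) + norm (b j)) * norm h)"
  proof (rule sum_mono)
    fix j
    have "norm (a j * h $ j + b j * cnj (h $ j)) \<le> norm (a j) * norm (h $ j) + norm (b j) * norm (h $ j)"
      by (rule order_trans[OF norm_triangle_ineq]) (simp add: norm_mult)
    also have "\<dots> \<le> norm (a j) * norm h + norm (b j) * norm h"
      by (intro add_mono mult_left_mono Finite_Cartesian_Product.norm_nth_le) auto
    finally show "norm (a j * h $ j + b j * cnj (h $ j)) \<le> (norm (a j) + norm (b j)) * norm h"
      by (simp add: algebra_simps)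
  qed
  finally show ?thesis by (simp add: sum_distrib_right)
qed

lemma C1_const: "C1 (\<lambda>z. c) (\<lambda>j z. 0) (\<lambda>j z. 0)"
  by (auto simp: C1_def wlin_def[abs_def])

lemma C1_add:
  assumes "C1 f A B" "C1 g A' B'"
  shows "C1 (\<lambda>z. f z + g z) (\<lambda>j z. A j z + A' j z) (\<lambda>j z. B j z + B' j z)"
  using assms unfolding C1_def
  by (auto intro!: continuous_intros has_derivative_eq_rhs[OF has_derivative_add] simp: wlin_add fun_eq_iff)

lemma C1_mult:
  assumes "C1 f A B" "C1 g A' B'"
  shows "C1 (\<lambda>z. f z * g z) (\<lambda>j z. f z * A' j z + A j z * g z) (\<lambda>j z. f z * B' j z + B j z * g z)"
proof -
  have "((\<lambda>z. f z * g z) has_derivative wlin (\<lambda>j. f z * A' j z + A j z * g z) (\<lambda>j. f z * B' j z + B j z * g z)) (at z)" for z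
    by (rule has_derivative_eq_rhs[OF has_derivative_mult[OF C1_deriv[OF assms(1)] C1_deriv[OF assms(2)]]])
      (auto simp: wlin_mult wlin_add fun_eq_iff mult.commute[of "wlin _ _ _"] mult.commute[of "g z"])
  then show ?thesis
    using assms C1_cont[OF assms(1)] C1_cont[OF assms(2)] unfolding C1_def
    by (auto intro!: continuous_intros)
qed

lemma C1_cnj:
  assumes "C1 f A B"
  shows "C1 (\<lambda>z. cnj (f z)) (\<lambda>j z. cnj (B j z)) (\<lambda>j z. cnj (A j z))"
  using assms unfolding C1_def
  by (auto intro!: continuous_intros has_derivative_eq_rhs[OF has_derivative_cnj] simp: wlin_cnj fun_eq_iff)

lemma C1_cmult: "C1 f A B \<Longrightarrow> C1 (\<lambda>z. c * f z) (\<lambda>j z. c * A j z) (\<lambda>j z. c * B j z)"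
  using C1_mult[OF C1_const[of c]] by simp

lemma C1_minus: "C1 f A B \<Longrightarrow> C1 (\<lambda>z. - f z) (\<lambda>j z. - A j z) (\<lambda>j z. - B j z)"
  using C1_cmult[of f A B "-1"] by simp

lemma C1_coord:
  fixes i :: "'n::finite"
  shows "C1 (\<lambda>z. z $ i) (\<lambda>j z. if j = i then 1 else 0) (\<lambda>j z. 0)"
proof -
  have "wlin (\<lambda>j. if j = i then 1 else 0) (\<lambda>j. 0) h = h $ i" for h :: "complex^'n"
  proof -
    have "(if j = i then 1 else 0) * h $ j + 0 * cnj (h $ j) = (if j = i then h $ i else 0)" for j
      by simp
    then show ?thesis by (simp add: wlin_def)
  qed
  then have "wlin (\<lambda>j. if j = i then 1 else 0) (\<lambda>j. 0) = (\<lambda>h::complex^'n. h $ i)"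
    by auto
  then show ?thesis
    unfolding C1_def by (auto intro!: bounded_linear_imp_has_derivative bounded_linear_vec_nth)
qed

lemma C1_real_comp:
  assumes u: "C1 (\<lambda>z. complex_of_real (u z)) A B"
    and g: "\<And>z. (g has_real_derivative g' (u z)) (at (u z))"
    and c: "continuous_on UNIV (\<lambda>z. g' (u z))"
  shows "C1 (\<lambda>z. complex_of_real (g (u z))) (\<lambda>j z. complex_of_real (g' (u z)) * A j z) (\<lambda>j z. complex_of_real (g' (u z)) * B j z)"
proof -
  have "((\<lambda>z. complex_of_real (g (u z))) has_derivative
      wlin (\<lambda>j. complex_of_real (g' (u z)) * A j z) (\<lambda>j. complex_of_real (g' (u z)) * B j z)) (at z)" for z
  proof -
    have du: "(u has_derivative (\<lambda>h. Re (wlin (\<lambda>j. A j z) (\<lambda>j. B j z) h))) (at z)"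
      using has_derivative_Re[OF C1_deriv[OF u], of z] by simp
    \<comment> \<open>\<open>u\<close> is real, so u - cnj u is identically zero and so is its
      differential. Hence the differential of \<open>u\<close> takes real values, and the real chain
      rule can be rewritten in terms of \<open>wlin\<close>.\<close>
    have "((\<lambda>z. complex_of_real (u z) - cnj (complex_of_real (u z))) has_derivative
       (\<lambda>h. wlin (\<lambda>j. A j z) (\<lambda>j. B j z) h - cnj (wlin (\<lambda>j. A j z) (\<lambda>j. B j z) h))) (at z)"
      by (intro has_derivative_diff has_derivative_cnj C1_deriv[OF u])
    then have "(\<lambda>h. wlin (\<lambda>j. A j z) (\<lambda>j. B j z) h - cnj (wlin (\<lambda>j. A j z) (\<lambda>j. B j z) h)) = (\<lambda>h. 0)"
      by (intro has_derivative_unique[of "\<lambda>z. 0" _ z]) auto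
    then have re: "complex_of_real (Re (wlin (\<lambda>j. A j z) (\<lambda>j. B j z) h)) = wlin (\<lambda>j. A j z) (\<lambda>j. B j z) h" for h
      by (simp add: fun_eq_iff complex_eq_iff)
    have "((\<lambda>z. complex_of_real (g (u z))) has_derivative
       (\<lambda>h. complex_of_real (g' (u z) * Re (wlin (\<lambda>j. A j z) (\<lambda>j. B j z) h)))) (at z)"
      by (intro has_derivative_of_real has_derivative_compose[OF du])
         (use g[of z] in \<open>simp add: has_field_derivative_def\<close>)
    then show ?thesis
      by (simp add: re wlin_mult)
  qed
  then show ?thesis
    using u c unfolding C1_def by (auto intro!: continuous_intros)
qed

lemma C1_reflect:
  assumes "C1 k A B"
  shows "C1 (\<lambda>y. k (x - y)) (\<lambda>j y. - A j (x - y)) (\<lambda>j y. - B j (x - y))"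
proof -
  have "((\<lambda>y. k (x - y)) has_derivative wlin (\<lambda>j. - A j (x - z)) (\<lambda>j. - B j (x - z))) (at z)" for z
  proof -
    have "((\<lambda>y. k (x - y)) has_derivative (\<lambda>h. wlin (\<lambda>j. A j (x - z)) (\<lambda>j. B j (x - z)) (- h))) (at z)"
      by (rule has_derivative_compose[OF _ C1_deriv[OF assms]]) (auto intro!: derivative_eq_intros)
    moreover have "wlin (\<lambda>j. A j (x - z)) (\<lambda>j. B j (x - z)) (- h) = wlin (\<lambda>j. - A j (x - z)) (\<lambda>j. - B j (x - z)) h" for h
      by (simp add: wlin_def)
    ultimately show ?thesis by simp
  qed
  then show ?thesis
    using assms unfolding C1_def
    by (auto intro!: continuous_intros continuous_on_compose2[where f="\<lambda>y. x - y" and s=UNIV and t=UNIV])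
qed

lemma bsupp_0 [simp]: "bsupp (\<lambda>z. 0)"
  by (simp add: bsupp_def)

lemma bsupp_add: "bsupp f \<Longrightarrow> bsupp g \<Longrightarrow> bsupp (\<lambda>z. f z + (g z :: 'b::monoid_add))"
proof -
  assume "bsupp f" "bsupp g"
  then obtain R S where "\<And>z. norm z \<ge> R \<Longrightarrow> f z = 0" "\<And>z. norm z \<ge> S \<Longrightarrow> g z = 0"
    by (auto simp: bsupp_def)
  then show ?thesis unfolding bsupp_def by (intro exI[of _ "max R S"]) auto
qed

lemma bsupp_comp: "bsupp f \<Longrightarrow> (\<And>z. f z = 0 \<Longrightarrow> g z = 0) \<Longrightarrow> bsupp g"
  unfolding bsupp_def by blast

lemma bsupp_sum: "(\<And>i. i \<in> I \<Longrightarrow> bsupp (f i)) \<Longrightarrow> bsupp (\<lambda>z. \<Sum>i\<in>I. f i z :: 'b::comm_monoid_add)"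
  by (induction I rule: infinite_finite_induct) (auto intro: bsupp_add)

lemma bsupp_reflect: "bsupp f \<Longrightarrow> bsupp (\<lambda>y. f (x - y))"
proof -
  assume "bsupp f"
  then obtain R where R: "\<And>z. norm z \<ge> R \<Longrightarrow> f z = 0" by (auto simp: bsupp_def)
  have "norm (x - y) \<ge> R" if "norm y \<ge> R + norm x" for y
    using norm_triangle_ineq2[of y x] that by (simp add: norm_minus_commute)
  then show ?thesis using R unfolding bsupp_def by blast
qed

text \<open>Beyond the support radius plus one the function vanishes on a whole ball, so its
  differential is zero there.\<close>

lemma C1_bsupp:
  assumes "C1 f A B" "bsupp f"
  shows "bsupp (A j)" "bsupp (B j)"
proof -
  obtain R where R: "\<And>z. norm z \<ge> R \<Longrightarrow> f z = 0" using assms(2) by (auto simp: bsupp_def)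
  have "A j z = 0 \<and> B j z = 0" if "norm z \<ge> R + 1" for z
  proof -
    have "((\<lambda>z. 0) has_derivative wlin (\<lambda>j. A j z) (\<lambda>j. B j z)) (at z)"
    proof (rule has_derivative_transform_within_open[OF C1_deriv[OF assms(1)]])
      show "open (ball z 1)" by simp
      show "f w = 0" if "w \<in> ball z 1" for w
      proof (rule R)
        show "norm w \<ge> R"
          using that \<open>norm z \<ge> R + 1\<close> norm_triangle_ineq2[of z w] by (simp add: dist_norm)
      qed
    qed auto
    from has_derivative_unique[OF this has_derivative_const]
    show ?thesis by (intro wlin_zero_imp) (auto dest: fun_cong)
  qed
  then show "bsupp (A j)" "bsupp (B j)" unfolding bsupp_def by blast+
qed

section \<open>Integration by parts for functions of bounded support\<close>

lemma integrable_bsupp: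
  fixes f :: "'a::euclidean_space \<Rightarrow> 'b::{banach,second_countable_topology}"
  assumes "continuous_on UNIV f" "bsupp f"
  shows "integrable lborel f"
proof -
  obtain R where R: "\<And>z. norm z \<ge> R \<Longrightarrow> f z = 0" using assms(2) by (auto simp: bsupp_def)
  have "integrable lborel (\<lambda>x. indicator (cball 0 R) x *\<^sub>R f x)"
    by (rule borel_integrable_compact) (auto intro: continuous_on_subset[OF assms(1)])
  moreover have "(\<lambda>x. indicator (cball 0 R) x *\<^sub>R f x) = f"
    using R by (auto simp: indicator_def fun_eq_iff)
  ultimately show ?thesis by simp
qed

lemma bounded_bsupp:
  fixes f :: "'a::euclidean_space \<Rightarrow> 'b::real_normed_vector"
  assumes "continuous_on UNIV f" "bsupp f"
  shows "\<exists>K>0. \<forall>z. norm (f z) \<le> K"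
proof -
  obtain R where R: "\<And>z. norm z \<ge> R \<Longrightarrow> f z = 0" using assms(2) by (auto simp: bsupp_def)
  have "bounded (f ` cball 0 R)"
    by (intro compact_imp_bounded compact_continuous_image continuous_on_subset[OF assms(1)]) auto
  then obtain K where K: "K > 0" "\<forall>x\<in>f ` cball 0 R. norm x \<le> K" unfolding bounded_pos by blast
  have "norm (f z) \<le> K" for z
    using K R[of z] by (cases "norm z \<le> R") auto
  then show ?thesis using K by blast
qed

lemma C1_lipschitz:
  assumes "C1 f A B" "bsupp f"
  shows "\<exists>K>0. \<forall>x y. norm (f x - f y) \<le> K * norm (x - y)"
proof -
  have "\<exists>K. \<forall>j. K j > 0 \<and> (\<forall>z. norm (A j z) \<le> K j)"
    using bounded_bsupp[OF C1_contA[OF assms(1)] C1_bsupp(1)[OF assms]] by metis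
  then obtain K where K: "\<And>j. K j > 0" "\<And>j z. norm (A j z) \<le> K j" by blast
  have "\<exists>K. \<forall>j. K j > 0 \<and> (\<forall>z. norm (B j z) \<le> K j)"
    using bounded_bsupp[OF C1_contB[OF assms(1)] C1_bsupp(2)[OF assms]] by metis
  then obtain L where L: "\<And>j. L j > 0" "\<And>j z. norm (B j z) \<le> L j" by blast
  define C where "C = (\<Sum>j\<in>UNIV. K j + L j)"
  have C: "C > 0" unfolding C_def by (intro sum_pos) (auto intro: add_pos_pos K L)
  have "norm (f x - f y) \<le> C * norm (x - y)" for x y
  proof (rule differentiable_bound[where S=UNIV and f'="\<lambda>z. wlin (\<lambda>j. A j z) (\<lambda>j. B j z)"])
    show "(f has_derivative wlin (\<lambda>j. A j z) (\<lambda>j. B j z)) (at z within UNIV)" for z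
      using C1_deriv[OF assms(1)] by simp
    have "norm (wlin (\<lambda>j. A j z) (\<lambda>j. B j z) h) \<le> C * norm h" for z h
      by (rule order_trans[OF norm_wlin_le])
        (auto simp: C_def intro!: mult_right_mono sum_mono add_mono K L)
    then show "onorm (wlin (\<lambda>j. A j z) (\<lambda>j. B j z)) \<le> C" for z
      by (intro onorm_bound) (use C in auto)
  qed auto
  then show ?thesis using C by blast
qed

lemma lborel_integral_translate:
  fixes f :: "'a::euclidean_space \<Rightarrow> 'b::{banach,second_countable_topology}"
  assumes [measurable]: "f \<in> borel_measurable borel"
  shows "(\<integral>x. f (c + x) \<partial>lborel) = integral\<^sup>L lborel f"
proof -
  have "integral\<^sup>L lborel f = integral\<^sup>L (distr lborel borel ((+) c)) f"
    by (simp add: lborel_distr_plus)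
  also have "\<dots> = (\<integral>x. f (c + x) \<partial>lborel)"
    by (rule integral_distr) auto
  finally show ?thesis by simp
qed

lemma borel_measurable_lborel_cont:
  "continuous_on UNIV f \<Longrightarrow> f \<in> borel_measurable lborel"
  by (simp add: borel_measurable_continuous_onI)

text \<open>Lebesgue measure is translation invariant, so every difference quotient in direction
  \<open>v\<close> has integral zero; the Lipschitz bound and the bounded support dominate the
  passage to the derivative.\<close>

lemma C1_integral_wlin:
  assumes f: "C1 f A B" "bsupp f"
  shows "(\<integral>z. wlin (\<lambda>j. A j z) (\<lambda>j. B j z) v \<partial>lborel) = 0"
proof -
  obtain R where R: "\<And>z. norm z \<ge> R \<Longrightarrow> f z = 0" using f(2) by (auto simp: bsupp_def)
  obtain K where K: "K > 0" "\<And>x y. norm (f x - f y) \<le> K * norm (x - y)"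
    using C1_lipschitz[OF f] by auto
  have cf: "continuous_on UNIV f" by (rule C1_cont[OF f(1)])
  have [measurable]: "f \<in> borel_measurable borel"
    using borel_measurable_continuous_onI[OF cf] .
  define s where "s n x = real (Suc n) *\<^sub>R (f ((1 / real (Suc n)) *\<^sub>R v + x) - f x)" for n x
  have "(\<lambda>n. \<integral>x. s n x \<partial>lborel) \<longlonglongrightarrow> (\<integral>z. wlin (\<lambda>j. A j z) (\<lambda>j. B j z) v \<partial>lborel)"
  proof (rule integral_dominated_convergence)
    show "integrable lborel (\<lambda>x. indicator (cball 0 (\<bar>R\<bar> + norm v)) x *\<^sub>R (K * norm v))"
      by (rule integrableI_bounded_set_indicator[where B="K * norm v"])
        (use K emeasure_lborel_cball_finite[of 0 "\<bar>R\<bar> + norm v"] in auto)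
    show "(\<lambda>z. wlin (\<lambda>j. A j z) (\<lambda>j. B j z) v) \<in> borel_measurable lborel"
      unfolding wlin_def
      by (intro borel_measurable_lborel_cont continuous_intros C1_contA[OF f(1)] C1_contB[OF f(1)])
    show "s n \<in> borel_measurable lborel" for n
      unfolding s_def by measurable
    show "AE x in lborel. norm (s n x) \<le> indicator (cball 0 (\<bar>R\<bar> + norm v)) x *\<^sub>R (K * norm v)" for n
    proof (rule AE_I2)
      fix x
      show "norm (s n x) \<le> indicator (cball 0 (\<bar>R\<bar> + norm v)) x *\<^sub>R (K * norm v)"
      proof (cases "x \<in> cball 0 (\<bar>R\<bar> + norm v)")
        case True
        have "norm (s n x) \<le> real (Suc n) * (K * norm ((1 / real (Suc n)) *\<^sub>R v))"
        proof -
          have "norm (f ((1 / real (Suc n)) *\<^sub>R v + x) - f x) \<le> K * norm ((1 / real (Suc n)) *\<^sub>R v)"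
            using K(2)[of "(1 / real (Suc n)) *\<^sub>R v + x" x] by (simp del: of_nat_Suc)
          then have "real (Suc n) * norm (f ((1 / real (Suc n)) *\<^sub>R v + x) - f x) \<le> real (Suc n) * (K * norm ((1 / real (Suc n)) *\<^sub>R v))"
            by (rule mult_left_mono) simp
          then show ?thesis by (simp add: s_def del: of_nat_Suc)
        qed
        also have "\<dots> = K * norm v" by (simp del: of_nat_Suc)
        finally show ?thesis using True by simp
      next
        case False
        have "norm ((1 / real (Suc n)) *\<^sub>R v) \<le> norm v"
          using mult_right_mono[of "1 / real (Suc n)" 1 "norm v"] by simp
        then have "norm ((1 / real (Suc n)) *\<^sub>R v + x) \<ge> R"
          using False norm_triangle_ineq2[of x "- ((1 / real (Suc n)) *\<^sub>R v)"]
          by (simp add: add.commute del: of_nat_Suc)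
        moreover have "norm x > \<bar>R\<bar> + norm v" using False by simp
        then have "norm x \<ge> R" using norm_ge_zero[of v] abs_ge_self[of R] by linarith
        ultimately show ?thesis using False by (simp add: s_def R)
      qed
    qed
    show "AE x in lborel. (\<lambda>n. s n x) \<longlonglongrightarrow> wlin (\<lambda>j. A j x) (\<lambda>j. B j x) v"
    proof (rule AE_I2)
      fix x
      have "((\<lambda>t::real. f (x + t *\<^sub>R v)) has_derivative (\<lambda>t. wlin (\<lambda>j. A j x) (\<lambda>j. B j x) (t *\<^sub>R v))) (at 0)"
        by (rule has_derivative_compose[of _ _ 0 UNIV f]) (auto intro!: derivative_eq_intros C1_deriv[OF f(1)])
      then have "(\<lambda>h. norm (f (x + h *\<^sub>R v) - f x - h *\<^sub>R wlin (\<lambda>j. A j x) (\<lambda>j. B j x) v) / norm h) \<midarrow>0\<rightarrow> 0"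
        unfolding has_derivative_at
        by (simp add: linear_scale[OF bounded_linear.linear[OF bounded_linear_wlin]])
      then have "(\<lambda>h. norm ((f (x + h *\<^sub>R v) - f x) /\<^sub>R h - wlin (\<lambda>j. A j x) (\<lambda>j. B j x) v)) \<midarrow>0\<rightarrow> 0"
      proof (rule Lim_transform_eventually)
        show "\<forall>\<^sub>F h in at 0. norm (f (x + h *\<^sub>R v) - f x - h *\<^sub>R wlin (\<lambda>j. A j x) (\<lambda>j. B j x) v) / norm h
            = norm ((f (x + h *\<^sub>R v) - f x) /\<^sub>R h - wlin (\<lambda>j. A j x) (\<lambda>j. B j x) v)"
        proof (rule eventually_at_topological[THEN iffD2], intro exI[of _ UNIV] conjI ballI impI)
          fix h :: real assume "h \<noteq> 0"
          then have "(f (x + h *\<^sub>R v) - f x) /\<^sub>R h - wlin (\<lambda>j. A j x) (\<lambda>j. B j x) v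
            = (f (x + h *\<^sub>R v) - f x - h *\<^sub>R wlin (\<lambda>j. A j x) (\<lambda>j. B j x) v) /\<^sub>R h"
            by (simp add: scaleR_diff_right)
          then show "norm (f (x + h *\<^sub>R v) - f x - h *\<^sub>R wlin (\<lambda>j. A j x) (\<lambda>j. B j x) v) / norm h
            = norm ((f (x + h *\<^sub>R v) - f x) /\<^sub>R h - wlin (\<lambda>j. A j x) (\<lambda>j. B j x) v)"
            by (simp add: divide_inverse mult.commute)
        qed auto
      qed
      then have "((\<lambda>h. (f (x + h *\<^sub>R v) - f x) /\<^sub>R h) \<longlongrightarrow> wlin (\<lambda>j. A j x) (\<lambda>j. B j x) v) (at 0)"
        by (simp add: tendsto_norm_zero_iff LIM_zero_iff)
      moreover have "filterlim (\<lambda>n. 1 / real (Suc n)) (at 0) sequentially"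
        by (intro filterlim_atI LIMSEQ_Suc[OF lim_1_over_n]) auto
      ultimately have "(\<lambda>n. (f (x + (1 / real (Suc n)) *\<^sub>R v) - f x) /\<^sub>R (1 / real (Suc n))) \<longlonglongrightarrow> wlin (\<lambda>j. A j x) (\<lambda>j. B j x) v"
        by (rule filterlim_compose)
      then show "(\<lambda>n. s n x) \<longlonglongrightarrow> wlin (\<lambda>j. A j x) (\<lambda>j. B j x) v"
        by (simp add: s_def add.commute del: of_nat_Suc)
    qed
  qed
  moreover have "(\<integral>x. s n x \<partial>lborel) = 0" for n
  proof -
    have i: "integrable lborel f" by (rule integrable_bsupp[OF cf f(2)])
    have "bsupp (\<lambda>x. f ((1 / real (Suc n)) *\<^sub>R v + x))"
      using bsupp_reflect[OF bsupp_reflect[OF f(2), of 0], of "- ((1 / real (Suc n)) *\<^sub>R v)"]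
      by (simp add: algebra_simps del: of_nat_Suc)
    then have "integrable lborel (\<lambda>x. f ((1 / real (Suc n)) *\<^sub>R v + x))"
      by (intro integrable_bsupp continuous_on_compose2[OF cf] continuous_intros) auto
    then show ?thesis
      unfolding s_def using i lborel_integral_translate[of f "(1 / real (Suc n)) *\<^sub>R v"]
      by (simp del: of_nat_Suc)
  qed
  ultimately show ?thesis by (simp add: LIMSEQ_const_iff)
qed

text \<open>The directions e_j and i e_j give two independent linear relations between the integrals
  of the two Wirtinger derivatives.\<close>

lemma C1_integral_zero:
  assumes f: "C1 f A B" "bsupp f"
  shows "(\<integral>z. A j z \<partial>lborel) = 0" "(\<integral>z. B j z \<partial>lborel) = 0"
proof -
  have iA: "integrable lborel (A j)" by (intro integrable_bsupp C1_contA[OF f(1)] C1_bsupp(1)[OF f])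
  have iB: "integrable lborel (B j)" by (intro integrable_bsupp C1_contB[OF f(1)] C1_bsupp(2)[OF f])
  have 1: "(\<integral>z. A j z \<partial>lborel) + (\<integral>z. B j z \<partial>lborel) = 0"
    using C1_integral_wlin[OF f, of "axis j 1"] iA iB by (simp add: wlin_axis)
  have "(\<integral>z. A j z \<partial>lborel) * \<i> - (\<integral>z. B j z \<partial>lborel) * \<i> = 0"
    using C1_integral_wlin[OF f, of "axis j \<i>"] iA iB by (simp add: wlin_axis)
  then have "(\<integral>z. A j z \<partial>lborel) = (\<integral>z. B j z \<partial>lborel)" by (simp add: left_diff_distrib[symmetric])
  then show "(\<integral>z. A j z \<partial>lborel) = 0" "(\<integral>z. B j z \<partial>lborel) = 0" using 1 by auto
qed

text \<open>\<open>AA j k\<close> is the derivative in z_j and z_k, \<open>AB j k\<close> the one in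
  z_j and the conjugate of z_k. The symmetry of the first and the Hermitian symmetry of the second
  are carried along as data.\<close>

definition C2R :: "(complex^'n \<Rightarrow> real) \<Rightarrow> ('n \<Rightarrow> complex^'n \<Rightarrow> complex) \<Rightarrow>
    ('n \<Rightarrow> 'n \<Rightarrow> complex^'n \<Rightarrow> complex) \<Rightarrow> ('n \<Rightarrow> 'n \<Rightarrow> complex^'n \<Rightarrow> complex) \<Rightarrow> bool" where
  "C2R u A AA AB \<longleftrightarrow> C1 (\<lambda>z. complex_of_real (u z)) A (\<lambda>j z. cnj (A j z)) \<and>
     (\<forall>j. C1 (A j) (AA j) (AB j)) \<and> (\<forall>j k z. AA j k z = AA k j z) \<and> (\<forall>j k z. AB j k z = cnj (AB k j z))"

text \<open>The chain rule to second order. Through it the bump functions and all summands of the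
  weights obtain their Hessians from those of sums of squared moduli.\<close>

lemma C2R_comp:
  assumes u: "C2R u A AA AB"
    and g: "\<And>z. (g has_real_derivative g' (u z)) (at (u z))"
    and g': "\<And>z. (g' has_real_derivative g'' (u z)) (at (u z))"
    and c: "continuous_on UNIV (\<lambda>z. g'' (u z))"
  shows "C2R (\<lambda>z. g (u z)) (\<lambda>j z. complex_of_real (g' (u z)) * A j z)
     (\<lambda>j k z. complex_of_real (g' (u z)) * AA j k z + complex_of_real (g'' (u z)) * A k z * A j z)
     (\<lambda>j k z. complex_of_real (g' (u z)) * AB j k z + complex_of_real (g'' (u z)) * cnj (A k z) * A j z)"
proof -
  have u1: "C1 (\<lambda>z. complex_of_real (u z)) A (\<lambda>j z. cnj (A j z))" and A: "\<And>j. C1 (A j) (AA j) (AB j)"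
    and s: "\<And>j k z. AA j k z = AA k j z" "\<And>j k z. AB j k z = cnj (AB k j z)"
    using u unfolding C2R_def by blast+
  have cu: "continuous_on UNIV u"
    using continuous_on_Re[OF C1_cont[OF u1]] by simp
  have "isCont (\<lambda>z. g' (u z)) z" for z
    using isCont_o2[where f=u and g=g' and a=z] DERIV_isCont[OF g'] cu
    by (simp add: continuous_on_eq_continuous_at)
  then have c': "continuous_on UNIV (\<lambda>z. g' (u z))" by (simp add: continuous_at_imp_continuous_on)
  have 1: "C1 (\<lambda>z. complex_of_real (g (u z))) (\<lambda>j z. complex_of_real (g' (u z)) * A j z) (\<lambda>j z. complex_of_real (g' (u z)) * cnj (A j z))"
    by (rule C1_real_comp[OF u1 g c'])
  have 2: "C1 (\<lambda>z. complex_of_real (g' (u z)) * A j z)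
     (\<lambda>k z. complex_of_real (g' (u z)) * AA j k z + complex_of_real (g'' (u z)) * A k z * A j z)
     (\<lambda>k z. complex_of_real (g' (u z)) * AB j k z + complex_of_real (g'' (u z)) * cnj (A k z) * A j z)" for j
    by (rule C1_mult[OF C1_real_comp[OF u1 g' c] A])
  show ?thesis
    unfolding C2R_def
  proof (intro conjI allI)
    show "C1 (\<lambda>z. complex_of_real (g (u z))) (\<lambda>j z. complex_of_real (g' (u z)) * A j z)
       (\<lambda>j z. cnj (complex_of_real (g' (u z)) * A j z))" using 1 by simp
    show "complex_of_real (g' (u z)) * AA j k z + complex_of_real (g'' (u z)) * A k z * A j z =
       complex_of_real (g' (u z)) * AA k j z + complex_of_real (g'' (u z)) * A j z * A k z" for j k z
      using s(1)[of j k z] by simp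
    show "complex_of_real (g' (u z)) * AB j k z + complex_of_real (g'' (u z)) * cnj (A k z) * A j z =
       cnj (complex_of_real (g' (u z)) * AB k j z + complex_of_real (g'' (u z)) * cnj (A j z) * A k z)" for j k z
      using s(2)[of j k z] by simp
  qed (rule 2)
qed

lemma C2R_add:
  assumes "C2R u A AA AB" "C2R v A' AA' AB'"
  shows "C2R (\<lambda>z. u z + v z) (\<lambda>j z. A j z + A' j z) (\<lambda>j k z. AA j k z + AA' j k z) (\<lambda>j k z. AB j k z + AB' j k z)"
proof -
  note a = assms[unfolded C2R_def]
  have "C1 (\<lambda>z. complex_of_real (u z + v z)) (\<lambda>j z. A j z + A' j z) (\<lambda>j z. cnj (A j z + A' j z))"
    using C1_add[OF conjunct1[OF a(1)] conjunct1[OF a(2)]] by simp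
  moreover have "C1 (\<lambda>z. A j z + A' j z) (\<lambda>k z. AA j k z + AA' j k z) (\<lambda>k z. AB j k z + AB' j k z)" for j
    using a by (intro C1_add) blast+
  moreover have "AA j k z + AA' j k z = AA k j z + AA' k j z" "AB j k z + AB' j k z = cnj (AB k j z + AB' k j z)" for j k z
    unfolding complex_cnj_add using a by metis+
  ultimately show ?thesis unfolding C2R_def by blast
qed

lemma C2R_const: "C2R (\<lambda>z. c) (\<lambda>j z. 0) (\<lambda>j k z. 0) (\<lambda>j k z. 0)"
  unfolding C2R_def by (auto intro: C1_const)

lemma C2R_sum:
  assumes "\<And>i. i \<in> I \<Longrightarrow> C2R (u i) (A i) (AA i) (AB i)"
  shows "C2R (\<lambda>z. \<Sum>i\<in>I. u i z) (\<lambda>j z. \<Sum>i\<in>I. A i j z) (\<lambda>j k z. \<Sum>i\<in>I. AA i j k z) (\<lambda>j k z. \<Sum>i\<in>I. AB i j k z)"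
  using assms
  by (induction I rule: infinite_finite_induct) (auto intro: C2R_const C2R_add)

text \<open>A holomorphic function with its first and second complex derivatives; the zero
  antiholomorphic part in \<open>C1\<close> is the Cauchy-Riemann system.\<close>

definition hol2 :: "(complex^'n \<Rightarrow> complex) \<Rightarrow> ('n \<Rightarrow> complex^'n \<Rightarrow> complex) \<Rightarrow> ('n \<Rightarrow> 'n \<Rightarrow> complex^'n \<Rightarrow> complex) \<Rightarrow> bool" where
  "hol2 q q1 q2 \<longleftrightarrow> C1 q q1 (\<lambda>j z. 0) \<and> (\<forall>j. C1 (q1 j) (q2 j) (\<lambda>k z. 0)) \<and> (\<forall>j k z. q2 j k z = q2 k j z)"

lemma C2R_cmod_sq:
  assumes "hol2 q q1 q2"
  shows "C2R (\<lambda>z. (cmod (q z))\<^sup>2) (\<lambda>j z. cnj (q z) * q1 j z) (\<lambda>j k z. cnj (q z) * q2 j k z) (\<lambda>j k z. cnj (q1 k z) * q1 j z)"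
proof -
  have q: "C1 q q1 (\<lambda>j z. 0)" "\<And>j. C1 (q1 j) (q2 j) (\<lambda>k z. 0)" "\<And>j k z. q2 j k z = q2 k j z"
    using assms unfolding hol2_def by blast+
  have "C1 (\<lambda>z. cnj (q z) * q z) (\<lambda>j z. cnj (q z) * q1 j z) (\<lambda>j z. cnj (cnj (q z) * q1 j z))"
    using C1_mult[OF C1_cnj[OF q(1)] q(1)] by (simp add: mult.commute)
  moreover have "cnj (q z) * q z = complex_of_real ((cmod (q z))\<^sup>2)" for z
    by (metis complex_norm_square mult.commute)
  moreover have "C1 (\<lambda>z. cnj (q z) * q1 j z) (\<lambda>k z. cnj (q z) * q2 j k z) (\<lambda>k z. cnj (q1 k z) * q1 j z)" for j
    using C1_mult[OF C1_cnj[OF q(1)] q(2)] by simp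
  ultimately show ?thesis
    unfolding C2R_def using q(3) by auto
qed

lemma hol2_coord: "hol2 (\<lambda>z. z $ i) (\<lambda>j z. if j = i then 1 else 0) (\<lambda>j k z. 0)"
  unfolding hol2_def by (auto intro: C1_coord C1_const)

lemma norm_vec_sq: "(norm (z::complex^'n))\<^sup>2 = (\<Sum>i\<in>UNIV. (cmod (z $ i))\<^sup>2)"
  unfolding norm_vec_def L2_set_def by (simp add: sum_nonneg)

lemma C2R_norm_sq: "C2R (\<lambda>z::complex^'n. (norm z)\<^sup>2) (\<lambda>j z. cnj (z $ j)) (\<lambda>j k z. 0) (\<lambda>j k z. if j = k then 1 else 0)"
proof -
  have "C2R (\<lambda>z::complex^'n. \<Sum>i\<in>UNIV. (cmod (z $ i))\<^sup>2) (\<lambda>j z. \<Sum>i\<in>UNIV. cnj (z $ i) * (if j = i then 1 else 0))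
    (\<lambda>j k z. \<Sum>i\<in>UNIV. cnj (z $ i) * 0) (\<lambda>j k z. \<Sum>i\<in>UNIV. cnj (if k = i then 1 else 0) * (if j = i then 1 else 0))"
    by (intro C2R_sum C2R_cmod_sq[OF hol2_coord])
  moreover have "(\<Sum>i\<in>UNIV. cnj (if k = i then 1 else 0) * (if j = i then 1 else 0)) = (if j = k then 1 else 0::complex)" for j k :: 'n
  proof -
    have "cnj (if k = i then 1 else 0) * (if j = i then 1 else 0) = (if i = k then if j = k then 1 else 0 else 0::complex)" for i
      by auto
    then show ?thesis by simp
  qed
  moreover have "(\<Sum>i\<in>UNIV. cnj (z $ i) * (if j = i then 1 else 0)) = cnj (z $ j)" for j and z :: "complex^'n"
  proof -
    have "cnj (z $ i) * (if j = i then 1 else 0) = (if i = j then cnj (z $ j) else 0)" for i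
      by auto
    then show ?thesis by simp
  qed
  ultimately show ?thesis by (simp add: norm_vec_sq)
qed

section \<open>Cut-off functions and their derivatives\<close>

definition pos_part :: "real \<Rightarrow> real" where "pos_part t = max 0 t"

lemma pos_part_nonneg [simp]: "0 \<le> pos_part t" by (simp add: pos_part_def)

lemma continuous_pos_part [continuous_intros]: "continuous_on S f \<Longrightarrow> continuous_on S (\<lambda>x. pos_part (f x))"
  unfolding pos_part_def by (intro continuous_intros)

lemma pos_part_power_deriv:
  "((\<lambda>t. pos_part t ^ Suc (Suc n)) has_real_derivative real (Suc (Suc n)) * pos_part x ^ Suc n) (at x)"
proof -
  consider "x > 0" | "x < 0" | "x = 0" by linarith
  then show ?thesis
  proof cases
    case 1
    have "((\<lambda>t. t ^ Suc (Suc n)) has_real_derivative real (Suc (Suc n)) * x ^ Suc n) (at x)"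
      using DERIV_pow[of "Suc (Suc n)" x] by simp
    then have "((\<lambda>t. pos_part t ^ Suc (Suc n)) has_real_derivative real (Suc (Suc n)) * x ^ Suc n) (at x)"
      by (rule has_field_derivative_transform_within_open[where S="{0<..}"]) (use 1 in \<open>auto simp: pos_part_def\<close>)
    then show ?thesis using 1 by (simp add: pos_part_def)
  next
    case 2
    have "((\<lambda>t. 0) has_real_derivative 0) (at x)" by simp
    then have "((\<lambda>t. pos_part t ^ Suc (Suc n)) has_real_derivative 0) (at x)"
      by (rule has_field_derivative_transform_within_open[where S="{..<0}"]) (use 2 in \<open>auto simp: pos_part_def\<close>)
    then show ?thesis using 2 by (simp add: pos_part_def)
  next
    case 3
    have "(\<lambda>h. (pos_part (0 + h) ^ Suc (Suc n) - pos_part 0 ^ Suc (Suc n)) / h) \<midarrow>0\<rightarrow> 0"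
    proof (rule Lim_null_comparison)
      have "norm ((pos_part (0 + h) ^ Suc (Suc n) - pos_part 0 ^ Suc (Suc n)) / h) \<le> \<bar>h\<bar> ^ Suc n" for h
      proof (cases "h > 0")
        case False
        then have "pos_part (0 + h) = 0" by (simp add: pos_part_def)
        moreover have "pos_part 0 = 0" by (simp add: pos_part_def)
        ultimately have "norm ((pos_part (0 + h) ^ Suc (Suc n) - pos_part 0 ^ Suc (Suc n)) / h) = 0" by simp
        then show ?thesis by (metis abs_ge_zero zero_le_power)
      qed (auto simp: pos_part_def max_def)
      then show "\<forall>\<^sub>F h in at 0. norm ((pos_part (0 + h) ^ Suc (Suc n) - pos_part 0 ^ Suc (Suc n)) / h) \<le> \<bar>h\<bar> ^ Suc n"
        by (intro always_eventually allI)
      have "(\<lambda>h::real. \<bar>h\<bar> ^ Suc n) \<midarrow>0\<rightarrow> \<bar>0\<bar> ^ Suc n" by (intro tendsto_intros)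
      then show "(\<lambda>h::real. \<bar>h\<bar> ^ Suc n) \<midarrow>0\<rightarrow> 0" by simp
    qed
    then show ?thesis unfolding 3 by (simp add: DERIV_def pos_part_def)
  qed
qed

text \<open>Supported in the ball of radius 1 / sqrt s; the fourth power leaves two continuous
  derivatives. For s -> 0 these functions exhaust the space as cut-offs, while for large s, suitably
  normalised, they serve as mollifiers.\<close>

definition bump :: "real \<Rightarrow> complex^'n \<Rightarrow> real" where
  "bump s z = pos_part (1 - s * (norm z)\<^sup>2) ^ 4"

definition bumpA :: "real \<Rightarrow> 'n \<Rightarrow> complex^'n \<Rightarrow> complex" where
  "bumpA s j z = complex_of_real (- 4 * s * pos_part (1 - s * (norm z)\<^sup>2) ^ 3) * cnj (z $ j)"

lemma pos_part_aff_deriv: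
  "((\<lambda>t. c * pos_part (1 - s * t) ^ Suc (Suc n)) has_real_derivative (- s * c * real (Suc (Suc n))) * pos_part (1 - s * t) ^ Suc n) (at t)"
proof -
  have "((\<lambda>t. pos_part (1 - s * t) ^ Suc (Suc n)) has_real_derivative (real (Suc (Suc n)) * pos_part (1 - s * t) ^ Suc n) * (- s)) (at t)"
    by (rule DERIV_chain2[OF pos_part_power_deriv]) (auto intro!: derivative_eq_intros)
  from DERIV_cmult[OF this, of c] show ?thesis by (simp add: mult_ac)
qed

lemma bump_C2R: "\<exists>AA AB. C2R (bump s) (bumpA s) AA AB"
proof -
  have g: "((\<lambda>t. pos_part (1 - s * t) ^ 4) has_real_derivative (- 4 * s * pos_part (1 - s * t) ^ 3)) (at t)" for t
    using pos_part_aff_deriv[of 1 s 2 t] by (simp add: eval_nat_numeral mult_ac)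
  have g': "((\<lambda>t. - 4 * s * pos_part (1 - s * t) ^ 3) has_real_derivative (12 * s\<^sup>2 * pos_part (1 - s * t) ^ 2)) (at t)" for t
    using pos_part_aff_deriv[of "-4 * s" s 1 t] by (simp add: eval_nat_numeral mult_ac)
  have c: "continuous_on UNIV (\<lambda>z::complex^'n. 12 * s\<^sup>2 * pos_part (1 - s * (norm z)\<^sup>2) ^ 2)"
    by (intro continuous_intros)
  show ?thesis
    using C2R_comp[OF C2R_norm_sq g g' c] unfolding bump_def[abs_def] bumpA_def[abs_def] by blast
qed

lemma bump_C1: "C1 (\<lambda>z. complex_of_real (bump s z)) (bumpA s) (\<lambda>j z. cnj (bumpA s j z))"
  using bump_C2R[of s] unfolding C2R_def by blast

lemma bump_bounds: "0 \<le> bump s z" "s \<ge> 0 \<Longrightarrow> bump s z \<le> 1"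
proof -
  show "0 \<le> bump s z" by (simp add: bump_def)
  assume "s \<ge> 0"
  then have "pos_part (1 - s * (norm z)\<^sup>2) \<le> 1" by (simp add: pos_part_def)
  then show "bump s z \<le> 1" unfolding bump_def by (intro power_le_one) auto
qed

lemma bump_zero: "s > 0 \<Longrightarrow> norm z \<ge> 1 / sqrt s \<Longrightarrow> pos_part (1 - s * (norm z)\<^sup>2) = 0"
proof -
  assume s: "s > 0" "norm z \<ge> 1 / sqrt s"
  then have "(1 / sqrt s)\<^sup>2 \<le> (norm z)\<^sup>2" by (intro power_mono) auto
  then have "1 / s \<le> (norm z)\<^sup>2" using s by (simp add: power_divide)
  then show ?thesis using s by (simp add: pos_part_def field_simps)
qed

lemma bump_bsupp: "s > 0 \<Longrightarrow> bsupp (bump s)"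
  unfolding bsupp_def bump_def using bump_zero by (metis power_eq_0_iff zero_less_numeral)

lemma bump_bsupp': "s > 0 \<Longrightarrow> bsupp (\<lambda>z. complex_of_real (bump s z))"
  by (rule bsupp_comp[OF bump_bsupp]) auto

text \<open>On the support |z_j| is at most 1 / sqrt s, which turns the factor 4 s into 4 sqrt s.
  Thus the gradients of the cut-offs tend to zero uniformly as s -> 0, the form in which
  completeness of C^n enters the a priori inequality.\<close>

lemma bumpA_bound: "s > 0 \<Longrightarrow> cmod (bumpA s j z) \<le> 4 * sqrt s"
proof -
  assume s: "s > 0"
  show ?thesis
  proof (cases "norm z \<ge> 1 / sqrt s")
    case True
    then show ?thesis using s bump_zero[OF s True] by (simp add: bumpA_def)
  next
    case False
    have "pos_part (1 - s * (norm z)\<^sup>2) \<le> 1" using s by (simp add: pos_part_def)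
    then have p: "pos_part (1 - s * (norm z)\<^sup>2) ^ 3 \<le> 1" by (intro power_le_one) auto
    have "cmod (z $ j) \<le> norm z" by (rule Finite_Cartesian_Product.norm_nth_le)
    then have zj: "cmod (z $ j) \<le> 1 / sqrt s" using False by linarith
    have "cmod (bumpA s j z) = 4 * s * pos_part (1 - s * (norm z)\<^sup>2) ^ 3 * cmod (z $ j)"
      using s by (simp add: bumpA_def norm_mult norm_power)
    also have "\<dots> \<le> 4 * s * 1 * (1 / sqrt s)"
      using s p zj by (intro mult_mono) auto
    also have "\<dots> = 4 * sqrt s" using s by (simp add: field_simps)
    finally show ?thesis .
  qed
qed

lemma bump_uminus: "bump s (- z) = bump s z"
  by (simp add: bump_def)

section \<open>Convolution with kernels of bounded support\<close>

definition locint :: "(complex^'n \<Rightarrow> complex) \<Rightarrow> bool" where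
  "locint f \<longleftrightarrow> f \<in> borel_measurable borel \<and> (\<forall>R. integrable lborel (\<lambda>y. indicator (cball 0 R) y *\<^sub>R f y))"

lemma locint_measurable [measurable_dest]: "locint f \<Longrightarrow> f \<in> borel_measurable borel"
  by (simp add: locint_def)

lemma locint_mult_bound:
  assumes f: "locint f" and [measurable]: "K \<in> borel_measurable borel"
    and c: "\<And>y. norm (K y) \<le> c" and r: "\<And>y. norm y > r \<Longrightarrow> K y = 0"
  shows "integrable lborel (\<lambda>y. f y * K y)"
    and "norm (\<integral>y. f y * K y \<partial>lborel) \<le> c * (\<integral>y. indicator (cball 0 r) y *\<^sub>R norm (f y) \<partial>lborel)"
proof -
  have [measurable]: "f \<in> borel_measurable borel" using f by (simp add: locint_def)
  have "integrable lborel (\<lambda>y. norm (indicator (cball 0 r) y *\<^sub>R f y))"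
    using f unfolding locint_def by (intro Bochner_Integration.integrable_norm) blast
  then have i: "integrable lborel (\<lambda>y. indicator (cball 0 r) y *\<^sub>R norm (f y))"
    by simp
  have b: "norm (f y * K y) \<le> c * (indicator (cball 0 r) y *\<^sub>R norm (f y))" for y
    using r[of y] mult_right_mono[OF c[of y], of "norm (f y)"] by (auto simp: indicator_def norm_mult mult.commute)
  show 1: "integrable lborel (\<lambda>y. f y * K y)"
    by (rule Bochner_Integration.integrable_bound[OF integrable_mult_right[OF i, of c]])
      (use b in \<open>auto intro!: AE_I2 order_trans[OF b]\<close>)
  have "norm (\<integral>y. f y * K y \<partial>lborel) \<le> (\<integral>y. c * (indicator (cball 0 r) y *\<^sub>R norm (f y)) \<partial>lborel)"
    by (rule Bochner_Integration.integral_norm_bound_integral[OF 1 integrable_mult_right[OF i]]) (rule b)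
  then show "norm (\<integral>y. f y * K y \<partial>lborel) \<le> c * (\<integral>y. indicator (cball 0 r) y *\<^sub>R norm (f y) \<partial>lborel)"
    by simp
qed

definition cv :: "(complex^'n \<Rightarrow> complex) \<Rightarrow> (complex^'n \<Rightarrow> complex) \<Rightarrow> complex^'n \<Rightarrow> complex" where
  "cv f k x = (\<integral>y. f y * k (x - y) \<partial>lborel)"

lemma bsupp_unif_cont:
  fixes k :: "'a::euclidean_space \<Rightarrow> 'b::real_normed_vector"
  assumes c: "continuous_on UNIV k" and "bsupp k" and e: "e > 0"
  shows "\<exists>d>0. \<forall>x y. norm (x - y) < d \<longrightarrow> norm (k x - k y) < e"
proof -
  obtain R where R: "\<And>z. norm z \<ge> R \<Longrightarrow> k z = 0" using assms(2) by (auto simp: bsupp_def)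
  have "uniformly_continuous_on (cball 0 (R + 1)) k"
    by (intro compact_uniformly_continuous continuous_on_subset[OF c]) auto
  then obtain d where d: "d > 0" "\<And>x y. x \<in> cball 0 (R + 1) \<Longrightarrow> y \<in> cball 0 (R + 1) \<Longrightarrow> dist y x < d \<Longrightarrow> dist (k y) (k x) < e"
    using e unfolding uniformly_continuous_on_def by metis
  have "norm (k x - k y) < e" if "norm (x - y) < min d 1" for x y
  proof (cases "norm x \<le> R + 1 \<and> norm y \<le> R + 1")
    case True
    then show ?thesis using d(2)[of y x] that by (simp add: dist_norm)
  next
    case False
    then have "norm x \<ge> R \<and> norm y \<ge> R"
      using norm_triangle_ineq2[of x y] norm_triangle_ineq2[of y x] that by (auto simp: norm_minus_commute)
    then show ?thesis using R e by simp
  qed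
  then show ?thesis using d by (intro exI[of _ "min d 1"]) auto
qed

lemma cv_integrable:
  assumes f: "locint f" and k: "continuous_on UNIV k" "bsupp k"
  shows "integrable lborel (\<lambda>y. f y * k (x - y))"
proof -
  obtain R where R: "\<And>z. norm z \<ge> R \<Longrightarrow> k (x - z) = 0" using bsupp_reflect[OF k(2), of x] by (auto simp: bsupp_def)
  obtain K where K: "\<And>z. norm (k z) \<le> K" using bounded_bsupp[OF k] by blast
  show ?thesis
    by (rule locint_mult_bound(1)[OF f, where r=R and c=K])
      (use R K in \<open>auto intro!: borel_measurable_continuous_onI continuous_on_compose2[OF k(1)] continuous_intros\<close>)
qed

lemma cv_cont:
  assumes f: "locint f" and k: "continuous_on UNIV k" "bsupp k"
  shows "continuous_on UNIV (cv f k)"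
proof (rule continuous_at_imp_continuous_on, rule ballI)
  fix x :: "complex^'a"
  obtain R where R: "\<And>z. norm z \<ge> R \<Longrightarrow> k z = 0" using k(2) by (auto simp: bsupp_def)
  define r where "r = R + norm x + 1"
  define I where "I = (\<integral>y. indicator (cball 0 r) y *\<^sub>R norm (f y) \<partial>lborel)"
  have I: "I \<ge> 0" unfolding I_def by (rule Bochner_Integration.integral_nonneg) auto
  show "isCont (cv f k) x"
    unfolding continuous_at_eps_delta
  proof (intro allI impI)
    fix e :: real assume e: "e > 0"
    define e' where "e' = e / (2 * (I + 1))"
    have e': "e' > 0" using e I by (simp add: e'_def)
    obtain d where d: "d > 0" "\<And>x y. norm (x - y) < d \<Longrightarrow> norm (k x - k y) < e'"
      using bsupp_unif_cont[OF k e'] by blast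
    have "dist (cv f k x') (cv f k x) < e" if x': "dist x' x < min d 1" for x'
    proof -
      have "cv f k x' - cv f k x = (\<integral>y. f y * (k (x' - y) - k (x - y)) \<partial>lborel)"
        unfolding cv_def using cv_integrable[OF f k] by (simp add: right_diff_distrib)
      moreover have "norm (\<integral>y. f y * (k (x' - y) - k (x - y)) \<partial>lborel) \<le> e' * I"
        unfolding I_def
      proof (rule locint_mult_bound(2)[OF f])
        show "(\<lambda>y. k (x' - y) - k (x - y)) \<in> borel_measurable borel"
          by (auto intro!: borel_measurable_continuous_onI continuous_on_compose2[OF k(1)] continuous_intros)
        show "norm (k (x' - y) - k (x - y)) \<le> e'" for y
          using d(2)[of "x' - y" "x - y"] x' by (simp add: dist_norm less_imp_le)
        fix y :: "complex^'a" assume "norm y > r"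
        then have "norm (x - y) \<ge> R" "norm (x' - y) \<ge> R"
          using norm_triangle_ineq2[of y x] norm_triangle_ineq2[of "y - x" "x' - x"] x'
          by (auto simp: r_def norm_minus_commute dist_norm algebra_simps)
        then show "k (x' - y) - k (x - y) = 0" using R by simp
      qed
      moreover have "e' * I < e"
      proof -
        have "e' * I \<le> e' * (I + 1)" using e' by simp
        also have "\<dots> = e / 2" using I by (simp add: e'_def field_simps)
        also have "\<dots> < e" using e by simp
        finally show ?thesis .
      qed
      ultimately show ?thesis by (simp add: dist_norm)
    qed
    then show "\<exists>d>0. \<forall>x'. dist x' x < d \<longrightarrow> dist (cv f k x') (cv f k x) < e"
      using d by (intro exI[of _ "min d 1"]) auto
  qed
qed

text \<open>Uniform continuity of the derivatives makes the remainder of the first-order expansion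
  uniform in the base point; this is what allows differentiation under a convolution
  integral.\<close>

lemma C1_unif:
  assumes k: "C1 k A B" "bsupp k" and e: "e > 0"
  shows "\<exists>d>0. \<forall>w h. norm h < d \<longrightarrow> norm (k (w + h) - k w - wlin (\<lambda>j. A j w) (\<lambda>j. B j w) h) \<le> e * norm h"
proof -
  define N where "N = real CARD('a)"
  have N: "N > 0" by (simp add: N_def)
  define e' where "e' = e / (2 * N)"
  have e': "e' > 0" using e N by (simp add: e'_def)
  have "\<exists>d. \<forall>j. d j > 0 \<and> (\<forall>x y. norm (x - y) < d j \<longrightarrow> norm (A j x - A j y) < e')"
    using bsupp_unif_cont[OF C1_contA[OF k(1)] C1_bsupp(1)[OF k] e'] by metis
  then obtain dA where dA: "\<And>j. dA j > 0" "\<And>j x y. norm (x - y) < dA j \<Longrightarrow> norm (A j x - A j y) < e'" by blast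
  have "\<exists>d. \<forall>j. d j > 0 \<and> (\<forall>x y. norm (x - y) < d j \<longrightarrow> norm (B j x - B j y) < e')"
    using bsupp_unif_cont[OF C1_contB[OF k(1)] C1_bsupp(2)[OF k] e'] by metis
  then obtain dB where dB: "\<And>j. dB j > 0" "\<And>j x y. norm (x - y) < dB j \<Longrightarrow> norm (B j x - B j y) < e'" by blast
  define d where "d = min (Min (range dA)) (Min (range dB))"
  have d: "d > 0" "\<And>j. d \<le> dA j" "\<And>j. d \<le> dB j"
    using dA(1) dB(1) by (auto simp: d_def intro: min.coboundedI1 min.coboundedI2)
  have "norm (k (w + h) - k w - wlin (\<lambda>j. A j w) (\<lambda>j. B j w) h) \<le> e * norm h" if h: "norm h < d" for w h
  proof -
    have "norm (k (w + h) - k w - wlin (\<lambda>j. A j w) (\<lambda>j. B j w) (w + h - w)) \<le> norm (w + h - w) * e"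
    proof (rule differentiable_bound_linearization[where S="ball w d" and f'="\<lambda>z. wlin (\<lambda>j. A j z) (\<lambda>j. B j z)"])
      show "w + t *\<^sub>R (w + h - w) \<in> ball w d" if "t \<in> {0..1}" for t
      proof -
        have "norm (t *\<^sub>R h) \<le> norm h" using that by (simp add: mult_left_le_one_le)
        then show ?thesis using h by (simp add: dist_norm)
      qed
      show "(k has_derivative wlin (\<lambda>j. A j z) (\<lambda>j. B j z)) (at z within ball w d)" for z
        by (rule has_derivative_at_withinI[OF C1_deriv[OF k(1)]])
      fix z assume z: "z \<in> ball w d"
      have "norm ((wlin (\<lambda>j. A j z) (\<lambda>j. B j z) - wlin (\<lambda>j. A j w) (\<lambda>j. B j w)) v) \<le> e * norm v" for v
      proof -
        have "(wlin (\<lambda>j. A j z) (\<lambda>j. B j z) - wlin (\<lambda>j. A j w) (\<lambda>j. B j w)) v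
            = wlin (\<lambda>j. A j z - A j w) (\<lambda>j. B j z - B j w) v"
          by (simp add: wlin_def sum_subtractf[symmetric] algebra_simps)
        also have "norm \<dots> \<le> (\<Sum>j\<in>UNIV. norm (A j z - A j w) + norm (B j z - B j w)) * norm v"
          by (rule norm_wlin_le)
        also have "\<dots> \<le> (\<Sum>j\<in>(UNIV::'a set). e' + e') * norm v"
        proof (intro mult_right_mono sum_mono add_mono)
          have zw: "norm (z - w) < d" using z by (simp add: dist_norm norm_minus_commute)
          show "norm (A j z - A j w) \<le> e'" "norm (B j z - B j w) \<le> e'" for j
            using dA(2)[of z w j] dB(2)[of z w j] d(2,3)[of j] zw by auto
        qed auto
        also have "(\<Sum>j\<in>(UNIV::'a set). e' + e') = e" using N by (simp add: e'_def N_def)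
        finally show ?thesis .
      qed
      then show "onorm (wlin (\<lambda>j. A j z) (\<lambda>j. B j z) - wlin (\<lambda>j. A j w) (\<lambda>j. B j w)) \<le> e"
        by (intro onorm_bound) (use e in auto)
    next
      show "w \<in> ball w d" using d by simp
    qed
    then show ?thesis by (simp add: mult.commute)
  qed
  then show ?thesis using d by blast
qed

text \<open>All derivatives fall on the kernel, so local integrability of \<open>f\<close> is
  enough. Points \<open>y\<close> within distance one of \<open>x\<close> keep the kernels involved
  inside one ball of radius \<open>r\<close>, and the uniform remainder is integrated against |f|
  there.\<close>

lemma cv_C1:
  assumes f: "locint f" and k: "C1 k A B" "bsupp k"
  shows "C1 (cv f k) (\<lambda>j. cv f (A j)) (\<lambda>j. cv f (B j))"
proof -
  note kc = C1_cont[OF k(1)]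
  have cA: "continuous_on UNIV (cv f (A j))" "continuous_on UNIV (cv f (B j))" for j
    by (intro cv_cont f C1_contA[OF k(1)] C1_contB[OF k(1)] C1_bsupp[OF k])+
  have iA: "integrable lborel (\<lambda>y. f y * A j (x - y))" "integrable lborel (\<lambda>y. f y * B j (x - y))" for j x
    by (intro cv_integrable f C1_contA[OF k(1)] C1_contB[OF k(1)] C1_bsupp[OF k])+
  have "(cv f k has_derivative wlin (\<lambda>j. cv f (A j) x) (\<lambda>j. cv f (B j) x)) (at x)" for x
    unfolding has_derivative_at_alt
  proof (intro conjI allI impI)
    show "bounded_linear (wlin (\<lambda>j. cv f (A j) x) (\<lambda>j. cv f (B j) x))" by (rule bounded_linear_wlin)
    fix e :: real assume e: "e > 0"
    obtain R where R: "\<And>z. norm z \<ge> R \<Longrightarrow> k z = 0" using k(2) by (auto simp: bsupp_def)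
    define r where "r = \<bar>R\<bar> + norm x + 2"
    define I where "I = (\<integral>y. indicator (cball 0 r) y *\<^sub>R norm (f y) \<partial>lborel)"
    have I: "I \<ge> 0" unfolding I_def by (rule Bochner_Integration.integral_nonneg) auto
    define e' where "e' = e / (I + 1)"
    have e': "e' > 0" using e I by (simp add: e'_def)
    obtain d where d: "d > 0" "\<And>w h. norm h < d \<Longrightarrow> norm (k (w + h) - k w - wlin (\<lambda>j. A j w) (\<lambda>j. B j w) h) \<le> e' * norm h"
      using C1_unif[OF k e'] by blast
    have AB0: "A j w = 0" "B j w = 0" if w: "norm w \<ge> \<bar>R\<bar> + 1" for j w
    proof -
      have "((\<lambda>z. 0) has_derivative wlin (\<lambda>j. A j w) (\<lambda>j. B j w)) (at w)"
      proof (rule has_derivative_transform_within_open[OF C1_deriv[OF k(1)]])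
        show "open (ball w 1)" "w \<in> ball w 1" by simp_all
        show "k v = 0" if "v \<in> ball w 1" for v
          using that w norm_triangle_ineq2[of w v] by (intro R) (simp add: dist_norm)
      qed
      from has_derivative_unique[OF this has_derivative_const]
      have "A j w = 0 \<and> B j w = 0" by (intro wlin_zero_imp) (auto dest: fun_cong)
      then show "A j w = 0" "B j w = 0" by auto
    qed
    have "norm (cv f k y - cv f k x - wlin (\<lambda>j. cv f (A j) x) (\<lambda>j. cv f (B j) x) (y - x)) \<le> e * norm (y - x)"
      if y: "norm (y - x) < min d 1" for y
    proof -
      define h where "h = y - x"
      have yx: "y = x + h" by (simp add: h_def)
      have w: "wlin (\<lambda>j. cv f (A j) x) (\<lambda>j. cv f (B j) x) h = (\<integral>v. f v * wlin (\<lambda>j. A j (x - v)) (\<lambda>j. B j (x - v)) h \<partial>lborel)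
         \<and> integrable lborel (\<lambda>v. f v * wlin (\<lambda>j. A j (x - v)) (\<lambda>j. B j (x - v)) h)"
      proof -
        have eq: "f v * wlin (\<lambda>j. A j (x - v)) (\<lambda>j. B j (x - v)) h = (\<Sum>j\<in>UNIV. (f v * A j (x - v)) * h $ j + (f v * B j (x - v)) * cnj (h $ j))" for v
          by (simp add: wlin_def sum_distrib_left algebra_simps)
        show ?thesis
          unfolding eq using iA by (simp add: wlin_def cv_def)
      qed
      have "cv f k y - cv f k x - wlin (\<lambda>j. cv f (A j) x) (\<lambda>j. cv f (B j) x) h =
          (\<integral>v. f v * (k (y - v) - k (x - v) - wlin (\<lambda>j. A j (x - v)) (\<lambda>j. B j (x - v)) h) \<partial>lborel)"
        using w cv_integrable[OF f kc k(2)] by (simp add: cv_def right_diff_distrib)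
      also have "norm \<dots> \<le> (e' * norm h) * I"
        unfolding I_def
      proof (rule locint_mult_bound(2)[OF f])
        show "(\<lambda>v. k (y - v) - k (x - v) - wlin (\<lambda>j. A j (x - v)) (\<lambda>j. B j (x - v)) h) \<in> borel_measurable borel"
          unfolding wlin_def
          by (intro borel_measurable_continuous_onI continuous_intros continuous_on_compose2[OF kc]
             continuous_on_compose2[OF C1_contA[OF k(1)]] continuous_on_compose2[OF C1_contB[OF k(1)]]) auto
        show "norm (k (y - v) - k (x - v) - wlin (\<lambda>j. A j (x - v)) (\<lambda>j. B j (x - v)) h) \<le> e' * norm h" for v
          using d(2)[of h "x - v"] y by (simp add: yx algebra_simps)
        fix v :: "complex^'a" assume v: "norm v > r"
        have "norm (x - v) \<ge> \<bar>R\<bar> + 2"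
          using v norm_triangle_ineq2[of v x] by (simp add: r_def norm_minus_commute)
        moreover have "norm (y - v) \<ge> norm (x - v) - norm h"
          using norm_triangle_ineq2[of "x - v" "- h"] by (simp add: yx algebra_simps)
        moreover have "norm h < 1" using y by (simp add: h_def)
        ultimately have "norm (x - v) \<ge> \<bar>R\<bar> + 1" "norm (x - v) \<ge> R" "norm (y - v) \<ge> R" by linarith+
        then show "k (y - v) - k (x - v) - wlin (\<lambda>j. A j (x - v)) (\<lambda>j. B j (x - v)) h = 0"
          using R[of "x - v"] R[of "y - v"] AB0[of "x - v"] by (simp add: wlin_def)
      qed
      also have "\<dots> \<le> e * norm h"
      proof -
        have "e' * I \<le> e' * (I + 1)" using e' by simp
        also have "\<dots> = e" using I by (simp add: e'_def field_simps)
        finally have "(e' * I) * norm h \<le> e * norm h" by (rule mult_right_mono) simp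
        moreover have "(e' * norm h) * I = (e' * I) * norm h" by (simp only: mult_ac)
        ultimately show ?thesis by linarith
      qed
      finally show ?thesis by (simp add: h_def)
    qed
    then show "\<exists>d>0. \<forall>y. norm (y - x) < d \<longrightarrow> norm (cv f k y - cv f k x - wlin (\<lambda>j. cv f (A j) x) (\<lambda>j. cv f (B j) x) (y - x)) \<le> e * norm (y - x)"
      using d by (intro exI[of _ "min d 1"]) auto
  qed
  then show ?thesis unfolding C1_def using cA by auto
qed

section \<open>Mollification and weakly holomorphic functions\<close>

text \<open>The support has radius 1 / sqrt s in real dimension 2n, so the factor s^n makes the
  integral independent of \<open>s\<close>.\<close>

definition kr :: "real \<Rightarrow> complex^'n \<Rightarrow> real" where
  "kr s z = s ^ CARD('n) * bump s z"

definition krc :: "real \<Rightarrow> complex^'n \<Rightarrow> complex" where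
  "krc s z = complex_of_real (kr s z)"

text \<open>The equation dbar F = 0 in the sense of distributions, with C^1 test functions of
  bounded support.\<close>

definition weak_hol :: "(complex^'n \<Rightarrow> complex) \<Rightarrow> bool" where
  "weak_hol F \<longleftrightarrow> locint F \<and> (\<forall>k A B j. C1 k A B \<longrightarrow> bsupp k \<longrightarrow> (\<integral>y. F y * B j y \<partial>lborel) = 0)"

lemma kr_cont: "continuous_on UNIV (kr s)"
  unfolding kr_def[abs_def] bump_def by (intro continuous_intros)

lemma krc_cont: "continuous_on UNIV (krc s)"
  unfolding krc_def[abs_def] kr_def bump_def by (intro continuous_intros)

lemma kr_nonneg: "s \<ge> 0 \<Longrightarrow> 0 \<le> kr s z"
  by (simp add: kr_def bump_bounds)

lemma kr_bsupp: "s > 0 \<Longrightarrow> bsupp (kr s)"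
  by (rule bsupp_comp[OF bump_bsupp]) (auto simp: kr_def)

lemma krc_bsupp: "s > 0 \<Longrightarrow> bsupp (krc s)"
  by (rule bsupp_comp[OF bump_bsupp]) (auto simp: krc_def kr_def)

lemma kr_zero: "s > 0 \<Longrightarrow> norm z \<ge> 1 / sqrt s \<Longrightarrow> kr s z = 0"
  using bump_zero[of s z] by (simp add: kr_def bump_def)

lemma kr_uminus: "kr s (- z) = kr s z"
  by (simp add: kr_def bump_uminus)

text \<open>The derivative of \<open>kr s w\<close> with respect to the scale parameter
  \<open>s\<close>.\<close>

definition dk :: "real \<Rightarrow> complex^'n \<Rightarrow> real" where
  "dk s w = s ^ (CARD('n) - 1) * (real CARD('n) * pos_part (1 - s * (norm w)\<^sup>2) ^ 4 - 4 * s * (norm w)\<^sup>2 * pos_part (1 - s * (norm w)\<^sup>2) ^ 3)"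

lemma kr_deriv: "((\<lambda>s. kr s w) has_real_derivative dk s w) (at s)"
  for w :: "complex^'n"
proof -
  define N where "N = (norm w)\<^sup>2"
  have d1: "((\<lambda>s. pos_part (1 - s * N) ^ 4) has_real_derivative (- 4 * N * pos_part (1 - s * N) ^ 3)) (at s)"
    using pos_part_aff_deriv[of 1 N 2 s] by (simp add: eval_nat_numeral mult_ac)
  have d2: "((\<lambda>s. s ^ CARD('n)) has_real_derivative real CARD('n) * s ^ (CARD('n) - Suc 0)) (at s)"
    by (rule DERIV_pow)
  have e: "s ^ CARD('n) = s * s ^ (CARD('n) - 1)"
    by (metis One_nat_def Suc_pred power_Suc zero_less_card_finite)
  have "((\<lambda>s. s ^ CARD('n) * pos_part (1 - s * N) ^ 4) has_real_derivative
     s ^ CARD('n) * (- 4 * N * pos_part (1 - s * N) ^ 3) + real CARD('n) * s ^ (CARD('n) - Suc 0) * pos_part (1 - s * N) ^ 4) (at s)"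
    by (rule DERIV_mult'[OF d2 d1])
  moreover have "s ^ CARD('n) * (- 4 * N * pos_part (1 - s * N) ^ 3) + real CARD('n) * s ^ (CARD('n) - Suc 0) * pos_part (1 - s * N) ^ 4 = dk s w"
    unfolding dk_def N_def[symmetric] by (simp add: e algebra_simps)
  ultimately show ?thesis by (simp add: kr_def bump_def N_def)
qed

lemma dk_zero: "s > 0 \<Longrightarrow> norm z \<ge> 1 / sqrt s \<Longrightarrow> dk s z = 0"
  using bump_zero[of s z] by (simp add: dk_def)

text \<open>\<open>dk\<close> is uniformly continuous on the compact set where the scale stays
  between s/2 and 2s and \<open>w\<close> stays in the common support; outside that support all
  terms vanish.\<close>

lemma kr_unif:
  assumes s: "s > 0" and e: "e > 0"
  shows "\<exists>d>0. d < s / 2 \<and> (\<forall>h w::complex^'n. \<bar>h\<bar> < d \<longrightarrow> \<bar>kr (s + h) w - kr s w - h * dk s w\<bar> \<le> e * \<bar>h\<bar>)"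
proof -
  define \<rho> where "\<rho> = 1 / sqrt (s / 2)"
  define K where "K = {s / 2..2 * s} \<times> cball (0::complex^'n) \<rho>"
  have "continuous_on K (\<lambda>p. dk (fst p) (snd p))"
    unfolding dk_def by (intro continuous_intros)
  moreover have "compact K" unfolding K_def by (intro compact_Times) auto
  ultimately have "uniformly_continuous_on K (\<lambda>p. dk (fst p) (snd p))"
    by (rule compact_uniformly_continuous)
  then obtain d where d: "d > 0" "\<And>p q. p \<in> K \<Longrightarrow> q \<in> K \<Longrightarrow> dist q p < d \<Longrightarrow> dist (dk (fst q) (snd q)) (dk (fst p) (snd p)) < e"
    using e unfolding uniformly_continuous_on_def by metis
  define d' where "d' = min d (s / 4)"
  have d': "d' > 0" "d' < s / 2" "d' \<le> d" using d s by (auto simp: d'_def)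
  have "\<bar>kr (s + h) w - kr s w - h * dk s w\<bar> \<le> e * \<bar>h\<bar>" if h: "\<bar>h\<bar> < d'" for h and w :: "complex^'n"
  proof (cases "norm w \<le> \<rho>")
    case True
    have "norm (kr (s + h) w - kr s w - (\<lambda>h. dk s w * h) (s + h - s)) \<le> norm (s + h - s) * e"
    proof (rule differentiable_bound_linearization[where S="ball s d'" and f'="\<lambda>t h. dk t w * h"])
      show "s + t *\<^sub>R (s + h - s) \<in> ball s d'" if "t \<in> {0..1}" for t
      proof -
        have "\<bar>t * h\<bar> \<le> \<bar>h\<bar>" using that by (simp add: abs_mult mult_left_le_one_le)
        then show ?thesis using h by (simp add: dist_real_def)
      qed
      show "((\<lambda>s. kr s w) has_derivative (\<lambda>h. dk t w * h)) (at t within ball s d')" for t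
        using kr_deriv[of w t] by (auto simp: has_field_derivative_def intro: has_derivative_at_withinI)
      show "s \<in> ball s d'" using d' by simp
      fix t assume t: "t \<in> ball s d'"
      have "(t, w) \<in> K" "(s, w) \<in> K" using True t d' s by (auto simp: K_def dist_real_def)
      moreover have "dist (t, w) (s, w) < d" using t d' by (simp add: dist_prod_def dist_real_def abs_minus_commute)
      ultimately have "\<bar>dk t w - dk s w\<bar> \<le> e" using d(2)[of "(s, w)" "(t, w)"] by (simp add: dist_real_def)
      then show "onorm ((\<lambda>h. dk t w * h) - (\<lambda>h. dk s w * h)) \<le> e"
        by (intro onorm_bound) (use e in \<open>auto simp: left_diff_distrib[symmetric] abs_mult intro: mult_right_mono\<close>)
    qed
    then show ?thesis by (simp add: mult.commute)
  next
    case False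
    have "norm w \<ge> 1 / sqrt t" if "t \<ge> s / 2" for t
    proof -
      have "1 / sqrt t \<le> 1 / sqrt (s / 2)" using that s by (intro divide_left_mono) auto
      then show ?thesis using False by (simp add: \<rho>_def)
    qed
    moreover have "s + h \<ge> s / 2" using h d' by linarith
    ultimately show ?thesis using kr_zero[of "s + h" w] kr_zero[of s w] dk_zero[of s w] s e by simp
  qed
  then show ?thesis using d' by blast
qed

text \<open>The scaling derivative of the kernel is the divergence, in the conjugate variables, of the
  compactly supported fields \<open>kj\<close>; hence mollifying \<open>F\<close> does not depend on the scale.\<close>

lemma weak_hol_dk:
  fixes x :: "complex^'n"
  assumes F: "weak_hol F" and s: "s > 0"
  shows "(\<integral>y. F y * complex_of_real (dk s (x - y)) \<partial>lborel) = 0"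
proof -
  define kj where "kj j w = cnj (w $ j) * complex_of_real (bump s w)" for j and w :: "complex^'n"
  define Bj where "Bj j i w = cnj (w $ j) * cnj (bumpA s i w) + cnj (if i = j then 1 else 0) * complex_of_real (bump s w)" for j i and w :: "complex^'n"
  have C: "C1 (kj j) (\<lambda>i w. cnj (w $ j) * bumpA s i w + cnj 0 * complex_of_real (bump s w)) (Bj j)" for j
    unfolding kj_def[abs_def] Bj_def[abs_def] by (rule C1_mult[OF C1_cnj[OF C1_coord] bump_C1])
  have b: "bsupp (kj j)" for j
    by (rule bsupp_comp[OF bump_bsupp'[OF s]]) (simp add: kj_def)
  have z: "(\<integral>y. F y * Bj j i (x - y) \<partial>lborel) = 0" for i j
  proof -
    have "(\<integral>y. F y * (- Bj j i (x - y)) \<partial>lborel) = 0"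
      using F C1_reflect[OF C[of j], of x] bsupp_reflect[OF b[of j], of x] unfolding weak_hol_def by blast
    then show ?thesis by simp
  qed
  have int: "integrable lborel (\<lambda>y. F y * Bj j i (x - y))" for i j
    by (rule cv_integrable[OF _ C1_contB[OF C] C1_bsupp(2)[OF C b]]) (use F in \<open>simp add: weak_hol_def\<close>)
  \<comment> \<open>Writing the bump as chi(s |w|^2), both sides equal s^(n-1) (n chi + s |w|^2
    chi'): on the left the s-derivative of s^n chi, on the right s^(n-1) times the divergence of the
    fields conj(w_j) chi.\<close>
  have eq: "complex_of_real (dk s w) = complex_of_real (s ^ (CARD('n) - 1)) * (\<Sum>j\<in>UNIV. Bj j j w)" for w
  proof -
    have "Bj j j w = complex_of_real (pos_part (1 - s * (norm w)\<^sup>2) ^ 4 - 4 * s * pos_part (1 - s * (norm w)\<^sup>2) ^ 3 * (cmod (w $ j))\<^sup>2)" for j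
      unfolding Bj_def bumpA_def bump_def of_real_diff of_real_mult complex_norm_square
      by (simp add: algebra_simps)
    then have "(\<Sum>j\<in>UNIV. Bj j j w) = complex_of_real (\<Sum>j\<in>(UNIV::'n set). pos_part (1 - s * (norm w)\<^sup>2) ^ 4 - 4 * s * pos_part (1 - s * (norm w)\<^sup>2) ^ 3 * (cmod (w $ j))\<^sup>2)"
      by (simp only: of_real_sum)
    also have "(\<Sum>j\<in>(UNIV::'n set). pos_part (1 - s * (norm w)\<^sup>2) ^ 4 - 4 * s * pos_part (1 - s * (norm w)\<^sup>2) ^ 3 * (cmod (w $ j))\<^sup>2)
        = real CARD('n) * pos_part (1 - s * (norm w)\<^sup>2) ^ 4 - 4 * s * pos_part (1 - s * (norm w)\<^sup>2) ^ 3 * (norm w)\<^sup>2"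
      by (simp only: sum_subtractf sum_distrib_left[symmetric] norm_vec_sq[symmetric]) simp
    finally have "(\<Sum>j\<in>UNIV. Bj j j w) = complex_of_real (real CARD('n) * pos_part (1 - s * (norm w)\<^sup>2) ^ 4 - 4 * s * (norm w)\<^sup>2 * pos_part (1 - s * (norm w)\<^sup>2) ^ 3)"
      by (simp only: mult_ac)
    then show ?thesis unfolding dk_def by (simp only: of_real_mult)
  qed
  have "(\<integral>y. F y * complex_of_real (dk s (x - y)) \<partial>lborel)
      = (\<integral>y. complex_of_real (s ^ (CARD('n) - 1)) * (\<Sum>j\<in>UNIV. F y * Bj j j (x - y)) \<partial>lborel)"
    unfolding eq by (simp only: sum_distrib_left mult_ac)
  also have "\<dots> = 0"
    using int z by simp
  finally show ?thesis .
qed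

text \<open>The derivative in \<open>s\<close> of the mollification is the pairing of
  \<open>F\<close> with \<open>dk\<close>, which vanishes. This takes the part of the mean value
  property: the values of \<open>F\<close> at small scales can be read off at any larger
  one.\<close>

lemma weak_hol_cv_const:
  fixes x :: "complex^'n"
  assumes F: "weak_hol F" and s: "s > 0" "t > 0"
  shows "cv F (krc s) x = cv F (krc t) x"
proof -
  have lF: "locint F" using F by (simp add: weak_hol_def)
  have deriv: "((\<lambda>s. cv F (krc s) x) has_derivative (\<lambda>h. 0)) (at s)" if s: "s > 0" for s
    unfolding has_derivative_at_alt
  proof (intro conjI allI impI)
    fix e :: real assume e: "e > 0"
    define r where "r = norm x + 1 / sqrt (s / 2)"
    define I where "I = (\<integral>y. indicator (cball 0 r) y *\<^sub>R norm (F y) \<partial>lborel)"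
    have I: "I \<ge> 0" unfolding I_def by (rule Bochner_Integration.integral_nonneg) auto
    define e' where "e' = e / (I + 1)"
    have e': "e' > 0" using e I by (simp add: e'_def)
    obtain d where d: "d > 0" "d < s / 2"
      "\<And>h (w::complex^'n). \<bar>h\<bar> < d \<Longrightarrow> \<bar>kr (s + h) w - kr s w - h * dk s w\<bar> \<le> e' * \<bar>h\<bar>"
      using kr_unif[OF s e'] by blast
    have "norm (cv F (krc y) x - cv F (krc s) x - 0) \<le> e * norm (y - s)" if y: "norm (y - s) < d" for y
    proof -
      define h where "h = y - s"
      have yh: "y = s + h" by (simp add: h_def)
      have hd: "\<bar>h\<bar> < d" using y by (simp add: h_def)
      have y0: "y > 0" "y \<ge> s / 2" using hd d by (auto simp: yh)
      have far: "norm (x - v) \<ge> 1 / sqrt t" if "norm v > r" "t \<ge> s / 2" for t v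
      proof -
        have "1 / sqrt t \<le> 1 / sqrt (s / 2)" using that s by (intro divide_left_mono) auto
        then show ?thesis using that norm_triangle_ineq2[of v x] by (simp add: r_def norm_minus_commute)
      qed
      have dkc: "continuous_on UNIV (\<lambda>v. complex_of_real (dk s (x - v)))"
        unfolding dk_def by (intro continuous_intros)
      have "bsupp (\<lambda>v. complex_of_real (dk s (x - v)))"
      proof -
        have "dk s (x - v) = 0" if "norm v \<ge> r + 1" for v
          using dk_zero[OF s far[of v s]] that s by simp
        then show ?thesis unfolding bsupp_def by auto
      qed
      then obtain K where K: "\<And>v. norm (complex_of_real (dk s (x - v))) \<le> K" using bounded_bsupp[OF dkc] by blast
      have idk: "integrable lborel (\<lambda>v. F v * complex_of_real (dk s (x - v)))"
        by (rule locint_mult_bound(1)[OF lF, where r=r and c=K])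
          (use K far[of _ s] dk_zero[OF s] s dkc in \<open>auto intro: borel_measurable_continuous_onI\<close>)
      have ik: "integrable lborel (\<lambda>v. F v * krc y (x - v))" "integrable lborel (\<lambda>v. F v * krc s (x - v))"
        using y0 s by (auto intro!: cv_integrable[OF lF krc_cont krc_bsupp])
      have "cv F (krc y) x - cv F (krc s) x = cv F (krc y) x - cv F (krc s) x - complex_of_real h * (\<integral>v. F v * complex_of_real (dk s (x - v)) \<partial>lborel)"
        by (simp add: weak_hol_dk[OF F s])
      also have "\<dots> = (\<integral>v. F v * krc y (x - v) - F v * krc s (x - v) - complex_of_real h * (F v * complex_of_real (dk s (x - v))) \<partial>lborel)"
        unfolding cv_def using ik idk by simp
      also have "\<dots> = (\<integral>v. F v * complex_of_real (kr (s + h) (x - v) - kr s (x - v) - h * dk s (x - v)) \<partial>lborel)"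
        by (rule Bochner_Integration.integral_cong) (auto simp: krc_def yh algebra_simps)
      also have "norm \<dots> \<le> (e' * \<bar>h\<bar>) * I"
        unfolding I_def
      proof (rule locint_mult_bound(2)[OF lF])
        show "(\<lambda>v. complex_of_real (kr (s + h) (x - v) - kr s (x - v) - h * dk s (x - v))) \<in> borel_measurable borel"
          unfolding kr_def bump_def dk_def by (intro borel_measurable_continuous_onI continuous_intros)
        show "norm (complex_of_real (kr (s + h) (x - v) - kr s (x - v) - h * dk s (x - v))) \<le> e' * \<bar>h\<bar>" for v
          using d(3)[OF hd, of "x - v"] by (simp only: norm_of_real)
        show "complex_of_real (kr (s + h) (x - v) - kr s (x - v) - h * dk s (x - v)) = 0" if "norm v > r" for v
          using kr_zero[OF y0(1) far[OF that y0(2)]] kr_zero[OF s far[OF that]] dk_zero[OF s far[OF that]] s by (simp add: yh)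
      qed
      also have "\<dots> \<le> e * \<bar>h\<bar>"
      proof -
        have "e' * I \<le> e' * (I + 1)" using e' by simp
        also have "\<dots> = e" using I by (simp add: e'_def field_simps)
        finally have "(e' * I) * \<bar>h\<bar> \<le> e * \<bar>h\<bar>" by (rule mult_right_mono) simp
        moreover have "(e' * \<bar>h\<bar>) * I = (e' * I) * \<bar>h\<bar>" by (simp only: mult_ac)
        ultimately show ?thesis by linarith
      qed
      finally show ?thesis by (simp add: h_def)
    qed
    then show "\<exists>d>0. \<forall>y. norm (y - s) < d \<longrightarrow> norm (cv F (krc y) x - cv F (krc s) x - 0) \<le> e * norm (y - s)"
      using d by blast
  qed simp
  have "\<exists>c. \<forall>s\<in>{0<..}. cv F (krc s) x = c"
    by (rule has_derivative_zero_constant[where f="\<lambda>s. cv F (krc s) x"]) (auto intro: has_derivative_at_withinI deriv)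
  then show ?thesis using s by (metis greaterThan_iff)
qed

lemma locint_const: "locint (\<lambda>y. c)"
  unfolding locint_def
  by (intro conjI allI borel_integrable_compact compact_cball continuous_on_const borel_measurable_const)

lemma weak_hol_const: "weak_hol (\<lambda>y. c)"
  unfolding weak_hol_def
proof (intro conjI allI impI locint_const)
  fix k and A B :: "'a \<Rightarrow> complex^'a \<Rightarrow> complex" and j
  assume "C1 k A B" "bsupp k"
  then have "integral\<^sup>L lborel (B j) = 0" by (rule C1_integral_zero(2))
  then show "(\<integral>y. c * B j y \<partial>lborel) = 0" by simp
qed

definition km :: "'n::finite itself \<Rightarrow> real" where
  "km _ = (\<integral>y. kr 1 (y::complex^'n) \<partial>lborel)"

lemma lborel_integral_reflect:
  fixes f :: "complex^'n \<Rightarrow> real"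
  assumes f: "f \<in> borel_measurable borel" and u: "\<And>z. f (- z) = f z"
  shows "(\<integral>y. f (x - y) \<partial>lborel) = integral\<^sup>L lborel f"
proof -
  have "f (x - y) = f (- x + y)" for y using u[of "x - y"] by (simp add: algebra_simps)
  then show ?thesis using lborel_integral_translate[OF f, of "- x"] by simp
qed

lemma kr_integrable: "s > 0 \<Longrightarrow> integrable lborel (\<lambda>y. kr s (x - y))"
  by (rule integrable_bsupp[OF continuous_on_compose2[OF kr_cont] bsupp_reflect[OF kr_bsupp]])
    (auto intro!: continuous_on_diff continuous_on_const continuous_on_id)

text \<open>The constant 1 is weakly holomorphic, and scale independence of its mollification says
  that all kernels have the same mass.\<close>

lemma kr_mass:
  fixes x :: "complex^'n"
  assumes "s > 0"
  shows "(\<integral>y. kr s (x - y) \<partial>lborel) = km TYPE('n)"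
proof -
  have m: "kr s \<in> borel_measurable borel" for s :: real
    by (rule borel_measurable_continuous_onI[OF kr_cont])
  have "cv (\<lambda>y::complex^'n. 1) (krc s) 0 = cv (\<lambda>y::complex^'n. 1) (krc 1) 0"
    by (rule weak_hol_cv_const[OF weak_hol_const[of 1] assms zero_less_one])
  then have "(\<integral>y. kr s (0 - y :: complex^'n) \<partial>lborel) = (\<integral>y. kr 1 (0 - y :: complex^'n) \<partial>lborel)"
    unfolding cv_def krc_def by (simp only: mult_1 integral_complex_of_real of_real_eq_iff)
  then have "integral\<^sup>L lborel (kr s :: complex^'n \<Rightarrow> real) = integral\<^sup>L lborel (kr 1 :: complex^'n \<Rightarrow> real)"
    by (simp only: lborel_integral_reflect[OF m kr_uminus])
  then show ?thesis
    by (simp only: lborel_integral_reflect[OF m kr_uminus] km_def)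
qed

lemma km_pos: "km TYPE('n::finite) > 0"
proof -
  have i: "integrable lborel (kr 1 :: complex^'n \<Rightarrow> real)"
    by (intro integrable_bsupp kr_cont kr_bsupp) auto
  have "km TYPE('n) \<ge> (\<integral>y. indicator (ball (0::complex^'n) (1/2)) y *\<^sub>R ((1/2)^4) \<partial>lborel)"
    unfolding km_def
  proof (rule integral_mono[OF _ i])
    show "integrable lborel (\<lambda>y. indicator (ball (0::complex^'n) (1/2)) y *\<^sub>R ((1/2)^4::real))"
      by (rule integrableI_bounded_set_indicator[where B=1]) (use emeasure_lborel_ball_finite[of "0::complex^'n" "1/2"] in \<open>auto simp: power_le_one\<close>)
    show "indicator (ball 0 (1/2)) y *\<^sub>R (1/2)^4 \<le> kr 1 y" for y :: "complex^'n"
    proof (cases "y \<in> ball 0 (1/2)")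
      case True
      then have "(norm y)\<^sup>2 \<le> (1/2)\<^sup>2" by (intro power_mono) auto
      then have "1/2 \<le> pos_part (1 - 1 * (norm y)\<^sup>2)" by (simp add: pos_part_def power2_eq_square)
      then have "(1/2)^4 \<le> pos_part (1 - 1 * (norm y)\<^sup>2)^4" by (intro power_mono) auto
      then show ?thesis using True by (simp add: kr_def bump_def)
    next
      case False
      then show ?thesis by (simp add: kr_nonneg)
    qed
  qed
  moreover have "(\<integral>y. indicator (ball (0::complex^'n) (1/2)) y *\<^sub>R ((1/2)^4::real) \<partial>lborel) = measure lborel (ball (0::complex^'n) (1/2)) * (1/2)^4"
    by simp
  moreover have "measure lborel (ball (0::complex^'n) (1/2)) > 0"
    by (rule content_ball_pos) simp
  ultimately have "km TYPE('n) \<ge> measure lborel (ball (0::complex^'n) (1/2)) * (1/2)^4" by simp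
  moreover have "measure lborel (ball (0::complex^'n) (1/2)) * (1/2)^4 > 0"
    using \<open>measure lborel (ball (0::complex^'n) (1/2)) > 0\<close> by simp
  ultimately show ?thesis by (rule less_le_trans[rotated])
qed

section \<open>Local square integrability and convergence of mollifications\<close>

definition mollify :: "real \<Rightarrow> (complex^'n \<Rightarrow> complex) \<Rightarrow> complex^'n \<Rightarrow> complex" where
  "mollify s f x = cv f (krc s) x / complex_of_real (km TYPE('n))"

definition ib :: "real \<Rightarrow> (complex^'n \<Rightarrow> complex) \<Rightarrow> complex^'n \<Rightarrow> complex" where
  "ib R f x = indicator (cball 0 R) x *\<^sub>R f x"

text \<open>Density of continuous functions is built into local square integrability, which avoids
  invoking it as a theorem.\<close>

definition L2loc :: "(complex^'n \<Rightarrow> complex) \<Rightarrow> bool" where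
  "L2loc f \<longleftrightarrow> f \<in> borel_measurable borel \<and>
     (\<forall>R. \<forall>e>0. \<exists>c. continuous_on UNIV c \<and> L2 lborel (ib R (\<lambda>x. f x - c x)) \<and> n2 lborel (ib R (\<lambda>x. f x - c x)) < e)"

lemma ib_measurable:
  assumes [measurable]: "f \<in> borel_measurable borel"
  shows "ib R f \<in> borel_measurable lborel"
proof -
  have [measurable]: "cball (0::complex^'a) R \<in> sets borel" by simp
  have "ib R f \<in> borel_measurable borel" unfolding ib_def[abs_def] by measurable
  then show ?thesis by simp
qed

lemma L2_ib_cont:
  assumes "continuous_on UNIV c"
  shows "L2 lborel (ib R c)"
proof -
  have m: "ib R c \<in> borel_measurable lborel"
    by (intro ib_measurable borel_measurable_continuous_onI assms)
  have "integrable lborel (\<lambda>x. indicator (cball 0 R) x *\<^sub>R ((norm (c x))\<^sup>2))"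
    by (rule borel_integrable_compact) (auto intro!: continuous_intros continuous_on_subset[OF assms])
  moreover have "(\<lambda>x. indicator (cball 0 R) x *\<^sub>R ((norm (c x))\<^sup>2)) = (\<lambda>x. (norm (ib R c x))\<^sup>2)"
    by (auto simp: ib_def indicator_def fun_eq_iff)
  ultimately show ?thesis using m by (simp add: L2_def)
qed

lemma L2loc_measurable [measurable_dest]: "L2loc f \<Longrightarrow> f \<in> borel_measurable borel"
  by (simp add: L2loc_def)

lemma L2loc_L2:
  assumes "L2loc f"
  shows "L2 lborel (ib R f)"
proof -
  obtain c where c: "continuous_on UNIV c" "L2 lborel (ib R (\<lambda>x. f x - c x))"
    using assms unfolding L2loc_def by (meson zero_less_one)
  have "ib R f = (\<lambda>x. ib R (\<lambda>x. f x - c x) x + ib R c x)"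
    by (auto simp: ib_def fun_eq_iff scaleR_diff_right)
  then show ?thesis using L2_add[OF c(2) L2_ib_cont[OF c(1), of R]] by simp
qed

lemma integrable_ib_L2:
  assumes "L2 lborel (ib R f)"
  shows "integrable lborel (ib R f)"
proof (rule Bochner_Integration.integrable_bound)
  have "integrable lborel (\<lambda>x::complex^'a. indicator (cball 0 R) x *\<^sub>R (1::real))"
    by (rule borel_integrable_compact) auto
  then show "integrable lborel (\<lambda>x. indicator (cball 0 R) x *\<^sub>R 1 + (norm (ib R f x))\<^sup>2)"
    using assms unfolding L2_def by (intro Bochner_Integration.integrable_add) auto
  have "norm (ib R f x) \<le> indicator (cball 0 R) x *\<^sub>R 1 + (norm (ib R f x))\<^sup>2" for x
  proof (cases "x \<in> cball 0 R")
    case True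
    have "norm (ib R f x) \<le> 1 + (norm (ib R f x))\<^sup>2"
    proof -
      have "2 * norm (ib R f x) \<le> 1 + (norm (ib R f x))\<^sup>2"
        using sum_squares_bound[of 1 "norm (ib R f x)"] by simp
      then show ?thesis using norm_ge_zero[of "ib R f x"] by linarith
    qed
    then show ?thesis using True by simp
  qed (simp add: ib_def)
  then show "AE x in lborel. norm (ib R f x) \<le> norm (indicator (cball 0 R) x *\<^sub>R 1 + (norm (ib R f x))\<^sup>2)"
    by (auto intro!: AE_I2 order_trans[OF _ abs_ge_self])
qed (use assms in \<open>simp add: L2_def\<close>)

lemma L2loc_locint: "L2loc f \<Longrightarrow> locint f"
  unfolding locint_def ib_def[symmetric]
  using integrable_ib_L2[OF L2loc_L2] L2loc_measurable by blast

lemma L2_locint: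
  assumes "L2 lborel f"
  shows "locint f"
proof -
  have m: "f \<in> borel_measurable borel" using assms by (simp add: L2_def)
  have "L2 lborel (ib R f)" for R
    by (rule L2_bound[OF assms ib_measurable[OF m], where C=1]) (auto simp: ib_def indicator_def)
  from integrable_ib_L2[OF this] show ?thesis
    unfolding locint_def using m by (simp add: ib_def[abs_def])
qed

lemma L2loc_mult:
  assumes f: "L2loc f" and g: "continuous_on UNIV g"
  shows "L2loc (\<lambda>x. g x * f x)"
  unfolding L2loc_def
proof (intro conjI allI impI)
  have mg: "g \<in> borel_measurable borel" by (rule borel_measurable_continuous_onI[OF g])
  have mf: "f \<in> borel_measurable borel" by (rule L2loc_measurable[OF f])
  show "(\<lambda>x. g x * f x) \<in> borel_measurable borel" using mg mf by measurable
  fix R e :: real assume e: "e > 0"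
  have "bounded (g ` cball 0 R)"
    by (intro compact_imp_bounded compact_continuous_image continuous_on_subset[OF g]) auto
  then obtain K where K: "K > 0" "\<And>x. x \<in> cball 0 R \<Longrightarrow> norm (g x) \<le> K" unfolding bounded_pos by auto
  have "e / K\<^sup>2 > 0" using e K by simp
  then obtain c where c: "continuous_on UNIV c" "L2 lborel (ib R (\<lambda>x. f x - c x))" "n2 lborel (ib R (\<lambda>x. f x - c x)) < e / K\<^sup>2"
    using f unfolding L2loc_def by blast
  have mc: "c \<in> borel_measurable borel" by (rule borel_measurable_continuous_onI[OF c(1)])
  have b: "norm (ib R (\<lambda>x. g x * f x - g x * c x) x) \<le> K * norm (ib R (\<lambda>x. f x - c x) x)" for x
    using K by (auto simp: ib_def indicator_def right_diff_distrib[symmetric] norm_mult intro: mult_right_mono)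
  have L: "L2 lborel (ib R (\<lambda>x. g x * f x - g x * c x))"
    by (rule L2_bound[OF c(2) _ b]) (use mf mg mc in \<open>intro ib_measurable borel_measurable_diff borel_measurable_times\<close>)
  have "n2 lborel (ib R (\<lambda>x. g x * f x - g x * c x)) \<le> K\<^sup>2 * n2 lborel (ib R (\<lambda>x. f x - c x))"
    by (rule n2_mono_bound[OF c(2) L b])
  also have "\<dots> < e" using c(3) K by (simp add: field_simps)
  finally show "\<exists>c. continuous_on UNIV c \<and> L2 lborel (ib R (\<lambda>x. g x * f x - c x)) \<and> n2 lborel (ib R (\<lambda>x. g x * f x - c x)) < e"
    using L by (intro exI[of _ "\<lambda>x. g x * c x"]) (auto intro!: continuous_intros g c(1))
qed

lemma L2loc_add:
  assumes f: "L2loc f" and g: "L2loc g"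
  shows "L2loc (\<lambda>x. f x + g x)"
  unfolding L2loc_def
proof (intro conjI allI impI)
  show "(\<lambda>x. f x + g x) \<in> borel_measurable borel"
    using L2loc_measurable[OF f] L2loc_measurable[OF g] by measurable
  fix R e :: real assume e: "e > 0"
  then have "e / 4 > 0" by simp
  then obtain c d where c: "continuous_on UNIV c" "L2 lborel (ib R (\<lambda>x. f x - c x))" "n2 lborel (ib R (\<lambda>x. f x - c x)) < e / 4"
    and d: "continuous_on UNIV d" "L2 lborel (ib R (\<lambda>x. g x - d x))" "n2 lborel (ib R (\<lambda>x. g x - d x)) < e / 4"
    using f g unfolding L2loc_def by meson
  have eq: "ib R (\<lambda>x. f x + g x - (c x + d x)) = (\<lambda>x. ib R (\<lambda>x. f x - c x) x + ib R (\<lambda>x. g x - d x) x)"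
    by (auto simp: ib_def fun_eq_iff algebra_simps)
  have "n2 lborel (ib R (\<lambda>x. f x + g x - (c x + d x))) < e"
    unfolding eq using n2_add_le[OF c(2) d(2)] c(3) d(3) by linarith
  moreover have "L2 lborel (ib R (\<lambda>x. f x + g x - (c x + d x)))"
    unfolding eq by (rule L2_add[OF c(2) d(2)])
  ultimately show "\<exists>c. continuous_on UNIV c \<and> L2 lborel (ib R (\<lambda>x. f x + g x - c x)) \<and> n2 lborel (ib R (\<lambda>x. f x + g x - c x)) < e"
    by (intro exI[of _ "\<lambda>x. c x + d x"]) (auto intro!: continuous_intros c(1) d(1))
qed

lemma L2loc_cont:
  assumes "continuous_on UNIV f"
  shows "L2loc f"
  unfolding L2loc_def
proof (intro conjI allI impI)
  show "f \<in> borel_measurable borel" by (rule borel_measurable_continuous_onI[OF assms])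
  fix R e :: real assume "e > 0"
  moreover have "ib R (\<lambda>x. f x - f x) = (\<lambda>x. 0)" by (simp add: ib_def fun_eq_iff)
  moreover have "n2 lborel (\<lambda>x::complex^'a. 0::complex) = 0" by (simp add: n2_def)
  ultimately show "\<exists>c. continuous_on UNIV c \<and> L2 lborel (ib R (\<lambda>x. f x - c x)) \<and> n2 lborel (ib R (\<lambda>x. f x - c x)) < e"
    by (intro exI[of _ f]) (simp add: assms)
qed

lemma L2loc_sum: "(\<And>i. i \<in> I \<Longrightarrow> L2loc (f i)) \<Longrightarrow> L2loc (\<lambda>x. \<Sum>i\<in>I. f i x)"
proof (induction I rule: infinite_finite_induct)
  case (insert i I)
  then show ?case by (simp add: L2loc_add)
qed (auto intro: L2loc_cont[OF continuous_on_const])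

text \<open>The continuous functions \<open>s n\<close> themselves serve as the approximants that
  \<open>L2loc\<close> demands.\<close>

lemma L2loc_L2_limit:
  assumes s: "\<And>n. continuous_on UNIV (s n)" "\<And>n. L2 lborel (s n)" and v: "L2 lborel v"
    and lim: "(\<lambda>n. n2 lborel (\<lambda>x. s n x - v x)) \<longlonglongrightarrow> 0"
  shows "L2loc v"
  unfolding L2loc_def
proof (intro conjI allI impI)
  show mv: "v \<in> borel_measurable borel" using v by (simp add: L2_def)
  fix R e :: real assume e: "e > 0"
  from LIMSEQ_D[OF lim e] obtain n where n: "n2 lborel (\<lambda>x. s n x - v x) < e" by auto
  have ms: "s n \<in> borel_measurable borel" by (rule borel_measurable_continuous_onI[OF s(1)])
  have b: "norm (ib R (\<lambda>x. v x - s n x) x) \<le> 1 * norm (s n x - v x)" for x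
    by (auto simp: ib_def indicator_def norm_minus_commute)
  have L: "L2 lborel (ib R (\<lambda>x. v x - s n x))"
    by (rule L2_bound[OF L2_diff[OF s(2) v] _ b]) (use ms mv in \<open>intro ib_measurable borel_measurable_diff\<close>)
  have "n2 lborel (ib R (\<lambda>x. v x - s n x)) \<le> 1\<^sup>2 * n2 lborel (\<lambda>x. s n x - v x)"
    by (rule n2_mono_bound[OF L2_diff[OF s(2) v] L b])
  then show "\<exists>c. continuous_on UNIV c \<and> L2 lborel (ib R (\<lambda>x. v x - c x)) \<and> n2 lborel (ib R (\<lambda>x. v x - c x)) < e"
    using L n s(1) by (intro exI[of _ "s n"]) auto
qed

lemma mollify_cont:
  fixes f :: "complex^'n \<Rightarrow> complex"
  assumes "locint f" "s > 0"
  shows "continuous_on UNIV (mollify s f)"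
proof -
  have "continuous_on UNIV (\<lambda>x. cv f (krc s) x / complex_of_real (km TYPE('n)))"
    by (rule continuous_on_divide[OF cv_cont[OF assms(1) krc_cont krc_bsupp[OF assms(2)]] continuous_on_const])
      (use km_pos[where 'n='n] in auto)
  then show ?thesis by (simp add: mollify_def[abs_def])
qed

text \<open>Cauchy-Schwarz for the probability density given by the normalised kernel bounds
  |mollify G|^2 pointwise by the mollification of |G|^2; Fubini and the unit mass do the
  rest.\<close>

lemma mollify_Young:
  fixes G :: "complex^'n \<Rightarrow> complex"
  assumes G: "L2 lborel G" and s: "s > 0"
  shows "L2 lborel (mollify s G)" "n2 lborel (mollify s G) \<le> n2 lborel G"
proof -
  define m where "m = km TYPE('n)"
  have m: "m > 0" unfolding m_def by (rule km_pos)
  have [measurable]: "G \<in> borel_measurable borel" using G by (simp add: L2_def)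
  have lG: "locint G" by (rule L2_locint[OF G])
  have mm: "mollify s G \<in> borel_measurable lborel"
    by (intro borel_measurable_lborel_cont mollify_cont lG s)
  have [measurable]: "kr s \<in> borel_measurable borel" by (rule borel_measurable_continuous_onI[OF kr_cont])
  obtain K where K: "\<And>z::complex^'n. norm (kr s z) \<le> K" using bounded_bsupp[OF kr_cont kr_bsupp[OF s]] by blast
  have pt: "(norm (mollify s G x))\<^sup>2 \<le> (\<integral>y. (norm (G y))\<^sup>2 * kr s (x - y) \<partial>lborel) / m
      \<and> integrable lborel (\<lambda>y. (norm (G y))\<^sup>2 * kr s (x - y))" for x
  proof -
    have i1: "integrable lborel (\<lambda>y. (norm (G y))\<^sup>2 * kr s (x - y))"
    proof (rule Bochner_Integration.integrable_bound)
      show "integrable lborel (\<lambda>y. K * (norm (G y))\<^sup>2)" using G by (auto simp: L2_def)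
      have "norm ((norm (G y))\<^sup>2 * kr s (x - y)) \<le> norm (K * (norm (G y))\<^sup>2)" for y
        using mult_left_mono[OF order_trans[OF K[of "x - y"] abs_ge_self], of "(norm (G y))\<^sup>2"]
        by (simp add: abs_mult mult.commute)
      then show "AE y in lborel. norm ((norm (G y))\<^sup>2 * kr s (x - y)) \<le> norm (K * (norm (G y))\<^sup>2)" by simp
    qed measurable
    define f1 where "f1 y = norm (G y) * sqrt (kr s (x - y))" for y
    define f2 where "f2 y = sqrt (kr s (x - y))" for y :: "complex^'n"
    have nn: "kr s z \<ge> 0" for z :: "complex^'n" using s by (simp add: kr_nonneg)
    have sq1: "(norm (f1 y))\<^sup>2 = (norm (G y))\<^sup>2 * kr s (x - y)" and sq2: "(norm (f2 y))\<^sup>2 = kr s (x - y)" for y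
      using nn[of "x - y"] by (simp_all add: f1_def f2_def power_mult_distrib)
    have L1: "L2 lborel f1" unfolding L2_def sq1 using i1 by (simp add: f1_def[abs_def])
    have L2: "L2 lborel f2" unfolding L2_def sq2 using kr_integrable[OF s, of x] by (simp add: f2_def[abs_def])
    have n2f2: "n2 lborel f2 = m" unfolding n2_def sq2 m_def by (rule kr_mass[OF s])
    have prod: "f1 y \<bullet> f2 y = norm (G y * krc s (x - y))" for y
      using nn[of "x - y"] by (simp add: f1_def f2_def krc_def norm_mult mult.assoc)
    have "norm (cv G (krc s) x) \<le> (\<integral>y. f1 y \<bullet> f2 y \<partial>lborel)"
      unfolding cv_def prod by (rule integral_norm_bound)
    then have "(norm (cv G (krc s) x))\<^sup>2 \<le> (\<integral>y. f1 y \<bullet> f2 y \<partial>lborel)\<^sup>2"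
      by (intro power_mono) auto
    also have "\<dots> \<le> n2 lborel f1 * m"
      using L2_Cauchy_Schwarz[OF L1 L2] by (simp add: n2f2)
    finally have "(norm (cv G (krc s) x))\<^sup>2 \<le> n2 lborel f1 * m" .
    then have "(norm (mollify s G x))\<^sup>2 \<le> n2 lborel f1 / m"
      using m by (simp add: mollify_def m_def[symmetric] norm_divide power_divide power2_eq_square field_simps)
    then show ?thesis using i1 unfolding n2_def sq1 by blast
  qed
  have "(\<integral>\<^sup>+x. ennreal ((norm (mollify s G x))\<^sup>2) \<partial>lborel)
      \<le> (\<integral>\<^sup>+x. (\<integral>\<^sup>+y. ennreal ((norm (G y))\<^sup>2 * kr s (x - y) / m) \<partial>lborel) \<partial>lborel)"
  proof (rule nn_integral_mono)
    fix x :: "complex^'n"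
    have "(\<integral>\<^sup>+y. ennreal ((norm (G y))\<^sup>2 * kr s (x - y) / m) \<partial>lborel) = ennreal (\<integral>y. (norm (G y))\<^sup>2 * kr s (x - y) / m \<partial>lborel)"
      using pt[of x] m s by (intro nn_integral_eq_integral) (auto simp: kr_nonneg)
    then show "ennreal ((norm (mollify s G x))\<^sup>2) \<le> (\<integral>\<^sup>+y. ennreal ((norm (G y))\<^sup>2 * kr s (x - y) / m) \<partial>lborel)"
      using pt[of x] by (simp add: ennreal_leI)
  qed
  also have "\<dots> = (\<integral>\<^sup>+y. (\<integral>\<^sup>+x. ennreal ((norm (G y))\<^sup>2 * kr s (x - y) / m) \<partial>lborel) \<partial>lborel)"
    by (rule lborel_pair.Fubini'[symmetric]) measurable
  also have "\<dots> = (\<integral>\<^sup>+y. ennreal ((norm (G y))\<^sup>2) \<partial>lborel)"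
  proof (rule nn_integral_cong)
    fix y :: "complex^'n"
    have sw: "kr s (x - y) = kr s (y - x)" for x using kr_uminus[of s "x - y"] by simp
    have "(\<integral>\<^sup>+x. ennreal ((norm (G y))\<^sup>2 * kr s (x - y) / m) \<partial>lborel) = ennreal (\<integral>x. (norm (G y))\<^sup>2 / m * kr s (y - x) \<partial>lborel)"
      unfolding sw using kr_integrable[OF s, of y] m s
      by (subst nn_integral_eq_integral[symmetric]) (auto simp: kr_nonneg field_simps)
    also have "(\<integral>x. (norm (G y))\<^sup>2 / m * kr s (y - x) \<partial>lborel) = (norm (G y))\<^sup>2"
      using kr_mass[OF s, of y] m by (simp add: m_def[symmetric])
    finally show "(\<integral>\<^sup>+x. ennreal ((norm (G y))\<^sup>2 * kr s (x - y) / m) \<partial>lborel) = ennreal ((norm (G y))\<^sup>2)" .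
  qed
  also have "\<dots> = ennreal (n2 lborel G)"
    unfolding n2_def using G by (intro nn_integral_eq_integral) (auto simp: L2_def)
  finally have le: "(\<integral>\<^sup>+x. ennreal ((norm (mollify s G x))\<^sup>2) \<partial>lborel) \<le> ennreal (n2 lborel G)" .
  have "integrable lborel (\<lambda>x. (norm (mollify s G x))\<^sup>2)"
    using le mm by (intro integrableI_bounded) (auto intro: le_less_trans)
  then show "L2 lborel (mollify s G)" using mm by (simp add: L2_def)
  show "n2 lborel (mollify s G) \<le> n2 lborel G"
    unfolding n2_def[of _ "mollify s G"] using le mm by (subst integral_eq_nn_integral) (auto intro!: enn2real_leI)
qed

lemma mollify_unif:
  fixes c :: "complex^'n \<Rightarrow> complex"
  assumes c: "continuous_on UNIV c" and e: "e > 0"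
  shows "\<exists>S\<ge>1. \<forall>s\<ge>S. \<forall>x\<in>cball 0 R. norm (mollify s c x - c x) \<le> e"
proof -
  define m where "m = km TYPE('n)"
  have m: "m > 0" unfolding m_def by (rule km_pos)
  have "uniformly_continuous_on (cball 0 (R + 1)) c"
    by (intro compact_uniformly_continuous continuous_on_subset[OF c]) auto
  then obtain d where d: "d > 0" "\<And>x y. x \<in> cball 0 (R + 1) \<Longrightarrow> y \<in> cball 0 (R + 1) \<Longrightarrow> dist y x < d \<Longrightarrow> dist (c y) (c x) < e"
    using e unfolding uniformly_continuous_on_def by metis
  \<comment> \<open>For s >= S the kernel lives in the ball of radius \<open>min d 1\<close>: within
    the modulus of continuity of \<open>c\<close>, and without leaving the ball of radius R + 1 on
    which that modulus was taken.\<close>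
  define S where "S = max 1 (1 / (min d 1)\<^sup>2)"
  have "norm (mollify s c x - c x) \<le> e" if s: "s \<ge> S" and x: "x \<in> cball 0 R" for s x
  proof -
    have s1: "s > 0" "s \<ge> 1 / (min d 1)\<^sup>2" using s by (auto simp: S_def)
    then have "sqrt s \<ge> sqrt (1 / (min d 1)\<^sup>2)" by (intro real_sqrt_le_mono)
    then have "sqrt s \<ge> 1 / min d 1" using d by (simp add: real_sqrt_divide)
    moreover have "min d 1 > 0" "sqrt s > 0" using d s1 by auto
    ultimately have sd: "1 / sqrt s \<le> min d 1" by (metis divide_le_eq mult.commute)
    have lc: "locint c" by (rule L2loc_locint[OF L2loc_cont[OF c]])
    have i: "integrable lborel (\<lambda>y. c y * krc s (x - y))"
      by (rule cv_integrable[OF lc krc_cont krc_bsupp[OF s1(1)]])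
    have ik: "integrable lborel (\<lambda>y. c x * krc s (x - y))"
      by (rule cv_integrable[OF locint_const krc_cont krc_bsupp[OF s1(1)]])
    have cm: "(\<integral>y. c x * krc s (x - y) \<partial>lborel) = c x * complex_of_real m"
      using kr_mass[OF s1(1), of x] by (simp add: krc_def m_def)
    have "cv c (krc s) x - c x * complex_of_real m = (\<integral>y. (c y - c x) * krc s (x - y) \<partial>lborel)"
      unfolding cv_def cm[symmetric] left_diff_distrib
      by (rule Bochner_Integration.integral_diff[OF i ik, symmetric])
    also have "norm \<dots> \<le> (\<integral>y. e * kr s (x - y) \<partial>lborel)"
    proof (rule Bochner_Integration.integral_norm_bound_integral)
      show "integrable lborel (\<lambda>y. (c y - c x) * krc s (x - y))" using i ik by (simp add: left_diff_distrib)
      show "integrable lborel (\<lambda>y. e * kr s (x - y))" using kr_integrable[OF s1(1), of x] by simp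
      fix y :: "complex^'n"
      show "norm ((c y - c x) * krc s (x - y)) \<le> e * kr s (x - y)"
      proof (cases "norm (x - y) \<ge> 1 / sqrt s")
        case True
        then show ?thesis using kr_zero[OF s1(1) True] by (simp add: krc_def)
      next
        case False
        then have xy: "norm (x - y) < min d 1" using sd by linarith
        then have "norm y \<le> R + 1" using x norm_triangle_ineq2[of y x] by (simp add: norm_minus_commute)
        then have "norm (c y - c x) \<le> e"
          using d(2)[of x y] xy x by (simp add: dist_norm norm_minus_commute less_imp_le)
        then show ?thesis using s1 by (simp add: krc_def norm_mult kr_nonneg mult_right_mono)
      qed
    qed
    also have "\<dots> = e * m" using kr_mass[OF s1(1), of x] by (simp add: m_def)
    finally have "norm (cv c (krc s) x - c x * complex_of_real m) \<le> e * m" .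
    moreover have "mollify s c x - c x = (cv c (krc s) x - c x * complex_of_real m) / complex_of_real m"
      using m by (simp add: mollify_def m_def[symmetric] field_simps)
    then have "norm (mollify s c x - c x) = norm (cv c (krc s) x - c x * complex_of_real m) / m"
      using m by (simp add: norm_divide)
    ultimately show ?thesis using m by (simp add: divide_le_eq)
  qed
  then show ?thesis by (intro exI[of _ S]) (auto simp: S_def)
qed

lemma sum_of_sixteenths_less:
  fixes p q r e :: real
  assumes "p \<le> e / 16" "q \<le> e / 16" "r \<le> e / 16" "e > 0"
  shows "2 * p + 2 * (2 * q + 2 * r) < e"
  using assms by argo

text \<open>\<open>f\<close> is replaced by a continuous \<open>c\<close> close to it in L^2 of a
  slightly larger ball. Mollifications of \<open>c\<close> converge uniformly on the ball, and on
  the error f - c mollification is a contraction.\<close>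

lemma mollify_conv_ib:
  fixes f :: "complex^'n \<Rightarrow> complex"
  assumes f: "L2loc f"
  shows "(\<lambda>n. n2 lborel (ib R (\<lambda>x. mollify (real (Suc n)) f x - f x))) \<longlonglongrightarrow> 0"
    and "\<And>n. L2 lborel (ib R (\<lambda>x. mollify (real (Suc n)) f x - f x))"
proof -
  have lf: "locint f" by (rule L2loc_locint[OF f])
  have mf: "f \<in> borel_measurable borel" by (rule L2loc_measurable[OF f])
  have Lm: "L2 lborel (ib R (\<lambda>x. mollify (real (Suc n)) f x - f x))" for n
  proof -
    have "ib R (\<lambda>x. mollify (real (Suc n)) f x - f x) = (\<lambda>x. ib R (mollify (real (Suc n)) f) x - ib R f x)"
      by (simp add: ib_def fun_eq_iff scaleR_diff_right)
    then show ?thesis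
      using L2_diff[OF L2_ib_cont[OF mollify_cont[OF lf]] L2loc_L2[OF f]] by simp
  qed
  then show "\<And>n. L2 lborel (ib R (\<lambda>x. mollify (real (Suc n)) f x - f x))" .
  show "(\<lambda>n. n2 lborel (ib R (\<lambda>x. mollify (real (Suc n)) f x - f x))) \<longlonglongrightarrow> 0"
  proof (rule LIMSEQ_I)
    fix e :: real assume e: "e > 0"
    define V where "V = measure lborel (cball (0::complex^'n) R)"
    have V: "V \<ge> 0" by (simp add: V_def)
    \<comment> \<open>Each of the three pieces may contribute e/16; applying |a + b|^2 <= 2|a|^2 +
      2|b|^2 twice costs 2 + 4 + 4 sixteenths. \<open>e2\<close> is a sup bound, spread over the
      volume \<open>V\<close>.\<close>
    define e1 where "e1 = e / 16"
    define e2 where "e2 = sqrt (e / (16 * (V + 1)))"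
    have e12: "e1 > 0" "e2 > 0" using e V by (auto simp: e1_def e2_def)
    obtain c where c: "continuous_on UNIV c" "L2 lborel (ib (R + 1) (\<lambda>x. f x - c x))" "n2 lborel (ib (R + 1) (\<lambda>x. f x - c x)) < e1"
      using f e12(1) unfolding L2loc_def by blast
    have lc: "locint c" by (rule L2loc_locint[OF L2loc_cont[OF c(1)]])
    have mc: "c \<in> borel_measurable borel" by (rule borel_measurable_continuous_onI[OF c(1)])
    obtain S where S: "S \<ge> 1" "\<And>s x. s \<ge> S \<Longrightarrow> x \<in> cball 0 R \<Longrightarrow> norm (mollify s c x - c x) \<le> e2"
      using mollify_unif[OF c(1) e12(2)] by blast
    define G where "G = ib (R + 1) (\<lambda>x. f x - c x)"
    have GL: "L2 lborel G" using c(2) by (simp add: G_def)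
    have "n2 lborel (ib R (\<lambda>x. mollify (real (Suc n)) f x - f x)) < e" if n: "real (Suc n) \<ge> S" for n
    proof -
      define s where "s = real (Suc n)"
      have s: "s > 0" "s \<ge> 1" "s \<ge> S" using n by (auto simp: s_def)
      \<comment> \<open>For s >= 1 the kernel has radius at most one, so over the ball of radius R
        the mollification of f - c sees only its truncation \<open>G\<close> to radius R +
        1.\<close>
      have dec: "ib R (\<lambda>x. mollify s f x - f x) x = ib R (mollify s G) x + (ib R (\<lambda>x. mollify s c x - c x) x + ib R (\<lambda>x. c x - f x) x)" for x
      proof (cases "x \<in> cball 0 R")
        case True
        have eq: "G y * krc s (x - y) = f y * krc s (x - y) - c y * krc s (x - y)" for y
        proof (cases "y \<in> cball 0 (R + 1)")
          case True
          then show ?thesis by (simp add: G_def ib_def left_diff_distrib)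
        next
          case False
          have "norm (x - y) \<ge> 1" using \<open>x \<in> cball 0 R\<close> False norm_triangle_ineq2[of y x] by (simp add: norm_minus_commute)
          moreover have "1 / sqrt s \<le> 1" using s by simp
          ultimately have "norm (x - y) \<ge> 1 / sqrt s" by linarith
          from kr_zero[OF s(1) this] show ?thesis by (simp add: krc_def)
        qed
        have "cv G (krc s) x = cv f (krc s) x - cv c (krc s) x"
          unfolding cv_def eq
          by (rule Bochner_Integration.integral_diff[OF cv_integrable[OF lf krc_cont krc_bsupp[OF s(1)]] cv_integrable[OF lc krc_cont krc_bsupp[OF s(1)]]])
        then have "mollify s G x = mollify s f x - mollify s c x" by (simp add: mollify_def diff_divide_distrib)
        then show ?thesis using True by (simp add: ib_def)
      qed (simp add: ib_def)
      have L1: "L2 lborel (ib R (mollify s G))"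
        by (rule L2_bound[OF mollify_Young(1)[OF GL s(1)] ib_measurable[OF borel_measurable_continuous_onI[OF mollify_cont[OF L2_locint[OF GL] s(1)]]], where C=1])
          (auto simp: ib_def indicator_def)
      have n1: "n2 lborel (ib R (mollify s G)) \<le> e1"
      proof -
        have "n2 lborel (ib R (mollify s G)) \<le> 1\<^sup>2 * n2 lborel (mollify s G)"
          by (rule n2_mono_bound[OF mollify_Young(1)[OF GL s(1)] L1]) (auto simp: ib_def indicator_def)
        also have "\<dots> \<le> n2 lborel G" using mollify_Young(2)[OF GL s(1)] by simp
        finally show ?thesis using c(3) by (simp add: G_def)
      qed
      have L2: "L2 lborel (ib R (\<lambda>x. mollify s c x - c x))"
        by (intro L2_ib_cont continuous_intros c(1) mollify_cont lc s(1))
      have n2': "n2 lborel (ib R (\<lambda>x. mollify s c x - c x)) \<le> e / 16"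
      proof -
        have "n2 lborel (ib R (\<lambda>x. mollify s c x - c x)) \<le> (\<integral>x. indicator (cball (0::complex^'n) R) x *\<^sub>R (e2\<^sup>2) \<partial>lborel)"
          unfolding n2_def
        proof (rule integral_mono)
          show "integrable lborel (\<lambda>x. (norm (ib R (\<lambda>x. mollify s c x - c x) x))\<^sup>2)" using L2 by (simp add: L2_def)
          show "integrable lborel (\<lambda>x::complex^'n. indicator (cball 0 R) x *\<^sub>R (e2\<^sup>2))"
            by (rule borel_integrable_compact) auto
          show "(norm (ib R (\<lambda>x. mollify s c x - c x) x))\<^sup>2 \<le> indicator (cball 0 R) x *\<^sub>R e2\<^sup>2" for x
            using power_mono[OF S(2)[OF s(3), of x], of 2] by (auto simp: ib_def indicator_def)
        qed
        also have "\<dots> = V * e2\<^sup>2" by (simp add: V_def)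
        also have "\<dots> = V * (e / (16 * (V + 1)))" using e V by (simp add: e2_def)
        also have "\<dots> \<le> e / 16" using e V by (simp add: field_simps)
        finally show ?thesis .
      qed
      have L3: "L2 lborel (ib R (\<lambda>x. c x - f x))" and n3: "n2 lborel (ib R (\<lambda>x. c x - f x)) \<le> e1"
      proof -
        have b: "norm (ib R (\<lambda>x. c x - f x) x) \<le> 1 * norm (G x)" for x
          by (auto simp: ib_def G_def indicator_def norm_minus_commute)
        show L3: "L2 lborel (ib R (\<lambda>x. c x - f x))"
          by (rule L2_bound[OF GL _ b]) (intro ib_measurable borel_measurable_diff mf mc)
        show "n2 lborel (ib R (\<lambda>x. c x - f x)) \<le> e1"
          using n2_mono_bound[OF GL L3 b] c(3) by (simp add: G_def)
      qed
      have "n2 lborel (ib R (\<lambda>x. mollify s f x - f x)) = n2 lborel (\<lambda>x. ib R (mollify s G) x + (ib R (\<lambda>x. mollify s c x - c x) x + ib R (\<lambda>x. c x - f x) x))"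
        by (simp only: n2_def dec)
      also have "\<dots> \<le> 2 * n2 lborel (ib R (mollify s G)) + 2 * (2 * n2 lborel (ib R (\<lambda>x. mollify s c x - c x)) + 2 * n2 lborel (ib R (\<lambda>x. c x - f x)))"
        by (rule order_trans[OF n2_add_le[OF L1 L2_add[OF L2 L3]] add_left_mono[OF mult_left_mono[OF n2_add_le[OF L2 L3]]]]) simp
      also have "\<dots> < e"
      proof -
        show ?thesis by (rule sum_of_sixteenths_less[OF n1[unfolded e1_def] n2' n3[unfolded e1_def] e])
      qed
      finally show ?thesis by (simp only: s_def)
    qed
    moreover obtain N where "real N \<ge> S" using real_arch_simple by blast
    ultimately have "n2 lborel (ib R (\<lambda>x. mollify (real (Suc n)) f x - f x)) < e" if "n \<ge> N" for n
      using that by auto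
    then show "\<exists>no. \<forall>n\<ge>no. norm (n2 lborel (ib R (\<lambda>x. mollify (real (Suc n)) f x - f x)) - 0) < e"
      by (intro exI[of _ N]) auto
  qed
qed

text \<open>A multiplier of bounded support reduces global L^2 convergence to convergence on a ball;
  every term of the a priori estimate is brought into this shape.\<close>

lemma mollify_conv:
  fixes f g :: "complex^'n \<Rightarrow> complex"
  assumes f: "L2loc f" and g: "continuous_on UNIV g" "bsupp g"
  shows "(\<lambda>n. n2 lborel (\<lambda>x. g x * mollify (real (Suc n)) f x - g x * f x)) \<longlonglongrightarrow> 0"
    and "L2 lborel (\<lambda>x. g x * mollify (real (Suc n)) f x)" and "L2 lborel (\<lambda>x. g x * f x)"
proof -
  obtain R where R: "\<And>z. norm z \<ge> R \<Longrightarrow> g z = 0" using g(2) by (auto simp: bsupp_def)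
  obtain K where K: "K > 0" "\<And>z. norm (g z) \<le> K" using bounded_bsupp[OF g] by blast
  have mg: "g \<in> borel_measurable borel" by (rule borel_measurable_continuous_onI[OF g(1)])
  have mf: "f \<in> borel_measurable borel" by (rule L2loc_measurable[OF f])
  have lf: "locint f" by (rule L2loc_locint[OF f])
  have mm: "mollify (real (Suc n)) f \<in> borel_measurable borel" for n
    by (intro borel_measurable_continuous_onI mollify_cont lf) simp
  have gb: "norm (g x * h x) \<le> K * norm (ib R h x)" for x h
    using R[of x] K(2)[of x] by (cases "norm x \<le> R") (auto simp: ib_def norm_mult intro: mult_right_mono)
  have L: "L2 lborel (\<lambda>x. g x * h x)" if "L2 lborel (ib R h)" "h \<in> borel_measurable borel" for h
    by (rule L2_bound[OF that(1) _ gb]) (use mg that(2) in simp)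
  show "L2 lborel (\<lambda>x. g x * f x)" by (rule L[OF L2loc_L2[OF f] mf])
  show "L2 lborel (\<lambda>x. g x * mollify (real (Suc n)) f x)"
    by (rule L[OF L2_ib_cont[OF mollify_cont[OF lf]] mm]) simp
  define d where "d n x = mollify (real (Suc n)) f x - f x" for n x
  have "n2 lborel (\<lambda>x. g x * d n x) \<le> K\<^sup>2 * n2 lborel (ib R (d n))" for n
    using mollify_conv_ib(2)[OF f, of R n] mm[of n] mf
    by (intro n2_mono_bound gb L) (auto simp: d_def[abs_def])
  then have ev: "\<forall>\<^sub>F n in sequentially. norm (n2 lborel (\<lambda>x. g x * d n x)) \<le> K\<^sup>2 * n2 lborel (ib R (d n))"
    by (intro always_eventually allI) simp
  have "(\<lambda>n. K\<^sup>2 * n2 lborel (ib R (d n))) \<longlonglongrightarrow> K\<^sup>2 * 0"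
    unfolding d_def by (intro tendsto_mult tendsto_const mollify_conv_ib(1) f)
  then have "(\<lambda>n. K\<^sup>2 * n2 lborel (ib R (d n))) \<longlonglongrightarrow> 0" by simp
  from Lim_null_comparison[OF ev this] have "(\<lambda>n. n2 lborel (\<lambda>x. g x * d n x)) \<longlonglongrightarrow> 0" .
  then show "(\<lambda>n. n2 lborel (\<lambda>x. g x * mollify (real (Suc n)) f x - g x * f x)) \<longlonglongrightarrow> 0"
    by (simp add: d_def right_diff_distrib)
qed

section \<open>Hoermander's estimate\<close>

text \<open>The mixed derivatives occur once: \<open>AB j k\<close> is both the conj z_k derivative
  of \<open>A j\<close> and the z_j derivative of \<open>B k\<close>. This shared entry is what
  cancels in the Bochner identity.\<close>

definition C2 :: "(complex^'n \<Rightarrow> complex) \<Rightarrow> ('n \<Rightarrow> complex^'n \<Rightarrow> complex) \<Rightarrow> ('n \<Rightarrow> complex^'n \<Rightarrow> complex) \<Rightarrow>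
    ('n \<Rightarrow> 'n \<Rightarrow> complex^'n \<Rightarrow> complex) \<Rightarrow> ('n \<Rightarrow> 'n \<Rightarrow> complex^'n \<Rightarrow> complex) \<Rightarrow>
    ('n \<Rightarrow> 'n \<Rightarrow> complex^'n \<Rightarrow> complex) \<Rightarrow> bool" where
  "C2 u A B AA AB BB \<longleftrightarrow> C1 u A B \<and> (\<forall>j. C1 (A j) (AA j) (AB j)) \<and> (\<forall>j. C1 (B j) (\<lambda>k. AB k j) (BB j))"

lemma C2_D:
  assumes "C2 u A B AA AB BB"
  shows "C1 u A B" "C1 (A j) (AA j) (AB j)" "C1 (B j) (\<lambda>k. AB k j) (BB j)"
  using assms by (simp_all add: C2_def)

lemma C2_of_C2R:
  assumes "C2R u A AA AB"
  shows "C2 (\<lambda>z. complex_of_real (u z)) A (\<lambda>j z. cnj (A j z)) AA AB (\<lambda>j k z. cnj (AA j k z))"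
proof -
  have u: "C1 (\<lambda>z. complex_of_real (u z)) A (\<lambda>j z. cnj (A j z))" "\<And>j. C1 (A j) (AA j) (AB j)"
    and h: "\<And>j k z. AB j k z = cnj (AB k j z)"
    using assms unfolding C2R_def by blast+
  have "C1 (\<lambda>z. cnj (A j z)) (\<lambda>k. AB k j) (\<lambda>k z. cnj (AA j k z))" for j
  proof (rule C1_eq[OF C1_cnj[OF u(2)]])
    show "(\<lambda>k z. cnj (AB j k z)) = (\<lambda>k. AB k j)"
    proof (intro ext)
      fix k z
      show "cnj (AB j k z) = AB k j z" by (rule h[symmetric])
    qed
  qed simp
  then show ?thesis using u unfolding C2_def by blast
qed

lemma C2_cmult:
  assumes "C2 u A B AA AB BB"
  shows "C2 (\<lambda>z. c * u z) (\<lambda>j z. c * A j z) (\<lambda>j z. c * B j z) (\<lambda>j k z. c * AA j k z) (\<lambda>j k z. c * AB j k z) (\<lambda>j k z. c * BB j k z)"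
  using C2_D[OF assms] unfolding C2_def by (intro conjI allI C1_cmult) auto

lemma C2_mult:
  assumes u: "C2 u A B AA AB BB" and v: "C2 v A' B' AA' AB' BB'"
  shows "\<exists>AA'' AB'' BB''. C2 (\<lambda>z. u z * v z) (\<lambda>j z. u z * A' j z + A j z * v z) (\<lambda>j z. u z * B' j z + B j z * v z) AA'' AB'' BB''"
proof -
  note U = C2_D[OF u] and V = C2_D[OF v]
  define AB'' where "AB'' j k z = (u z * AB' j k z + B k z * A' j z) + (A j z * B' k z + AB j k z * v z)" for j k z
  define AA'' where "AA'' j k z = (u z * AA' j k z + A k z * A' j z) + (A j z * A' k z + AA j k z * v z)" for j k z
  define BB'' where "BB'' j k z = (u z * BB' j k z + B k z * B' j z) + (B j z * B' k z + BB j k z * v z)" for j k z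
  have 1: "C1 (\<lambda>z. u z * v z) (\<lambda>j z. u z * A' j z + A j z * v z) (\<lambda>j z. u z * B' j z + B j z * v z)"
    by (rule C1_mult[OF U(1) V(1)])
  have 2: "C1 (\<lambda>z. u z * A' j z + A j z * v z) (AA'' j) (AB'' j)" for j
    by (rule C1_eq[OF C1_add[OF C1_mult[OF U(1) V(2)] C1_mult[OF U(2) V(1)]]])
      (auto simp: AA''_def AB''_def fun_eq_iff)
  have 3: "C1 (\<lambda>z. u z * B' j z + B j z * v z) (\<lambda>k. AB'' k j) (BB'' j)" for j
    by (rule C1_eq[OF C1_add[OF C1_mult[OF U(1) V(3)] C1_mult[OF U(3) V(1)]]])
      (auto simp: BB''_def AB''_def fun_eq_iff)
  show ?thesis using 1 2 3 unfolding C2_def by blast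
qed

lemma cv_C2:
  assumes f: "locint f" and k: "C2 k A B AA AB BB" "bsupp k"
  shows "C2 (cv f k) (\<lambda>j. cv f (A j)) (\<lambda>j. cv f (B j)) (\<lambda>j i. cv f (AA j i)) (\<lambda>j i. cv f (AB j i)) (\<lambda>j i. cv f (BB j i))"
proof -
  note K = C2_D[OF k(1)]
  show ?thesis
    unfolding C2_def
    by (intro conjI allI cv_C1[OF f K(1) k(2)] cv_C1[OF f K(2) C1_bsupp(1)[OF K(1) k(2)]] cv_C1[OF f K(3) C1_bsupp(2)[OF K(1) k(2)]])
qed

definition krcA :: "real \<Rightarrow> 'n \<Rightarrow> complex^'n \<Rightarrow> complex" where
  "krcA s j z = complex_of_real (s ^ CARD('n)) * bumpA s j z"

lemma krc_C2R: "\<exists>AA AB. C2R (kr s :: complex^'n \<Rightarrow> real) (krcA s) AA AB"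
proof -
  obtain AA AB where c: "C2R (bump s :: complex^'n \<Rightarrow> real) (bumpA s) AA AB" using bump_C2R by blast
  have "C2R (\<lambda>z. s ^ CARD('n) * bump s z) (\<lambda>j z. complex_of_real (s ^ CARD('n)) * bumpA s j z)
     (\<lambda>j k z. complex_of_real (s ^ CARD('n)) * AA j k z + complex_of_real 0 * bumpA s k z * bumpA s j z)
     (\<lambda>j k z. complex_of_real (s ^ CARD('n)) * AB j k z + complex_of_real 0 * cnj (bumpA s k z) * (bumpA s j z :: complex))"
    by (rule C2R_comp[OF c, of "\<lambda>t. s ^ CARD('n) * t" "\<lambda>t. s ^ CARD('n)" "\<lambda>t. 0"]) (auto intro!: derivative_eq_intros)
  then show ?thesis unfolding kr_def[abs_def] krcA_def[abs_def] by blast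
qed

lemma krc_C2: "\<exists>AA AB BB. C2 (krc s) (krcA s) (\<lambda>j z. cnj (krcA s j z)) AA AB BB \<and> (\<forall>j k z. AA j k z = AA k j z)"
proof -
  obtain AA AB where c: "C2R (kr s :: complex^'a \<Rightarrow> real) (krcA s) AA AB" using krc_C2R by blast
  then have "\<forall>j k z. AA j k z = AA k j z" unfolding C2R_def by blast
  then show ?thesis using C2_of_C2R[OF c] unfolding krc_def[abs_def] by blast
qed

lemma mollify_C2:
  fixes f :: "complex^'n \<Rightarrow> complex"
  assumes f: "locint f" and s: "s > 0"
  shows "\<exists>AA AB BB. C2 (mollify s f) (\<lambda>j x. cv f (krcA s j) x / complex_of_real (km TYPE('n)))
     (\<lambda>j x. cv f (\<lambda>z. cnj (krcA s j z)) x / complex_of_real (km TYPE('n))) AA AB BB"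
proof -
  obtain AA AB BB where k: "C2 (krc s :: complex^'n \<Rightarrow> complex) (krcA s) (\<lambda>j z. cnj (krcA s j z)) AA AB BB"
    using krc_C2 by blast
  from C2_cmult[OF cv_C2[OF f k krc_bsupp[OF s]], of "inverse (complex_of_real (km TYPE('n)))"]
  show ?thesis unfolding mollify_def[abs_def] by (auto simp: divide_inverse mult.commute)
qed

text \<open>The weight \<^term>\<open>\<phi>\<close> enters through its Wirtinger derivatives
  \<^term>\<open>P j\<close> \<open>= \<partial>\<phi>/\<partial>z\<^sub>j\<close> and the complex Hessian \<^term>\<open>H j k\<close> \<open>= \<partial>\<^sup>2\<phi>/\<partial>z\<^sub>j\<partial>z\<^sub>k\<close>, the second derivative being conjugate.\<close>

locale weight =
  fixes \<phi> :: "complex^'n \<Rightarrow> real" and P :: "'n \<Rightarrow> complex^'n \<Rightarrow> complex"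
    and Q H :: "'n \<Rightarrow> 'n \<Rightarrow> complex^'n \<Rightarrow> complex"
  assumes phi: "C1 (\<lambda>z. complex_of_real (\<phi> z)) P (\<lambda>j z. cnj (P j z))"
    and dphi: "\<And>j. C1 (P j) (Q j) (H j)"
begin

lemma phi_cont: "continuous_on UNIV \<phi>"
  using continuous_on_Re[OF C1_cont[OF phi]] by simp

lemma P_cont: "continuous_on UNIV (P j)"
  by (rule C1_cont[OF dphi])

lemma H_cont: "continuous_on UNIV (H j k)"
  by (rule C1_contB[OF dphi])

abbreviation "w z \<equiv> complex_of_real (exp (- \<phi> z))"

lemma w_C1: "C1 (\<lambda>z. w z) (\<lambda>j z. - w z * P j z) (\<lambda>j z. - w z * cnj (P j z))"
proof -
  have "C1 (\<lambda>z. complex_of_real (exp (- \<phi> z))) (\<lambda>j z. complex_of_real (- exp (- \<phi> z)) * P j z) (\<lambda>j z. complex_of_real (- exp (- \<phi> z)) * cnj (P j z))"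
    by (rule C1_real_comp[OF phi, where g="\<lambda>t. exp (- t)" and g'="\<lambda>t. - exp (- t)"])
      (auto intro!: derivative_eq_intros continuous_intros phi_cont)
  then show ?thesis by simp
qed

text \<open>Kohn's computation for one pair of components: \<open>I\<close> is minus the sum of a
  conj z_k derivative and a z_j derivative of functions of bounded support. The curvature term with
  \<open>H\<close> appears when the conj z_k derivative hits \<open>P j\<close>.\<close>

lemma bochner_pair:
  fixes j k :: 'n
  assumes u: "C2 u A B AA AB BB" "bsupp u" and v: "C1 v A' B'"
  defines "I \<equiv> \<lambda>z. ((- A j z + P j z * u z) * cnj (- A' k z + P k z * v z) - B k z * cnj (B' j z) - H j k z * u z * cnj (v z)) * w z"
  shows "integral\<^sup>L lborel I = 0" "integrable lborel I"
proof -
  note U = C2_D[OF u(1)]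
  \<comment> \<open>The j-th summand of the adjoint of dbar in the weighted space: - e^\<phi> d/dz_j
    (e^(-\<phi>) u).\<close>
  define d where "d z = - A j z + P j z * u z" for z
  have d: "C1 d (\<lambda>k z. - AA j k z + (P j z * A k z + Q j k z * u z)) (\<lambda>k z. - AB j k z + (P j z * B k z + H j k z * u z))"
    unfolding d_def[abs_def] by (rule C1_add[OF C1_minus[OF U(2)] C1_mult[OF dphi U(1)]])
  have bd: "bsupp d" unfolding d_def[abs_def]
    by (intro bsupp_add bsupp_comp[OF C1_bsupp(1)[OF U(1) u(2)]] bsupp_comp[OF u(2)]) auto
  note vw = C1_mult[OF C1_cnj[OF v] w_C1]
  have W1: "C1 (\<lambda>z. d z * (cnj (v z) * w z)) (\<lambda>k z. d z * (cnj (v z) * (- w z * P k z) + cnj (B' k z) * w z) + (- AA j k z + (P j z * A k z + Q j k z * u z)) * (cnj (v z) * w z))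
      (\<lambda>k z. d z * (cnj (v z) * (- w z * cnj (P k z)) + cnj (A' k z) * w z) + (- AB j k z + (P j z * B k z + H j k z * u z)) * (cnj (v z) * w z))" (is "C1 _ _ ?b")
    by (rule C1_mult[OF d vw])
  have W2: "C1 (\<lambda>z. B k z * (cnj (v z) * w z)) (\<lambda>j z. B k z * (cnj (v z) * (- w z * P j z) + cnj (B' j z) * w z) + AB j k z * (cnj (v z) * w z))
      (\<lambda>j z. B k z * (cnj (v z) * (- w z * cnj (P j z)) + cnj (A' j z) * w z) + BB k j z * (cnj (v z) * w z))" (is "C1 _ ?a _")
    by (rule C1_mult[OF U(3) vw])
  have b1: "bsupp (\<lambda>z. d z * (cnj (v z) * w z))" by (rule bsupp_comp[OF bd]) simp
  have b2: "bsupp (\<lambda>z. B k z * (cnj (v z) * w z))" by (rule bsupp_comp[OF C1_bsupp(2)[OF U(1) u(2), of k]]) simp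
  have i1: "integrable lborel (?b k)" by (intro integrable_bsupp C1_contB[OF W1] C1_bsupp(2)[OF W1 b1])
  have i2: "integrable lborel (?a j)" by (intro integrable_bsupp C1_contA[OF W2] C1_bsupp(1)[OF W2 b2])
  have z1: "integral\<^sup>L lborel (?b k) = 0" by (rule C1_integral_zero(2)[OF W1 b1])
  have z2: "integral\<^sup>L lborel (?a j) = 0" by (rule C1_integral_zero(1)[OF W2 b2])
  \<comment> \<open>Between the two divergences the second derivatives \<open>AB j k\<close> cancel,
    and so do the products of \<open>P j\<close> with \<open>B k\<close>.\<close>
  have eq: "I = (\<lambda>z. - (?b k z + ?a j z))"
    unfolding I_def d_def fun_eq_iff by (simp add: algebra_simps)
  show "integrable lborel I" unfolding eq by (intro Bochner_Integration.integrable_minus Bochner_Integration.integrable_add i1 i2)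
  have "integral\<^sup>L lborel I = - (integral\<^sup>L lborel (?b k) + integral\<^sup>L lborel (?a j))"
    unfolding eq Bochner_Integration.integral_minus Bochner_Integration.integral_add[OF i1 i2] ..
  then show "integral\<^sup>L lborel I = 0" using z1 z2 by simp
qed

text \<open>The Bochner-Kodaira inequality for the \<open>(0,1)\<close>-form with coefficients \<open>\<beta> j\<close>.\<close>

lemma bochner:
  assumes b: "\<And>j. C2 (\<beta> j) (A j) (B j) (AA j) (AB j) (BB j)" "\<And>j. bsupp (\<beta> j)"
  shows "(\<integral>z. Re (\<Sum>j\<in>UNIV. \<Sum>k\<in>UNIV. H j k z * \<beta> j z * cnj (\<beta> k z)) * exp (- \<phi> z) \<partial>lborel)
    \<le> (\<integral>z. ((cmod (\<Sum>j\<in>UNIV. - A j j z + P j z * \<beta> j z))\<^sup>2 + (1/2) * (\<Sum>j\<in>UNIV. \<Sum>k\<in>UNIV. (cmod (B j k z - B k j z))\<^sup>2)) * exp (- \<phi> z) \<partial>lborel)"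
    (is "(\<integral>z. ?L z \<partial>lborel) \<le> (\<integral>z. ?R z \<partial>lborel)")
proof -
  define d where "d j z = - A j j z + P j z * \<beta> j z" for j z
  define I where "I j k z = (d j z * cnj (d k z) - B j k z * cnj (B k j z) - H j k z * \<beta> j z * cnj (\<beta> k z)) * w z" for j k z
  have I: "integral\<^sup>L lborel (I j k) = 0" "integrable lborel (I j k)" for j k
    using bochner_pair[OF b(1)[of j] b(2)[of j] C2_D(1)[OF b(1)[of k]], of j k] unfolding I_def[abs_def] d_def by auto
  have s0: "(\<integral>z. Re (\<Sum>j\<in>UNIV. \<Sum>k\<in>UNIV. I j k z) \<partial>lborel) = 0"
    using I by (simp add: integral_Re)
  have cb: "continuous_on UNIV (\<beta> j)" "continuous_on UNIV (A j k)" "continuous_on UNIV (B j k)" for j k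
    by (rule C1_cont[OF C2_D(1)[OF b(1)]] C1_contA[OF C2_D(1)[OF b(1)]] C1_contB[OF C2_D(1)[OF b(1)]])+
  have bs: "bsupp (A j k)" "bsupp (B j k)" for j k
    by (rule C1_bsupp[OF C2_D(1)[OF b(1)] b(2)])+
  have iL: "integrable lborel ?L"
  proof (rule integrable_bsupp)
    show "continuous_on UNIV ?L" by (intro continuous_intros phi_cont cb H_cont)
    have "bsupp (\<lambda>z. \<Sum>j\<in>UNIV. \<Sum>k\<in>UNIV. H j k z * \<beta> j z * cnj (\<beta> k z))"
      by (intro bsupp_sum bsupp_comp[OF b(2)]) auto
    then show "bsupp ?L" by (rule bsupp_comp) simp
  qed
  have iR: "integrable lborel ?R"
  proof (rule integrable_bsupp)
    show "continuous_on UNIV ?R" by (intro continuous_intros phi_cont cb P_cont)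
    have 1: "bsupp (\<lambda>z. \<Sum>j\<in>UNIV. - A j j z + P j z * \<beta> j z)"
      by (intro bsupp_sum bsupp_add bsupp_comp[OF bs(1)] bsupp_comp[OF b(2)]) auto
    have "bsupp (\<lambda>z. B j k z - B k j z)" for j k
      using bsupp_add[OF bs(2)[of j k] bsupp_comp[OF bs(2)[of k j], of "\<lambda>z. - B k j z"]] by simp
    then have "bsupp (\<lambda>z. (cmod (B j k z - B k j z))\<^sup>2)" for j k
      by (rule bsupp_comp) simp
    then have 2: "bsupp (\<lambda>z. \<Sum>j\<in>UNIV. \<Sum>k\<in>UNIV. (cmod (B j k z - B k j z))\<^sup>2)"
      by (intro bsupp_sum)
    have "bsupp (\<lambda>z. (cmod (\<Sum>j\<in>UNIV. - A j j z + P j z * \<beta> j z))\<^sup>2 + (1/2) * (\<Sum>j\<in>UNIV. \<Sum>k\<in>UNIV. (cmod (B j k z - B k j z))\<^sup>2))"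
      by (intro bsupp_add bsupp_comp[OF 1] bsupp_comp[OF 2]) auto
    then show "bsupp ?R" by (rule bsupp_comp) simp
  qed
  have pt: "?L z \<le> ?R z - Re (\<Sum>j\<in>UNIV. \<Sum>k\<in>UNIV. I j k z)" for z
  proof -
    have sq: "(\<Sum>j\<in>UNIV. \<Sum>k\<in>UNIV. d j z * cnj (d k z)) = complex_of_real ((cmod (\<Sum>j\<in>UNIV. d j z))\<^sup>2)"
      unfolding complex_norm_square cnj_sum sum_product ..
    \<comment> \<open>Re(x conj y) = (|x|^2 + |y|^2 - |x - y|^2) / 2; dropping the two squares
      leaves a bound by the components B j k - B k j of the dbar derivative of the form, which
      vanish when the form is closed.\<close>
    have re: "Re (x * cnj y) \<ge> - (1/2) * (cmod (x - y))\<^sup>2" for x y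
    proof -
      have "(cmod (x - y))\<^sup>2 = (cmod x)\<^sup>2 + (cmod y)\<^sup>2 - 2 * Re (x * cnj y)"
        unfolding cmod_power2 by (simp add: power2_eq_square algebra_simps)
      then show ?thesis using zero_le_power2[of "cmod x"] zero_le_power2[of "cmod y"] by linarith
    qed
    have "(\<Sum>j\<in>UNIV. \<Sum>k\<in>UNIV. Re (B j k z * cnj (B k j z))) \<ge> (\<Sum>j\<in>UNIV. \<Sum>k\<in>UNIV. - (1/2) * (cmod (B j k z - B k j z))\<^sup>2)"
      by (intro sum_mono re)
    then have B: "Re (\<Sum>j\<in>UNIV. \<Sum>k\<in>UNIV. B j k z * cnj (B k j z)) \<ge> - (1/2) * (\<Sum>j\<in>UNIV. \<Sum>k\<in>UNIV. (cmod (B j k z - B k j z))\<^sup>2)"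
      by (simp only: Re_sum sum_distrib_left[symmetric])
    have "(\<Sum>j\<in>UNIV. \<Sum>k\<in>UNIV. I j k z) = (complex_of_real ((cmod (\<Sum>j\<in>UNIV. d j z))\<^sup>2)
        - (\<Sum>j\<in>UNIV. \<Sum>k\<in>UNIV. B j k z * cnj (B k j z)) - (\<Sum>j\<in>UNIV. \<Sum>k\<in>UNIV. H j k z * \<beta> j z * cnj (\<beta> k z))) * w z"
      unfolding I_def sum_distrib_right[symmetric] sum_subtractf sq[symmetric] ..
    then have "Re (\<Sum>j\<in>UNIV. \<Sum>k\<in>UNIV. I j k z) = ((cmod (\<Sum>j\<in>UNIV. d j z))\<^sup>2
        - Re (\<Sum>j\<in>UNIV. \<Sum>k\<in>UNIV. B j k z * cnj (B k j z)) - Re (\<Sum>j\<in>UNIV. \<Sum>k\<in>UNIV. H j k z * \<beta> j z * cnj (\<beta> k z))) * exp (- \<phi> z)"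
      by (simp add: Re_complex_of_real minus_complex.sel times_complex.sel Im_complex_of_real)
    moreover have "((cmod (\<Sum>j\<in>UNIV. d j z))\<^sup>2
        - Re (\<Sum>j\<in>UNIV. \<Sum>k\<in>UNIV. B j k z * cnj (B k j z)) - Re (\<Sum>j\<in>UNIV. \<Sum>k\<in>UNIV. H j k z * \<beta> j z * cnj (\<beta> k z))) * exp (- \<phi> z)
       \<le> ((cmod (\<Sum>j\<in>UNIV. d j z))\<^sup>2
        + (1/2) * (\<Sum>j\<in>UNIV. \<Sum>k\<in>UNIV. (cmod (B j k z - B k j z))\<^sup>2) - Re (\<Sum>j\<in>UNIV. \<Sum>k\<in>UNIV. H j k z * \<beta> j z * cnj (\<beta> k z))) * exp (- \<phi> z)"
      using B by (intro mult_right_mono) auto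
    ultimately show ?thesis by (simp add: d_def left_diff_distrib)
  qed
  have iI: "integrable lborel (\<lambda>z. Re (\<Sum>j\<in>UNIV. \<Sum>k\<in>UNIV. I j k z))"
    using I by (intro integrable_Re Bochner_Integration.integrable_sum)
  have "(\<integral>z. ?L z \<partial>lborel) \<le> (\<integral>z. ?R z - Re (\<Sum>j\<in>UNIV. \<Sum>k\<in>UNIV. I j k z) \<partial>lborel)"
    by (intro integral_mono iL Bochner_Integration.integrable_diff iR iI pt)
  also have "\<dots> = (\<integral>z. ?R z \<partial>lborel)"
    using Bochner_Integration.integral_diff[OF iR iI] s0 by simp
  finally show ?thesis .
qed

end

text \<open>Strong convergence in unweighted L^2; the weight is carried by the functions
  themselves.\<close>

definition Lconv :: "(nat \<Rightarrow> complex^'n \<Rightarrow> complex) \<Rightarrow> (complex^'n \<Rightarrow> complex) \<Rightarrow> bool" where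
  "Lconv f F \<longleftrightarrow> (\<forall>n. L2 lborel (f n)) \<and> L2 lborel F \<and> (\<lambda>n. n2 lborel (\<lambda>x. f n x - F x)) \<longlonglongrightarrow> 0"

lemma Lconv_add:
  assumes "Lconv f F" "Lconv g G"
  shows "Lconv (\<lambda>n x. f n x + g n x) (\<lambda>x. F x + G x)"
  unfolding Lconv_def
proof (intro conjI allI)
  have f: "\<And>n. L2 lborel (f n)" "L2 lborel F" "(\<lambda>n. n2 lborel (\<lambda>x. f n x - F x)) \<longlonglongrightarrow> 0"
    and g: "\<And>n. L2 lborel (g n)" "L2 lborel G" "(\<lambda>n. n2 lborel (\<lambda>x. g n x - G x)) \<longlonglongrightarrow> 0"
    using assms by (auto simp: Lconv_def)
  show "L2 lborel (\<lambda>x. f n x + g n x)" for n by (intro L2_add f g)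
  show "L2 lborel (\<lambda>x. F x + G x)" by (intro L2_add f g)
  have lim: "(\<lambda>n. 2 * n2 lborel (\<lambda>x. f n x - F x) + 2 * n2 lborel (\<lambda>x. g n x - G x)) \<longlonglongrightarrow> 0"
    using tendsto_add[OF tendsto_mult[OF tendsto_const f(3), of 2] tendsto_mult[OF tendsto_const g(3), of 2]] by simp
  show "(\<lambda>n. n2 lborel (\<lambda>x. f n x + g n x - (F x + G x))) \<longlonglongrightarrow> 0"
  proof (rule Lim_null_comparison[OF always_eventually lim], rule allI)
    fix n
    have eq: "(\<lambda>x. f n x + g n x - (F x + G x)) = (\<lambda>x. (f n x - F x) + (g n x - G x))" by auto
    show "norm (n2 lborel (\<lambda>x. f n x + g n x - (F x + G x))) \<le> 2 * n2 lborel (\<lambda>x. f n x - F x) + 2 * n2 lborel (\<lambda>x. g n x - G x)"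
      unfolding eq using n2_add_le[OF L2_diff[OF f(1)[of n] f(2)] L2_diff[OF g(1)[of n] g(2)]] by simp
  qed
qed

lemma Lconv_const: "L2 lborel F \<Longrightarrow> Lconv (\<lambda>n. F) F"
  by (simp add: Lconv_def n2_def)

lemma Lconv_sum:
  assumes "\<And>i. i \<in> I \<Longrightarrow> Lconv (f i) (F i)"
  shows "Lconv (\<lambda>n x. \<Sum>i\<in>I. f i n x) (\<lambda>x. \<Sum>i\<in>I. F i x)"
  using assms
proof (induction I rule: infinite_finite_induct)
  case (insert i I)
  then show ?case by (simp add: Lconv_add)
qed (auto intro: Lconv_const)

lemma Lconv_mollify:
  assumes "L2loc f" "continuous_on UNIV g" "bsupp g"
  shows "Lconv (\<lambda>n x. g x * mollify (real (Suc n)) f x) (\<lambda>x. g x * f x)"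
  unfolding Lconv_def using mollify_conv[OF assms] by blast

lemma Lconv_inner:
  assumes "Lconv f F" "Lconv g G"
  shows "(\<lambda>n. \<integral>x. f n x \<bullet> g n x \<partial>lborel) \<longlonglongrightarrow> (\<integral>x. F x \<bullet> G x \<partial>lborel)"
  using assms unfolding Lconv_def by (intro inner_tendsto_L2) auto

lemma Lconv_n2:
  assumes "Lconv f F"
  shows "(\<lambda>n. n2 lborel (f n)) \<longlonglongrightarrow> n2 lborel F"
  using assms unfolding Lconv_def by (intro n2_tendsto) auto

lemma cnj_measurable [measurable]: "cnj \<in> borel_measurable borel"
  by (intro borel_measurable_continuous_onI continuous_on_cnj continuous_on_id)

text \<open>Serves for cut-offs tending to 1 pointwise: |c - 1| <= 2 gives the integrable majorant 4
  |F|^2.\<close>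

lemma Lconv_dom:
  fixes F :: "complex^'n \<Rightarrow> complex"
  assumes F: "L2 lborel F" and c: "\<And>n. c n \<in> borel_measurable borel" "\<And>n z. norm (c n z) \<le> 1" "\<And>z. (\<lambda>n. c n z) \<longlonglongrightarrow> 1"
  shows "Lconv (\<lambda>n z. c n z * F z) F"
  unfolding Lconv_def
proof (intro conjI allI F)
  have mF: "F \<in> borel_measurable borel" using F by (simp add: L2_def)
  show "L2 lborel (\<lambda>z. c n z * F z)" for n
    by (rule L2_bound[OF F, where C=1]) (use mF c in \<open>auto simp: norm_mult mult_left_le_one_le\<close>)
  have "(\<lambda>n. \<integral>z. (norm (c n z * F z - F z))\<^sup>2 \<partial>lborel) \<longlonglongrightarrow> integral\<^sup>L lborel (\<lambda>z::complex^'n. 0)"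
  proof (rule integral_dominated_convergence[where w="\<lambda>z. 4 * (norm (F z))\<^sup>2"])
    show "integrable lborel (\<lambda>z. 4 * (norm (F z))\<^sup>2)" using F by (simp add: L2_def)
    show "(\<lambda>z. (norm (c n z * F z - F z))\<^sup>2) \<in> borel_measurable lborel" for n
      using mF c(1)[of n] by measurable
    show "AE z in lborel. (\<lambda>n. (norm (c n z * F z - F z))\<^sup>2) \<longlonglongrightarrow> 0"
    proof (rule AE_I2)
      fix z
      have "(\<lambda>n. (norm (c n z * F z - F z))\<^sup>2) \<longlonglongrightarrow> (norm (1 * F z - F z))\<^sup>2"
        by (intro tendsto_intros c)
      then show "(\<lambda>n. (norm (c n z * F z - F z))\<^sup>2) \<longlonglongrightarrow> 0" by simp
    qed
    show "AE z in lborel. norm ((norm (c n z * F z - F z))\<^sup>2) \<le> 4 * (norm (F z))\<^sup>2" for n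
    proof (rule AE_I2)
      fix z
      have "norm (c n z * F z - F z) = norm (c n z - 1) * norm (F z)" by (simp add: norm_mult[symmetric] left_diff_distrib)
      also have "norm (c n z - 1) \<le> 2" using norm_triangle_ineq4[of "c n z" 1] c(2)[of n z] by simp
      finally have "norm (c n z * F z - F z) \<le> 2 * norm (F z)" by (simp add: mult_right_mono)
      from power_mono[OF this, of 2] show "norm ((norm (c n z * F z - F z))\<^sup>2) \<le> 4 * (norm (F z))\<^sup>2"
        by (simp add: power_mult_distrib)
    qed
  qed simp
  then show "(\<lambda>n. n2 lborel (\<lambda>x. c n x * F x - F x)) \<longlonglongrightarrow> 0" by (simp add: n2_def)
qed

text \<open>Serves for the gradients of the cut-offs, whose sup norms \<open>K n\<close> tend to
  zero.\<close>

lemma Lconv_small: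
  assumes F: "L2 lborel F" and c: "\<And>n. c n \<in> borel_measurable borel" "\<And>n z. norm (c n z) \<le> K n" and K: "K \<longlonglongrightarrow> 0"
  shows "Lconv (\<lambda>n z. c n z * F z) (\<lambda>z. 0)"
  unfolding Lconv_def
proof (intro conjI allI)
  have mF: "F \<in> borel_measurable borel" using F by (simp add: L2_def)
  have b: "norm (c n z * F z) \<le> K n * norm (F z)" for n z
    using c(2)[of n z] by (simp add: norm_mult mult_right_mono)
  show L: "L2 lborel (\<lambda>z. c n z * F z)" for n
    by (rule L2_bound[OF F _ b]) (use mF c(1) in simp)
  have lim: "(\<lambda>n. (K n)\<^sup>2 * n2 lborel F) \<longlonglongrightarrow> 0"
    using tendsto_mult[OF tendsto_power[OF K, of 2] tendsto_const[of "n2 lborel F"]] by simp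
  have "(\<lambda>n. n2 lborel (\<lambda>z. c n z * F z)) \<longlonglongrightarrow> 0"
  proof (rule Lim_null_comparison[OF always_eventually lim], rule allI)
    show "norm (n2 lborel (\<lambda>z. c n z * F z)) \<le> (K n)\<^sup>2 * n2 lborel F" for n
      using n2_mono_bound[OF F L b, of n] by simp
  qed
  then show "(\<lambda>n. n2 lborel (\<lambda>x. c n x * F x - 0)) \<longlonglongrightarrow> 0" by simp
qed simp

section \<open>The a priori inequality for weakly closed forms\<close>

context weight
begin

text \<open>Multiplication by \<open>E\<close> maps the space weighted by exp(-\<phi>) isometrically
  onto unweighted L^2, so that all projections take place in one fixed Hilbert space;
  \<open>Ei\<close> is the inverse factor.\<close>

definition E :: "complex^'n \<Rightarrow> complex" where "E z = complex_of_real (exp (- \<phi> z / 2))"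
definition Ei :: "complex^'n \<Rightarrow> complex" where "Ei z = complex_of_real (exp (\<phi> z / 2))"

lemma E_cont: "continuous_on UNIV E" and Ei_cont: "continuous_on UNIV Ei"
  unfolding E_def[abs_def] Ei_def[abs_def] by (auto intro!: continuous_intros phi_cont)

lemma E_Ei: "E z * Ei z = 1" "Ei z * E z = 1"
  unfolding E_def Ei_def of_real_mult[symmetric] by (auto simp: exp_add[symmetric])

lemma norm_E_sq: "(cmod (E z))\<^sup>2 = exp (- \<phi> z)"
  by (simp add: E_def power2_eq_square exp_add[symmetric])

lemma cnj_E: "cnj (E z) = E z" "cnj (Ei z) = Ei z"
  by (simp_all add: E_def Ei_def)

lemma sqE: "(cmod x)\<^sup>2 * exp (- \<phi> z) = (cmod (E z * x))\<^sup>2"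
  by (simp add: norm_mult power_mult_distrib norm_E_sq)

lemma Re_of_real_mult: "Re (complex_of_real r * x) = r * Re x"
  by simp

lemma cinner: "(x::complex) \<bullet> y = Re (x * cnj y)"
  by (simp add: inner_complex_def)

text \<open>\<open>closed\<close> and \<open>div\<close> express, through mollifier kernels only,
  that dbar A = 0 and that the adjoint of dbar sends A to -h; in this form they make sense for
  non-smooth \<open>A\<close>. Bochner's inequality is applied to the bump times the mollification,
  which is C^2 with bounded support, and then the mollification is removed.\<close>

lemma apriori_bump:
  assumes A: "\<And>j. L2loc (A j)" and h: "L2loc h"
    and closed: "\<And>s x j k. s > 0 \<Longrightarrow> cv (A j) (\<lambda>z. cnj (krcA s k z)) x = cv (A k) (\<lambda>z. cnj (krcA s j z)) x"
    and div: "\<And>s x. s > 0 \<Longrightarrow> (\<Sum>j\<in>UNIV. cv (A j) (krcA s j) x) = cv (\<lambda>y. (\<Sum>j\<in>UNIV. P j y * A j y) + h y) (krc s) x"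
    and \<sigma>: "\<sigma> > 0"
  shows "integrable lborel (\<lambda>z. (bump \<sigma> z)\<^sup>2 * Re (\<Sum>j\<in>UNIV. \<Sum>k\<in>UNIV. H j k z * (E z * A j z) * cnj (E z * A k z)))" (is ?int)
    and "(\<integral>z. (bump \<sigma> z)\<^sup>2 * Re (\<Sum>j\<in>UNIV. \<Sum>k\<in>UNIV. H j k z * (E z * A j z) * cnj (E z * A k z)) \<partial>lborel)
      \<le> n2 lborel (\<lambda>z. complex_of_real (bump \<sigma> z) * (E z * h z) + (\<Sum>j\<in>UNIV. bumpA \<sigma> j z * (E z * A j z)))
        + (1/2) * (\<Sum>j\<in>UNIV. \<Sum>k\<in>UNIV. n2 lborel (\<lambda>z. cnj (bumpA \<sigma> k z) * (E z * A j z) + (- cnj (bumpA \<sigma> j z)) * (E z * A k z)))" (is ?le)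
proof -
  define M where "M = complex_of_real (km TYPE('n))"
  have M: "M \<noteq> 0" using km_pos[where 'n='n] by (simp add: M_def)
  define \<theta> where "\<theta> z = complex_of_real (bump \<sigma> z)" for z :: "complex^'n"
  have \<theta>c: "continuous_on UNIV \<theta>" using C1_cont[OF bump_C1[of \<sigma>]] by (simp add: \<theta>_def[abs_def])
  have \<theta>b: "bsupp \<theta>" using bump_bsupp'[OF \<sigma>] by (simp add: \<theta>_def[abs_def])
  have cA: "continuous_on UNIV (bumpA \<sigma> j)" for j by (rule C1_contA[OF bump_C1])
  have bA: "bsupp (bumpA \<sigma> j)" for j by (rule C1_bsupp(1)[OF bump_C1 bump_bsupp'[OF \<sigma>]])
  define G where "G y = (\<Sum>j\<in>UNIV. P j y * A j y) + h y" for y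
  have G: "L2loc G" unfolding G_def[abs_def] by (intro L2loc_add L2loc_sum L2loc_mult A h P_cont)
  have lA: "locint (A j)" for j by (rule L2loc_locint[OF A])
  define s where "s n = real (Suc n)" for n
  have s: "s n > 0" for n by (simp add: s_def)
  define m where "m n j = mollify (s n) (A j)" for n j
  define mA where "mA n j i x = cv (A j) (krcA (s n) i) x / M" for n j i x
  define mB where "mB n j i x = cv (A j) (\<lambda>z. cnj (krcA (s n) i z)) x / M" for n j i x
  define FL where "FL n j k z = (H j k z * (E z * \<theta> z)) * m n j z" for n j k z
  define GL where "GL n k z = (E z * \<theta> z) * m n k z" for n k z
  \<comment> \<open>The whole right-hand side \<open>G\<close> of the divergence equation is
    mollified as one function. In the limit the products P_j A_j cancel, and only \<open>h\<close>
    and the gradient of the cut-off survive.\<close>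
  define f where "f n z = (- (E z * \<theta> z)) * mollify (s n) G z + (\<Sum>j\<in>UNIV. (E z * (P j z * \<theta> z - bumpA \<sigma> j z)) * m n j z)" for n z
  define g where "g n j k z = (E z * cnj (bumpA \<sigma> k z)) * m n j z + (- (E z * cnj (bumpA \<sigma> j z))) * m n k z" for n j k z
  define F' where "F' z = (- (E z * \<theta> z)) * G z + (\<Sum>j\<in>UNIV. (E z * (P j z * \<theta> z - bumpA \<sigma> j z)) * A j z)" for z
  define g' where "g' j k z = (E z * cnj (bumpA \<sigma> k z)) * A j z + (- (E z * cnj (bumpA \<sigma> j z))) * A k z" for j k z
  have cf: "Lconv f F'"
    unfolding f_def F'_def m_def s_def
  proof (intro Lconv_add Lconv_sum Lconv_mollify A G)
    show "continuous_on UNIV (\<lambda>z. - (E z * \<theta> z))" by (intro continuous_intros E_cont \<theta>c)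
    show "bsupp (\<lambda>z. - (E z * \<theta> z))" by (rule bsupp_comp[OF \<theta>b]) simp
    show "continuous_on UNIV (\<lambda>z. E z * (P j z * \<theta> z - bumpA \<sigma> j z))" for j by (intro continuous_intros E_cont \<theta>c P_cont cA)
    show "bsupp (\<lambda>z. E z * (P j z * \<theta> z - bumpA \<sigma> j z))" for j
    proof -
      have "bsupp (\<lambda>z. P j z * \<theta> z + (- bumpA \<sigma> j z))" by (intro bsupp_add bsupp_comp[OF \<theta>b] bsupp_comp[OF bA]) auto
      then show ?thesis by (rule bsupp_comp) simp
    qed
  qed
  have cg: "Lconv (\<lambda>n. g n j k) (g' j k)" for j k
    unfolding g_def g'_def m_def s_def
    by (intro Lconv_add Lconv_mollify A continuous_intros E_cont cA; rule bsupp_comp[OF bA]; force)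
  have cFL: "Lconv (\<lambda>n. FL n j k) (\<lambda>z. (H j k z * (E z * \<theta> z)) * A j z)" for j k
    unfolding FL_def m_def s_def
    by (intro Lconv_mollify A continuous_intros E_cont \<theta>c H_cont bsupp_comp[OF \<theta>b]) auto
  have cGL: "Lconv (\<lambda>n. GL n k) (\<lambda>z. (E z * \<theta> z) * A k z)" for k
    unfolding GL_def m_def s_def
    by (intro Lconv_mollify A continuous_intros E_cont \<theta>c bsupp_comp[OF \<theta>b]) auto
  have ineq: "(\<Sum>j\<in>UNIV. \<Sum>k\<in>UNIV. \<integral>z. FL n j k z \<bullet> GL n k z \<partial>lborel) \<le> n2 lborel (f n) + (1/2) * (\<Sum>j\<in>UNIV. \<Sum>k\<in>UNIV. n2 lborel (g n j k))" for n
  proof -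
    have "\<forall>j. \<exists>AA AB BB. C2 (\<lambda>z. \<theta> z * m n j z) (\<lambda>i z. \<theta> z * mA n j i z + bumpA \<sigma> i z * m n j z) (\<lambda>i z. \<theta> z * mB n j i z + cnj (bumpA \<sigma> i z) * m n j z) AA AB BB"
    proof
      fix j
      obtain AA AB where c: "C2R (bump \<sigma> :: complex^'n \<Rightarrow> real) (bumpA \<sigma>) AA AB" using bump_C2R by blast
      obtain AA' AB' BB' where mm: "C2 (m n j) (mA n j) (mB n j) AA' AB' BB'"
        using mollify_C2[OF lA s] unfolding m_def mA_def[abs_def] mB_def[abs_def] M_def by blast
      show "\<exists>AA AB BB. C2 (\<lambda>z. \<theta> z * m n j z) (\<lambda>i z. \<theta> z * mA n j i z + bumpA \<sigma> i z * m n j z) (\<lambda>i z. \<theta> z * mB n j i z + cnj (bumpA \<sigma> i z) * m n j z) AA AB BB"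
        using C2_mult[OF C2_of_C2R[OF c] mm] unfolding \<theta>_def .
    qed
    from choice[OF this] obtain AA where "\<forall>j. \<exists>AB BB. C2 (\<lambda>z. \<theta> z * m n j z) (\<lambda>i z. \<theta> z * mA n j i z + bumpA \<sigma> i z * m n j z) (\<lambda>i z. \<theta> z * mB n j i z + cnj (bumpA \<sigma> i z) * m n j z) (AA j) AB BB" ..
    from choice[OF this] obtain AB where "\<forall>j. \<exists>BB. C2 (\<lambda>z. \<theta> z * m n j z) (\<lambda>i z. \<theta> z * mA n j i z + bumpA \<sigma> i z * m n j z) (\<lambda>i z. \<theta> z * mB n j i z + cnj (bumpA \<sigma> i z) * m n j z) (AA j) (AB j) BB" ..
    from choice[OF this] obtain BB where C: "\<And>j. C2 (\<lambda>z. \<theta> z * m n j z) (\<lambda>i z. \<theta> z * mA n j i z + bumpA \<sigma> i z * m n j z) (\<lambda>i z. \<theta> z * mB n j i z + cnj (bumpA \<sigma> i z) * m n j z) (AA j) (AB j) (BB j)"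
      by blast
    have b: "bsupp (\<lambda>z. \<theta> z * m n j z)" for j by (rule bsupp_comp[OF \<theta>b]) simp
    have L: "(\<integral>z. Re (\<Sum>j\<in>UNIV. \<Sum>k\<in>UNIV. H j k z * (\<theta> z * m n j z) * cnj (\<theta> z * m n k z)) * exp (- \<phi> z) \<partial>lborel)
        = (\<Sum>j\<in>UNIV. \<Sum>k\<in>UNIV. \<integral>z. FL n j k z \<bullet> GL n k z \<partial>lborel)"
    proof -
      have "Re (\<Sum>j\<in>UNIV. \<Sum>k\<in>UNIV. H j k z * (\<theta> z * m n j z) * cnj (\<theta> z * m n k z)) * exp (- \<phi> z)
          = (\<Sum>j\<in>UNIV. \<Sum>k\<in>UNIV. FL n j k z \<bullet> GL n k z)" for z
      proof -
        have "FL n j k z \<bullet> GL n k z = Re (H j k z * (\<theta> z * m n j z) * cnj (\<theta> z * m n k z)) * exp (- \<phi> z)" for j k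
        proof -
          have "FL n j k z * cnj (GL n k z) = (E z * cnj (E z)) * (H j k z * (\<theta> z * m n j z) * cnj (\<theta> z * m n k z))"
            unfolding FL_def GL_def by (simp add: mult_ac)
          also have "E z * cnj (E z) = complex_of_real (exp (- \<phi> z))"
            unfolding complex_norm_square[symmetric] norm_E_sq ..
          finally show ?thesis unfolding cinner by (simp only: Re_of_real_mult mult.commute)
        qed
        then show ?thesis by (simp only: Re_sum sum_distrib_right)
      qed
      then show ?thesis
        using cFL cGL by (simp add: L2_integrable_inner Lconv_def)
    qed
    have R: "((cmod (\<Sum>j\<in>UNIV. - (\<theta> z * mA n j j z + bumpA \<sigma> j z * m n j z) + P j z * (\<theta> z * m n j z)))\<^sup>2 +
        (1/2) * (\<Sum>j\<in>UNIV. \<Sum>k\<in>UNIV. (cmod (\<theta> z * mB n j k z + cnj (bumpA \<sigma> k z) * m n j z - (\<theta> z * mB n k j z + cnj (bumpA \<sigma> j z) * m n k z)))\<^sup>2)) * exp (- \<phi> z)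
       = (cmod (f n z))\<^sup>2 + (1/2) * (\<Sum>j\<in>UNIV. \<Sum>k\<in>UNIV. (cmod (g n j k z))\<^sup>2)" for z
    proof -
      have "(\<Sum>j\<in>UNIV. mA n j j z) = mollify (s n) G z"
        unfolding mA_def sum_divide_distrib[symmetric] div[OF s] mollify_def G_def[abs_def] M_def ..
      then have "E z * (\<Sum>j\<in>UNIV. - (\<theta> z * mA n j j z + bumpA \<sigma> j z * m n j z) + P j z * (\<theta> z * m n j z)) = f n z"
        unfolding f_def
        by (simp add: sum.distrib sum_subtractf sum_negf sum_distrib_left[symmetric] algebra_simps)
          (auto simp: sum_distrib_left mult_ac)
      then have 1: "(cmod (\<Sum>j\<in>UNIV. - (\<theta> z * mA n j j z + bumpA \<sigma> j z * m n j z) + P j z * (\<theta> z * m n j z)))\<^sup>2 * exp (- \<phi> z) = (cmod (f n z))\<^sup>2"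
        unfolding sqE by simp
      have 2: "(cmod (\<theta> z * mB n j k z + cnj (bumpA \<sigma> k z) * m n j z - (\<theta> z * mB n k j z + cnj (bumpA \<sigma> j z) * m n k z)))\<^sup>2 * exp (- \<phi> z) = (cmod (g n j k z))\<^sup>2" for j k
      proof -
        have "mB n j k z = mB n k j z" unfolding mB_def closed[OF s[of n], where j=j and k=k] ..
        then have "E z * (\<theta> z * mB n j k z + cnj (bumpA \<sigma> k z) * m n j z - (\<theta> z * mB n k j z + cnj (bumpA \<sigma> j z) * m n k z)) = g n j k z"
          unfolding g_def by (simp add: algebra_simps)
        then show ?thesis unfolding sqE by simp
      qed
      show ?thesis
        unfolding distrib_right 1 mult.assoc sum_distrib_right 2 ..
    qed
    have "(\<integral>z. (cmod (f n z))\<^sup>2 + (1/2) * (\<Sum>j\<in>UNIV. \<Sum>k\<in>UNIV. (cmod (g n j k z))\<^sup>2) \<partial>lborel) = n2 lborel (f n) + (1/2) * (\<Sum>j\<in>UNIV. \<Sum>k\<in>UNIV. n2 lborel (g n j k))"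
      using cf cg by (simp add: Lconv_def L2_def n2_def)
    then show ?thesis
      using bochner[where \<beta>="\<lambda>j z. \<theta> z * m n j z" and A="\<lambda>j i z. \<theta> z * mA n j i z + bumpA \<sigma> i z * m n j z"
          and B="\<lambda>j i z. \<theta> z * mB n j i z + cnj (bumpA \<sigma> i z) * m n j z" and AA=AA and AB=AB and BB=BB, OF C b]
      unfolding L R by simp
  qed
  have lim: "(\<Sum>j\<in>UNIV. \<Sum>k\<in>UNIV. \<integral>z. ((H j k z * (E z * \<theta> z)) * A j z) \<bullet> ((E z * \<theta> z) * A k z) \<partial>lborel)
     \<le> n2 lborel F' + (1/2) * (\<Sum>j\<in>UNIV. \<Sum>k\<in>UNIV. n2 lborel (g' j k))"
  proof (rule LIMSEQ_le)
    show "(\<lambda>n. \<Sum>j\<in>UNIV. \<Sum>k\<in>UNIV. \<integral>z. FL n j k z \<bullet> GL n k z \<partial>lborel) \<longlonglongrightarrow> (\<Sum>j\<in>UNIV. \<Sum>k\<in>UNIV. \<integral>z. ((H j k z * (E z * \<theta> z)) * A j z) \<bullet> ((E z * \<theta> z) * A k z) \<partial>lborel)"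
      by (intro tendsto_sum Lconv_inner cFL cGL)
    show "(\<lambda>n. n2 lborel (f n) + (1/2) * (\<Sum>j\<in>UNIV. \<Sum>k\<in>UNIV. n2 lborel (g n j k))) \<longlonglongrightarrow> n2 lborel F' + (1/2) * (\<Sum>j\<in>UNIV. \<Sum>k\<in>UNIV. n2 lborel (g' j k))"
      by (intro tendsto_add tendsto_mult tendsto_const tendsto_sum Lconv_n2 cf cg)
    show "\<exists>N. \<forall>n\<ge>N. (\<Sum>j\<in>UNIV. \<Sum>k\<in>UNIV. \<integral>z. FL n j k z \<bullet> GL n k z \<partial>lborel) \<le> n2 lborel (f n) + (1/2) * (\<Sum>j\<in>UNIV. \<Sum>k\<in>UNIV. n2 lborel (g n j k))"
      using ineq by blast
  qed
  have pt: "(bump \<sigma> z)\<^sup>2 * Re (\<Sum>j\<in>UNIV. \<Sum>k\<in>UNIV. H j k z * (E z * A j z) * cnj (E z * A k z))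
     = (\<Sum>j\<in>UNIV. \<Sum>k\<in>UNIV. ((H j k z * (E z * \<theta> z)) * A j z) \<bullet> ((E z * \<theta> z) * A k z))" for z
  proof -
    have "((H j k z * (E z * \<theta> z)) * A j z) \<bullet> ((E z * \<theta> z) * A k z) = (bump \<sigma> z)\<^sup>2 * Re (H j k z * (E z * A j z) * cnj (E z * A k z))" for j k
    proof -
      have "((H j k z * (E z * \<theta> z)) * A j z) * cnj ((E z * \<theta> z) * A k z) = complex_of_real ((bump \<sigma> z)\<^sup>2) * (H j k z * (E z * A j z) * cnj (E z * A k z))"
        by (simp add: \<theta>_def power2_eq_square mult_ac)
      then show ?thesis unfolding cinner by (simp only: Re_of_real_mult)
    qed
    then show ?thesis by (simp only: Re_sum sum_distrib_left)
  qed
  have inI: "integrable lborel (\<lambda>z. ((H j k z * (E z * \<theta> z)) * A j z) \<bullet> ((E z * \<theta> z) * A k z))" for j k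
    using cFL[of j k] cGL[of k] by (intro L2_integrable_inner) (auto simp: Lconv_def)
  show ?int unfolding pt by (intro Bochner_Integration.integrable_sum inI)
  have e1: "n2 lborel F' = n2 lborel (\<lambda>z. complex_of_real (bump \<sigma> z) * (E z * h z) + (\<Sum>j\<in>UNIV. bumpA \<sigma> j z * (E z * A j z)))"
  proof -
    have "F' z = - (complex_of_real (bump \<sigma> z) * (E z * h z) + (\<Sum>j\<in>UNIV. bumpA \<sigma> j z * (E z * A j z)))" for z
      unfolding F'_def G_def \<theta>_def
      by (simp add: algebra_simps sum_subtractf sum_distrib_left sum_negf)
    then show ?thesis unfolding n2_def by (simp only: norm_minus_cancel)
  qed
  have e2: "g' j k = (\<lambda>z. cnj (bumpA \<sigma> k z) * (E z * A j z) + (- cnj (bumpA \<sigma> j z)) * (E z * A k z))" for j k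
    by (simp add: g'_def fun_eq_iff mult_ac)
  have "(\<integral>z. (bump \<sigma> z)\<^sup>2 * Re (\<Sum>j\<in>UNIV. \<Sum>k\<in>UNIV. H j k z * (E z * A j z) * cnj (E z * A k z)) \<partial>lborel)
     = (\<Sum>j\<in>UNIV. \<Sum>k\<in>UNIV. \<integral>z. ((H j k z * (E z * \<theta> z)) * A j z) \<bullet> ((E z * \<theta> z) * A k z) \<partial>lborel)"
    unfolding pt using inI by simp
  then show ?le using lim unfolding e1 e2 by simp
qed

text \<open>The cut-offs exhaust the space. On the right their gradients drop out, being of size
  sqrt \<sigma>; on the left Fatou's lemma applies because the Hessian form is nonnegative.\<close>

lemma apriori:
  assumes Hpos: "\<And>z a. 0 \<le> Re (\<Sum>j\<in>UNIV. \<Sum>k\<in>UNIV. H j k z * a j * cnj (a k))"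
    and A: "\<And>j. L2loc (A j)" and h: "L2loc h"
    and closed: "\<And>s x j k. s > 0 \<Longrightarrow> cv (A j) (\<lambda>z. cnj (krcA s k z)) x = cv (A k) (\<lambda>z. cnj (krcA s j z)) x"
    and div: "\<And>s x. s > 0 \<Longrightarrow> (\<Sum>j\<in>UNIV. cv (A j) (krcA s j) x) = cv (\<lambda>y. (\<Sum>j\<in>UNIV. P j y * A j y) + h y) (krc s) x"
    and a2: "\<And>j. L2 lborel (\<lambda>z. E z * A j z)" and h2: "L2 lborel (\<lambda>z. E z * h z)"
  defines "q \<equiv> \<lambda>z. Re (\<Sum>j\<in>UNIV. \<Sum>k\<in>UNIV. H j k z * (E z * A j z) * cnj (E z * A k z))"
  shows "integrable lborel q" "integral\<^sup>L lborel q \<le> n2 lborel (\<lambda>z. E z * h z)"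
proof -
  define \<sigma> where "\<sigma> n = 1 / real (Suc n)" for n
  have \<sigma>: "\<sigma> n > 0" for n by (simp add: \<sigma>_def)
  have \<sigma>0: "\<sigma> \<longlonglongrightarrow> 0" unfolding \<sigma>_def by (rule LIMSEQ_Suc[OF lim_1_over_n])
  have K0: "(\<lambda>n. 4 * sqrt (\<sigma> n)) \<longlonglongrightarrow> 0"
    using tendsto_mult[OF tendsto_const[of 4] tendsto_real_sqrt[OF \<sigma>0]] by simp
  have cutlim: "(\<lambda>n. bump (\<sigma> n) z) \<longlonglongrightarrow> 1" for z :: "complex^'n"
  proof -
    have "(\<lambda>n. max 0 (1 - \<sigma> n * (norm z)\<^sup>2) ^ 4) \<longlonglongrightarrow> max 0 (1 - 0 * (norm z)\<^sup>2) ^ 4"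
      by (intro tendsto_intros \<sigma>0)
    then show ?thesis by (simp add: bump_def pos_part_def)
  qed
  have cm: "(\<lambda>z::complex^'n. complex_of_real (bump s z)) \<in> borel_measurable borel" "bumpA s j \<in> borel_measurable borel" for s j
    by (intro borel_measurable_continuous_onI C1_cont[OF bump_C1] C1_contA[OF bump_C1])+
  have cmc: "(\<lambda>z. cnj (bumpA s j z)) \<in> borel_measurable borel" "(\<lambda>z. - cnj (bumpA s j z)) \<in> borel_measurable borel" for s j
    by (intro borel_measurable_continuous_onI continuous_intros C1_contA[OF bump_C1])+
  have mA: "A j \<in> borel_measurable borel" for j by (rule L2loc_measurable[OF A])
  have mE: "E \<in> borel_measurable borel" by (rule borel_measurable_continuous_onI[OF E_cont])
  have mH: "H j k \<in> borel_measurable borel" for j k by (rule borel_measurable_continuous_onI[OF H_cont])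
  have mq: "q \<in> borel_measurable borel"
    unfolding q_def using mA mE mH by measurable
  have q0: "q z \<ge> 0" for z unfolding q_def by (rule Hpos)
  define R where "R n = n2 lborel (\<lambda>z. complex_of_real (bump (\<sigma> n) z) * (E z * h z) + (\<Sum>j\<in>UNIV. bumpA (\<sigma> n) j z * (E z * A j z)))
        + (1/2) * (\<Sum>j\<in>UNIV. \<Sum>k\<in>UNIV. n2 lborel (\<lambda>z. cnj (bumpA (\<sigma> n) k z) * (E z * A j z) + (- cnj (bumpA (\<sigma> n) j z)) * (E z * A k z)))" for n
  have "R \<longlonglongrightarrow> n2 lborel (\<lambda>z. E z * h z + (\<Sum>j\<in>(UNIV::'n set). 0)) + (1/2) * (\<Sum>j\<in>(UNIV::'n set). \<Sum>k\<in>(UNIV::'n set). n2 lborel (\<lambda>z::complex^'n. 0 + (0::complex)))"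
    unfolding R_def
  proof (intro tendsto_add tendsto_mult tendsto_const tendsto_sum Lconv_n2 Lconv_add Lconv_sum)
    show "Lconv (\<lambda>n z. complex_of_real (bump (\<sigma> n) z) * (E z * h z)) (\<lambda>z. E z * h z)"
    proof (rule Lconv_dom[OF h2 cm(1)])
      show "norm (complex_of_real (bump (\<sigma> n) z)) \<le> 1" for n and z :: "complex^'n"
        using bump_bounds(1)[of "\<sigma> n" z] bump_bounds(2)[of "\<sigma> n" z] \<sigma>[of n] by simp
      show "(\<lambda>n. complex_of_real (bump (\<sigma> n) z)) \<longlonglongrightarrow> 1" for z :: "complex^'n"
      proof -
        have "(\<lambda>n. complex_of_real (bump (\<sigma> n) z)) \<longlonglongrightarrow> complex_of_real 1" by (intro tendsto_of_real cutlim)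
        then show ?thesis by simp
      qed
    qed
    show "Lconv (\<lambda>n z. bumpA (\<sigma> n) j z * (E z * A j z)) (\<lambda>z. 0)" for j
      by (rule Lconv_small[OF a2 cm(2) bumpA_bound[OF \<sigma>] K0])
    show "Lconv (\<lambda>n z. cnj (bumpA (\<sigma> n) k z) * (E z * A j z)) (\<lambda>z. 0)" for j k
      by (rule Lconv_small[OF a2 _ _ K0]) (use cmc bumpA_bound[OF \<sigma>] in \<open>auto simp del: complex_cnj_minus\<close>)
    show "Lconv (\<lambda>n z. - cnj (bumpA (\<sigma> n) j z) * (E z * A k z)) (\<lambda>z. 0)" for j k
      by (rule Lconv_small[OF a2 _ _ K0]) (use cmc bumpA_bound[OF \<sigma>] in \<open>auto simp del: complex_cnj_minus\<close>)
  qed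
  then have Rlim: "R \<longlonglongrightarrow> n2 lborel (\<lambda>z. E z * h z)" by (simp add: n2_def)
  have step: "integrable lborel (\<lambda>z. (bump (\<sigma> n) z)\<^sup>2 * q z)" "(\<integral>z. (bump (\<sigma> n) z)\<^sup>2 * q z \<partial>lborel) \<le> R n" for n
    using apriori_bump[OF A h closed div \<sigma>[of n]] unfolding q_def R_def by blast+
  have "(\<integral>\<^sup>+z. ennreal (q z) \<partial>lborel) = (\<integral>\<^sup>+z. liminf (\<lambda>n. ennreal ((bump (\<sigma> n) z)\<^sup>2 * q z)) \<partial>lborel)"
  proof (rule nn_integral_cong)
    fix z :: "complex^'n"
    have "(\<lambda>n. (bump (\<sigma> n) z)\<^sup>2 * q z) \<longlonglongrightarrow> 1\<^sup>2 * q z" by (intro tendsto_intros cutlim)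
    then have "(\<lambda>n. ennreal ((bump (\<sigma> n) z)\<^sup>2 * q z)) \<longlonglongrightarrow> ennreal (q z)" by (intro tendsto_ennrealI) simp
    from lim_imp_Liminf[OF _ this] show "ennreal (q z) = liminf (\<lambda>n. ennreal ((bump (\<sigma> n) z)\<^sup>2 * q z))" by simp
  qed
  also have "\<dots> \<le> liminf (\<lambda>n. \<integral>\<^sup>+z. ennreal ((bump (\<sigma> n) z)\<^sup>2 * q z) \<partial>lborel)"
  proof (rule nn_integral_liminf)
    show "(\<lambda>z. ennreal ((bump (\<sigma> n) z)\<^sup>2 * q z)) \<in> borel_measurable lborel" for n
      using borel_measurable_integrable[OF step(1)[of n]] by measurable
  qed
  also have "\<dots> \<le> liminf (\<lambda>n. ennreal (R n))"
  proof (rule Liminf_mono[OF always_eventually], rule allI)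
    fix n
    have "(\<integral>\<^sup>+z. ennreal ((bump (\<sigma> n) z)\<^sup>2 * q z) \<partial>lborel) = ennreal (\<integral>z. (bump (\<sigma> n) z)\<^sup>2 * q z \<partial>lborel)"
      using step(1)[of n] q0 by (intro nn_integral_eq_integral) auto
    then show "(\<integral>\<^sup>+z. ennreal ((bump (\<sigma> n) z)\<^sup>2 * q z) \<partial>lborel) \<le> ennreal (R n)"
      using step(2)[of n] by (simp add: ennreal_leI)
  qed
  also have "\<dots> = ennreal (n2 lborel (\<lambda>z. E z * h z))"
    using lim_imp_Liminf[OF _ tendsto_ennrealI[OF Rlim]] by simp
  finally have le: "(\<integral>\<^sup>+z. ennreal (q z) \<partial>lborel) \<le> ennreal (n2 lborel (\<lambda>z. E z * h z))" .
  show iq: "integrable lborel q"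
    using le mq q0 by (intro integrableI_bounded) (auto intro: le_less_trans)
  show "integral\<^sup>L lborel q \<le> n2 lborel (\<lambda>z. E z * h z)"
    using le nn_integral_eq_integral[OF iq] q0 by simp
qed

end

section \<open>Duality and existence for the dbar equation\<close>

inductive_set lspan :: "('a \<Rightarrow> 'b::real_vector) set \<Rightarrow> ('a \<Rightarrow> 'b) set" for G where
  lspan_zero: "(\<lambda>x. 0) \<in> lspan G"
| lspan_step: "g \<in> G \<Longrightarrow> s \<in> lspan G \<Longrightarrow> (\<lambda>x. c *\<^sub>R g x + s x) \<in> lspan G"

lemma lspan_add: "s \<in> lspan G \<Longrightarrow> t \<in> lspan G \<Longrightarrow> (\<lambda>x. s x + t x) \<in> lspan G"
proof (induction rule: lspan.induct)
  case (lspan_step g s c)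
  from lspan.lspan_step[OF lspan_step(1) lspan_step(3)[OF lspan_step(4)], of c] show ?case by (simp add: add.assoc)
qed simp

lemma lspan_scale: "s \<in> lspan G \<Longrightarrow> (\<lambda>x. c *\<^sub>R s x) \<in> lspan G"
proof (induction rule: lspan.induct)
  case lspan_zero
  then show ?case by (simp add: lspan.lspan_zero)
next
  case (lspan_step g s d)
  from lspan.lspan_step[OF lspan_step(1) lspan_step(3), of "c * d"] show ?case by (simp add: scaleR_right_distrib)
qed

lemma lspan_base: "g \<in> G \<Longrightarrow> g \<in> lspan G"
  using lspan_step[OF _ lspan_zero, of g G 1] by simp

lemma vec_inner_complex: "(x::complex^'n) \<bullet> y = (\<Sum>i\<in>UNIV. Re (x $ i * cnj (y $ i)))"
  by (simp add: inner_vec_def inner_complex_def)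

lemma L2_cont_bsupp:
  fixes f :: "complex^'n \<Rightarrow> 'b::euclidean_space"
  assumes "continuous_on UNIV f" "bsupp f"
  shows "L2 lborel f"
  unfolding L2_def
proof
  show "f \<in> borel_measurable lborel" by (rule borel_measurable_lborel_cont[OF assms(1)])
  show "integrable lborel (\<lambda>x. (norm (f x))\<^sup>2)"
    by (intro integrable_bsupp continuous_intros assms bsupp_comp[OF assms(2)]) auto
qed

lemma L2_vec:
  fixes f :: "'n::finite \<Rightarrow> complex^'m \<Rightarrow> complex"
  assumes "\<And>j. L2 lborel (f j)"
  shows "L2 lborel (\<lambda>z. \<chi> j. f j z)"
  unfolding L2_def
proof
  have m: "f j \<in> borel_measurable borel" for j using assms[of j] by (simp add: L2_def)
  have "(\<lambda>z. \<chi> j. f j z) = (\<lambda>z. \<Sum>j\<in>UNIV. axis j (f j z))"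
    by (auto simp: fun_eq_iff vec_eq_iff axis_def if_distrib cong: if_cong)
  moreover have "(\<lambda>z. axis j (f j z)) \<in> borel_measurable borel" for j
  proof -
    have "continuous_on UNIV (axis j :: complex \<Rightarrow> complex^'n)"
      unfolding axis_def[abs_def]
    proof (rule continuous_on_vec_lambda)
      show "continuous_on UNIV (\<lambda>x. if i = j then x else (0::complex))" for i
        by (cases "i = j") (simp_all add: continuous_on_id)
    qed
    from measurable_compose[OF m borel_measurable_continuous_onI[OF this]] show ?thesis .
  qed
  ultimately show "(\<lambda>z. \<chi> j. f j z) \<in> borel_measurable lborel" by simp
  have "(norm (\<chi> j. f j z))\<^sup>2 = (\<Sum>j\<in>UNIV. (cmod (f j z))\<^sup>2)" for z
    by (simp add: norm_vec_sq)
  then show "integrable lborel (\<lambda>x. (norm (\<chi> j. f j x))\<^sup>2)"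
    using assms by (simp add: L2_def)
qed

lemma L2_nth:
  fixes f :: "complex^'m \<Rightarrow> complex^'n"
  assumes "L2 lborel f"
  shows "L2 lborel (\<lambda>z. f z $ j)"
proof (rule L2_bound[OF assms, where C=1])
  have "(\<lambda>x::complex^'n. x $ j) \<in> borel_measurable borel"
    by (intro borel_measurable_continuous_onI continuous_intros)
  moreover have "f \<in> borel_measurable lborel" using assms by (simp add: L2_def)
  ultimately show "(\<lambda>z. f z $ j) \<in> borel_measurable lborel" by (rule measurable_compose[rotated])
qed (simp add: Finite_Cartesian_Product.norm_nth_le)

lemma n2_nth_le:
  fixes f :: "complex^'m \<Rightarrow> complex^'n"
  assumes "L2 lborel f"
  shows "n2 lborel (\<lambda>z. f z $ j) \<le> n2 lborel f"
proof -
  have "norm (f z $ j) \<le> 1 * norm (f z)" for z by (simp add: Finite_Cartesian_Product.norm_nth_le)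
  from n2_mono_bound[OF assms L2_nth[OF assms] this] show ?thesis by simp
qed

lemma C2_reflect:
  assumes "C2 k A B AA AB BB"
  shows "C2 (\<lambda>y. k (x - y)) (\<lambda>j y. - A j (x - y)) (\<lambda>j y. - B j (x - y)) (\<lambda>j i y. AA j i (x - y)) (\<lambda>j i y. AB j i (x - y)) (\<lambda>j i y. BB j i (x - y))"
proof -
  note K = C2_D[OF assms]
  show ?thesis
    unfolding C2_def
  proof (intro conjI allI)
    show "C1 (\<lambda>y. k (x - y)) (\<lambda>j y. - A j (x - y)) (\<lambda>j y. - B j (x - y))" by (rule C1_reflect[OF K(1)])
    show "C1 (\<lambda>y. - A j (x - y)) (\<lambda>i y. AA j i (x - y)) (\<lambda>i y. AB j i (x - y))" for j
      using C1_minus[OF C1_reflect[OF K(2)]] by simp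
    show "C1 (\<lambda>y. - B j (x - y)) (\<lambda>i y. AB i j (x - y)) (\<lambda>i y. BB j i (x - y))" for j
      using C1_minus[OF C1_reflect[OF K(3)]] by simp
  qed
qed

text \<open>Orthogonality is measured with the real inner product; testing with the multiples by 1
  and by i recovers the vanishing of a complex integral.\<close>

lemma Re_scaled_zero: "Re (cnj 1 * Z) = 0 \<Longrightarrow> Re (cnj \<i> * Z) = 0 \<Longrightarrow> Z = 0"
  by (simp add: complex_eq_iff)

declare times_complex.sel [simp del]

context weight
begin

text \<open>Being orthogonal to these fields expresses, after removing the factor \<open>Ei\<close>, that a
  \<open>(0,1)\<close>-form is weakly closed.\<close>

definition TG :: "(complex^'n \<Rightarrow> complex^'n) set" where
  "TG = {t. \<exists>j k K A B AA AB BB. C2 K A B AA AB BB \<and> (\<forall>j k z. AA j k z = AA k j z) \<and> bsupp K \<and>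
     t = (\<lambda>z. \<chi> i. Ei z * ((if i = j then A k z else 0) - (if i = k then A j z else 0)))}"

lemma TG_inner:
  "(\<chi> i. Ei z * ((if i = j then a else 0) - (if i = k then b else 0))) \<bullet> (y::complex^'n)
    = Re (Ei z * a * cnj (y $ j) - Ei z * b * cnj (y $ k))"
proof -
  have "(Ei z * ((if i = j then a else 0) - (if i = k then b else 0))) * cnj (y $ i)
    = (if i = j then Ei z * a * cnj (y $ j) else 0) - (if i = k then Ei z * b * cnj (y $ k) else 0)" for i
    by (auto simp: algebra_simps)
  then have "(\<Sum>i\<in>UNIV. (Ei z * ((if i = j then a else 0) - (if i = k then b else 0))) * cnj (y $ i))
     = Ei z * a * cnj (y $ j) - Ei z * b * cnj (y $ k)"
    by (simp add: sum_subtractf)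
  moreover have "(\<chi> i. Ei z * ((if i = j then a else 0) - (if i = k then b else 0))) \<bullet> y
    = Re (\<Sum>i\<in>UNIV. (Ei z * ((if i = j then a else 0) - (if i = k then b else 0))) * cnj (y $ i))"
    unfolding vec_inner_complex Re_sum by simp
  ultimately show ?thesis by simp
qed

lemma TG_props:
  assumes "t \<in> TG"
  shows "continuous_on UNIV t" "bsupp t" "L2 lborel t"
proof -
  obtain j k K A B AA AB BB where C: "C2 K A B AA AB BB" and b: "bsupp K"
    and t: "t = (\<lambda>z. \<chi> i. Ei z * ((if i = j then A k z else 0) - (if i = k then A j z else 0)))"
    using assms unfolding TG_def by blast
  note C1 = C2_D(1)[OF C]
  have cA: "continuous_on UNIV (A j)" for j by (rule C1_contA[OF C1])
  have bA: "bsupp (A j)" for j by (rule C1_bsupp(1)[OF C1 b])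
  show c: "continuous_on UNIV t"
    unfolding t
  proof (rule continuous_on_vec_lambda)
    fix i
    have 1: "continuous_on UNIV (\<lambda>z. if i = j then A k z else 0)" by (cases "i = j") (simp_all add: cA)
    have 2: "continuous_on UNIV (\<lambda>z. if i = k then A j z else 0)" by (cases "i = k") (simp_all add: cA)
    show "continuous_on UNIV (\<lambda>z. Ei z * ((if i = j then A k z else 0) - (if i = k then A j z else 0)))"
      by (intro continuous_on_mult continuous_on_diff 1 2 Ei_cont)
  qed
  obtain R S where "\<And>z. norm z \<ge> R \<Longrightarrow> A k z = 0" "\<And>z. norm z \<ge> S \<Longrightarrow> A j z = 0"
    using bA[of k] bA[of j] unfolding bsupp_def by blast
  then show b': "bsupp t"
    unfolding t bsupp_def by (intro exI[of _ "max R S"]) (auto simp: vec_eq_iff)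
  show "L2 lborel t" by (rule L2_cont_bsupp[OF c b'])
qed

lemma lspan_TG:
  assumes "t \<in> lspan TG"
  shows "continuous_on UNIV t \<and> L2 lborel t"
  using assms
proof (induction rule: lspan.induct)
  case (lspan_step g s c)
  then show ?case using TG_props[of g] by (auto intro!: continuous_intros L2_add L2_scaleR)
qed auto

text \<open>A form dbar F is closed: after one integration by parts the pairing involves only the
  antisymmetrised second derivatives of \<open>K\<close>, which vanish by symmetry.\<close>

lemma TG_orth:
  assumes t: "t \<in> TG" and F: "C1 F F1 F2"
  shows "(\<integral>z. t z \<bullet> (\<chi> j. E z * F2 j z) \<partial>lborel) = 0"
proof -
  obtain j k K A B AA AB BB where C: "C2 K A B AA AB BB" and sym: "\<And>j k z. AA j k z = AA k j z" and b: "bsupp K"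
    and t: "t = (\<lambda>z. \<chi> i. Ei z * ((if i = j then A k z else 0) - (if i = k then A j z else 0)))"
    using t unfolding TG_def by blast
  have W: "C1 (\<lambda>z. A k z * cnj (F z)) (\<lambda>j z. A k z * cnj (F2 j z) + AA k j z * cnj (F z)) (\<lambda>j z. A k z * cnj (F1 j z) + AB k j z * cnj (F z))" for k
    by (rule C1_mult[OF C2_D(2)[OF C] C1_cnj[OF F]])
  have bA: "bsupp (A j)" for j by (rule C1_bsupp(1)[OF C2_D(1)[OF C] b])
  have bW: "bsupp (\<lambda>z. A k z * cnj (F z))" for k by (rule bsupp_comp[OF bA[of k]]) simp
  have i: "integrable lborel (\<lambda>z. A k z * cnj (F2 j z) + AA k j z * cnj (F z))" for j k
    by (intro integrable_bsupp C1_contA[OF W] C1_bsupp(1)[OF W bW])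
  have z: "(\<integral>z. A k z * cnj (F2 j z) + AA k j z * cnj (F z) \<partial>lborel) = 0" for j k
    by (rule C1_integral_zero(1)[OF W bW])
  have "t z \<bullet> (\<chi> j. E z * F2 j z) = Re ((A k z * cnj (F2 j z) + AA k j z * cnj (F z)) - (A j z * cnj (F2 k z) + AA j k z * cnj (F z)))" for z
  proof -
    have "Ei z * A k z * cnj (E z * F2 j z) - Ei z * A j z * cnj (E z * F2 k z) = (Ei z * E z) * (A k z * cnj (F2 j z) - A j z * cnj (F2 k z))"
      by (simp add: cnj_E algebra_simps)
    then show ?thesis unfolding t TG_inner vec_lambda_beta using sym[of j k z] by (simp add: E_Ei)
  qed
  then show ?thesis
    using i z by (simp add: integral_Re del: minus_complex.simps)
qed

lemma lspan_TG_orth: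
  assumes t: "t \<in> lspan TG" and F: "C1 F F1 F2" and L: "L2 lborel (\<lambda>z. \<chi> j. E z * F2 j z)"
  shows "(\<integral>z. t z \<bullet> (\<chi> j. E z * F2 j z) \<partial>lborel) = 0"
  using t
proof (induction rule: lspan.induct)
  case (lspan_step g s c)
  have i: "integrable lborel (\<lambda>z. g z \<bullet> (\<chi> j. E z * F2 j z))" "integrable lborel (\<lambda>z. s z \<bullet> (\<chi> j. E z * F2 j z))"
    using TG_props(3)[OF lspan_step(1)] lspan_TG[OF lspan_step(2)] L by (auto intro!: L2_integrable_inner)
  then show ?case
    using TG_orth[OF lspan_step(1) F] lspan_step(3) by (simp add: inner_add_left)
qed simp

text \<open>A test form is in general not closed, while the a priori inequality concerns closed
  forms. Splitting off the projection \<open>v\<close> on the closure of the span of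
  \<open>TG\<close> leaves a weakly closed \<open>b\<close>. Since \<open>v\<close> is orthogonal to
  E dbar F for every C^1 function F for which this is square integrable, passing from the test form
  to \<open>b\<close> changes neither the divergence nor the pairing with dbar \<eta>.\<close>

lemma dual_estimate:
  assumes Hpos: "\<And>z a. 0 \<le> Re (\<Sum>j\<in>UNIV. \<Sum>k\<in>UNIV. H j k z * a j * cnj (a k))"
    and eta: "C1 \<eta> E1 E2"
    and bound: "\<And>z a. (cmod (\<Sum>j\<in>UNIV. E2 j z * cnj (a j)))\<^sup>2 \<le> (Bf z)\<^sup>2 * Re (\<Sum>j\<in>UNIV. \<Sum>k\<in>UNIV. H j k z * a j * cnj (a k))"
    and LE: "\<And>j. L2 lborel (\<lambda>z. E z * E2 j z)"
    and Bf: "\<And>z. Bf z \<ge> 0" and LB: "L2 lborel (\<lambda>z. exp (- \<phi> z / 2) * Bf z)"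
    and a: "\<And>j. C1 (a j) (a1 j) (a2 j)" "\<And>j. bsupp (a j)"
  defines "sa \<equiv> \<lambda>z. Ei z * (\<Sum>j\<in>UNIV. a1 j j z)"
  shows "\<bar>\<integral>z. (E z * \<eta> z) \<bullet> sa z \<partial>lborel\<bar> \<le> sqrt (n2 lborel (\<lambda>z. exp (- \<phi> z / 2) * Bf z)) * sqrt (n2 lborel sa)"
proof -
  define ah where "ah z = (\<chi> j. Ei z * a j z)" for z
  have ca: "continuous_on UNIV (a j)" "continuous_on UNIV (a1 j k)" for j k
    by (rule C1_cont[OF a(1)] C1_contA[OF a(1)])+
  have ba: "bsupp (a1 j k)" for j k by (rule C1_bsupp(1)[OF a])
  have ahc: "continuous_on UNIV ah"
    unfolding ah_def[abs_def] by (intro continuous_on_vec_lambda continuous_on_mult Ei_cont ca)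
  have ahL: "L2 lborel ah"
  proof -
    have "bsupp (\<lambda>z. Ei z * a j z)" for j by (rule bsupp_comp[OF a(2)[of j]]) simp
    then show ?thesis unfolding ah_def[abs_def]
      by (intro L2_vec L2_cont_bsupp continuous_on_mult Ei_cont ca)
  qed
  have sac: "continuous_on UNIV sa" unfolding sa_def by (intro continuous_intros Ei_cont ca)
  have sab: "bsupp sa"
  proof -
    have "bsupp (\<lambda>z. \<Sum>j\<in>UNIV. a1 j j z)" by (intro bsupp_sum ba)
    then show ?thesis unfolding sa_def by (rule bsupp_comp) simp
  qed
  have saL: "L2 lborel sa" by (rule L2_cont_bsupp[OF sac sab])
  obtain v t where v: "L2 lborel v" and t: "\<And>n. t n \<in> lspan TG" and tv: "(\<lambda>n. n2 lborel (\<lambda>x. t n x - v x)) \<longlonglongrightarrow> 0"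
    and orth: "\<And>u. u \<in> lspan TG \<Longrightarrow> (\<integral>x. (ah x - v x) \<bullet> u x \<partial>lborel) = 0"
  proof -
    have "\<exists>v s. L2 lborel v \<and> (\<forall>n. s n \<in> lspan TG) \<and> (\<lambda>n. n2 lborel (\<lambda>x. s n x - v x)) \<longlonglongrightarrow> 0 \<and>
           (\<forall>t\<in>lspan TG. (\<integral>x. (ah x - v x) \<bullet> t x \<partial>lborel) = 0)"
      by (rule L2_projection[OF ahL conjunct2[OF lspan_TG] lspan_zero lspan_add lspan_scale])
    then show ?thesis using that by auto
  qed
  have tL: "L2 lborel (t n)" and tc: "continuous_on UNIV (t n)" for n using lspan_TG[OF t] by auto
  have v_orth: "(\<integral>z. v z \<bullet> (\<chi> j. E z * F2 j z) \<partial>lborel) = 0"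
    if F: "C1 F F1 F2" and L: "L2 lborel (\<lambda>z. \<chi> j. E z * F2 j z)" for F F1 F2
  proof -
    have "(\<lambda>n. \<integral>z. t n z \<bullet> (\<chi> j. E z * F2 j z) \<partial>lborel) \<longlonglongrightarrow> (\<integral>z. v z \<bullet> (\<chi> j. E z * F2 j z) \<partial>lborel)"
      by (rule inner_tendsto_L2[OF tL L v L tv]) (simp add: n2_def)
    then show ?thesis unfolding lspan_TG_orth[OF t F L] by (simp add: LIMSEQ_const_iff)
  qed
  define b where "b z = ah z - v z" for z
  have bL: "L2 lborel b" unfolding b_def[abs_def] by (rule L2_diff[OF ahL v])
  \<comment> \<open>\<open>b\<close> lives in the unweighted space; \<open>A\<close> is the
    corresponding form in the weighted one.\<close>
  define A where "A j z = Ei z * b z $ j" for j z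
  have EA: "E z * A j z = b z $ j" for z j by (simp add: A_def E_Ei mult.assoc[symmetric])
  have A: "L2loc (A j)" for j
    unfolding A_def[abs_def]
  \<comment> \<open>The differences \<open>ah - t n\<close> are continuous and tend to
    \<open>b\<close>, so local approximability is read off the sequence supplied by the
    projection.\<close>
  proof (rule L2loc_mult[OF L2loc_L2_limit Ei_cont])
    show "continuous_on UNIV (\<lambda>z. (ah z - t n z) $ j)" for n by (intro continuous_intros ahc tc)
    show "L2 lborel (\<lambda>z. (ah z - t n z) $ j)" for n by (rule L2_nth[OF L2_diff[OF ahL tL]])
    show "L2 lborel (\<lambda>z. b z $ j)" by (rule L2_nth[OF bL])
    have le: "norm (n2 lborel (\<lambda>x. (ah x - t n x) $ j - b x $ j)) \<le> n2 lborel (\<lambda>x. t n x - v x)" for n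
    proof -
      have "n2 lborel (\<lambda>x. (ah x - t n x) $ j - b x $ j) = n2 lborel (\<lambda>x. (t n x - v x) $ j)"
        by (simp add: n2_def b_def norm_minus_commute)
      then show ?thesis using n2_nth_le[OF L2_diff[OF tL v], of n j] by simp
    qed
    show "(\<lambda>n. n2 lborel (\<lambda>x. (ah x - t n x) $ j - b x $ j)) \<longlonglongrightarrow> 0"
      by (rule Lim_null_comparison[OF always_eventually tv]) (use le in blast)
  qed
  have lA: "locint (A j)" for j by (rule L2loc_locint[OF A])
  define h where "h z = Ei z * sa z" for z
  have hc: "continuous_on UNIV h" unfolding h_def[abs_def] by (intro continuous_intros Ei_cont sac)
  have h: "L2loc h" by (rule L2loc_cont[OF hc])
  have Eh: "(\<lambda>z. E z * h z) = sa" by (simp add: h_def fun_eq_iff E_Ei mult.assoc[symmetric])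
  have closed: "cv (A j) (\<lambda>z. cnj (krcA s k z)) x = cv (A k) (\<lambda>z. cnj (krcA s j z)) x" if s: "s > 0" for s x j k
  proof -
    obtain AA AB BB where K: "C2 (krc s :: complex^'n \<Rightarrow> complex) (krcA s) (\<lambda>j z. cnj (krcA s j z)) AA AB BB" and sym: "\<And>j k z. AA j k z = AA k j z"
      using krc_C2 by blast
    define Z where "Z = cv (A j) (\<lambda>z. cnj (krcA s k z)) x - cv (A k) (\<lambda>z. cnj (krcA s j z)) x"
    have int: "integrable lborel (\<lambda>y. A j y * cnj (krcA s k (x - y)))" for j k
      by (rule cv_integrable[OF lA C1_contB[OF C2_D(1)[OF K]] C1_bsupp(2)[OF C2_D(1)[OF K] krc_bsupp[OF s]]])
    have "Re (cnj c * Z) = 0" for c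
    proof -
      \<comment> \<open>The reflected mollifier kernel times a constant \<open>c\<close> is an
        admissible \<open>K\<close> in \<open>TG\<close>; orthogonality of \<open>b\<close> to this
        field is the closedness relation at scale \<open>s\<close> and point
        \<open>x\<close>.\<close>
      define u where "u y = (\<chi> i. Ei y * ((if i = j then c * (- krcA s k (x - y)) else 0) - (if i = k then c * (- krcA s j (x - y)) else 0)))" for y
      have "u \<in> TG"
        unfolding TG_def u_def[abs_def]
        using C2_cmult[OF C2_reflect[OF K, of x], of c] sym bsupp_comp[OF bsupp_reflect[OF krc_bsupp[OF s], of x], of "\<lambda>y. c * krc s (x - y)"]
        by (intro CollectI exI[of _ j] exI[of _ k] exI[of _ "\<lambda>y. c * krc s (x - y)"] exI conjI) auto
      from orth[OF lspan_base[OF this]] have "(\<integral>y. u y \<bullet> b y \<partial>lborel) = 0" by (simp add: b_def inner_commute)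
      moreover have "u y \<bullet> b y = Re (cnj c * (A k y * cnj (krcA s j (x - y)) - A j y * cnj (krcA s k (x - y))))" for y
      proof -
        have "Re (Ei y * (c * - krcA s k (x - y)) * cnj (b y $ j) - Ei y * (c * - krcA s j (x - y)) * cnj (b y $ k))
          = Re (cnj (Ei y * (c * - krcA s k (x - y)) * cnj (b y $ j) - Ei y * (c * - krcA s j (x - y)) * cnj (b y $ k)))"
          by (simp only: cnj.sel)
        also have "cnj (Ei y * (c * - krcA s k (x - y)) * cnj (b y $ j) - Ei y * (c * - krcA s j (x - y)) * cnj (b y $ k))
          = cnj c * (A k y * cnj (krcA s j (x - y)) - A j y * cnj (krcA s k (x - y)))"
          by (simp add: A_def cnj_E algebra_simps)
        finally show ?thesis unfolding u_def TG_inner .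
      qed
      ultimately have "(\<integral>y. Re (cnj c * (A k y * cnj (krcA s j (x - y)) - A j y * cnj (krcA s k (x - y)))) \<partial>lborel) = 0" by simp
      moreover have ii: "integrable lborel (\<lambda>y. cnj c * (A k y * cnj (krcA s j (x - y)) - A j y * cnj (krcA s k (x - y))))"
        by (intro integrable_mult_right Bochner_Integration.integrable_diff int)
      moreover have "(\<integral>y. cnj c * (A k y * cnj (krcA s j (x - y)) - A j y * cnj (krcA s k (x - y))) \<partial>lborel) = cnj c * (- Z)"
        unfolding integral_mult_right_zero Bochner_Integration.integral_diff[OF int int] Z_def cv_def by simp
      ultimately have "Re (cnj c * (- Z)) = 0" using integral_Re[OF ii] by simp
      then show ?thesis by simp
    qed
    from Re_scaled_zero[OF this this] show ?thesis by (simp add: Z_def)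
  qed
  have div: "(\<Sum>j\<in>UNIV. cv (A j) (krcA s j) x) = cv (\<lambda>y. (\<Sum>j\<in>UNIV. P j y * A j y) + h y) (krc s) x" if s: "s > 0" for s x
  proof -
    obtain AA AB BB where K: "C2 (krc s :: complex^'n \<Rightarrow> complex) (krcA s) (\<lambda>j z. cnj (krcA s j z)) AA AB BB"
      using krc_C2 by blast
    note K1 = C2_D(1)[OF K]
    have Kr: "C1 (\<lambda>y. krc s (x - y)) (\<lambda>j y. - krcA s j (x - y)) (\<lambda>j y. - cnj (krcA s j (x - y)))"
      by (rule C1_reflect[OF K1])
    have W: "C1 (\<lambda>z. complex_of_real (exp (\<phi> z))) (\<lambda>j z. complex_of_real (exp (\<phi> z)) * P j z) (\<lambda>j z. complex_of_real (exp (\<phi> z)) * cnj (P j z))"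
      by (rule C1_real_comp[OF phi, where g=exp and g'=exp]) (auto intro!: derivative_eq_intros continuous_intros phi_cont)
    have WE: "complex_of_real (exp (\<phi> z)) = Ei z * Ei z" for z
      by (simp add: Ei_def of_real_mult[symmetric] exp_add[symmetric])
    have int1: "integrable lborel (\<lambda>y. A j y * krcA s j (x - y))" for j
      by (rule cv_integrable[OF lA C1_contA[OF K1] C1_bsupp(1)[OF K1 krc_bsupp[OF s]]])
    have lG: "locint (\<lambda>y. (\<Sum>j\<in>UNIV. P j y * A j y) + h y)"
      by (intro L2loc_locint L2loc_add L2loc_sum L2loc_mult A h P_cont)
    have int2: "integrable lborel (\<lambda>y. ((\<Sum>j\<in>UNIV. P j y * A j y) + h y) * krc s (x - y))"
      by (rule cv_integrable[OF lG krc_cont krc_bsupp[OF s]])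
    define Z where "Z = (\<Sum>j\<in>UNIV. cv (A j) (krcA s j) x) - cv (\<lambda>y. (\<Sum>j\<in>UNIV. P j y * A j y) + h y) (krc s) x"
    have "Re (cnj c * Z) = 0" for c
    proof -
      \<comment> \<open>The factor exp(\<phi>) is inserted because E exp(\<phi>) = Ei turns
        \<open>b\<close> into \<open>A\<close>; its own derivative contributes the terms with
        \<open>P j\<close>.\<close>
      define F where "F y = c * (complex_of_real (exp (\<phi> y)) * krc s (x - y))" for y
      define F1 where "F1 j y = c * (complex_of_real (exp (\<phi> y)) * (- krcA s j (x - y)) + complex_of_real (exp (\<phi> y)) * P j y * krc s (x - y))" for j y
      define F2 where "F2 j y = c * (complex_of_real (exp (\<phi> y)) * (- cnj (krcA s j (x - y))) + complex_of_real (exp (\<phi> y)) * cnj (P j y) * krc s (x - y))" for j y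
      have F: "C1 F F1 F2" unfolding F_def[abs_def] F1_def[abs_def] F2_def[abs_def]
        by (rule C1_cmult[OF C1_mult[OF W Kr]])
      have bF: "bsupp F"
        by (rule bsupp_comp[OF bsupp_reflect[OF krc_bsupp[OF s], of x]]) (simp add: F_def)
      have LF: "L2 lborel (\<lambda>z. \<chi> j. E z * F2 j z)"
      proof -
        have "bsupp (\<lambda>z. E z * F2 j z)" for j by (rule bsupp_comp[OF C1_bsupp(2)[OF F bF, of j]]) simp
        then show ?thesis by (intro L2_vec L2_cont_bsupp continuous_on_mult E_cont C1_contB[OF F])
      qed
      have i1: "(\<integral>z. b z \<bullet> (\<chi> j. E z * F2 j z) \<partial>lborel) = (\<integral>z. ah z \<bullet> (\<chi> j. E z * F2 j z) \<partial>lborel)"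
        unfolding b_def inner_diff_left
        using L2_integrable_inner[OF ahL LF] L2_integrable_inner[OF v LF] v_orth[OF F LF] by simp
      have "ah z \<bullet> (\<chi> j. E z * F2 j z) = Re (\<Sum>j\<in>UNIV. a j z * cnj (F2 j z))" for z
      proof -
        have "(Ei z * a j z) * cnj (E z * F2 j z) = (Ei z * E z) * (a j z * cnj (F2 j z))" for j
          by (simp add: cnj_E)
        then have "(Ei z * a j z) * cnj (E z * F2 j z) = a j z * cnj (F2 j z)" for j by (simp only: E_Ei mult_1)
        then show ?thesis unfolding ah_def vec_inner_complex vec_lambda_beta by (simp only: Re_sum)
      qed
      moreover have "(\<integral>z. Re (\<Sum>j\<in>UNIV. a j z * cnj (F2 j z)) \<partial>lborel) = - (\<integral>z. Re ((\<Sum>j\<in>UNIV. a1 j j z) * cnj (F z)) \<partial>lborel)"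
      proof -
        have W: "C1 (\<lambda>z. a j z * cnj (F z)) (\<lambda>k z. a j z * cnj (F2 k z) + a1 j k z * cnj (F z)) (\<lambda>k z. a j z * cnj (F1 k z) + a2 j k z * cnj (F z))" for j
          by (rule C1_mult[OF a(1) C1_cnj[OF F]])
        have bW: "bsupp (\<lambda>z. a j z * cnj (F z))" for j by (rule bsupp_comp[OF a(2)[of j]]) simp
        have z0: "(\<integral>z. a j z * cnj (F2 j z) + a1 j j z * cnj (F z) \<partial>lborel) = 0" for j
          by (rule C1_integral_zero(1)[OF W bW])
        have ia: "integrable lborel (\<lambda>z. a j z * cnj (F2 j z))" "integrable lborel (\<lambda>z. a1 j j z * cnj (F z))" for j
        proof -
          show "integrable lborel (\<lambda>z. a j z * cnj (F2 j z))"
            by (rule integrable_bsupp[OF _ bsupp_comp[OF a(2)[of j]]]) (auto intro!: continuous_on_mult continuous_on_cnj ca C1_contB[OF F])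
          show "integrable lborel (\<lambda>z. a1 j j z * cnj (F z))"
            by (rule integrable_bsupp[OF _ bsupp_comp[OF ba[of j j]]]) (auto intro!: continuous_on_mult continuous_on_cnj ca C1_cont[OF F])
        qed
        have e: "(\<integral>z. a j z * cnj (F2 j z) \<partial>lborel) = - (\<integral>z. a1 j j z * cnj (F z) \<partial>lborel)" for j
          using z0[of j] ia[of j] by (simp add: eq_neg_iff_add_eq_0)
        have eS: "(\<integral>z. (\<Sum>j\<in>UNIV. a j z * cnj (F2 j z)) \<partial>lborel) = - (\<integral>z. (\<Sum>j\<in>UNIV. a1 j j z) * cnj (F z) \<partial>lborel)"
          unfolding sum_distrib_right using ia e by (simp add: sum_negf)
        have iS: "integrable lborel (\<lambda>z. \<Sum>j\<in>UNIV. a j z * cnj (F2 j z))" "integrable lborel (\<lambda>z. (\<Sum>j\<in>UNIV. a1 j j z) * cnj (F z))"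
          unfolding sum_distrib_right using ia by simp_all
        show ?thesis unfolding integral_Re[OF iS(1)] integral_Re[OF iS(2)] eS by simp
      qed
      ultimately have R: "(\<integral>z. b z \<bullet> (\<chi> j. E z * F2 j z) \<partial>lborel) = - (\<integral>z. Re ((\<Sum>j\<in>UNIV. a1 j j z) * cnj (F z)) \<partial>lborel)"
        using i1 by simp
      have "b z \<bullet> (\<chi> j. E z * F2 j z) = Re (cnj c * ((\<Sum>j\<in>UNIV. P j z * A j z) * krc s (x - z) - (\<Sum>j\<in>UNIV. A j z * krcA s j (x - z))))" for z
      proof -
        have kc: "cnj (krc s w) = krc s w" for w :: "complex^'n" by (simp add: krc_def)
        have "b z $ j * cnj (E z * F2 j z) = cnj c * (P j z * A j z * krc s (x - z) - A j z * krcA s j (x - z))" for j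
        proof -
          have "b z $ j * cnj (E z * F2 j z) = (E z * Ei z) * (cnj c * (Ei z * b z $ j * (P j z * krc s (x - z) - krcA s j (x - z))))"
            unfolding F2_def WE by (simp add: cnj_E kc algebra_simps)
          then show ?thesis by (simp add: E_Ei A_def algebra_simps)
        qed
        then show ?thesis
          unfolding vec_inner_complex vec_lambda_beta Re_sum[symmetric]
          by (simp only: sum_distrib_left[symmetric] sum_subtractf sum_distrib_right[symmetric])
      qed
      moreover have "Re ((\<Sum>j\<in>UNIV. a1 j j z) * cnj (F z)) = Re (cnj c * (h z * krc s (x - z)))" for z
      proof -
        have kc: "cnj (krc s w) = krc s w" for w :: "complex^'n" by (simp add: krc_def)
        have "(\<Sum>j\<in>UNIV. a1 j j z) * cnj (F z) = cnj c * (h z * krc s (x - z))"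
          unfolding F_def WE h_def sa_def by (simp add: cnj_E kc algebra_simps)
        then show ?thesis by simp
      qed
      ultimately have eq: "(\<integral>z. Re (cnj c * ((\<Sum>j\<in>UNIV. P j z * A j z) * krc s (x - z) - (\<Sum>j\<in>UNIV. A j z * krcA s j (x - z)))) \<partial>lborel)
         = - (\<integral>z. Re (cnj c * (h z * krc s (x - z))) \<partial>lborel)" using R by simp
      have ih: "integrable lborel (\<lambda>z. h z * krc s (x - z))"
        by (rule cv_integrable[OF L2loc_locint[OF h] krc_cont krc_bsupp[OF s]])
      have iP: "integrable lborel (\<lambda>z. (\<Sum>j\<in>UNIV. P j z * A j z) * krc s (x - z))"
        using Bochner_Integration.integrable_diff[OF int2 ih] by (simp add: distrib_right)
      have iK: "integrable lborel (\<lambda>z. \<Sum>j\<in>UNIV. A j z * krcA s j (x - z))" using int1 by simp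
      have Zi: "Z = (\<integral>z. (\<Sum>j\<in>UNIV. A j z * krcA s j (x - z)) \<partial>lborel) - ((\<integral>z. (\<Sum>j\<in>UNIV. P j z * A j z) * krc s (x - z) \<partial>lborel) + (\<integral>z. h z * krc s (x - z) \<partial>lborel))"
        unfolding Z_def cv_def distrib_right using int1 iP ih by simp
      have r1: "(\<integral>z. Re (cnj c * ((\<Sum>j\<in>UNIV. P j z * A j z) * krc s (x - z) - (\<Sum>j\<in>UNIV. A j z * krcA s j (x - z)))) \<partial>lborel)
        = Re (cnj c * ((\<integral>z. (\<Sum>j\<in>UNIV. P j z * A j z) * krc s (x - z) \<partial>lborel) - (\<integral>z. (\<Sum>j\<in>UNIV. A j z * krcA s j (x - z)) \<partial>lborel)))"
        by (subst integral_Re) (use iP iK in \<open>simp_all only: integral_mult_right_zero Bochner_Integration.integral_diff[OF iP iK] integrable_mult_right Bochner_Integration.integrable_diff\<close>)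
      have r2: "(\<integral>z. Re (cnj c * (h z * krc s (x - z))) \<partial>lborel) = Re (cnj c * (\<integral>z. h z * krc s (x - z) \<partial>lborel))"
        by (subst integral_Re) (use ih in \<open>simp_all only: integral_mult_right_zero integrable_mult_right\<close>)
      have "Re (cnj c * Z) = - (Re (cnj c * ((\<integral>z. (\<Sum>j\<in>UNIV. P j z * A j z) * krc s (x - z) \<partial>lborel) - (\<integral>z. (\<Sum>j\<in>UNIV. A j z * krcA s j (x - z)) \<partial>lborel)))
          + Re (cnj c * (\<integral>z. h z * krc s (x - z) \<partial>lborel)))"
        unfolding Zi by (simp add: algebra_simps)
      also have "\<dots> = 0" using eq unfolding r1 r2 by simp
      finally show ?thesis .
    qed
    from Re_scaled_zero[OF this this] show ?thesis by (simp add: Z_def)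
  qed
  \<comment> \<open>The Hessian form of the closed part \<open>b\<close> is integrable, with
    integral bounded by the weighted divergence \<open>sa\<close> of the original test form.\<close>
  define q where "q z = Re (\<Sum>j\<in>UNIV. \<Sum>k\<in>UNIV. H j k z * b z $ j * cnj (b z $ k))" for z
  have q: "integrable lborel q" "integral\<^sup>L lborel q \<le> n2 lborel sa"
  proof -
    have "L2 lborel (\<lambda>z. E z * A j z)" for j unfolding EA by (rule L2_nth[OF bL])
    from apriori[OF Hpos A h closed div this] saL
    show "integrable lborel q" "integral\<^sup>L lborel q \<le> n2 lborel sa"
      unfolding Eh EA q_def[abs_def] by blast+
  qed
  have q0: "q z \<ge> 0" for z unfolding q_def by (rule Hpos)
  have LEv: "L2 lborel (\<lambda>z. \<chi> j. E z * E2 j z)" by (rule L2_vec[OF LE])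
  have "(\<integral>z. (E z * \<eta> z) \<bullet> sa z \<partial>lborel) = - (\<integral>z. ah z \<bullet> (\<chi> j. E z * E2 j z) \<partial>lborel)"
  proof -
    have W: "C1 (\<lambda>z. \<eta> z * cnj (a j z)) (\<lambda>k z. \<eta> z * cnj (a2 j k z) + E1 k z * cnj (a j z)) (\<lambda>k z. \<eta> z * cnj (a1 j k z) + E2 k z * cnj (a j z))" for j
      by (rule C1_mult[OF eta C1_cnj[OF a(1)]])
    have bW: "bsupp (\<lambda>z. \<eta> z * cnj (a j z))" for j by (rule bsupp_comp[OF a(2)[of j]]) simp
    have z0: "(\<integral>z. \<eta> z * cnj (a1 j j z) + E2 j z * cnj (a j z) \<partial>lborel) = 0" for j
      by (rule C1_integral_zero(2)[OF W bW])
    have ia: "integrable lborel (\<lambda>z. \<eta> z * cnj (a1 j j z))" "integrable lborel (\<lambda>z. E2 j z * cnj (a j z))" for j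
    proof -
      show "integrable lborel (\<lambda>z. \<eta> z * cnj (a1 j j z))"
        by (rule integrable_bsupp[OF _ bsupp_comp[OF ba[of j j]]]) (auto intro!: continuous_on_mult continuous_on_cnj ca C1_cont[OF eta])
      show "integrable lborel (\<lambda>z. E2 j z * cnj (a j z))"
        by (rule integrable_bsupp[OF _ bsupp_comp[OF a(2)[of j]]]) (auto intro!: continuous_on_mult continuous_on_cnj ca C1_contB[OF eta])
    qed
    have e: "(\<integral>z. \<eta> z * cnj (a1 j j z) \<partial>lborel) = - (\<integral>z. E2 j z * cnj (a j z) \<partial>lborel)" for j
      using z0[of j] ia[of j] by (simp add: eq_neg_iff_add_eq_0)
    have p1: "(E z * \<eta> z) \<bullet> sa z = (\<Sum>j\<in>UNIV. Re (\<eta> z * cnj (a1 j j z)))" for z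
    proof -
      have "(E z * \<eta> z) * cnj (sa z) = (E z * Ei z) * (\<eta> z * cnj (\<Sum>j\<in>UNIV. a1 j j z))"
        unfolding sa_def by (simp add: cnj_E)
      then show ?thesis unfolding cinner E_Ei by (simp only: cnj_sum sum_distrib_left Re_sum mult_1)
    qed
    have p2: "ah z \<bullet> (\<chi> j. E z * E2 j z) = (\<Sum>j\<in>UNIV. Re (E2 j z * cnj (a j z)))" for z
    proof -
      have "Re ((Ei z * a j z) * cnj (E z * E2 j z)) = Re (E2 j z * cnj (a j z))" for j
      proof -
        have "(Ei z * a j z) * cnj (E z * E2 j z) = (Ei z * E z) * cnj (E2 j z * cnj (a j z))" by (simp add: cnj_E)
        then show ?thesis unfolding E_Ei by (simp only: mult_1 cnj.sel)
      qed
      then show ?thesis unfolding ah_def vec_inner_complex vec_lambda_beta by simp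
    qed
    have "(\<integral>z. (E z * \<eta> z) \<bullet> sa z \<partial>lborel) = (\<Sum>j\<in>UNIV. Re (\<integral>z. \<eta> z * cnj (a1 j j z) \<partial>lborel))"
      unfolding p1 using ia by (simp only: Bochner_Integration.integral_sum integrable_Re integral_Re)
    also have "\<dots> = - (\<Sum>j\<in>UNIV. Re (\<integral>z. E2 j z * cnj (a j z) \<partial>lborel))"
      unfolding e by (simp add: sum_negf)
    also have "(\<Sum>j\<in>UNIV. Re (\<integral>z. E2 j z * cnj (a j z) \<partial>lborel)) = (\<integral>z. ah z \<bullet> (\<chi> j. E z * E2 j z) \<partial>lborel)"
      unfolding p2 using ia by (simp only: Bochner_Integration.integral_sum integrable_Re integral_Re)
    finally show ?thesis .
  qed
  also have "(\<integral>z. ah z \<bullet> (\<chi> j. E z * E2 j z) \<partial>lborel) = (\<integral>z. b z \<bullet> (\<chi> j. E z * E2 j z) \<partial>lborel)"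
    unfolding b_def inner_diff_left
    using L2_integrable_inner[OF ahL LEv] L2_integrable_inner[OF v LEv] v_orth[OF eta LEv] by simp
  finally have main: "\<bar>\<integral>z. (E z * \<eta> z) \<bullet> sa z \<partial>lborel\<bar> = \<bar>\<integral>z. b z \<bullet> (\<chi> j. E z * E2 j z) \<partial>lborel\<bar>" by simp
  define B' where "B' z = exp (- \<phi> z / 2) * Bf z" for z
  have Lq: "L2 lborel (\<lambda>z. sqrt (q z))" and nq: "n2 lborel (\<lambda>z. sqrt (q z)) = integral\<^sup>L lborel q"
    using q0 q(1) by (auto simp: L2_def n2_def)
  have LB': "L2 lborel B'" using LB by (simp add: B'_def[abs_def])
  \<comment> \<open>Pointwise Cauchy-Schwarz for the possibly degenerate Hessian form, in the shape
    provided by \<open>bound\<close>; \<open>sqrt (q z)\<close> is the length of \<open>b\<close> in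
    it.\<close>
  have pt: "\<bar>b z \<bullet> (\<chi> j. E z * E2 j z)\<bar> \<le> B' z \<bullet> sqrt (q z)" for z
  proof -
    have "b z \<bullet> (\<chi> j. E z * E2 j z) = Re (\<Sum>j\<in>UNIV. E2 j z * cnj (b z $ j)) * exp (- \<phi> z / 2)"
    proof -
      have "Re (b z $ j * cnj (E z * E2 j z)) = Re (E2 j z * cnj (b z $ j)) * exp (- \<phi> z / 2)" for j
        by (simp add: E_def times_complex.sel algebra_simps)
      then show ?thesis unfolding vec_inner_complex vec_lambda_beta by (simp only: Re_sum sum_distrib_right)
    qed
    also have "\<bar>\<dots>\<bar> \<le> cmod (\<Sum>j\<in>UNIV. E2 j z * cnj (b z $ j)) * exp (- \<phi> z / 2)"
      unfolding abs_mult abs_exp_cancel by (intro mult_right_mono abs_Re_le_cmod exp_ge_zero)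
    also have "cmod (\<Sum>j\<in>UNIV. E2 j z * cnj (b z $ j)) \<le> Bf z * sqrt (q z)"
    proof -
      have "sqrt ((cmod (\<Sum>j\<in>UNIV. E2 j z * cnj (b z $ j)))\<^sup>2) \<le> sqrt ((Bf z)\<^sup>2 * q z)"
        unfolding q_def by (intro real_sqrt_le_mono bound)
      then show ?thesis using Bf[of z] by (simp add: real_sqrt_mult)
    qed
    finally show ?thesis by (simp add: B'_def mult_right_mono mult_ac)
  qed
  have "\<bar>\<integral>z. b z \<bullet> (\<chi> j. E z * E2 j z) \<partial>lborel\<bar> \<le> (\<integral>z. B' z \<bullet> sqrt (q z) \<partial>lborel)"
    using Bochner_Integration.integral_norm_bound_integral[OF L2_integrable_inner[OF bL LEv] L2_integrable_inner[OF LB' Lq]] pt by simp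
  also have "\<dots> \<le> sqrt (n2 lborel B') * sqrt (n2 lborel (\<lambda>z. sqrt (q z)))"
    using L2_Cauchy_Schwarz_abs[OF LB' Lq] by linarith
  also have "\<dots> \<le> sqrt (n2 lborel B') * sqrt (n2 lborel sa)"
    unfolding nq using q(2) by (intro mult_left_mono real_sqrt_le_mono) auto
  finally show ?thesis unfolding main B'_def[abs_def] .
qed

text \<open>E \<eta> is projected on the closure of the space \<open>S\<close> of weighted
  divergences of test fields. The residual is orthogonal to all divergences, which is weak
  holomorphy of F, and the duality estimate bounds the projection, which equals E (\<eta> - F). The
  Hessian has to dominate the single form dbar \<eta>, with the factor recorded in
  \<open>Bf\<close>.\<close>

theorem hormander:
  assumes Hpos: "\<And>z a. 0 \<le> Re (\<Sum>j\<in>UNIV. \<Sum>k\<in>UNIV. H j k z * a j * cnj (a k))"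
    and eta: "C1 \<eta> E1 E2"
    and bound: "\<And>z a. (cmod (\<Sum>j\<in>UNIV. E2 j z * cnj (a j)))\<^sup>2 \<le> (Bf z)\<^sup>2 * Re (\<Sum>j\<in>UNIV. \<Sum>k\<in>UNIV. H j k z * a j * cnj (a k))"
    and LE: "\<And>j. L2 lborel (\<lambda>z. E z * E2 j z)" and Leta: "L2 lborel (\<lambda>z. E z * \<eta> z)"
    and Bf: "\<And>z. Bf z \<ge> 0" and LB: "L2 lborel (\<lambda>z. exp (- \<phi> z / 2) * Bf z)"
  shows "\<exists>F. weak_hol F \<and> L2loc F \<and> L2 lborel (\<lambda>z. E z * (\<eta> z - F z)) \<and>
    n2 lborel (\<lambda>z. E z * (\<eta> z - F z)) \<le> n2 lborel (\<lambda>z. exp (- \<phi> z / 2) * Bf z)"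
proof -
  define S where "S = {u. \<exists>a a1 a2. (\<forall>j. C1 (a j) (a1 j) (a2 j) \<and> bsupp (a j)) \<and> u = (\<lambda>z. Ei z * (\<Sum>j\<in>UNIV. a1 j j z))}"
  have SE: "\<exists>a a1 a2. (\<forall>j. C1 (a j) (a1 j) (a2 j) \<and> bsupp (a j)) \<and> u = (\<lambda>z. Ei z * (\<Sum>j\<in>UNIV. a1 j j z))" if "u \<in> S" for u
    using that unfolding S_def by (rule CollectD)
  define N where "N = n2 lborel (\<lambda>z. exp (- \<phi> z / 2) * Bf z)"
  have N: "N \<ge> 0" by (simp add: N_def)
  have Sp: "continuous_on UNIV u \<and> L2 lborel u \<and> \<bar>\<integral>z. (E z * \<eta> z) \<bullet> u z \<partial>lborel\<bar> \<le> sqrt N * sqrt (n2 lborel u)" if uS: "u \<in> S" for u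
  proof -
    obtain a a1 a2 where aa: "\<forall>j. C1 (a j) (a1 j) (a2 j) \<and> bsupp (a j)" and u: "u = (\<lambda>z. Ei z * (\<Sum>j\<in>UNIV. a1 j j z))"
      using SE[OF uS] by blast
    note a = aa[rule_format, THEN conjunct1] aa[rule_format, THEN conjunct2]
    have c: "continuous_on UNIV u" unfolding u by (intro continuous_intros Ei_cont C1_contA[OF a(1)])
    have "bsupp (\<lambda>z. \<Sum>j\<in>UNIV. a1 j j z)" by (intro bsupp_sum C1_bsupp(1)[OF a])
    then have b: "bsupp u" unfolding u by (rule bsupp_comp) simp
    show ?thesis
      using c L2_cont_bsupp[OF c b] dual_estimate[where a=a and ?a1.0=a1 and ?a2.0=a2, OF Hpos eta bound LE Bf LB a] unfolding u N_def by blast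
  qed
  have "\<exists>v s. L2 lborel v \<and> (\<forall>n. s n \<in> S) \<and> (\<lambda>n. n2 lborel (\<lambda>x. s n x - v x)) \<longlonglongrightarrow> 0 \<and>
           (\<forall>t\<in>S. (\<integral>x. (E x * \<eta> x - v x) \<bullet> t x \<partial>lborel) = 0)"
  proof (rule L2_projection[OF Leta])
    show "L2 lborel u" if "u \<in> S" for u using Sp[OF that] by blast
    show "(\<lambda>x. 0) \<in> S"
      unfolding S_def using C1_const[of 0]
      by (intro CollectI exI[of _ "\<lambda>j z. 0"] exI[of _ "\<lambda>j k z. 0"]) (auto simp: fun_eq_iff)
    show "(\<lambda>x. u x + v x) \<in> S" if uS: "u \<in> S" and vS: "v \<in> S" for u v
    proof -
      obtain a a1 a2 where aa: "\<forall>j. C1 (a j) (a1 j) (a2 j) \<and> bsupp (a j)" and u: "u = (\<lambda>z. Ei z * (\<Sum>j\<in>UNIV. a1 j j z))"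
        using SE[OF uS] by blast
      note a = aa[rule_format, THEN conjunct1] aa[rule_format, THEN conjunct2]
      obtain b b1 b2 where bb: "\<forall>j. C1 (b j) (b1 j) (b2 j) \<and> bsupp (b j)" and v: "v = (\<lambda>z. Ei z * (\<Sum>j\<in>UNIV. b1 j j z))"
        using SE[OF vS] by blast
      note b = bb[rule_format, THEN conjunct1] bb[rule_format, THEN conjunct2]
      have "\<forall>j. C1 (\<lambda>z. a j z + b j z) (\<lambda>k z. a1 j k z + b1 j k z) (\<lambda>k z. a2 j k z + b2 j k z) \<and> bsupp (\<lambda>z. a j z + b j z)"
        using C1_add[OF a(1) b(1)] bsupp_add[OF a(2) b(2)] by blast
      moreover have "(\<lambda>x. u x + v x) = (\<lambda>z. Ei z * (\<Sum>j\<in>UNIV. a1 j j z + b1 j j z))"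
        unfolding u v by (simp add: sum.distrib distrib_left)
      ultimately show ?thesis unfolding S_def
        by (intro CollectI exI[of _ "\<lambda>j z. a j z + b j z"] exI[of _ "\<lambda>j k z. a1 j k z + b1 j k z"] exI[of _ "\<lambda>j k z. a2 j k z + b2 j k z"] conjI)
    qed
    show "(\<lambda>x. c *\<^sub>R u x) \<in> S" if uS: "u \<in> S" for u c
    proof -
      obtain a a1 a2 where aa: "\<forall>j. C1 (a j) (a1 j) (a2 j) \<and> bsupp (a j)" and u: "u = (\<lambda>z. Ei z * (\<Sum>j\<in>UNIV. a1 j j z))"
        using SE[OF uS] by blast
      note a = aa[rule_format, THEN conjunct1] aa[rule_format, THEN conjunct2]
      define cc where "cc = complex_of_real c"
      have "bsupp (\<lambda>z. cc * a j z)" for j by (rule bsupp_comp[OF a(2)[of j]]) simp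
      then have "\<forall>j. C1 (\<lambda>z. cc * a j z) (\<lambda>k z. cc * a1 j k z) (\<lambda>k z. cc * a2 j k z) \<and> bsupp (\<lambda>z. cc * a j z)"
        using C1_cmult[OF a(1)] by blast
      moreover have "(\<lambda>x. c *\<^sub>R u x) = (\<lambda>z. Ei z * (\<Sum>j\<in>UNIV. cc * a1 j j z))"
        unfolding u by (simp add: cc_def scaleR_conv_of_real sum_distrib_left[symmetric] mult_ac)
      ultimately show ?thesis unfolding S_def
        by (intro CollectI exI[of _ "\<lambda>j z. cc * a j z"] exI[of _ "\<lambda>j k z. cc * a1 j k z"] exI[of _ "\<lambda>j k z. cc * a2 j k z"] conjI)
    qed
  qed
  then obtain V s where V: "L2 lborel V" and s: "\<And>n. s n \<in> S" and sV: "(\<lambda>n. n2 lborel (\<lambda>x. s n x - V x)) \<longlonglongrightarrow> 0"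
    and orth: "\<And>t. t \<in> S \<Longrightarrow> (\<integral>x. (E x * \<eta> x - V x) \<bullet> t x \<partial>lborel) = 0"
    by blast
  have sL: "L2 lborel (s n)" and sc: "continuous_on UNIV (s n)" and sb: "\<bar>\<integral>z. (E z * \<eta> z) \<bullet> s n z \<partial>lborel\<bar> \<le> sqrt N * sqrt (n2 lborel (s n))" for n
    using Sp[OF s[of n]] by blast+
  \<comment> \<open>The estimate holds for members of \<open>S\<close> and passes to their limit:
    |V|^2 = <E \<eta>, V> <= sqrt N |V|, and one factor |V| is divided out.\<close>
  have VN: "n2 lborel V \<le> N"
  proof -
    have "(\<integral>z. (E z * \<eta> z) \<bullet> s n z \<partial>lborel) = (\<integral>z. V z \<bullet> s n z \<partial>lborel)" for n
      using orth[OF s[of n]] L2_integrable_inner[OF Leta sL[of n]] L2_integrable_inner[OF V sL[of n]]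
      by (simp add: inner_diff_left)
    then have le: "(\<integral>z. V z \<bullet> s n z \<partial>lborel) \<le> sqrt N * sqrt (n2 lborel (s n))" for n
      using sb[of n] by simp
    have l1: "(\<lambda>n. \<integral>z. V z \<bullet> s n z \<partial>lborel) \<longlonglongrightarrow> (\<integral>z. V z \<bullet> V z \<partial>lborel)"
      by (rule inner_tendsto_L2[OF V sL V V _ sV]) (simp add: n2_def)
    have l2: "(\<lambda>n. sqrt N * sqrt (n2 lborel (s n))) \<longlonglongrightarrow> sqrt N * sqrt (n2 lborel V)"
      by (intro tendsto_mult tendsto_const tendsto_real_sqrt n2_tendsto[OF sL V sV])
    have "(\<integral>z. V z \<bullet> V z \<partial>lborel) \<le> sqrt N * sqrt (n2 lborel V)"
      by (rule LIMSEQ_le[OF l1 l2]) (use le in blast)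
    then have "n2 lborel V \<le> sqrt N * sqrt (n2 lborel V)" by (simp add: n2_def power2_norm_eq_inner)
    moreover have "n2 lborel V = sqrt (n2 lborel V) * sqrt (n2 lborel V)" by simp
    ultimately have "sqrt (n2 lborel V) * sqrt (n2 lborel V) \<le> sqrt N * sqrt (n2 lborel V)" by linarith
    then have sq: "sqrt (n2 lborel V) * sqrt (n2 lborel V) \<le> sqrt N * sqrt (n2 lborel V)" .
    show ?thesis
    proof (cases "n2 lborel V = 0")
      case False
      then have "sqrt (n2 lborel V) > 0" using n2_nonneg[of lborel V] by (simp add: less_le)
      from mult_right_le_imp_le[OF sq this] show ?thesis by simp
    qed (simp add: N)
  qed
  define F where "F z = \<eta> z - Ei z * V z" for z
  have EF: "E z * (\<eta> z - F z) = V z" for z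
    by (simp add: F_def E_Ei mult.assoc[symmetric])
  have FL: "L2loc F"
  proof -
    have "L2loc V" by (rule L2loc_L2_limit[OF sc sL V sV])
    from L2loc_add[OF L2loc_cont[OF C1_cont[OF eta]] L2loc_mult[OF this, of "\<lambda>z. - Ei z"]]
    show ?thesis unfolding F_def[abs_def] using Ei_cont by (auto intro: continuous_on_minus)
  qed
  have "weak_hol F"
    unfolding weak_hol_def
  proof (intro conjI allI impI)
    show lF: "locint F" by (rule L2loc_locint[OF FL])
    fix k :: "complex^'n \<Rightarrow> complex" and A B j assume k: "C1 k A B" "bsupp k"
    have iB: "integrable lborel (\<lambda>y. F y * B j y)"
    proof -
      have cB: "continuous_on UNIV (\<lambda>z. B j (- z))" by (rule continuous_on_compose2[OF C1_contB[OF k(1)]]) (auto intro: continuous_intros)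
      have bB: "bsupp (\<lambda>z. B j (- z))" using bsupp_reflect[OF C1_bsupp(2)[OF k, of j], of 0] by simp
      from cv_integrable[OF lF cB bB, of 0] show ?thesis by simp
    qed
    have "Re (cnj c * (\<integral>y. F y * B j y \<partial>lborel)) = 0" for c
    proof -
      define t where "t z = Ei z * (c * cnj (B j z))" for z
      have "t \<in> S"
      proof -
        \<comment> \<open>A test field with the single nonzero component c conj(k) at index
          \<open>j\<close>; its divergence is c conj(B j), so orthogonality to it tests F against
          \<open>B j\<close>.\<close>
        define a where "a i z = (if i = j then c * cnj (k z) else 0)" for i z
        define a1 where "a1 i l z = (if i = j then c * cnj (B l z) else 0)" for i l z
        define a2 where "a2 i l z = (if i = j then c * cnj (A l z) else 0)" for i l z
        have "C1 (a i) (a1 i) (a2 i) \<and> bsupp (a i)" for i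
        proof (cases "i = j")
          case True
          have "bsupp (\<lambda>z. c * cnj (k z))" by (rule bsupp_comp[OF k(2)]) simp
          then show ?thesis unfolding a_def[abs_def] a1_def[abs_def] a2_def[abs_def] using C1_cmult[OF C1_cnj[OF k(1)], of c] True by simp
        next
          case False
          then show ?thesis unfolding a_def[abs_def] a1_def[abs_def] a2_def[abs_def] using C1_const[of 0] by simp
        qed
        moreover have "t = (\<lambda>z. Ei z * (\<Sum>i\<in>UNIV. a1 i i z))"
          unfolding t_def[abs_def] a1_def by simp
        ultimately show ?thesis unfolding S_def by blast
      qed
      from orth[OF this] have "(\<integral>x. (E x * \<eta> x - V x) \<bullet> t x \<partial>lborel) = 0" .
      moreover have "(E x * \<eta> x - V x) \<bullet> t x = Re (cnj c * (F x * B j x))" for x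
      proof -
        have "(E x * \<eta> x - V x) * cnj (t x) = cnj c * ((Ei x * E x * \<eta> x - Ei x * V x) * B j x)"
          unfolding t_def by (simp add: cnj_E algebra_simps)
        then show ?thesis unfolding cinner F_def by (simp add: E_Ei)
      qed
      ultimately have "(\<integral>x. Re (cnj c * (F x * B j x)) \<partial>lborel) = 0" by simp
      then show ?thesis using integral_Re[OF integrable_mult_right[OF iB, of "cnj c"]] by simp
    qed
    from Re_scaled_zero[OF this this] show "(\<integral>y. F y * B j y \<partial>lborel) = 0" .
  qed
  then show ?thesis using FL V VN by (intro exI[of _ F]) (simp add: EF N_def)
qed

end

declare times_complex.sel [simp]

section \<open>Weights built from polynomials\<close>

text \<open>Summation over unit shells: the ball of radius m + 1 has volume at most a constant times
  e^(d m), and the rate d + 1 leaves the geometric series of e^(-m).\<close>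

lemma integrable_exp_norm:
  "integrable lborel (\<lambda>z::'a::euclidean_space. exp (- (real DIM('a) + 1) * norm z))"
proof -
  define d where "d = DIM('a)"
  define V where "V = unit_ball_vol (real d)"
  have V: "V \<ge> 0" by (simp add: V_def)
  define c where "c m = exp (- (real d + 1) * real m)" for m
  have pt: "ennreal (exp (- (real d + 1) * norm z)) \<le> (\<Sum>m. ennreal (c m) * indicator (ball 0 (real m + 1)) z)" for z :: 'a
  proof -
    define m where "m = nat \<lfloor>norm z\<rfloor>"
    have "real m = of_int \<lfloor>norm z\<rfloor>" unfolding m_def by simp
    then have m: "real m \<le> norm z" "norm z < real m + 1" by linarith+
    have "exp (- (real d + 1) * norm z) \<le> c m" unfolding c_def using m by (simp add: mult_left_mono)
    then have "ennreal (exp (- (real d + 1) * norm z)) \<le> ennreal (c m) * indicator (ball 0 (real m + 1)) z"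
      using m by (simp add: ennreal_leI)
    also have "\<dots> = sum (\<lambda>i. ennreal (c i) * indicator (ball 0 (real i + 1)) z) {m}"
      by (simp only: sum.insert[OF finite.emptyI] sum.empty empty_iff not_False_eq_True add_0_right)
    also have "\<dots> \<le> (\<Sum>i. ennreal (c i) * indicator (ball 0 (real i + 1)) z)"
      by (rule sum_le_suminf) auto
    finally show ?thesis .
  qed
  have "(\<integral>\<^sup>+z. ennreal (exp (- (real d + 1) * norm (z::'a))) \<partial>lborel) \<le> (\<integral>\<^sup>+z. (\<Sum>m. ennreal (c m) * indicator (ball (0::'a) (real m + 1)) z) \<partial>lborel)"
    by (rule nn_integral_mono) (rule pt)
  also have "\<dots> = (\<Sum>m. \<integral>\<^sup>+z. ennreal (c m) * indicator (ball (0::'a) (real m + 1)) z \<partial>lborel)"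
    by (rule nn_integral_suminf) (intro borel_measurable_times_ennreal borel_measurable_const borel_measurable_indicator; simp)
  also have "\<dots> \<le> (\<Sum>m. ennreal (V * exp (-1) ^ m))"
  proof (rule suminf_le)
    fix m
    have "(\<integral>\<^sup>+z. ennreal (c m) * indicator (ball (0::'a) (real m + 1)) z \<partial>lborel) = ennreal (c m) * ennreal (V * (real m + 1) ^ d)"
      by (subst nn_integral_cmult_indicator) (simp_all add: emeasure_ball V_def d_def)
    also have "\<dots> = ennreal (c m * (V * (real m + 1) ^ d))"
      using V by (simp add: ennreal_mult c_def)
    also have "\<dots> \<le> ennreal (V * exp (-1) ^ m)"
    proof (rule ennreal_leI)
      have "(real m + 1) ^ d \<le> exp (real m) ^ d"
        by (intro power_mono) (use exp_ge_add_one_self[of "real m"] in linarith)+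
      also have "\<dots> = exp (real d * real m)" by (simp add: exp_of_nat_mult)
      finally have "c m * (V * (real m + 1) ^ d) \<le> c m * (V * exp (real d * real m))"
        using V by (intro mult_left_mono) (auto simp: c_def)
      also have "\<dots> = V * (c m * exp (real d * real m))" by simp
      also have "c m * exp (real d * real m) = exp (real m * (-1))"
        unfolding c_def exp_add[symmetric] by (simp add: algebra_simps)
      also have "\<dots> = exp (-1) ^ m" by (simp add: exp_of_nat_mult[symmetric])
      finally show "c m * (V * (real m + 1) ^ d) \<le> V * exp (-1) ^ m" .
    qed
    finally show "(\<integral>\<^sup>+z. ennreal (c m) * indicator (ball (0::'a) (real m + 1)) z \<partial>lborel) \<le> ennreal (V * exp (-1) ^ m)" .
  qed auto
  also have "\<dots> = ennreal (\<Sum>m. V * exp (-1) ^ m)"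
    using V by (intro suminf_ennreal2 summable_mult summable_geometric) auto
  also have "\<dots> < \<infinity>" by simp
  finally have "(\<integral>\<^sup>+z. ennreal (exp (- (real d + 1) * norm (z::'a))) \<partial>lborel) < \<infinity>" .
  moreover have "(\<lambda>z::'a. exp (- (real d + 1) * norm z)) \<in> borel_measurable lborel"
    by (intro borel_measurable_lborel_cont continuous_intros)
  ultimately show ?thesis unfolding d_def[symmetric] by (intro integrableI_bounded) auto
qed

text \<open>(1 + t)^k <= e^(k t), and completing the square trades the Gaussian for e^(-l t), with
  \<open>l\<close> the exponential rate already known to be integrable.\<close>

lemma integrable_gauss_poly:
  assumes b: "b > 0"
  shows "integrable lborel (\<lambda>z::'a::euclidean_space. (1 + norm z) ^ k * exp (- b * (norm z)\<^sup>2))"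
proof -
  define l where "l = real DIM('a) + 1"
  define K where "K = exp ((real k + l)\<^sup>2 / (4 * b))"
  show ?thesis
  proof (rule Bochner_Integration.integrable_bound)
    show "integrable lborel (\<lambda>z::'a. K * exp (- l * norm z))"
      using integrable_exp_norm[where 'a='a] by (simp add: l_def)
    show "(\<lambda>z::'a. (1 + norm z) ^ k * exp (- b * (norm z)\<^sup>2)) \<in> borel_measurable lborel"
      by (intro borel_measurable_lborel_cont continuous_intros)
    have "norm ((1 + norm z) ^ k * exp (- b * (norm z)\<^sup>2)) \<le> norm (K * exp (- l * norm z))" for z :: 'a
    proof -
      define t where "t = norm z"
      have t: "t \<ge> 0" by (simp add: t_def)
      have "(1 + t) ^ k \<le> exp t ^ k" using t exp_ge_add_one_self[of t] by (intro power_mono) auto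
      then have "(1 + t) ^ k * exp (- b * t\<^sup>2) \<le> exp (real k * t) * exp (- b * t\<^sup>2)"
        by (intro mult_right_mono) (auto simp: exp_of_nat_mult)
      also have "\<dots> = exp (real k * t - b * t\<^sup>2)" by (simp add: exp_add[symmetric])
      also have "\<dots> \<le> exp ((real k + l)\<^sup>2 / (4 * b) - l * t)"
      proof -
        have "0 \<le> (2 * b * t - (real k + l))\<^sup>2" by simp
        then have "4 * b * ((real k + l) * t - b * t\<^sup>2) \<le> (real k + l)\<^sup>2" by (simp add: power2_eq_square algebra_simps)
        then have "(real k + l) * t - b * t\<^sup>2 \<le> (real k + l)\<^sup>2 / (4 * b)" using b by (simp add: field_simps)
        then show ?thesis by (simp add: algebra_simps)
      qed
      also have "\<dots> = K * exp (- l * t)" by (simp add: K_def exp_add[symmetric])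
      finally have "(1 + t) ^ k * exp (- b * t\<^sup>2) \<le> K * exp (- l * t)" .
      moreover have "(1 + t) ^ k * exp (- b * t\<^sup>2) \<ge> 0" using t by simp
      moreover have "K * exp (- l * t) \<ge> 0" by (simp add: K_def)
      ultimately show ?thesis unfolding t_def[symmetric] by (simp only: real_norm_def abs_of_nonneg)
    qed
    then show "AE z in lborel. norm ((1 + norm z) ^ k * exp (- b * (norm z)\<^sup>2)) \<le> norm (K * exp (- l * norm (z::'a)))" by (rule AE_I2)
  qed
qed

section \<open>Polynomials and polynomial growth\<close>

inductive cpoly :: "(complex^'n \<Rightarrow> complex) \<Rightarrow> bool" where
  cpoly_const: "cpoly (\<lambda>z. c)"
| cpoly_coord: "cpoly (\<lambda>z. z $ i)"
| cpoly_add: "cpoly p \<Longrightarrow> cpoly q \<Longrightarrow> cpoly (\<lambda>z. p z + q z)"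
| cpoly_mult: "cpoly p \<Longrightarrow> cpoly q \<Longrightarrow> cpoly (\<lambda>z. p z * q z)"

text \<open>At most polynomial growth, the class that the Gaussian decay of the weights makes square
  integrable.\<close>

definition tempered :: "(complex^'n \<Rightarrow> complex) \<Rightarrow> bool" where
  "tempered f \<longleftrightarrow> (\<exists>C D. C \<ge> 0 \<and> (\<forall>z. cmod (f z) \<le> C * (1 + norm z) ^ D))"

lemma tempered_mult: "tempered f \<Longrightarrow> tempered g \<Longrightarrow> tempered (\<lambda>z. f z * g z)"
proof -
  assume "tempered f" "tempered g"
  then obtain C D C' D' where f: "C \<ge> 0" "\<And>z. cmod (f z) \<le> C * (1 + norm z) ^ D" and g: "C' \<ge> 0" "\<And>z. cmod (g z) \<le> C' * (1 + norm z) ^ D'"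
    unfolding tempered_def by blast
  have "cmod (f z * g z) \<le> (C * C') * (1 + norm z) ^ (D + D')" for z
  proof -
    have "cmod (f z) * cmod (g z) \<le> (C * (1 + norm z) ^ D) * (C' * (1 + norm z) ^ D')"
      using f g by (intro mult_mono) auto
    then show ?thesis by (simp add: norm_mult power_add mult_ac)
  qed
  then show ?thesis unfolding tempered_def using f g by (intro exI[of _ "C * C'"] exI[of _ "D + D'"]) auto
qed

lemma tempered_bound: "tempered f \<Longrightarrow> (\<And>z. cmod (g z) \<le> cmod (f z)) \<Longrightarrow> tempered g"
  unfolding tempered_def by (meson order_trans)

lemma tempered_const: "tempered (\<lambda>z. c)"
  unfolding tempered_def by (intro exI[of _ "cmod c"] exI[of _ 0]) auto

lemma tempered_add: "tempered f \<Longrightarrow> tempered g \<Longrightarrow> tempered (\<lambda>z. f z + g z)"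
proof -
  assume "tempered f" "tempered g"
  then obtain C D C' D' where f: "C \<ge> 0" "\<And>z. cmod (f z) \<le> C * (1 + norm z) ^ D" and g: "C' \<ge> 0" "\<And>z. cmod (g z) \<le> C' * (1 + norm z) ^ D'"
    unfolding tempered_def by blast
  have "cmod (f z + g z) \<le> (C + C') * (1 + norm z) ^ max D D'" for z
  proof -
    have "C * (1 + norm z) ^ D \<le> C * (1 + norm z) ^ max D D'" "C' * (1 + norm z) ^ D' \<le> C' * (1 + norm z) ^ max D D'"
      using f g by (auto intro!: mult_left_mono power_increasing)
    then show ?thesis using norm_triangle_ineq[of "f z" "g z"] f(2)[of z] g(2)[of z] by (simp add: distrib_right)
  qed
  then show ?thesis unfolding tempered_def using f g by (intro exI[of _ "C + C'"] exI[of _ "max D D'"]) auto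
qed

lemma tempered_sum: "(\<And>i. i \<in> I \<Longrightarrow> tempered (f i)) \<Longrightarrow> tempered (\<lambda>z. \<Sum>i\<in>I. f i z)"
proof (induction I rule: infinite_finite_induct)
  case (insert i I)
  then show ?case by (simp add: tempered_add)
qed (simp_all add: tempered_const)

lemma tempered_cpoly: "cpoly p \<Longrightarrow> tempered p"
proof (induction rule: cpoly.induct)
  case (cpoly_coord i)
  have "cmod (z $ i) \<le> 1 * (1 + norm z) ^ 1" for z
    using Finite_Cartesian_Product.norm_nth_le[of z i] by simp
  then show ?case unfolding tempered_def by (intro exI[of _ 1]) auto
qed (auto intro: tempered_const tempered_add tempered_mult)

text \<open>That the first derivatives are polynomials again is recorded because they enter dbar of
  the cut-off, whose growth must be controlled.\<close>

lemma cpoly_hol2: "cpoly p \<Longrightarrow> \<exists>p1 p2. hol2 p p1 p2 \<and> (\<forall>j. cpoly (p1 j))"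
proof (induction rule: cpoly.induct)
  case (cpoly_const c)
  have "hol2 (\<lambda>z. c) (\<lambda>j z. 0) (\<lambda>j k z. 0)" unfolding hol2_def by (auto intro: C1_const)
  then show ?case using cpoly.cpoly_const[of 0] by (intro exI[of _ "\<lambda>j z. 0"] exI conjI) auto
next
  case (cpoly_coord i)
  have "cpoly (\<lambda>z. if j = i then 1 else 0)" for j by (rule cpoly.cpoly_const)
  then show ?case using hol2_coord[of i] by blast
next
  case (cpoly_add p q)
  then obtain p1 p2 q1 q2 where p: "hol2 p p1 p2" "\<And>j. cpoly (p1 j)" and q: "hol2 q q1 q2" "\<And>j. cpoly (q1 j)" by blast
  have "hol2 (\<lambda>z. p z + q z) (\<lambda>j z. p1 j z + q1 j z) (\<lambda>j k z. p2 j k z + q2 j k z)"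
    unfolding hol2_def
  proof (intro conjI allI)
    show "C1 (\<lambda>z. p z + q z) (\<lambda>j z. p1 j z + q1 j z) (\<lambda>j z. 0)"
      using C1_add[of p p1 "\<lambda>j z. 0" q q1 "\<lambda>j z. 0"] p(1) q(1) unfolding hol2_def by simp
    show "C1 (\<lambda>z. p1 j z + q1 j z) (\<lambda>k z. p2 j k z + q2 j k z) (\<lambda>k z. 0)" for j
      using C1_add[of "p1 j" "p2 j" "\<lambda>j z. 0" "q1 j" "q2 j" "\<lambda>j z. 0"] p(1) q(1) unfolding hol2_def by simp
    show "p2 j k z + q2 j k z = p2 k j z + q2 k j z" for j k z
      using p(1) q(1) unfolding hol2_def by metis
  qed
  moreover have "cpoly (\<lambda>z. p1 j z + q1 j z)" for j by (rule cpoly.cpoly_add[OF p(2) q(2)])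
  ultimately show ?case by blast
next
  case (cpoly_mult p q)
  then obtain p1 p2 q1 q2 where p: "hol2 p p1 p2" "\<And>j. cpoly (p1 j)" and q: "hol2 q q1 q2" "\<And>j. cpoly (q1 j)" by blast
  have P: "C1 p p1 (\<lambda>j z. 0)" "\<And>j. C1 (p1 j) (p2 j) (\<lambda>k z. 0)" "\<And>j k z. p2 j k z = p2 k j z"
    and Q: "C1 q q1 (\<lambda>j z. 0)" "\<And>j. C1 (q1 j) (q2 j) (\<lambda>k z. 0)" "\<And>j k z. q2 j k z = q2 k j z"
    using p(1) q(1) unfolding hol2_def by blast+
  have "hol2 (\<lambda>z. p z * q z) (\<lambda>j z. p z * q1 j z + p1 j z * q z) (\<lambda>j k z. (p z * q2 j k z + p1 k z * q1 j z) + (p1 j z * q1 k z + p2 j k z * q z))"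
    unfolding hol2_def
  proof (intro conjI allI)
    show "C1 (\<lambda>z. p z * q z) (\<lambda>j z. p z * q1 j z + p1 j z * q z) (\<lambda>j z. 0)"
      using C1_mult[OF P(1) Q(1)] by simp
    show "C1 (\<lambda>z. p z * q1 j z + p1 j z * q z) (\<lambda>k z. (p z * q2 j k z + p1 k z * q1 j z) + (p1 j z * q1 k z + p2 j k z * q z)) (\<lambda>k z. 0)" for j
      using C1_add[OF C1_mult[OF P(1) Q(2)] C1_mult[OF P(2) Q(1)], of j j] by simp
    show "(p z * q2 j k z + p1 k z * q1 j z) + (p1 j z * q1 k z + p2 j k z * q z)
        = (p z * q2 k j z + p1 j z * q1 k z) + (p1 k z * q1 j z + p2 k j z * q z)" for j k z
      using P(3)[of j k z] Q(3)[of j k z] by simp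
  qed
  moreover have "cpoly (\<lambda>z. p z * q1 j z + p1 j z * q z)" for j
    by (intro cpoly.cpoly_add cpoly.cpoly_mult p(2) q(2) cpoly_mult(1,2))
  ultimately show ?case by blast
qed

text \<open>The function x = sum |q_l|^2 with its derivatives: \<open>sqA\<close> is dx/dz_j,
  \<open>sqAA\<close> its derivative in z_k, \<open>sqAB\<close> the complex Hessian, and
  \<open>lev\<close> the Levi form on the vector \<open>a\<close>.\<close>

definition sqn :: "('l::finite \<Rightarrow> complex^'n \<Rightarrow> complex) \<Rightarrow> complex^'n \<Rightarrow> real" where
  "sqn q z = (\<Sum>l\<in>UNIV. (cmod (q l z))\<^sup>2)"
definition sqA :: "('l::finite \<Rightarrow> complex^'n \<Rightarrow> complex) \<Rightarrow> ('l \<Rightarrow> 'n \<Rightarrow> complex^'n \<Rightarrow> complex) \<Rightarrow> 'n \<Rightarrow> complex^'n \<Rightarrow> complex" where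
  "sqA q q1 j z = (\<Sum>l\<in>UNIV. cnj (q l z) * q1 l j z)"
definition sqAA :: "('l::finite \<Rightarrow> complex^'n \<Rightarrow> complex) \<Rightarrow> ('l \<Rightarrow> 'n \<Rightarrow> 'n \<Rightarrow> complex^'n \<Rightarrow> complex) \<Rightarrow> 'n \<Rightarrow> 'n \<Rightarrow> complex^'n \<Rightarrow> complex" where
  "sqAA q q2 j k z = (\<Sum>l\<in>UNIV. cnj (q l z) * q2 l j k z)"
definition sqAB :: "('l::finite \<Rightarrow> 'n \<Rightarrow> complex^'n \<Rightarrow> complex) \<Rightarrow> 'n \<Rightarrow> 'n \<Rightarrow> complex^'n \<Rightarrow> complex" where
  "sqAB q1 j k z = (\<Sum>l\<in>UNIV. cnj (q1 l k z) * q1 l j z)"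
definition lev :: "('l::finite \<Rightarrow> 'n \<Rightarrow> complex^'n \<Rightarrow> complex) \<Rightarrow> complex^'n \<Rightarrow> ('n \<Rightarrow> complex) \<Rightarrow> real" where
  "lev q1 z a = Re (\<Sum>j\<in>UNIV. \<Sum>k\<in>UNIV. sqAB q1 j k z * a j * cnj (a k))"

context
  fixes q :: "'l::finite \<Rightarrow> complex^'n \<Rightarrow> complex" and q1 q2
  assumes q: "\<And>l. hol2 (q l) (q1 l) (q2 l)"
begin

lemma sqn_C2R: "C2R (sqn q) (sqA q q1) (sqAA q q2) (sqAB q1)"
  unfolding sqn_def[abs_def] sqA_def[abs_def] sqAA_def[abs_def] sqAB_def[abs_def]
  by (rule C2R_sum[OF C2R_cmod_sq[OF q]])

lemma sqn_nonneg: "sqn q z \<ge> 0"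
  unfolding sqn_def by (intro sum_nonneg) simp

lemma lev_eq: "lev q1 z a = (\<Sum>l\<in>UNIV. (cmod (\<Sum>j\<in>UNIV. q1 l j z * a j))\<^sup>2)"
proof -
  have "(\<Sum>j\<in>UNIV. \<Sum>k\<in>UNIV. sqAB q1 j k z * a j * cnj (a k)) = (\<Sum>j\<in>UNIV. \<Sum>k\<in>UNIV. \<Sum>l\<in>UNIV. (q1 l j z * a j) * cnj (q1 l k z * a k))"
    unfolding sqAB_def by (simp add: sum_distrib_left sum_distrib_right mult_ac)
  also have "\<dots> = (\<Sum>j\<in>UNIV. \<Sum>l\<in>UNIV. \<Sum>k\<in>UNIV. (q1 l j z * a j) * cnj (q1 l k z * a k))"
    by (rule sum.cong[OF refl], rule sum.swap)
  also have "\<dots> = (\<Sum>l\<in>UNIV. \<Sum>j\<in>UNIV. \<Sum>k\<in>UNIV. (q1 l j z * a j) * cnj (q1 l k z * a k))"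
    by (rule sum.swap)
  also have "\<dots> = (\<Sum>l\<in>UNIV. complex_of_real ((cmod (\<Sum>j\<in>UNIV. q1 l j z * a j))\<^sup>2))"
    unfolding complex_norm_square cnj_sum sum_product ..
  finally show ?thesis unfolding lev_def by simp
qed

lemma lev_nonneg: "lev q1 z a \<ge> 0"
  unfolding lev_eq by (intro sum_nonneg) simp

text \<open>Cauchy-Schwarz over the index \<open>l\<close>. It is plurisubharmonicity of log x,
  multiplied out so as to make sense at zeros of x.\<close>

lemma sqA_lev: "(cmod (\<Sum>j\<in>UNIV. sqA q q1 j z * a j))\<^sup>2 \<le> sqn q z * lev q1 z a"
proof -
  define d where "d l = (\<Sum>j\<in>UNIV. q1 l j z * a j)" for l
  have "(\<Sum>j\<in>UNIV. sqA q q1 j z * a j) = (\<Sum>j\<in>UNIV. \<Sum>l\<in>UNIV. cnj (q l z) * (q1 l j z * a j))"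
    unfolding sqA_def by (simp add: sum_distrib_left sum_distrib_right mult_ac)
  also have "\<dots> = (\<Sum>l\<in>UNIV. cnj (q l z) * d l)"
    unfolding d_def sum_distrib_left by (rule sum.swap)
  finally have "cmod (\<Sum>j\<in>UNIV. sqA q q1 j z * a j) \<le> (\<Sum>l\<in>UNIV. cmod (q l z) * cmod (d l))"
    using norm_sum[of "\<lambda>l. cnj (q l z) * d l" UNIV] by (simp add: norm_mult)
  then have "(cmod (\<Sum>j\<in>UNIV. sqA q q1 j z * a j))\<^sup>2 \<le> (\<Sum>l\<in>UNIV. cmod (q l z) * cmod (d l))\<^sup>2"
    by (intro power_mono) auto
  also have "\<dots> \<le> (\<Sum>l\<in>UNIV. (cmod (q l z))\<^sup>2) * (\<Sum>l\<in>UNIV. (cmod (d l))\<^sup>2)"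
    by (rule Cauchy_Schwarz_ineq_sum)
  finally show ?thesis unfolding sqn_def lev_eq d_def .
qed

text \<open>The Hessian of g(x) is g' times the Levi form plus g'' |dx|^2, and the Levi form is at
  least |dx|^2 / (x + c). The resulting coefficient g'' + g' / (x + c) is zero for log (x + c) and
  a^2 (x + c)^(a - 2) for (x + c)^a.\<close>

lemma hessian_comp_ge:
  fixes g1 g2 :: real
  assumes c: "c > 0" and g1: "g1 \<ge> 0"
  shows "(g2 + g1 / (sqn q z + c)) * (cmod (\<Sum>j\<in>UNIV. sqA q q1 j z * a j))\<^sup>2
     \<le> Re (\<Sum>j\<in>UNIV. \<Sum>k\<in>UNIV. (complex_of_real g1 * sqAB q1 j k z + complex_of_real g2 * cnj (sqA q q1 k z) * sqA q q1 j z) * a j * cnj (a k))"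
proof -
  define S where "S = (cmod (\<Sum>j\<in>UNIV. sqA q q1 j z * a j))\<^sup>2"
  have "complex_of_real S = (\<Sum>j\<in>UNIV. \<Sum>k\<in>UNIV. (sqA q q1 j z * a j) * cnj (sqA q q1 k z * a k))"
    unfolding S_def complex_norm_square cnj_sum sum_product ..
  then have "(\<Sum>j\<in>UNIV. \<Sum>k\<in>UNIV. (complex_of_real g1 * sqAB q1 j k z + complex_of_real g2 * cnj (sqA q q1 k z) * sqA q q1 j z) * a j * cnj (a k))
    = complex_of_real g1 * (\<Sum>j\<in>UNIV. \<Sum>k\<in>UNIV. sqAB q1 j k z * a j * cnj (a k)) + complex_of_real g2 * complex_of_real S"
    by (simp add: sum_distrib_left sum.distrib[symmetric] algebra_simps)
  then have eq: "Re (\<Sum>j\<in>UNIV. \<Sum>k\<in>UNIV. (complex_of_real g1 * sqAB q1 j k z + complex_of_real g2 * cnj (sqA q q1 k z) * sqA q q1 j z) * a j * cnj (a k))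
    = g1 * lev q1 z a + g2 * S"
    unfolding lev_def by simp
  have "S \<le> sqn q z * lev q1 z a" unfolding S_def by (rule sqA_lev)
  also have "\<dots> \<le> (sqn q z + c) * lev q1 z a" using c lev_nonneg by (intro mult_right_mono) auto
  finally have "S / (sqn q z + c) \<le> lev q1 z a" using c sqn_nonneg[of z] by (simp add: field_simps)
  then have "g1 * (S / (sqn q z + c)) \<le> g1 * lev q1 z a" using g1 by (rule mult_left_mono)
  moreover have "(g2 + g1 / (sqn q z + c)) * S = g2 * S + g1 * (S / (sqn q z + c))" by (simp add: distrib_right)
  ultimately show ?thesis unfolding eq S_def[symmetric] by linarith
qed

end

definition qf :: "('n::finite \<Rightarrow> 'n \<Rightarrow> complex) \<Rightarrow> ('n \<Rightarrow> complex) \<Rightarrow> real" where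
  "qf H a = Re (\<Sum>j\<in>UNIV. \<Sum>k\<in>UNIV. H j k * a j * cnj (a k))"

lemma qf_add: "qf (\<lambda>j k. H j k + H' j k) a = qf H a + qf H' a"
  unfolding qf_def distrib_right sum.distrib by simp

lemma qf_zero: "qf (\<lambda>j k. 0) a = 0"
  by (simp add: qf_def)

lemma qf_sum: "qf (\<lambda>j k. \<Sum>i\<in>I. H i j k) a = (\<Sum>i\<in>I. qf (H i) a)"
proof (induction I rule: infinite_finite_induct)
  case (insert i I)
  then show ?case by (simp add: qf_add)
qed (simp_all add: qf_zero)

text \<open>The function \<Theta> of the overview: the smoothstep 3 s^2 - 2 s^3 in s = (2t - 1)_+.
  Beyond t = 1 it continues as this cubic, and what matters at the limit value t = 1 is \<Theta>(1)
  = 1 and \<Theta>'(1) = 0.\<close>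

definition ramp :: "real \<Rightarrow> real" where "ramp t = 3 * pos_part (2 * t - 1) ^ 2 - 2 * pos_part (2 * t - 1) ^ 3"
definition ramp' :: "real \<Rightarrow> real" where "ramp' t = 12 * (pos_part (2 * t - 1) * (1 - pos_part (2 * t - 1)))"

lemma ramp_deriv: "(ramp has_real_derivative ramp' t) (at t)"
proof -
  have 2: "((\<lambda>t. pos_part (2 * t - 1) ^ 2) has_real_derivative (2 * pos_part (2 * t - 1)) * 2) (at t)"
    by (rule DERIV_chain2[where f="\<lambda>t. pos_part t ^ 2"]) (use pos_part_power_deriv[of 0 "2 * t - 1"] in \<open>auto intro!: derivative_eq_intros simp: numeral_2_eq_2\<close>)
  have 3: "((\<lambda>t. pos_part (2 * t - 1) ^ 3) has_real_derivative (3 * pos_part (2 * t - 1) ^ 2) * 2) (at t)"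
    by (rule DERIV_chain2[where f="\<lambda>t. pos_part t ^ 3"]) (use pos_part_power_deriv[of 1 "2 * t - 1"] in \<open>auto intro!: derivative_eq_intros simp: eval_nat_numeral\<close>)
  have "((\<lambda>t. 3 * pos_part (2 * t - 1) ^ 2 - 2 * pos_part (2 * t - 1) ^ 3) has_real_derivative 3 * ((2 * pos_part (2 * t - 1)) * 2) - 2 * ((3 * pos_part (2 * t - 1) ^ 2) * 2)) (at t)"
    by (intro DERIV_diff DERIV_cmult 2 3)
  moreover have "3 * ((2 * pos_part (2 * t - 1)) * 2) - 2 * ((3 * pos_part (2 * t - 1) ^ 2) * 2) = ramp' t"
    by (simp add: ramp'_def power2_eq_square algebra_simps)
  ultimately show ?thesis unfolding ramp_def[abs_def] by simp
qed

lemma ramp_cont: "continuous_on S f \<Longrightarrow> continuous_on S (\<lambda>x. ramp (f x))"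
  and ramp'_cont: "continuous_on S f \<Longrightarrow> continuous_on S (\<lambda>x. ramp' (f x))"
  unfolding ramp_def ramp'_def by (intro continuous_intros; assumption)+

text \<open>The weight at fixed parameters: \<open>\<epsilon>\<close> makes log (x + \<epsilon>)
  smooth, \<open>y\<close> is the k-th root on which the cut-off is based, and \<open>Ph\<close>
  confines the mass to the polydisk of radius \<open>R\<close> when \<open>M\<close> is
  large.\<close>

locale poly_weight =
  fixes q :: "'l::finite \<Rightarrow> complex^'n \<Rightarrow> complex" and \<delta> \<epsilon> R :: real and k M :: nat
  assumes qp: "\<And>l. cpoly (q l)" and d: "\<delta> > 0" and e: "\<epsilon> > 0" and k: "k \<ge> 1" and R: "R > 0" and M: "M \<ge> 1"
begin

definition "x z = (\<Sum>l\<in>UNIV. (cmod (q l z))\<^sup>2)"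
definition "y z = (x z + (1/4)^k) powr (1 / real k)"
definition Ph :: "complex^'n \<Rightarrow> real" where "Ph z = (\<Sum>i\<in>UNIV. ((cmod (z $ i))\<^sup>2 / R\<^sup>2) ^ M)"
definition "W z = (x z + \<epsilon>) powr (- \<delta> / 2) * exp (- y z) * exp (- Ph z)"
definition "ph z = (\<delta> / 2) * ln (x z + \<epsilon>) + (y z + Ph z)"

lemma x_nonneg: "x z \<ge> 0"
  unfolding x_def by (intro sum_nonneg) simp

lemma exp_ph: "exp (- ph z) = W z"
proof -
  have "x z + \<epsilon> > 0" using x_nonneg[of z] e by simp
  then have "exp (- ((\<delta> / 2) * ln (x z + \<epsilon>))) = (x z + \<epsilon>) powr (- \<delta> / 2)" by (simp add: powr_def)
  moreover have "- ph z = - ((\<delta> / 2) * ln (x z + \<epsilon>)) + - y z + - Ph z" by (simp add: ph_def)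
  ultimately show ?thesis unfolding W_def by (simp only: exp_add)
qed

lemma y_pos: "y z > 0"
proof -
  have "x z + (1/4)^k > 0" by (intro add_nonneg_pos x_nonneg) simp
  then show ?thesis unfolding y_def by simp
qed

lemma y_le: "y z \<le> x z + 2"
proof -
  define t where "t = x z + (1/4)^k"
  have t: "t > 0" "t \<le> x z + 1" unfolding t_def using x_nonneg[of z] by (auto intro: add_nonneg_pos simp: power_le_one)
  have "t powr (1 / real k) \<le> t + 1"
  proof (cases "t \<le> 1")
    case True
    then have "t powr (1 / real k) \<le> 1" using t by (intro powr_le1) auto
    then show ?thesis using t by simp
  next
    case False
    then have "t powr (1 / real k) \<le> t powr 1" using k by (intro powr_mono) auto
    then show ?thesis using t by simp
  qed
  then show ?thesis using t unfolding y_def t_def[symmetric] by simp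
qed

text \<open>s^M >= s - 1 for s >= 0, so the quadratic lower bound, and with it the Gaussian decay,
  is the same for all \<open>M\<close>.\<close>

lemma Ph_ge: "Ph z \<ge> (norm z)\<^sup>2 / R\<^sup>2 - real CARD('n)"
proof -
  have "s ^ M \<ge> s - 1" if "s \<ge> 0" for s :: real
  proof (cases "s \<le> 1")
    case False
    then have "s ^ 1 \<le> s ^ M" using M by (intro power_increasing) auto
    then show ?thesis by simp
  qed (use that in \<open>auto intro: order_trans[of _ 0]\<close>)
  then have "(\<Sum>i\<in>UNIV. (cmod (z $ i))\<^sup>2 / R\<^sup>2 - 1) \<le> Ph z"
    unfolding Ph_def by (intro sum_mono) auto
  then show ?thesis by (simp add: sum_subtractf norm_vec_sq sum_divide_distrib)
qed

lemma tempered_x: "tempered (\<lambda>z. complex_of_real (x z))"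
proof -
  have "tempered (\<lambda>z. complex_of_real ((cmod (q l z))\<^sup>2))" for l
    by (rule tempered_bound[OF tempered_mult[OF tempered_cpoly[OF qp[of l]] tempered_cpoly[OF qp[of l]]]]) (simp add: norm_mult power2_eq_square)
  then show ?thesis unfolding x_def of_real_sum by (intro tempered_sum)
qed

lemma tempered_y: "tempered (\<lambda>z. complex_of_real (y z))"
proof (rule tempered_bound[OF tempered_add[OF tempered_x tempered_const[of 2]]])
  fix z
  have "cmod (complex_of_real (x z) + 2) = x z + 2"
    using x_nonneg[of z] by (metis abs_of_nonneg add_nonneg_nonneg norm_of_real of_real_add of_real_numeral zero_le_numeral)
  then show "cmod (complex_of_real (y z)) \<le> cmod (complex_of_real (x z) + 2)"
    using y_pos[of z] y_le[of z] by simp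
qed

lemma tempered_pos_part: "tempered (\<lambda>z. complex_of_real (pos_part (2 * y z - 1)))"
  by (rule tempered_bound[OF tempered_mult[OF tempered_const[of 2] tempered_y]])
    (use y_pos in \<open>auto simp: pos_part_def norm_mult less_imp_le\<close>)

lemma tempered_ramp: "tempered (\<lambda>z. complex_of_real (ramp (y z)))"
proof -
  have "tempered (\<lambda>z. (3 * complex_of_real (pos_part (2 * y z - 1))) * complex_of_real (pos_part (2 * y z - 1)) + (-2 * complex_of_real (pos_part (2 * y z - 1))) * (complex_of_real (pos_part (2 * y z - 1)) * complex_of_real (pos_part (2 * y z - 1))))"
    by (intro tempered_add tempered_mult tempered_const tempered_pos_part)
  then show ?thesis by (simp add: ramp_def power2_eq_square power3_eq_cube algebra_simps)
qed

lemma tempered_ramp': "tempered (\<lambda>z. complex_of_real (ramp' (y z)))"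
proof -
  have "tempered (\<lambda>z. 12 * (complex_of_real (pos_part (2 * y z - 1)) * (1 + (-1) * complex_of_real (pos_part (2 * y z - 1)))))"
    by (intro tempered_add tempered_mult tempered_const tempered_pos_part)
  then show ?thesis by (simp add: ramp'_def)
qed

lemma W_le: "W z \<le> (\<epsilon> powr (- \<delta> / 2) * exp (real CARD('n))) * exp (- (1 / R\<^sup>2) * (norm z)\<^sup>2)"
proof -
  have "(x z + \<epsilon>) powr (- \<delta> / 2) \<le> \<epsilon> powr (- \<delta> / 2)"
    using d e x_nonneg[of z] by (intro powr_mono2') auto
  moreover have "exp (- y z) \<le> 1" using y_pos[of z] by simp
  moreover have "exp (- Ph z) \<le> exp (real CARD('n) - (1 / R\<^sup>2) * (norm z)\<^sup>2)" using Ph_ge[of z] by simp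
  ultimately have "W z \<le> \<epsilon> powr (- \<delta> / 2) * 1 * exp (real CARD('n) - (1 / R\<^sup>2) * (norm z)\<^sup>2)"
    unfolding W_def by (intro mult_mono) auto
  then show ?thesis by (simp add: exp_add[symmetric] mult.assoc)
qed

lemma W_nonneg: "W z \<ge> 0"
  unfolding W_def by simp

lemma integrable_W_tempered:
  assumes f: "continuous_on UNIV f" "tempered f" and c: "continuous_on UNIV W"
  shows "integrable lborel (\<lambda>z. W z * (cmod (f z))\<^sup>2)"
proof -
  obtain C D where C: "C \<ge> 0" "\<And>z. cmod (f z) \<le> C * (1 + norm z) ^ D" using f(2) unfolding tempered_def by blast
  define K where "K = \<epsilon> powr (- \<delta> / 2) * exp (real CARD('n))"
  have K: "K \<ge> 0" by (simp add: K_def)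
  show ?thesis
  proof (rule Bochner_Integration.integrable_bound)
    show "integrable lborel (\<lambda>z::complex^'n. (K * C\<^sup>2) * ((1 + norm z) ^ (2 * D) * exp (- (1 / R\<^sup>2) * (norm z)\<^sup>2)))"
      by (intro integrable_mult_right integrable_gauss_poly) (use R in simp)
    show "(\<lambda>z. W z * (cmod (f z))\<^sup>2) \<in> borel_measurable lborel"
      by (intro borel_measurable_lborel_cont continuous_intros c f)
    have "norm (W z * (cmod (f z))\<^sup>2) \<le> norm ((K * C\<^sup>2) * ((1 + norm z) ^ (2 * D) * exp (- (1 / R\<^sup>2) * (norm z)\<^sup>2)))" for z
    proof -
      have "(cmod (f z))\<^sup>2 \<le> (C * (1 + norm z) ^ D)\<^sup>2" by (intro power_mono C) simp
      then have "W z * (cmod (f z))\<^sup>2 \<le> (K * exp (- (1 / R\<^sup>2) * (norm z)\<^sup>2)) * (C * (1 + norm z) ^ D)\<^sup>2"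
        using W_le[of z] K unfolding K_def by (intro mult_mono) auto
      also have "\<dots> = (K * C\<^sup>2) * ((1 + norm z) ^ (2 * D) * exp (- (1 / R\<^sup>2) * (norm z)\<^sup>2))"
        by (simp only: power_mult_distrib power_mult[symmetric] mult_ac)
      finally have le: "W z * (cmod (f z))\<^sup>2 \<le> (K * C\<^sup>2) * ((1 + norm z) ^ (2 * D) * exp (- (1 / R\<^sup>2) * (norm z)\<^sup>2))" .
      moreover have "W z * (cmod (f z))\<^sup>2 \<ge> 0" by (simp add: W_nonneg)
      ultimately show ?thesis by (simp only: real_norm_def)
    qed
    then show "AE z in lborel. norm (W z * (cmod (f z))\<^sup>2) \<le> norm ((K * C\<^sup>2) * ((1 + norm z) ^ (2 * D) * exp (- (1 / R\<^sup>2) * (norm z)\<^sup>2)))"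
      by (rule AE_I2)
  qed
qed

lemma qf_comp_nonneg:
  fixes p :: "'m::finite \<Rightarrow> complex^'n \<Rightarrow> complex" and g1 g2 :: real
  assumes p: "\<And>l. hol2 (p l) (p1 l) (p2 l)" and c: "c > 0" and g1: "g1 \<ge> 0" and g2: "g2 + g1 / (sqn p z + c) \<ge> 0"
  shows "qf (\<lambda>j k. complex_of_real g1 * sqAB p1 j k z + complex_of_real g2 * cnj (sqA p p1 k z) * sqA p p1 j z) a \<ge> 0"
proof -
  have "0 \<le> (g2 + g1 / (sqn p z + c)) * (cmod (\<Sum>j\<in>UNIV. sqA p p1 j z * a j))\<^sup>2" using g2 by simp
  also have "\<dots> \<le> qf (\<lambda>j k. complex_of_real g1 * sqAB p1 j k z + complex_of_real g2 * cnj (sqA p p1 k z) * sqA p p1 j z) a"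
    unfolding qf_def by (rule hessian_comp_ge[OF p c g1])
  finally show ?thesis .
qed

text \<open>All summands of the weight have nonnegative Hessians, and that of \<open>y\<close> is
  used quantitatively: it absorbs dbar of ramp(y) with \<open>Bf\<close> = |ramp'(y)| sqrt y.
  Integrability comes from polynomial growth against Gaussian decay.\<close>

lemma dbar_solution:
  "\<exists>F. weak_hol F \<and> L2loc F \<and> integrable lborel (\<lambda>z. W z * (cmod (complex_of_real (ramp (y z)) - F z))\<^sup>2) \<and>
     integrable lborel (\<lambda>z. W z * ((ramp' (y z))\<^sup>2 * y z)) \<and>
     (\<integral>z. W z * (cmod (complex_of_real (ramp (y z)) - F z))\<^sup>2 \<partial>lborel) \<le> (\<integral>z. W z * ((ramp' (y z))\<^sup>2 * y z) \<partial>lborel)"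
proof -
  have "\<forall>l. \<exists>p1 p2. hol2 (q l) p1 p2 \<and> (\<forall>j. cpoly (p1 j))" using cpoly_hol2[OF qp] by blast
  from choice[OF this] obtain q1 where "\<forall>l. \<exists>p2. hol2 (q l) (q1 l) p2 \<and> (\<forall>j. cpoly (q1 l j))" ..
  from choice[OF this] obtain q2 where q2: "\<forall>l. hol2 (q l) (q1 l) (q2 l) \<and> (\<forall>j. cpoly (q1 l j))" ..
  have q: "hol2 (q l) (q1 l) (q2 l)" and q1p: "cpoly (q1 l j)" for l j using q2 by blast+
  have xq: "sqn q = x" by (simp add: sqn_def[abs_def] x_def[abs_def])
  note XC = sqn_C2R[of q q1 q2, OF q, unfolded xq]
  have x1: "C1 (\<lambda>z. complex_of_real (x z)) (sqA q q1) (\<lambda>j z. cnj (sqA q q1 j z))" using XC unfolding C2R_def by blast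
  have xc: "continuous_on UNIV x" using continuous_on_Re[OF C1_cont[OF x1]] by simp
  have sAc: "continuous_on UNIV (sqA q q1 j)" for j by (rule C1_contA[OF x1])
  define a where "a = 1 / real k"
  have a: "a > 0" "a \<le> 1" using k by (auto simp: a_def)
  define c where "c = (1/4::real)^k"
  have c: "c > 0" by (simp add: c_def)
  have xcp: "x z + c > 0" "x z + \<epsilon> > 0" for z using x_nonneg[of z] c e by auto
  have yy: "y z = (x z + c) powr a" for z by (simp add: y_def a_def c_def)
  have yc: "continuous_on UNIV y"
    unfolding yy using xcp(1) by (intro continuous_intros xc) (auto simp: less_imp_neq[symmetric])
  define g1a where "g1a t = (\<delta> / 2) * inverse (t + \<epsilon>)" for t
  define g2a where "g2a t = (\<delta> / 2) * - (inverse (t + \<epsilon>) * 1 * inverse (t + \<epsilon>))" for t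
  define g1b where "g1b t = a * (t + c) powr (a - 1)" for t
  define g2b where "g2b t = a * (a - 1) * (t + c) powr (a - 2)" for t
  define g1c where "g1c t = real M * (t / R\<^sup>2) ^ (M - Suc 0) * (1 / R\<^sup>2)" for t
  \<comment> \<open>For M = 1 the exponent M - 2 is truncated to 0, which is harmless because the
    factor M - 1 is then zero.\<close>
  define g2c where "g2c t = real M * (real (M - Suc 0) * (t / R\<^sup>2) ^ (M - Suc 0 - Suc 0) * (1 / R\<^sup>2)) * (1 / R\<^sup>2)" for t
  have dp: "((\<lambda>t. (t / R\<^sup>2) ^ m) has_real_derivative real m * (t / R\<^sup>2) ^ (m - Suc 0) * (1 / R\<^sup>2)) (at t)" for m t
    by (rule DERIV_chain2[OF DERIV_pow DERIV_cdivide[OF DERIV_ident]])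
  have Ca: "C2R (\<lambda>z. (\<delta> / 2) * ln (x z + \<epsilon>)) (\<lambda>j z. complex_of_real (g1a (x z)) * sqA q q1 j z)
     (\<lambda>j k z. complex_of_real (g1a (x z)) * sqAA q q2 j k z + complex_of_real (g2a (x z)) * sqA q q1 k z * sqA q q1 j z)
     (\<lambda>j k z. complex_of_real (g1a (x z)) * sqAB q1 j k z + complex_of_real (g2a (x z)) * cnj (sqA q q1 k z) * sqA q q1 j z)"
  proof (rule C2R_comp[OF XC, where g="\<lambda>t. (\<delta> / 2) * ln (t + \<epsilon>)"])
    show "((\<lambda>t. (\<delta> / 2) * ln (t + \<epsilon>)) has_real_derivative g1a (x z)) (at (x z))" for z
    proof -
      have D: "((\<lambda>t. t + \<epsilon>) has_real_derivative 1) (at (x z))" by (auto intro!: derivative_eq_intros)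
      have "((\<lambda>t. ln (t + \<epsilon>)) has_real_derivative 1 / (x z + \<epsilon>) * 1) (at (x z))"
        by (rule DERIV_chain2[of ln _ "\<lambda>t. t + \<epsilon>"]) (rule DERIV_ln_divide[OF xcp(2)], rule D)
      then have "((\<lambda>t. (\<delta> / 2) * ln (t + \<epsilon>)) has_real_derivative (\<delta> / 2) * (1 / (x z + \<epsilon>) * 1)) (at (x z))"
        by (rule DERIV_cmult)
      moreover have "(\<delta> / 2) * (1 / (x z + \<epsilon>) * 1) = g1a (x z)" unfolding g1a_def by (simp only: inverse_eq_divide mult_1_right)
      ultimately show ?thesis by (simp only:)
    qed
    show "(g1a has_real_derivative g2a (x z)) (at (x z))" for z
    proof -
      have D: "((\<lambda>t. t + \<epsilon>) has_real_derivative 1) (at (x z))" by (auto intro!: derivative_eq_intros)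
      have "x z + \<epsilon> \<noteq> 0" using xcp(2)[of z] by simp
      then show ?thesis unfolding g1a_def[abs_def] g2a_def by (intro DERIV_cmult DERIV_inverse' D)
    qed
    show "continuous_on UNIV (\<lambda>z. g2a (x z))"
      unfolding g2a_def using xcp(2) by (intro continuous_intros xc) (auto simp: less_imp_neq[symmetric])
  qed
  have Cb: "C2R y (\<lambda>j z. complex_of_real (g1b (x z)) * sqA q q1 j z)
     (\<lambda>j k z. complex_of_real (g1b (x z)) * sqAA q q2 j k z + complex_of_real (g2b (x z)) * sqA q q1 k z * sqA q q1 j z)
     (\<lambda>j k z. complex_of_real (g1b (x z)) * sqAB q1 j k z + complex_of_real (g2b (x z)) * cnj (sqA q q1 k z) * sqA q q1 j z)"
    unfolding yy[abs_def]
  proof (rule C2R_comp[OF XC, where g="\<lambda>t. (t + c) powr a"])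
    show "((\<lambda>t. (t + c) powr a) has_real_derivative g1b (x z)) (at (x z))" for z
      using xcp(1)[of z] unfolding g1b_def by (auto intro!: derivative_eq_intros)
    show "(g1b has_real_derivative g2b (x z)) (at (x z))" for z
      unfolding g1b_def[abs_def] g2b_def using xcp(1)[of z] by (auto intro!: derivative_eq_intros)
    show "continuous_on UNIV (\<lambda>z. g2b (x z))"
      unfolding g2b_def using xcp(1) by (intro continuous_intros xc) (auto simp: less_imp_neq[symmetric])
  qed
  \<comment> \<open>|z_i|^2 is regarded as a sum of squares over a one-point index type, so that the
    Hessian lemmas for \<open>sqn\<close> also cover the summands of \<open>Ph\<close>.\<close>
  define p where "p i = (\<lambda>(u::unit) (z::complex^'n). z $ i)" for i
  define p1 where "p1 i = (\<lambda>(u::unit) j (z::complex^'n). if j = i then 1 else (0::complex))" for i :: 'n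
  define p2 where "p2 = (\<lambda>(u::unit) (j::'n) (k::'n) (z::complex^'n). 0::complex)"
  have p: "hol2 (p i u) (p1 i u) (p2 u)" for i u unfolding p_def p1_def p2_def by (rule hol2_coord)
  have sp: "sqn (p i) z = (cmod (z $ i))\<^sup>2" for i z by (simp add: sqn_def p_def)
  have sp0: "sqn (p i) z \<ge> 0" for i z by (simp add: sp)
  have Cc: "C2R (\<lambda>z. ((cmod (z $ i))\<^sup>2 / R\<^sup>2) ^ M) (\<lambda>j z. complex_of_real (g1c (sqn (p i) z)) * sqA (p i) (p1 i) j z)
     (\<lambda>j k z. complex_of_real (g1c (sqn (p i) z)) * sqAA (p i) p2 j k z + complex_of_real (g2c (sqn (p i) z)) * sqA (p i) (p1 i) k z * sqA (p i) (p1 i) j z)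
     (\<lambda>j k z. complex_of_real (g1c (sqn (p i) z)) * sqAB (p1 i) j k z + complex_of_real (g2c (sqn (p i) z)) * cnj (sqA (p i) (p1 i) k z) * sqA (p i) (p1 i) j z)" for i
    unfolding sp[symmetric]
  proof (rule C2R_comp[OF sqn_C2R[of "p i" "p1 i" p2, OF p], where g="\<lambda>t. (t / R\<^sup>2) ^ M"])
    show "((\<lambda>t. (t / R\<^sup>2) ^ M) has_real_derivative g1c (sqn (p i) z)) (at (sqn (p i) z))" for z
      unfolding g1c_def by (rule dp)
    show "(g1c has_real_derivative g2c (sqn (p i) z)) (at (sqn (p i) z))" for z
      unfolding g1c_def[abs_def] g2c_def by (rule DERIV_cmult_right[OF DERIV_cmult[OF dp]])
    show "continuous_on UNIV (\<lambda>z. g2c (sqn (p i) z))"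
      unfolding g2c_def sp using R by (intro continuous_intros) auto
  qed
  define P where "P j z = complex_of_real (g1a (x z)) * sqA q q1 j z + (complex_of_real (g1b (x z)) * sqA q q1 j z + (\<Sum>i\<in>UNIV. complex_of_real (g1c (sqn (p i) z)) * sqA (p i) (p1 i) j z))" for j z
  define Q where "Q j k z = (complex_of_real (g1a (x z)) * sqAA q q2 j k z + complex_of_real (g2a (x z)) * sqA q q1 k z * sqA q q1 j z)
     + ((complex_of_real (g1b (x z)) * sqAA q q2 j k z + complex_of_real (g2b (x z)) * sqA q q1 k z * sqA q q1 j z)
     + (\<Sum>i\<in>UNIV. complex_of_real (g1c (sqn (p i) z)) * sqAA (p i) p2 j k z + complex_of_real (g2c (sqn (p i) z)) * sqA (p i) (p1 i) k z * sqA (p i) (p1 i) j z))" for j k z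
  define Ha where "Ha j k z = complex_of_real (g1a (x z)) * sqAB q1 j k z + complex_of_real (g2a (x z)) * cnj (sqA q q1 k z) * sqA q q1 j z" for j k z
  define Hb where "Hb j k z = complex_of_real (g1b (x z)) * sqAB q1 j k z + complex_of_real (g2b (x z)) * cnj (sqA q q1 k z) * sqA q q1 j z" for j k z
  define Hc where "Hc i j k z = complex_of_real (g1c (sqn (p i) z)) * sqAB (p1 i) j k z + complex_of_real (g2c (sqn (p i) z)) * cnj (sqA (p i) (p1 i) k z) * sqA (p i) (p1 i) j z" for i j k z
  define H where "H j k z = Ha j k z + (Hb j k z + (\<Sum>i\<in>UNIV. Hc i j k z))" for j k z
  have CH: "C2R ph P Q H"
    unfolding ph_def[abs_def] P_def[abs_def] Q_def[abs_def] H_def[abs_def] Ha_def Hb_def Hc_def Ph_def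
    by (rule C2R_add[OF Ca C2R_add[OF Cb C2R_sum[OF Cc]]])
  interpret wt: weight ph P Q H
    by (rule weight.intro[OF conjunct1[OF CH[unfolded C2R_def]] spec[OF conjunct1[OF conjunct2[OF CH[unfolded C2R_def]]]]])
  have Ha0: "qf (\<lambda>j k. Ha j k z) b \<ge> 0" for z b
    unfolding Ha_def
  proof (rule qf_comp_nonneg[OF q e])
    show "g1a (x z) \<ge> 0" using d xcp(2)[of z] by (simp add: g1a_def)
    \<comment> \<open>The logarithm is the borderline case: the two contributions cancel
      exactly.\<close>
    have "g2a (x z) + g1a (x z) / (x z + \<epsilon>) = 0" 
      unfolding g1a_def g2a_def divide_inverse by (simp only: mult_1_right mult_minus_right mult.assoc left_minus)
    then show "g2a (x z) + g1a (x z) / (sqn q z + \<epsilon>) \<ge> 0" by (simp add: xq)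
  qed
  have Hc0: "qf (\<lambda>j k. Hc i j k z) b \<ge> 0" for i z b
    unfolding Hc_def
  proof (rule qf_comp_nonneg[OF p zero_less_one])
    show g: "g1c (sqn (p i) z) \<ge> 0" using sp0[of i z] by (simp add: g1c_def)
    have "g2c (sqn (p i) z) \<ge> 0" using sp0[of i z] by (simp add: g2c_def)
    then show "g2c (sqn (p i) z) + g1c (sqn (p i) z) / (sqn (p i) z + 1) \<ge> 0"
      using g sp0[of i z] by simp
  qed
  have Hbb: "a\<^sup>2 * (x z + c) powr (a - 2) * (cmod (\<Sum>j\<in>UNIV. sqA q q1 j z * b j))\<^sup>2 \<le> qf (\<lambda>j k. Hb j k z) b" for z b
  proof -
    have g: "g1b (x z) \<ge> 0" using a by (simp add: g1b_def)
    have pw: "(x z + c) powr (a - 1) / (x z + c) = (x z + c) powr (a - 2)"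
    proof -
      have "(x z + c) powr (a - 1) / (x z + c) = (x z + c) powr (a - 1) / (x z + c) powr 1" using xcp(1)[of z] by simp
      also have "\<dots> = (x z + c) powr (a - 1 - 1)" by (simp only: powr_diff)
      finally show ?thesis by simp
    qed
    have "g2b (x z) + g1b (x z) / (x z + c) = a * (a - 1) * (x z + c) powr (a - 2) + a * ((x z + c) powr (a - 1) / (x z + c))"
      by (simp add: g1b_def g2b_def)
    also have "\<dots> = a\<^sup>2 * (x z + c) powr (a - 2)" unfolding pw by (simp add: power2_eq_square algebra_simps)
    finally have eq: "g2b (x z) + g1b (x z) / (sqn q z + c) = a\<^sup>2 * (x z + c) powr (a - 2)" by (simp add: xq)
    show ?thesis unfolding Hb_def qf_def eq[symmetric] by (rule hessian_comp_ge[OF q c g])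
  qed
  have qH: "qf (\<lambda>j k. H j k z) b = qf (\<lambda>j k. Ha j k z) b + (qf (\<lambda>j k. Hb j k z) b + (\<Sum>i\<in>UNIV. qf (\<lambda>j k. Hc i j k z) b))" for z b
    unfolding H_def by (simp only: qf_add qf_sum)
  have Hge: "a\<^sup>2 * (x z + c) powr (a - 2) * (cmod (\<Sum>j\<in>UNIV. sqA q q1 j z * b j))\<^sup>2 \<le> qf (\<lambda>j k. H j k z) b" for z b
    unfolding qH using Ha0[of z b] Hbb[of z b] sum_nonneg[of UNIV "\<lambda>i. qf (\<lambda>j k. Hc i j k z) b"] Hc0 by force
  have Hpos: "0 \<le> qf (\<lambda>j k. H j k z) b" for z b
    using Hge[of z b] by (rule order_trans[rotated]) (simp add: a)
  define G where "G t = ramp' ((t + c) powr a) * g1b t" for t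
  have eta: "C1 (\<lambda>z. complex_of_real (ramp (y z))) (\<lambda>j z. complex_of_real (G (x z)) * sqA q q1 j z) (\<lambda>j z. complex_of_real (G (x z)) * cnj (sqA q q1 j z))"
    unfolding yy
  proof (rule C1_real_comp[OF x1, where g="\<lambda>t. ramp ((t + c) powr a)"])
    show "((\<lambda>t. ramp ((t + c) powr a)) has_real_derivative G (x z)) (at (x z))" for z
      unfolding G_def
    proof (rule DERIV_chain2[OF ramp_deriv])
      show "((\<lambda>t. (t + c) powr a) has_real_derivative g1b (x z)) (at (x z))"
        using xcp(1)[of z] unfolding g1b_def by (auto intro!: derivative_eq_intros)
    qed
    show "continuous_on UNIV (\<lambda>z. G (x z))"
      unfolding G_def g1b_def using xcp(1)
      by (intro continuous_intros ramp'_cont xc) (auto simp: less_imp_neq[symmetric])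
  qed
  define Bf where "Bf z = \<bar>ramp' (y z)\<bar> * sqrt (y z)" for z
  have Bf0: "Bf z \<ge> 0" for z using y_pos[of z] by (simp add: Bf_def)
  have bound: "(cmod (\<Sum>j\<in>UNIV. (complex_of_real (G (x z)) * cnj (sqA q q1 j z)) * cnj (b j)))\<^sup>2 \<le> (Bf z)\<^sup>2 * qf (\<lambda>j k. H j k z) b" for z b
  proof -
    define S where "S = (cmod (\<Sum>j\<in>UNIV. sqA q q1 j z * b j))\<^sup>2"
    have "(\<Sum>j\<in>UNIV. (complex_of_real (G (x z)) * cnj (sqA q q1 j z)) * cnj (b j)) = complex_of_real (G (x z)) * cnj (\<Sum>j\<in>UNIV. sqA q q1 j z * b j)"
      by (simp add: sum_distrib_left mult_ac)
    then have "(cmod (\<Sum>j\<in>UNIV. (complex_of_real (G (x z)) * cnj (sqA q q1 j z)) * cnj (b j)))\<^sup>2 = (G (x z))\<^sup>2 * S"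
      by (simp add: norm_mult power_mult_distrib S_def del: cnj_sum)
    \<comment> \<open>The left side is ramp'(y)^2 a^2 (x + c)^(2a - 2); one factor (x + c)^a of it
      is y and goes into \<open>Bf\<close>, and the rest is the lower bound \<open>Hge\<close> for
      the Hessian.\<close>
    also have "(G (x z))\<^sup>2 = (Bf z)\<^sup>2 * (a\<^sup>2 * (x z + c) powr (a - 2))"
    proof -
      have pw: "((x z + c) powr (a - 1))\<^sup>2 = (x z + c) powr a * (x z + c) powr (a - 2)"
        unfolding power2_eq_square powr_add[symmetric] by simp
      have "(Bf z)\<^sup>2 = (ramp' (y z))\<^sup>2 * y z" using y_pos[of z] by (simp add: Bf_def power_mult_distrib less_imp_le)
      then show ?thesis
        unfolding G_def g1b_def yy power_mult_distrib pw by (simp only: mult_ac)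
    qed
    also have "(Bf z)\<^sup>2 * (a\<^sup>2 * (x z + c) powr (a - 2)) * S \<le> (Bf z)\<^sup>2 * qf (\<lambda>j k. H j k z) b"
      using mult_left_mono[OF Hge[of z b], of "(Bf z)\<^sup>2"] by (simp add: S_def mult.assoc)
    finally show ?thesis .
  qed
  have Wc: "continuous_on UNIV W" unfolding exp_ph[symmetric] by (intro continuous_intros wt.phi_cont)
  have L2E: "L2 lborel (\<lambda>z. wt.E z * f z)" if f: "continuous_on UNIV f" "tempered f" for f
    unfolding L2_def
  proof
    show "(\<lambda>z. wt.E z * f z) \<in> borel_measurable lborel" by (intro borel_measurable_lborel_cont continuous_on_mult wt.E_cont f)
    have "(cmod (wt.E z * f z))\<^sup>2 = W z * (cmod (f z))\<^sup>2" for z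
      by (simp add: norm_mult power_mult_distrib wt.norm_E_sq exp_ph)
    then show "integrable lborel (\<lambda>z. (cmod (wt.E z * f z))\<^sup>2)" using integrable_W_tempered[OF f Wc] by simp
  qed
  have tG: "tempered (\<lambda>z. complex_of_real (G (x z)))"
  proof (rule tempered_bound[OF tempered_mult[OF tempered_const[of "complex_of_real (a * c powr (a - 1))"] tempered_ramp']])
    fix z
    \<comment> \<open>Since a <= 1 the exponent a - 1 is not positive, so the factor is largest at x
      = 0 and bounded there thanks to c > 0.\<close>
    have "(x z + c) powr (a - 1) \<le> c powr (a - 1)" using a c x_nonneg[of z] by (intro powr_mono2') auto
    then have "\<bar>ramp' (y z)\<bar> * (a * (x z + c) powr (a - 1)) \<le> \<bar>ramp' (y z)\<bar> * (a * c powr (a - 1))"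
      using a by (intro mult_left_mono) auto
    then show "cmod (complex_of_real (G (x z))) \<le> cmod (complex_of_real (a * c powr (a - 1)) * complex_of_real (ramp' (y z)))"
      using a unfolding G_def g1b_def yy[symmetric] by (simp add: norm_mult abs_mult mult_ac)
  qed
  have tA: "tempered (\<lambda>z. cnj (sqA q q1 j z))" for j
  proof -
    have "tempered (\<lambda>z. \<Sum>l\<in>UNIV. cnj (q l z) * q1 l j z)"
    proof (intro tempered_sum tempered_mult)
      show "tempered (\<lambda>z. cnj (q l z))" for l by (rule tempered_bound[OF tempered_cpoly[OF qp[of l]]]) simp
      show "tempered (q1 l j)" for l by (rule tempered_cpoly[OF q1p])
    qed
    then show ?thesis unfolding sqA_def by (rule tempered_bound) (simp only: complex_mod_cnj order_refl)
  qed
  have LE: "L2 lborel (\<lambda>z. wt.E z * (complex_of_real (G (x z)) * cnj (sqA q q1 j z)))" for j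
    by (rule L2E[OF C1_contB[OF eta] tempered_mult[OF tG tA]])
  have Leta: "L2 lborel (\<lambda>z. wt.E z * complex_of_real (ramp (y z)))"
    by (rule L2E[OF C1_cont[OF eta] tempered_ramp])
  have Bsq: "(norm (exp (- ph z / 2) * Bf z))\<^sup>2 = W z * ((ramp' (y z))\<^sup>2 * y z)" for z
  proof -
    have "(exp (- ph z / 2))\<^sup>2 = W z" unfolding exp_ph[symmetric] by (simp add: power2_eq_square exp_add[symmetric])
    then show ?thesis using y_pos[of z] by (simp add: power_mult_distrib Bf_def less_imp_le)
  qed
  have iB: "integrable lborel (\<lambda>z. W z * ((ramp' (y z))\<^sup>2 * y z))"
  proof (rule Bochner_Integration.integrable_bound)
    have t: "tempered (\<lambda>z. complex_of_real (ramp' (y z)) * (1 + complex_of_real (y z)))"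
      by (intro tempered_mult tempered_ramp' tempered_add tempered_const tempered_y)
    have ct: "continuous_on UNIV (\<lambda>z. complex_of_real (ramp' (y z)) * (1 + complex_of_real (y z)))"
      by (intro continuous_intros ramp'_cont yc)
    show "integrable lborel (\<lambda>z. W z * (cmod (complex_of_real (ramp' (y z)) * (1 + complex_of_real (y z))))\<^sup>2)"
      by (rule integrable_W_tempered[OF ct t Wc])
    show "(\<lambda>z. W z * ((ramp' (y z))\<^sup>2 * y z)) \<in> borel_measurable lborel"
      by (intro borel_measurable_lborel_cont continuous_intros Wc ramp'_cont yc)
    have "W z * ((ramp' (y z))\<^sup>2 * y z) \<le> W z * (cmod (complex_of_real (ramp' (y z)) * (1 + complex_of_real (y z))))\<^sup>2" for z
    proof (intro mult_left_mono W_nonneg)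
      have "1 + complex_of_real (y z) = complex_of_real (1 + y z)" by simp
      then have "(cmod (complex_of_real (ramp' (y z)) * (1 + complex_of_real (y z))))\<^sup>2 = (ramp' (y z))\<^sup>2 * (1 + y z)\<^sup>2"
        by (simp only: norm_mult norm_of_real power_mult_distrib power2_abs)
      moreover have "y z \<le> (1 + y z)\<^sup>2"
      proof -
        have "(1 + y z)\<^sup>2 = 1 + 2 * y z + (y z)\<^sup>2" by (simp add: power2_eq_square algebra_simps)
        then show ?thesis using y_pos[of z] zero_le_power2[of "y z"] by linarith
      qed
      ultimately show "(ramp' (y z))\<^sup>2 * y z \<le> (cmod (complex_of_real (ramp' (y z)) * (1 + complex_of_real (y z))))\<^sup>2"
        by (simp add: mult_left_mono)
    qed
    then show "AE z in lborel. norm (W z * ((ramp' (y z))\<^sup>2 * y z)) \<le> norm (W z * (cmod (complex_of_real (ramp' (y z)) * (1 + complex_of_real (y z))))\<^sup>2)"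
      using W_nonneg y_pos by (intro AE_I2) (simp add: abs_mult abs_of_nonneg less_imp_le)
  qed
  have LB: "L2 lborel (\<lambda>z. exp (- ph z / 2) * Bf z)"
    unfolding L2_def Bsq
  proof
    show "(\<lambda>z. exp (- ph z / 2) * Bf z) \<in> borel_measurable lborel"
      unfolding Bf_def by (intro borel_measurable_lborel_cont continuous_intros wt.phi_cont ramp'_cont yc) auto
  qed (rule iB)
  obtain F where F: "weak_hol F" "L2loc F" "L2 lborel (\<lambda>z. wt.E z * (complex_of_real (ramp (y z)) - F z))"
    "n2 lborel (\<lambda>z. wt.E z * (complex_of_real (ramp (y z)) - F z)) \<le> n2 lborel (\<lambda>z. exp (- ph z / 2) * Bf z)"
    using wt.hormander[OF Hpos[unfolded qf_def] eta bound[unfolded qf_def] LE Leta Bf0 LB] by blast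
  have sq: "(cmod (wt.E z * (complex_of_real (ramp (y z)) - F z)))\<^sup>2 = W z * (cmod (complex_of_real (ramp (y z)) - F z))\<^sup>2" for z
    by (simp add: norm_mult power_mult_distrib wt.norm_E_sq exp_ph)
  show ?thesis
    using F iB unfolding L2_def n2_def sq Bsq by blast
qed

end

section \<open>Polynomial approximation on polydisks\<close>

lemma root_unity_geometric:
  assumes N: "N > 0" and mk: "m < N" "k < N"
  defines "\<omega> \<equiv> exp (2 * of_real pi * \<i> / of_nat N)"
  shows "(\<Sum>l<N. (\<omega> ^ l) ^ m / (\<omega> ^ l) ^ k) = (if m = k then of_nat N else 0)"
proof -
  have w0: "\<omega> \<noteq> 0" by (simp add: \<omega>_def)
  have pw: "\<omega> ^ s = exp (2 * of_real pi * \<i> * of_nat s / of_nat N)" for s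
    unfolding \<omega>_def exp_of_nat_mult[symmetric] by (simp add: mult_ac)
  have one: "\<omega> ^ s = 1 \<longleftrightarrow> N dvd s" for s
    unfolding pw using complex_root_unity_eq_1[of N s] N by simp
  have wN: "\<omega> ^ N = 1" by (simp add: one)
  \<comment> \<open>s represents m - k modulo N without subtraction: (N - 1) k stands for
    -k.\<close>
  define s where "s = m + (N - 1) * k"
  have sk: "s + k = m + N * k"
    unfolding s_def using N by (cases N) auto
  have t: "(\<omega> ^ l) ^ m / (\<omega> ^ l) ^ k = (\<omega> ^ s) ^ l" for l
  proof -
    have "(\<omega> ^ s) ^ l * (\<omega> ^ l) ^ k = (\<omega> ^ (s + k)) ^ l"
      unfolding power_add power_mult_distrib by (simp add: power_mult[symmetric] mult.commute)
    also have "\<omega> ^ (s + k) = \<omega> ^ m"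
      unfolding sk power_add power_mult wN by simp
    also have "(\<omega> ^ m) ^ l = (\<omega> ^ l) ^ m"
      by (simp add: power_mult[symmetric] mult.commute)
    finally show ?thesis using w0 by (simp add: field_simps)
  qed
  show ?thesis
  proof (cases "m = k")
    case True
    then have "s = N * k" using sk by simp
    then have "\<omega> ^ s = 1" by (simp add: one)
    then show ?thesis unfolding t using True by simp
  next
    case False
    have "\<not> N dvd s"
    proof
      assume "N dvd s"
      then obtain c where "s = N * c" by (elim dvdE)
      then have "(s + k) mod N = k" using mk by simp
      moreover have "(m + N * k) mod N = m" using mk by simp
      ultimately show False using sk False by simp
    qed
    then have n1: "\<omega> ^ s \<noteq> 1" by (simp add: one)
    have "(\<omega> ^ s) ^ N = 1" by (simp add: power_mult[symmetric] one)
    then have "(\<Sum>l<N. (\<omega> ^ s) ^ l) = 0" using n1 by (simp add: geometric_sum)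
    then show ?thesis unfolding t using False by simp
  qed
qed

text \<open>Lagrange interpolation at the \<open>N\<close>-th roots of unity scaled by \<open>r\<close>.\<close>

definition root_interp :: "nat \<Rightarrow> real \<Rightarrow> nat \<Rightarrow> complex \<Rightarrow> complex" where
  "root_interp N r l t = (\<Sum>k<N. (t / (of_real r * exp (2 * of_real pi * \<i> / of_nat N) ^ l)) ^ k) / of_nat N"

text \<open>The interpolation reproduces monomials of degree below N. In degree m >= N its error is
  at most (N + 1) r^m, while Cauchy's estimate bounds the coefficient by B / r''^m, so the tail is
  (N + 1) B q^N / (1 - q) with q = r / r'' < 1. N depends on the radii, \<open>B\<close> and
  \<open>e\<close> alone: one set of nodes serves all slices of a function of several
  variables.\<close>

lemma root_interp_approx:
  assumes r: "0 < R" "R \<le> r" "r < r''" "r'' < 1" and e: "e > 0" and B: "B \<ge> 0"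
  shows "\<exists>N>0. \<forall>u. u holomorphic_on ball 0 1 \<longrightarrow> (\<forall>t\<in>cball 0 r''. cmod (u t) \<le> B) \<longrightarrow>
     (\<forall>t\<in>cball 0 R. cmod (u t - (\<Sum>l<N. root_interp N r l t * u (of_real r * exp (2 * of_real pi * \<i> / of_nat N) ^ l))) \<le> e)"
proof -
  define q where "q = r / r''"
  have q: "0 < q" "q < 1" using r by (auto simp: q_def)
  have l1: "(\<lambda>N. real N * q ^ N) \<longlonglongrightarrow> 0" using powser_times_n_limit_0[of q] q by simp
  have l2: "(\<lambda>N. q ^ N) \<longlonglongrightarrow> 0" using q by (intro LIMSEQ_realpow_zero) auto
  from tendsto_mult[OF tendsto_add[OF l1 l2] tendsto_const[of "B / (1 - q)"]]
  have "(\<lambda>N. (real N * q ^ N + q ^ N) * (B / (1 - q))) \<longlonglongrightarrow> 0" by simp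
  from LIMSEQ_D[OF this e] obtain N0 where N0: "\<And>N. N \<ge> N0 \<Longrightarrow> norm ((real N * q ^ N + q ^ N) * (B / (1 - q)) - 0) < e" by blast
  define N where "N = max N0 1"
  have N: "N > 0" by (simp add: N_def)
  have NB: "(real N * q ^ N + q ^ N) * (B / (1 - q)) \<le> e"
    using N0[of N] abs_ge_self[of "(real N * q ^ N + q ^ N) * (B / (1 - q))"] by (simp add: N_def)
  define \<omega> where "\<omega> = exp (2 * of_real pi * \<i> / of_nat N)"
  have w0: "\<omega> \<noteq> 0" by (simp add: \<omega>_def)
  have nw: "cmod \<omega> = 1"
  proof -
    have "\<omega> = exp (\<i> * of_real (2 * pi / real N))" by (simp add: \<omega>_def mult_ac)
    then show ?thesis by (simp only: norm_exp_i_times)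
  qed
  define a where "a l = of_real r * \<omega> ^ l" for l
  have na: "cmod (a l) = r" and a0: "a l \<noteq> 0" for l
    using r nw w0 by (auto simp: a_def norm_mult norm_power)
  have root_interp: "root_interp N r l t = (\<Sum>k<N. (t / a l) ^ k) / of_nat N" for l t by (simp add: root_interp_def a_def \<omega>_def)
  have mono: "(\<Sum>l<N. root_interp N r l t * a l ^ m) = t ^ m" if "m < N" for m t
  proof -
    have "(\<Sum>l<N. root_interp N r l t * a l ^ m) = (\<Sum>l<N. \<Sum>k<N. t ^ k * of_real r ^ m / of_real r ^ k / of_nat N * ((\<omega> ^ l) ^ m / (\<omega> ^ l) ^ k))"
      unfolding root_interp a_def by (simp add: sum_divide_distrib sum_distrib_right sum_distrib_left power_divide power_mult_distrib mult_ac)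
    also have "\<dots> = (\<Sum>k<N. \<Sum>l<N. t ^ k * of_real r ^ m / of_real r ^ k / of_nat N * ((\<omega> ^ l) ^ m / (\<omega> ^ l) ^ k))"
      by (rule sum.swap)
    also have "\<dots> = (\<Sum>k<N. t ^ k * of_real r ^ m / of_real r ^ k / of_nat N * (if m = k then of_nat N else 0))"
      unfolding sum_distrib_left[symmetric]
      by (rule sum.cong[OF refl]) (use root_unity_geometric[OF N that] in \<open>simp add: \<omega>_def\<close>)
    also have "\<dots> = (\<Sum>k<N. if k = m then t ^ m else 0)"
      by (rule sum.cong[OF refl]) (use N r in auto)
    also have "\<dots> = t ^ m" using that by simp
    finally show ?thesis .
  qed
  have LKb: "cmod (root_interp N r l t) \<le> 1" if "t \<in> cball 0 R" for l t
  proof -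
    have "cmod (t / a l) \<le> 1" using that r na[of l] by (simp add: norm_divide)
    then have "cmod (\<Sum>k<N. (t / a l) ^ k) \<le> (\<Sum>k<N. 1)"
      by (intro sum_norm_le) (simp add: norm_power power_le_one)
    then show ?thesis unfolding root_interp using N by (simp add: norm_divide divide_le_eq)
  qed
  have "cmod (u t - (\<Sum>l<N. root_interp N r l t * u (a l))) \<le> e"
    if u: "u holomorphic_on ball 0 1" "\<And>t. t \<in> cball 0 r'' \<Longrightarrow> cmod (u t) \<le> B" and t: "t \<in> cball 0 R" for u t
  proof -
    define c where "c n = (deriv ^^ n) u 0 / fact n" for n
    have cs: "(\<lambda>n. c n * w ^ n) sums u w" if "cmod w < 1" for w
      using holomorphic_power_series[OF u(1), of w] that by (simp add: c_def)
    have cb: "cmod (c n) \<le> B / r'' ^ n" for n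
    proof -
      have "cmod ((deriv ^^ n) u 0) \<le> fact n * B / r'' ^ n"
      proof (rule Cauchy_inequality)
        show "u holomorphic_on ball 0 r''" by (rule holomorphic_on_subset[OF u(1)]) (use r in auto)
        show "continuous_on (cball 0 r'') u"
          by (rule holomorphic_on_imp_continuous_on[OF holomorphic_on_subset[OF u(1)]]) (use r in auto)
        show "0 < r''" using r by simp
        show "cmod (u x) \<le> B" if "cmod (0 - x) = r''" for x using u(2)[of x] that by simp
      qed
      then show ?thesis by (simp add: c_def norm_divide field_simps)
    qed
    have tr: "cmod t \<le> r" "cmod t < 1" using t r by auto
    define T where "T m = t ^ m - (\<Sum>l<N. root_interp N r l t * a l ^ m)" for m
    have "(\<lambda>m. c m * t ^ m - (\<Sum>l<N. root_interp N r l t * (c m * a l ^ m))) sums (u t - (\<Sum>l<N. root_interp N r l t * u (a l)))"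
      by (intro sums_diff sums_sum sums_mult cs) (use tr na r in auto)
    moreover have "c m * t ^ m - (\<Sum>l<N. root_interp N r l t * (c m * a l ^ m)) = c m * T m" for m
      by (simp add: T_def sum_distrib_left algebra_simps)
    ultimately have S: "(\<lambda>m. c m * T m) sums (u t - (\<Sum>l<N. root_interp N r l t * u (a l)))" by simp
    have T0: "T m = 0" if "m < N" for m using mono[OF that, of t] by (simp add: T_def)
    have Tb: "cmod (T m) \<le> (real N + 1) * r ^ m" for m
    proof -
      have "cmod (\<Sum>l<N. root_interp N r l t * a l ^ m) \<le> (\<Sum>l<N. r ^ m)"
        using LKb[OF t] r by (intro sum_norm_le) (simp add: norm_mult norm_power na mult_left_le_one_le)
      moreover have "cmod (t ^ m) \<le> r ^ m" using tr by (simp add: norm_power power_mono)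
      ultimately show ?thesis unfolding T_def using norm_triangle_ineq4[of "t ^ m" "\<Sum>l<N. root_interp N r l t * a l ^ m"]
        by (simp add: algebra_simps)
    qed
    \<comment> \<open>The error vanishes on the first N monomials, so the series may be started at
      N.\<close>
    have S': "(\<lambda>m. c (m + N) * T (m + N)) sums (u t - (\<Sum>l<N. root_interp N r l t * u (a l)))"
      using S T0 by (subst sums_iff_shift) simp
    have b: "cmod (c (m + N) * T (m + N)) \<le> ((real N + 1) * B * q ^ N) * q ^ m" for m
    proof -
      have "cmod (c (m + N) * T (m + N)) \<le> (B / r'' ^ (m + N)) * ((real N + 1) * r ^ (m + N))"
        unfolding norm_mult using cb Tb B r by (intro mult_mono) auto
      also have "\<dots> = (real N + 1) * B * q ^ (m + N)" by (simp add: q_def power_divide)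
      finally show ?thesis by (simp add: power_add mult_ac)
    qed
    have gs: "(\<lambda>m. ((real N + 1) * B * q ^ N) * q ^ m) sums (((real N + 1) * B * q ^ N) * (1 / (1 - q)))"
      using q by (intro sums_mult geometric_sums) auto
    have "cmod (u t - (\<Sum>l<N. root_interp N r l t * u (a l))) \<le> ((real N + 1) * B * q ^ N) * (1 / (1 - q))"
      using norm_suminf_le[OF b sums_summable[OF gs]] sums_unique[OF S'] sums_unique[OF gs] by simp
    also have "\<dots> = (real N * q ^ N + q ^ N) * (B / (1 - q))" by (simp add: algebra_simps)
    also have "\<dots> \<le> e" by (rule NB)
    finally show ?thesis .
  qed
  then show ?thesis using N unfolding a_def \<omega>_def by blast
qed

section \<open>Several variables, one at a time\<close>

definition upd :: "complex^'n \<Rightarrow> 'n \<Rightarrow> complex \<Rightarrow> complex^'n" where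
  "upd z i t = (\<chi> j. if j = i then t else z $ j)"

definition mix :: "'n set \<Rightarrow> complex^'n \<Rightarrow> complex^'n \<Rightarrow> complex^'n" where
  "mix I w z = (\<chi> j. if j \<in> I then w $ j else z $ j)"

text \<open>The complex homogeneity of the differential demanded by \<open>holo_n\<close> turns,
  along a coordinate axis, into the ordinary complex derivative \<open>L (axis i 1)\<close>.\<close>

lemma holo_n_slice:
  assumes f: "holo_n f (polydisk 1)" and z: "z \<in> polydisk 1"
  shows "(\<lambda>t. f (upd z i t)) holomorphic_on ball 0 1"
  unfolding holomorphic_on_def
proof
  fix t :: complex assume t: "t \<in> ball 0 1"
  then have "upd z i t \<in> polydisk 1" using z by (auto simp: polydisk_def upd_def)
  then obtain L where L: "(f has_derivative L) (at (upd z i t))" "\<And>c v. L (c *s v) = c * L v"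
    using f unfolding holo_n_def by blast
  have eq: "upd z i s = upd z i 0 + axis i s" for s by (auto simp: upd_def axis_def vec_eq_iff)
  have bl: "bounded_linear (axis i :: complex \<Rightarrow> complex^'a)"
    unfolding linear_conv_bounded_linear[symmetric]
    by (intro linearI) (auto simp: axis_def vec_eq_iff)
  have "(upd z i has_derivative axis i) (at t)"
    using has_derivative_add[OF has_derivative_const[of "upd z i 0"] bounded_linear_imp_has_derivative[OF bl], of "at t"]
    by (simp only: eq[symmetric] add_0_left)
  from has_derivative_compose[OF this L(1)]
  have D: "((\<lambda>t. f (upd z i t)) has_derivative (\<lambda>h. L (axis i h))) (at t)" by simp
  have "L (axis i h) = L (axis i 1) * h" for h
  proof -
    have "axis i h = h *s axis i 1" by (auto simp: axis_def vec_eq_iff)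
    then show ?thesis using L(2)[of h "axis i 1"] by simp
  qed
  then have "(\<lambda>h. L (axis i h)) = (*) (L (axis i 1))" by (intro ext)
  with D have "((\<lambda>t. f (upd z i t)) has_field_derivative L (axis i 1)) (at t)"
    unfolding has_field_derivative_def by metis
  then show "(\<lambda>t. f (upd z i t)) field_differentiable at t within ball 0 1"
    using field_differentiable_at_within[of "\<lambda>t. f (upd z i t)" t "ball 0 1"] unfolding field_differentiable_def by blast
qed

lemma holo_n_cont: "holo_n f U \<Longrightarrow> continuous_on U f"
  unfolding holo_n_def
  by (intro continuous_at_imp_continuous_on ballI) (auto dest: has_derivative_continuous)

lemma compact_cpolydisk: "compact {z::complex^'n. \<forall>i. cmod (z $ i) \<le> r}"
proof -
  have "{z::complex^'n. \<forall>i. cmod (z $ i) \<le> r} = (\<Inter>i. (\<lambda>z. cmod (z $ i)) -` {..r})" by auto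
  moreover have "closed \<dots>"
    by (intro closed_INT ballI continuous_closed_vimage) (auto intro!: continuous_intros)
  moreover have "bounded {z::complex^'n. \<forall>i. cmod (z $ i) \<le> r}"
  proof (rule boundedI[where B="real CARD('n) * r"])
    fix z :: "complex^'n" assume "z \<in> {z. \<forall>i. cmod (z $ i) \<le> r}"
    then have "(\<Sum>i\<in>UNIV. cmod (z $ i)) \<le> (\<Sum>i\<in>(UNIV::'n set). r)" by (intro sum_mono) auto
    moreover have "norm z \<le> (\<Sum>i\<in>UNIV. cmod (z $ i))" unfolding norm_vec_def by (intro L2_set_le_sum) auto
    ultimately show "norm z \<le> real CARD('n) * r" by simp
  qed
  ultimately show ?thesis by (simp add: compact_eq_bounded_closed)
qed

text \<open>The functions obtained after interpolating in the variables of \<open>I\<close>; with \<open>I = UNIV\<close> they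
  are polynomials.\<close>

inductive_set interp_span :: "(complex^'n \<Rightarrow> complex) \<Rightarrow> real \<Rightarrow> 'n set \<Rightarrow> (complex^'n \<Rightarrow> complex) set" for f r I where
  interp_span_base: "cpoly p \<Longrightarrow> (\<And>j. cmod (w $ j) \<le> r) \<Longrightarrow> (\<lambda>z. p z * f (mix I w z)) \<in> interp_span f r I"
| interp_span_add: "F \<in> interp_span f r I \<Longrightarrow> G \<in> interp_span f r I \<Longrightarrow> (\<lambda>z. F z + G z) \<in> interp_span f r I"

lemma interp_span_sum:
  assumes "finite A" "A \<noteq> {}" "\<And>l. l \<in> A \<Longrightarrow> F l \<in> interp_span f r I"
  shows "(\<lambda>z. \<Sum>l\<in>A. F l z) \<in> interp_span f r I"
  using assms by (induction A rule: finite_ne_induct) (auto intro: interp_span_add)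

lemma cpoly_power: "cpoly p \<Longrightarrow> cpoly (\<lambda>z. p z ^ k)"
  by (induction k) (auto intro: cpoly_const cpoly_mult)

lemma cpoly_sum: "finite A \<Longrightarrow> (\<And>l. l \<in> A \<Longrightarrow> cpoly (F l)) \<Longrightarrow> cpoly (\<lambda>z. \<Sum>l\<in>A. F l z)"
  by (induction A rule: finite_induct) (auto intro: cpoly_const cpoly_add)

lemma cpoly_root_interp: "cpoly (\<lambda>z. root_interp N r l (z $ i))"
proof -
  define c where "c = inverse (of_real r * exp (2 * of_real pi * \<i> / of_nat N) ^ l)"
  have "cpoly (\<lambda>z. (\<Sum>k<N. (z $ i * c) ^ k) * inverse (of_nat N))"
    by (intro cpoly_mult cpoly_sum cpoly_power cpoly_const cpoly_coord) auto
  then show ?thesis by (simp add: root_interp_def c_def divide_inverse)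
qed

lemma cpoly_bounded: "cpoly p \<Longrightarrow> \<exists>C>0. \<forall>z\<in>polydisk R. cmod (p z) \<le> C"
proof (induction rule: cpoly.induct)
  case (cpoly_const c)
  then show ?case by (intro exI[of _ "cmod c + 1"]) (auto intro: add_nonneg_pos)
next
  case (cpoly_coord i)
  have "cmod (z $ i) \<le> \<bar>R\<bar> + 1" if "z \<in> polydisk R" for z
    using that[unfolded polydisk_def, simplified, rule_format, of i] by linarith
  then show ?case by (intro exI[of _ "\<bar>R\<bar> + 1"]) auto
next
  case (cpoly_add p q)
  then obtain C D where "C > 0" "\<forall>z\<in>polydisk R. cmod (p z) \<le> C" "D > 0" "\<forall>z\<in>polydisk R. cmod (q z) \<le> D" by blast
  then show ?case by (intro exI[of _ "C + D"]) (auto intro: norm_triangle_le add_mono)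
next
  case (cpoly_mult p q)
  then obtain C D where "C > 0" "\<forall>z\<in>polydisk R. cmod (p z) \<le> C" "D > 0" "\<forall>z\<in>polydisk R. cmod (q z) \<le> D" by blast
  then show ?case by (intro exI[of _ "C * D"]) (auto simp: norm_mult intro!: mult_mono)
qed

text \<open>Once every variable has been interpolated, f enters only through its values at finitely
  many nodes, multiplied by polynomials. The bound on the nodes in \<open>interp_span\<close> keeps
  all arguments of f in one compact polydisk.\<close>

lemma holo_n_cpoly_approx:
  fixes f :: "complex^'n \<Rightarrow> complex"
  assumes f: "holo_n f (polydisk 1)" and R: "0 < R" "R < 1" and e: "e > 0"
  shows "\<exists>p. cpoly p \<and> (\<forall>z\<in>polydisk R. cmod (f z - p z) \<le> e)"
proof -
  \<comment> \<open>Two radii dividing the interval from R to 1 in thirds: the nodes lie at radius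
    r, and Cauchy's estimate is taken at radius r''.\<close>
  define r where "r = (2 * R + 1) / 3"
  define r'' where "r'' = (R + 2) / 3"
  have r: "R \<le> r" "r < r''" "r'' < 1" "0 < r" using R by (auto simp: r_def r''_def)
  define K where "K = {z::complex^'n. \<forall>i. cmod (z $ i) \<le> r''}"
  have K1: "K \<subseteq> polydisk 1" using r by (auto simp: K_def polydisk_def intro: le_less_trans)
  have "compact (f ` K)"
    unfolding K_def by (intro compact_continuous_image compact_cpolydisk continuous_on_subset[OF holo_n_cont[OF f] K1[unfolded K_def]])
  then obtain B where B: "B > 0" "\<And>z. z \<in> K \<Longrightarrow> cmod (f z) \<le> B"
    using compact_imp_bounded[of "f ` K"] unfolding bounded_pos by auto
  have step: "\<exists>G\<in>interp_span f r (insert i I). \<forall>z\<in>polydisk R. cmod (F z - G z) \<le> e" if "F \<in> interp_span f r I" "e > 0" "i \<notin> I" for F I i e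
    using that
  proof (induction arbitrary: e rule: interp_span.induct)
    case (interp_span_base p w)
    obtain C where C: "C > 0" "\<And>z. z \<in> polydisk R \<Longrightarrow> cmod (p z) \<le> C" using cpoly_bounded[OF interp_span_base(1)] by blast
    \<comment> \<open>The interpolation error gets multiplied by the polynomial factor
      \<open>p\<close>, bounded by C.\<close>
    have "e / C > 0" using interp_span_base C by simp
    from root_interp_approx[OF R(1) r(1-3) this less_imp_le[OF B(1)]] obtain N where N: "N > 0"
      "\<And>u t. u holomorphic_on ball 0 1 \<Longrightarrow> (\<forall>t\<in>cball 0 r''. cmod (u t) \<le> B) \<Longrightarrow> t \<in> cball 0 R \<Longrightarrow>
         cmod (u t - (\<Sum>l<N. root_interp N r l t * u (of_real r * exp (2 * of_real pi * \<i> / of_nat N) ^ l))) \<le> e / C" by blast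
    define a where "a l = of_real r * exp (2 * of_real pi * \<i> / of_nat N) ^ l" for l
    have na: "cmod (a l) \<le> r" for l
    proof -
      have "exp (2 * of_real pi * \<i> / of_nat N) = exp (\<i> * of_real (2 * pi / real N))" by (simp add: mult_ac)
      then have "cmod (exp (2 * of_real pi * \<i> / of_nat N)) = 1" by (simp only: norm_exp_i_times)
      then show ?thesis using r by (simp add: a_def norm_mult norm_power)
    qed
    define G where "G z = (\<Sum>l<N. (p z * root_interp N r l (z $ i)) * f (mix (insert i I) (upd w i (a l)) z))" for z
    have "G \<in> interp_span f r (insert i I)"
      unfolding G_def[abs_def]
    proof (rule interp_span_sum)
      show "{..<N} \<noteq> {}" using N by auto
      show "(\<lambda>z. (p z * root_interp N r l (z $ i)) * f (mix (insert i I) (upd w i (a l)) z)) \<in> interp_span f r (insert i I)" for l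
        by (rule interp_span.interp_span_base[OF cpoly_mult[OF interp_span_base(1) cpoly_root_interp]]) (use interp_span_base(2) na in \<open>auto simp: upd_def\<close>)
    qed simp
    moreover have "cmod (p z * f (mix I w z) - G z) \<le> e" if z: "z \<in> polydisk R" for z
    proof -
      define Z where "Z = mix I w z"
      have ZK: "Z \<in> K" unfolding K_def
      proof (intro CollectI allI)
        fix j
        have "cmod (z $ j) \<le> R" "cmod (w $ j) \<le> r" using z interp_span_base(2)[of j] by (auto simp: polydisk_def less_imp_le)
        then show "cmod (Z $ j) \<le> r''" using r by (auto simp: Z_def mix_def)
      qed
      have uK: "upd Z i t \<in> K" if "cmod t \<le> r''" for t using ZK that by (auto simp: K_def upd_def)
      have m: "mix (insert i I) (upd w i t) z = upd Z i t" for t by (auto simp: mix_def upd_def Z_def vec_eq_iff)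
      show ?thesis
      proof -
        have "cmod (f (upd Z i (z $ i)) - (\<Sum>l<N. root_interp N r l (z $ i) * f (upd Z i (a l)))) \<le> e / C"
          unfolding a_def
        proof (rule N(2)[where u="\<lambda>t. f (upd Z i t)"])
          show "(\<lambda>t. f (upd Z i t)) holomorphic_on ball 0 1" by (rule holo_n_slice[OF f]) (use ZK K1 in auto)
          show "\<forall>t\<in>cball 0 r''. cmod (f (upd Z i t)) \<le> B" using uK B(2) by simp
          show "z $ i \<in> cball 0 R" using z by (simp add: polydisk_def less_imp_le)
        qed
        \<comment> \<open>Variable i is still free because i is outside I, so reinserting its own
          value changes nothing.\<close>
        moreover have "upd Z i (z $ i) = Z" using interp_span_base(4) by (auto simp: upd_def Z_def mix_def vec_eq_iff)
        moreover have "p z * f (mix I w z) - G z = p z * (f Z - (\<Sum>l<N. root_interp N r l (z $ i) * f (upd Z i (a l))))"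
          unfolding G_def m Z_def[symmetric] by (simp add: sum_distrib_left algebra_simps)
        ultimately have "cmod (p z * f (mix I w z) - G z) \<le> C * (e / C)"
          using C(2)[OF z] C(1) by (simp only: norm_mult) (intro mult_mono, auto)
        then show ?thesis using C(1) by simp
      qed
    qed
    ultimately show ?case by blast
  next
    case (interp_span_add F1 F2)
    obtain G1 where G1: "G1 \<in> interp_span f r (insert i I)" "\<And>z. z \<in> polydisk R \<Longrightarrow> cmod (F1 z - G1 z) \<le> e / 2" using interp_span_add(3)[of "e / 2"] interp_span_add(5,6) by auto
    obtain G2 where G2: "G2 \<in> interp_span f r (insert i I)" "\<And>z. z \<in> polydisk R \<Longrightarrow> cmod (F2 z - G2 z) \<le> e / 2" using interp_span_add(4)[of "e / 2"] interp_span_add(5,6) by auto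
    have "cmod (F1 z + F2 z - (G1 z + G2 z)) \<le> e" if "z \<in> polydisk R" for z
    proof -
      have "F1 z + F2 z - (G1 z + G2 z) = (F1 z - G1 z) + (F2 z - G2 z)" by simp
      then show ?thesis using norm_triangle_ineq[of "F1 z - G1 z" "F2 z - G2 z"] G1(2)[OF that] G2(2)[OF that] by (simp only:)
    qed
    then show ?case by (intro bexI[OF _ interp_span.interp_span_add[OF G1(1) G2(1)]] ballI)
  qed
  have "\<exists>F\<in>interp_span f r I. \<forall>z\<in>polydisk R. cmod (f z - F z) \<le> e" if "finite I" "e > 0" for I e
    using that
  proof (induction I arbitrary: e rule: finite_induct)
    case empty
    have "(\<lambda>z. 1 * f (mix {} 0 z)) \<in> interp_span f r {}" by (rule interp_span.interp_span_base[OF cpoly_const]) (use r in auto)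
    moreover have "mix {} 0 z = z" for z :: "complex^'n" by (simp add: mix_def)
    ultimately show ?case using empty by (intro bexI[of _ "\<lambda>z. 1 * f (mix {} 0 z)"]) auto
  next
    case (insert i I)
    obtain F where F: "F \<in> interp_span f r I" "\<And>z. z \<in> polydisk R \<Longrightarrow> cmod (f z - F z) \<le> e / 2" using insert(3)[of "e / 2"] insert(4) by auto
    obtain G where G: "G \<in> interp_span f r (insert i I)" "\<And>z. z \<in> polydisk R \<Longrightarrow> cmod (F z - G z) \<le> e / 2" using step[OF F(1), of "e / 2" i] insert(2,4) by auto
    have "cmod (f z - G z) \<le> e" if "z \<in> polydisk R" for z
      using norm_triangle_ineq[of "f z - F z" "F z - G z"] F(2)[OF that] G(2)[OF that] by simp
    then show ?case using G(1) by blast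
  qed
  from this[OF finite_class.finite_UNIV e] obtain F where F: "F \<in> interp_span f r UNIV" "\<forall>z\<in>polydisk R. cmod (f z - F z) \<le> e" by blast
  have "cpoly F"
    using F(1)
  proof (induction rule: interp_span.induct)
    case (interp_span_base p w)
    have "mix UNIV w z = w" for z by (simp add: mix_def)
    then show ?case using cpoly_mult[OF interp_span_base(1) cpoly_const[of "f w"]] by simp
  qed (rule cpoly_add)
  then show ?thesis using F(2) by blast
qed

section \<open>The uniform bound\<close>

lemma polydisk_open: "open (polydisk R :: (complex^'n) set)"
proof -
  have "polydisk R = (\<Inter>i\<in>UNIV. {z::complex^'n. cmod (z $ i) < R})" by (auto simp: polydisk_def)
  also have "open \<dots>"
    by (intro open_INT ballI open_Collect_less continuous_intros) auto
  finally show ?thesis .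
qed

lemma polydisk_sets [measurable]: "polydisk R \<in> sets borel"
  by (rule borel_open[OF polydisk_open])

lemma polydisk_mono: "r \<le> R \<Longrightarrow> polydisk r \<subseteq> polydisk R"
  by (auto simp: polydisk_def intro: less_le_trans)

lemma polydisk_cball: "(polydisk R :: (complex^'n::finite) set) \<subseteq> cball 0 (real CARD('n) * R)"
proof
  fix z :: "complex^'n" assume "z \<in> polydisk R"
  then have "(\<Sum>i\<in>UNIV. cmod (z $ i)) \<le> (\<Sum>i\<in>(UNIV::'n set). R)"
    by (intro sum_mono) (auto simp: polydisk_def less_imp_le)
  moreover have "norm z \<le> (\<Sum>i\<in>UNIV. cmod (z $ i))" unfolding norm_vec_def by (intro L2_set_le_sum) auto
  ultimately show "z \<in> cball 0 (real CARD('n) * R)" by simp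
qed

lemma polydisk_indicator_integrable: "integrable lborel (\<lambda>z. indicator (polydisk R :: (complex^'n) set) z :: real)"
proof -
  have "emeasure lborel (polydisk R :: (complex^'n) set) \<le> emeasure lborel (cball (0::complex^'n) (real CARD('n) * R))"
    by (intro emeasure_mono polydisk_cball) auto
  also have "\<dots> < \<infinity>" by (rule emeasure_lborel_cball_finite)
  finally show ?thesis by (subst integrable_indicator_iff) auto
qed

lemma polydisk_integrable:
  fixes u :: "complex^'n \<Rightarrow> real"
  assumes [measurable]: "u \<in> borel_measurable borel" and C: "\<And>z. z \<in> polydisk R \<Longrightarrow> \<bar>u z\<bar> \<le> C"
  shows "integrable lborel (\<lambda>z. indicator (polydisk R) z * u z)"
proof (rule Bochner_Integration.integrable_bound)
  show "integrable lborel (\<lambda>z::complex^'n. indicator (polydisk R) z * C)"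
    by (intro integrable_mult_left polydisk_indicator_integrable)
  show "AE z in lborel. norm (indicator (polydisk R) z * u z) \<le> norm (indicator (polydisk R) z * C)"
    by (intro AE_I2) (auto simp: indicator_def dest: C)
qed simp

lemma polydisk_cont_bounded:
  fixes u :: "complex^'n \<Rightarrow> real"
  assumes "continuous_on UNIV u"
  shows "\<exists>C. \<forall>z\<in>polydisk R. \<bar>u z\<bar> \<le> C"
proof -
  have "compact (u ` {z. \<forall>i. cmod (z $ i) \<le> R})"
    by (intro compact_continuous_image compact_cpolydisk continuous_on_subset[OF assms]) auto
  then obtain C where "\<And>z. (\<forall>i. cmod (z $ i) \<le> R) \<Longrightarrow> \<bar>u z\<bar> \<le> C"
    using compact_imp_bounded[of "u ` {z. \<forall>i. cmod (z $ i) \<le> R}"] unfolding bounded_iff by auto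
  then show ?thesis by (intro exI[of _ C]) (auto simp: polydisk_def less_imp_le)
qed

lemma polydisk_cont_integrable:
  fixes u :: "complex^'n \<Rightarrow> real"
  assumes u: "continuous_on UNIV u"
  shows "integrable lborel (\<lambda>z. indicator (polydisk R) z * u z)"
proof -
  obtain C where "\<forall>z\<in>polydisk R. \<bar>u z\<bar> \<le> C" using polydisk_cont_bounded[OF u] by blast
  then show ?thesis by (intro polydisk_integrable[where C=C] borel_measurable_continuous_onI u) auto
qed

lemma polydisk_bounded_convergence:
  fixes u :: "nat \<Rightarrow> complex^'n \<Rightarrow> real"
  assumes [measurable]: "\<And>m. u m \<in> borel_measurable borel" "U \<in> borel_measurable borel"
    and C: "\<And>m z. z \<in> polydisk R \<Longrightarrow> \<bar>u m z\<bar> \<le> C"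
    and l: "AE z in lborel. z \<in> polydisk R \<longrightarrow> (\<lambda>m. u m z) \<longlonglongrightarrow> U z"
  shows "(\<lambda>m. \<integral>z. indicator (polydisk R) z * u m z \<partial>lborel) \<longlonglongrightarrow> (\<integral>z. indicator (polydisk R) z * U z \<partial>lborel)"
proof (rule integral_dominated_convergence[where w="\<lambda>z. indicator (polydisk R) z * C"])
  show "integrable lborel (\<lambda>z::complex^'n. indicator (polydisk R) z * C)"
    by (intro integrable_mult_left polydisk_indicator_integrable)
  show "AE z in lborel. (\<lambda>m. indicator (polydisk R) z * u m z) \<longlonglongrightarrow> indicator (polydisk R) z * U z"
    using l by eventually_elim (auto simp: indicator_def)
  show "AE z in lborel. norm (indicator (polydisk R) z * u m z) \<le> indicator (polydisk R) z * C" for m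
    by (intro AE_I2) (auto simp: indicator_def dest: C)
qed auto

lemma L2loc_polydisk_integrable:
  fixes F :: "complex^'n \<Rightarrow> complex"
  assumes F: "L2loc F" and w [measurable]: "w \<in> borel_measurable borel" and C: "\<And>z. \<bar>w z\<bar> \<le> C"
  shows "integrable lborel (\<lambda>z. indicator (polydisk R) z * (w z * (cmod (F z))\<^sup>2))"
proof (rule Bochner_Integration.integrable_bound)
  note [measurable] = L2loc_measurable[OF F]
  show "integrable lborel (\<lambda>z. C * (norm (ib (real CARD('n) * R) F z))\<^sup>2)"
    using L2loc_L2[OF F] unfolding L2_def by (intro integrable_mult_right) blast
  have "\<bar>indicator (polydisk R) z * (w z * (cmod (F z))\<^sup>2)\<bar> \<le> \<bar>C * (norm (ib (real CARD('n) * R) F z))\<^sup>2\<bar>" for z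
  proof (cases "z \<in> polydisk R")
    case True
    then have "z \<in> cball 0 (real CARD('n) * R)" using polydisk_cball by blast
    then show ?thesis using True C[of z] by (auto simp: ib_def abs_mult intro!: mult_right_mono)
  qed simp
  then show "AE z in lborel. norm (indicator (polydisk R) z * (w z * (cmod (F z))\<^sup>2)) \<le> norm (C * (norm (ib (real CARD('n) * R) F z))\<^sup>2)"
    by (intro AE_I2) (simp only: real_norm_def)
  show "(\<lambda>z. indicator (polydisk R) z * (w z * (cmod (F z))\<^sup>2)) \<in> borel_measurable lborel"
    by measurable
qed

text \<open>F is determined only almost everywhere, so the lower bound is stated for its
  mollifications. By scale independence all of them may be evaluated at the one scale whose kernel
  has radius R - r, where L^2 closeness on the larger polydisk controls pointwise values.\<close>

lemma weak_hol_lower_bound: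
  fixes r R :: real
  assumes r: "0 < r" "r < R"
  shows "\<exists>\<kappa>>0. \<forall>F::complex^'n \<Rightarrow> complex. weak_hol F \<longrightarrow> L2loc F \<longrightarrow>
      (\<integral>z. indicator (polydisk R) z * (cmod (F z - 1))\<^sup>2 \<partial>lborel) \<le> \<kappa> \<longrightarrow>
      (\<forall>s>0. \<forall>x\<in>polydisk r. 1 / 2 \<le> cmod (mollify s F x))"
proof -
  define t where "t = 1 / (R - r)\<^sup>2"
  have t: "t > 0" using r by (simp add: t_def)
  have st: "1 / sqrt t = R - r" using r by (simp add: t_def real_sqrt_divide)
  define km0 where "km0 = km TYPE('n)"
  have km0: "km0 > 0" by (simp add: km0_def km_pos)
  define K where "K = t ^ CARD('n) / km0"
  have K: "K > 0" using t km0 by (simp add: K_def)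
  define V where "V = integral\<^sup>L lborel (\<lambda>z::complex^'n. indicator (polydisk R) z :: real)"
  have V: "V \<ge> 0" unfolding V_def by (intro integral_nonneg_AE) auto
  \<comment> \<open>|G| <= \<alpha>/2 + |G|^2 / (2 \<alpha>) splits the error of the average into
    two parts; \<alpha> and \<kappa> are chosen so that each contributes at most 1/4.\<close>
  define \<alpha> where "\<alpha> = 1 / (2 * K * (V + 1))"
  have \<alpha>: "\<alpha> > 0" using K V by (simp add: \<alpha>_def)
  define \<kappa> where "\<kappa> = \<alpha> / (2 * K)"
  have \<kappa>: "\<kappa> > 0" using \<alpha> K by (simp add: \<kappa>_def)
  have "1 / 2 \<le> cmod (mollify s F x)" if F: "weak_hol F" "L2loc F" and le: "(\<integral>z. indicator (polydisk R) z * (cmod (F z - 1))\<^sup>2 \<partial>lborel) \<le> \<kappa>"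
    and s: "s > 0" and x: "x \<in> polydisk r" for F :: "complex^'n \<Rightarrow> complex" and s x
  proof -
    note [measurable] = L2loc_measurable[OF F(2)]
    define G where "G y = F y + (- 1)" for y
    have G: "L2loc G" unfolding G_def[abs_def] by (intro L2loc_add F L2loc_cont continuous_on_const)
    note [measurable] = L2loc_measurable[OF G]
    have iG: "integrable lborel (\<lambda>z. indicator (polydisk R) z * (cmod (G z))\<^sup>2)"
      using L2loc_polydisk_integrable[OF G, of "\<lambda>_. 1" 1 R] by simp
    have e1: "mollify s F x = mollify t F x" unfolding mollify_def using weak_hol_cv_const[OF F(1) s t] by simp
    have i1: "integrable lborel (\<lambda>y. F y * krc t (x - y))"
      by (rule cv_integrable[OF L2loc_locint[OF F(2)] krc_cont krc_bsupp[OF t]])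
    have i2: "integrable lborel (\<lambda>y. krc t (x - y))"
      unfolding krc_def by (intro integrable_of_real kr_integrable t)
    have m2: "(\<integral>y. krc t (x - y) \<partial>lborel) = complex_of_real km0"
      unfolding krc_def km0_def integral_complex_of_real kr_mass[OF t] by simp
    have "(\<integral>y. G y * krc t (x - y) \<partial>lborel) = (\<integral>y. F y * krc t (x - y) - krc t (x - y) \<partial>lborel)"
      by (simp add: G_def algebra_simps)
    also have "\<dots> = cv F (krc t) x - complex_of_real km0"
      unfolding cv_def using i1 i2 by (simp only: Bochner_Integration.integral_diff m2)
    finally have e2: "mollify t F x - 1 = (\<integral>y. G y * krc t (x - y) \<partial>lborel) / complex_of_real km0"
      using km0 by (simp add: mollify_def km0_def[symmetric] field_simps)
    have pt: "cmod (G y * krc t (x - y)) \<le> indicator (polydisk R) y * (t ^ CARD('n) * (\<alpha> / 2)) + t ^ CARD('n) / (2 * \<alpha>) * (indicator (polydisk R) y * (cmod (G y))\<^sup>2)" for y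
    proof (cases "norm (x - y) \<ge> R - r")
      case True
      then have "krc t (x - y) = 0" using kr_zero[OF t, of "x - y"] st by (simp add: krc_def)
      then show ?thesis using t \<alpha> by simp
    next
      case False
      have "cmod (y $ i) < R" for i
      proof -
        have "cmod (y $ i) \<le> cmod (x $ i) + cmod ((x - y) $ i)" using norm_triangle_ineq4[of "x $ i" "(x - y) $ i"] by simp
        moreover have "cmod ((x - y) $ i) \<le> norm (x - y)" by (rule Finite_Cartesian_Product.norm_nth_le)
        moreover have "cmod (x $ i) < r" using x by (simp add: polydisk_def)
        ultimately show ?thesis using False by linarith
      qed
      then have y: "y \<in> polydisk R" by (simp add: polydisk_def)
      have k: "cmod (krc t (x - y)) \<le> t ^ CARD('n)"
        using t bump_bounds[of t "x - y"] by (simp add: krc_def kr_def norm_mult norm_power mult_left_le)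
      have ag: "cmod (G y) \<le> \<alpha> / 2 + (cmod (G y))\<^sup>2 / (2 * \<alpha>)"
      proof -
        have "0 \<le> (cmod (G y) - \<alpha>)\<^sup>2 / (2 * \<alpha>)" using \<alpha> by simp
        also have "\<dots> = (cmod (G y))\<^sup>2 / (2 * \<alpha>) + \<alpha> / 2 - cmod (G y)"
          using \<alpha> by (simp add: power2_eq_square field_simps)
        finally show ?thesis by simp
      qed
      have "cmod (G y * krc t (x - y)) \<le> (\<alpha> / 2 + (cmod (G y))\<^sup>2 / (2 * \<alpha>)) * t ^ CARD('n)"
        unfolding norm_mult using ag k \<alpha> by (intro mult_mono) auto
      then show ?thesis using y by (simp add: field_simps)
    qed
    have "cmod (\<integral>y. G y * krc t (x - y) \<partial>lborel) \<le> (\<integral>y. cmod (G y * krc t (x - y)) \<partial>lborel)"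
      by (rule integral_norm_bound)
    also have "\<dots> \<le> (\<integral>y. indicator (polydisk R) y * (t ^ CARD('n) * (\<alpha> / 2)) + t ^ CARD('n) / (2 * \<alpha>) * (indicator (polydisk R) y * (cmod (G y))\<^sup>2) \<partial>lborel)"
    proof (rule integral_mono)
      show "integrable lborel (\<lambda>y. cmod (G y * krc t (x - y)))"
        by (intro integrable_norm cv_integrable L2loc_locint G krc_cont krc_bsupp t)
      show "integrable lborel (\<lambda>y. indicator (polydisk R) y * (t ^ CARD('n) * (\<alpha> / 2)) + t ^ CARD('n) / (2 * \<alpha>) * (indicator (polydisk R) y * (cmod (G y))\<^sup>2))"
        by (intro Bochner_Integration.integrable_add integrable_mult_left integrable_mult_right polydisk_indicator_integrable iG)
    qed (rule pt)
    also have "\<dots> = V * (t ^ CARD('n) * (\<alpha> / 2)) + t ^ CARD('n) / (2 * \<alpha>) * (\<integral>y. indicator (polydisk R) y * (cmod (G y))\<^sup>2 \<partial>lborel)"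
      unfolding V_def
      by (subst Bochner_Integration.integral_add) (auto intro!: integrable_mult_left integrable_mult_right polydisk_indicator_integrable iG)
    also have "\<dots> \<le> V * (t ^ CARD('n) * (\<alpha> / 2)) + t ^ CARD('n) / (2 * \<alpha>) * \<kappa>"
      using le t \<alpha> by (intro add_left_mono mult_left_mono) (auto simp: G_def)
    also have "\<dots> = km0 * (K * \<alpha> * V / 2 + K * \<kappa> / (2 * \<alpha>))" using km0 \<alpha> by (simp add: K_def field_simps)
    also have "K * \<kappa> / (2 * \<alpha>) = 1 / 4" using \<alpha> K by (simp add: \<kappa>_def)
    also have "K * \<alpha> * V / 2 = V / (4 * (V + 1))" using K V by (simp add: \<alpha>_def)
    finally have "cmod (\<integral>y. G y * krc t (x - y) \<partial>lborel) / km0 \<le> V / (4 * (V + 1)) + 1 / 4"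
      using km0 by (simp only: pos_divide_le_eq mult.commute)
    also have "V / (4 * (V + 1)) \<le> 1 / 4" using V by (simp add: field_simps)
    finally have "cmod (mollify s F x - 1) \<le> 1 / 2" unfolding e1 e2 using km0 by (simp add: norm_divide)
    then show ?thesis using norm_triangle_ineq2[of 1 "1 - mollify s F x"] by (simp add: norm_minus_commute)
  qed
  then show ?thesis using \<kappa> by blast
qed

text \<open>The bound |mollify F|^2 >= 1/4 holds at every scale. Multiplied by sqrt w, the
  mollifications converge in L^2 of the polydisk, so the bound survives in integrated form for F
  itself.\<close>

lemma weak_hol_weight_bound:
  fixes F :: "complex^'n \<Rightarrow> complex" and r :: real
  assumes F: "L2loc F" and lb: "\<And>s x. s > 0 \<Longrightarrow> x \<in> polydisk r \<Longrightarrow> 1 / 2 \<le> cmod (mollify s F x)"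
    and w: "continuous_on UNIV w" "\<And>z. 0 \<le> w z" "\<And>z. w z \<le> C"
  shows "(\<integral>z. indicator (polydisk r) z * w z \<partial>lborel) \<le> 4 * (\<integral>z. indicator (polydisk r) z * (w z * (cmod (F z))\<^sup>2) \<partial>lborel)"
proof -
  define P where "P = real CARD('n) * r"
  define c where "c z = (indicator (polydisk r) z :: real) * sqrt (w z)" for z
  note [measurable] = L2loc_measurable[OF F] borel_measurable_continuous_onI[OF w(1)]
  have [measurable]: "c \<in> borel_measurable borel" unfolding c_def[abs_def] by measurable
  have C0: "C \<ge> 0" using w(2,3)[of 0] by linarith
  have cb: "norm (c z *\<^sub>R a) \<le> sqrt C * norm (indicator (cball 0 P) z *\<^sub>R a)" for z and a :: complex
  proof (cases "z \<in> polydisk r")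
    case True
    then have "z \<in> cball 0 P" unfolding P_def using polydisk_cball by blast
    then show ?thesis using True w(2,3)[of z] by (auto simp: c_def intro!: mult_right_mono)
  qed (simp add: c_def C0)
  define f where "f n z = c z *\<^sub>R mollify (real (Suc n)) F z" for n z
  define G where "G z = c z *\<^sub>R F z" for z
  have cont: "continuous_on UNIV (mollify (real (Suc n)) F)" for n by (intro mollify_cont L2loc_locint F) simp
  note [measurable] = borel_measurable_continuous_onI[OF cont]
  have L2f: "L2 lborel (f n)" for n
    by (rule L2_bound[OF L2_ib_cont[OF cont, of P n], where C="sqrt C"]) (unfold f_def[abs_def] ib_def, measurable, rule cb)
  have L2G: "L2 lborel G"
    by (rule L2_bound[OF L2loc_L2[OF F, of P], where C="sqrt C"]) (unfold G_def[abs_def] ib_def, measurable, rule cb)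
  have dif: "n2 lborel (\<lambda>z. f n z - G z) \<le> (sqrt C)\<^sup>2 * n2 lborel (ib P (\<lambda>x. mollify (real (Suc n)) F x - F x))" for n
  proof (rule n2_mono_bound[OF mollify_conv_ib(2)[OF F] L2_diff[OF L2f L2G]])
    show "norm (f n z - G z) \<le> sqrt C * norm (ib P (\<lambda>x. mollify (real (Suc n)) F x - F x) z)" for z
      using cb[of z "mollify (real (Suc n)) F z - F z"] by (simp only: f_def G_def ib_def scaleR_diff_right)
  qed
  have "(\<lambda>n. n2 lborel (\<lambda>z. f n z - G z)) \<longlonglongrightarrow> 0"
  proof (rule tendsto_sandwich[OF _ _ tendsto_const])
    show "(\<lambda>n. (sqrt C)\<^sup>2 * n2 lborel (ib P (\<lambda>x. mollify (real (Suc n)) F x - F x))) \<longlonglongrightarrow> 0"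
      using tendsto_mult_right_zero[OF mollify_conv_ib(1)[OF F, of P]] .
  qed (use dif in auto)
  then have lim: "(\<lambda>n. n2 lborel (f n)) \<longlonglongrightarrow> n2 lborel G" by (rule n2_tendsto[OF L2f L2G])
  have sq: "(norm (c z *\<^sub>R a))\<^sup>2 = indicator (polydisk r) z * (w z * (cmod a)\<^sup>2)" for z a
    using w(2)[of z] by (auto simp: c_def power_mult_distrib indicator_def)
  have "(1 / 4) * (\<integral>z. indicator (polydisk r) z * w z \<partial>lborel) \<le> n2 lborel (f n)" for n
  proof -
    have "(\<integral>z. (1 / 4) * (indicator (polydisk r) z * w z) \<partial>lborel) \<le> (\<integral>z. (norm (f n z))\<^sup>2 \<partial>lborel)"
    proof (rule integral_mono)
      show "integrable lborel (\<lambda>z. (1 / 4) * (indicator (polydisk r) z * w z))"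
        by (intro integrable_mult_right polydisk_cont_integrable w)
      show "integrable lborel (\<lambda>z. (norm (f n z))\<^sup>2)" using L2f by (simp add: L2_def)
      show "(1 / 4) * (indicator (polydisk r) z * w z) \<le> (norm (f n z))\<^sup>2" for z
      proof (cases "z \<in> polydisk r")
        case True
        have "(1 / 2)\<^sup>2 \<le> (cmod (mollify (real (Suc n)) F z))\<^sup>2" by (intro power_mono lb True) auto
        then have "w z * (1 / 4) \<le> w z * (cmod (mollify (real (Suc n)) F z))\<^sup>2"
          by (intro mult_left_mono w) (simp add: power2_eq_square)
        then show ?thesis unfolding f_def sq using True by simp
      qed simp
    qed
    then show ?thesis by (simp add: n2_def)
  qed
  then have "(1 / 4) * (\<integral>z. indicator (polydisk r) z * w z \<partial>lborel) \<le> n2 lborel G"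
    by (intro LIMSEQ_le_const[OF lim]) auto
  then show ?thesis unfolding n2_def G_def sq by simp
qed

lemma cpoly_cont: "cpoly p \<Longrightarrow> continuous_on UNIV p"
  by (induction rule: cpoly.induct) (auto intro!: continuous_intros)

section \<open>The cut-off variable as a function of |q|^2\<close>

lemma ramp_zero: "t \<le> 1 / 2 \<Longrightarrow> ramp t = 0" "t \<le> 1 / 2 \<Longrightarrow> ramp' t = 0"
  by (auto simp: ramp_def ramp'_def pos_part_def)

lemma ramp_one: "ramp 1 = 1" "ramp' 1 = 0"
  by (auto simp: ramp_def ramp'_def pos_part_def)

text \<open>\<open>y\<close> as a function of t = |q|^2 alone, so that limits in m and in k can be
  taken with |f|^2 in place of the squared norm of a polynomial vector.\<close>

definition yk :: "nat \<Rightarrow> real \<Rightarrow> real" where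
  "yk k t = (t + (1/4)^k) powr (1 / real k)"

lemma yk_measurable [measurable]: "yk k \<in> borel_measurable borel"
  unfolding yk_def[abs_def] by measurable

lemma yk_pos: "t \<ge> 0 \<Longrightarrow> yk k t > 0"
  using add_nonneg_pos[of t "(1/4)^k"] by (simp add: yk_def)

lemma yk_le:
  assumes t: "t \<ge> 0" and k: "k \<ge> 1"
  shows "yk k t \<le> t + 2"
proof -
  define s where "s = t + (1/4)^k"
  have s: "s > 0" "s \<le> t + 1" unfolding s_def using t by (auto intro: add_nonneg_pos simp: power_le_one)
  have "s powr (1 / real k) \<le> s + 1"
  proof (cases "s \<le> 1")
    case True
    then have "s powr (1 / real k) \<le> 1" using s by (intro powr_le1) auto
    then show ?thesis using s by simp
  next
    case False
    then have "s powr (1 / real k) \<le> s powr 1" using k by (intro powr_mono) auto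
    then show ?thesis using s by simp
  qed
  then show ?thesis using s unfolding yk_def s_def[symmetric] by simp
qed

text \<open>For k >= 1, t + 4^(-k) <= 2 4^(-k) <= 2^(-k), and the k-th root is 1/2: the base 4 is
  matched to the threshold 1/2 of \<open>ramp\<close>.\<close>

lemma yk_half:
  assumes t: "0 \<le> t" "t \<le> (1/4)^k" and k: "k \<ge> 1"
  shows "yk k t \<le> 1 / 2"
proof -
  have "(2::real) ^ 1 \<le> 2 ^ k" using k by (intro power_increasing) auto
  then have "2 * (1/4::real)^k \<le> 2 ^ k * (1/4)^k" by (intro mult_right_mono) auto
  also have "\<dots> = (1/2)^k" unfolding power_mult_distrib[symmetric] by simp
  finally have "t + (1/4)^k \<le> (1/2)^k" using t by simp
  then have "yk k t \<le> ((1/2)^k) powr (1 / real k)"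
    unfolding yk_def using t by (intro powr_mono2) auto
  also have "\<dots> = 1 / 2" using k by (simp add: powr_realpow[symmetric] powr_powr)
  finally show ?thesis .
qed

lemma yk_lim:
  assumes "t > 0"
  shows "(\<lambda>k. yk (Suc k) t) \<longlonglongrightarrow> 1"
proof -
  have a: "(\<lambda>k. t + (1/4)^Suc k) \<longlonglongrightarrow> t + 0"
    by (intro tendsto_add tendsto_const LIMSEQ_Suc[OF LIMSEQ_realpow_zero]) auto
  have b: "(\<lambda>k. 1 / real (Suc k)) \<longlonglongrightarrow> 0"
    using LIMSEQ_inverse_real_of_nat by (simp add: inverse_eq_divide)
  show ?thesis using tendsto_powr[OF a b] assms unfolding yk_def by simp
qed

lemma yk_tendsto:
  assumes "f \<longlonglongrightarrow> t" "t \<ge> 0"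
  shows "(\<lambda>m. yk k (f m)) \<longlonglongrightarrow> yk k t"
  unfolding yk_def
proof (rule tendsto_powr[OF tendsto_add[OF assms(1) tendsto_const] tendsto_const])
  have "t + (1 / 4) ^ k > 0" using assms(2) by (intro add_nonneg_pos) auto
  then show "t + (1 / 4) ^ k \<noteq> 0" by simp
qed

section \<open>The density estimate at fixed parameters\<close>

context poly_weight
begin

lemma y_yk: "y z = yk k (x z)"
  by (simp add: y_def yk_def)

lemma x_cont: "continuous_on UNIV x"
  unfolding x_def[abs_def] using cpoly_cont[OF qp] by (intro continuous_intros)

lemma y_cont: "continuous_on UNIV y"
  unfolding y_def[abs_def]
proof (intro continuous_intros x_cont ballI)
  fix z have "x z + (1 / 4) ^ k > 0" using x_nonneg[of z] by (intro add_nonneg_pos) auto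
  then show "x z + (1 / 4) ^ k \<noteq> 0" by simp
qed

lemma density_cont: "continuous_on UNIV (\<lambda>z. (x z + \<epsilon>) powr (- \<delta> / 2))"
proof (intro continuous_intros x_cont ballI)
  fix z show "x z + \<epsilon> \<noteq> 0" using x_nonneg[of z] e by simp
qed

lemma density_le: "(x z + \<epsilon>) powr (- \<delta> / 2) \<le> \<epsilon> powr (- \<delta> / 2)"
  using x_nonneg[of z] e d by (intro powr_mono2') auto

text \<open>On the polydisk of radius R each of the n summands of \<open>Ph\<close> is at most 1,
  and y <= X + 2. The loss from the density to the full weight is thus independent of k, M and
  \<epsilon>.\<close>

lemma W_lower:
  assumes z: "z \<in> polydisk R" and X: "x z \<le> X"
  shows "(x z + \<epsilon>) powr (- \<delta> / 2) \<le> exp (X + 2 + real CARD('n)) * W z"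
proof -
  have "Ph z \<le> (\<Sum>i\<in>(UNIV::'n set). 1)"
    unfolding Ph_def
  proof (intro sum_mono power_le_one)
    fix i
    have "(cmod (z $ i))\<^sup>2 \<le> R\<^sup>2" using z by (intro power_mono) (auto simp: polydisk_def less_imp_le)
    then show "(cmod (z $ i))\<^sup>2 / R\<^sup>2 \<le> 1" using R by simp
  qed simp
  then have "X + 2 + real CARD('n) - y z - Ph z \<ge> 0" using y_le[of z] X by simp
  then have "1 \<le> exp (X + 2 + real CARD('n) - y z - Ph z)" by simp
  then have "(x z + \<epsilon>) powr (- \<delta> / 2) * 1 \<le> (x z + \<epsilon>) powr (- \<delta> / 2) * exp (X + 2 + real CARD('n) - y z - Ph z)"
    by (intro mult_left_mono) auto
  also have "exp (X + 2 + real CARD('n) - y z - Ph z) = exp (X + 2 + real CARD('n)) * (exp (- y z) * exp (- Ph z))"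
    unfolding exp_add[symmetric] by (simp add: algebra_simps)
  finally show ?thesis by (simp add: W_def mult_ac)
qed

lemma W_le_density: "W z \<le> (x z + \<epsilon>) powr (- \<delta> / 2)"
proof -
  have "Ph z \<ge> 0" unfolding Ph_def by (intro sum_nonneg) auto
  then have "exp (- y z) * exp (- Ph z) \<le> 1 * 1" using y_pos[of z] by (intro mult_mono) auto
  then have "(x z + \<epsilon>) powr (- \<delta> / 2) * (exp (- y z) * exp (- Ph z)) \<le> (x z + \<epsilon>) powr (- \<delta> / 2) * 1"
    by (intro mult_left_mono) auto
  then show ?thesis by (simp add: W_def mult_ac)
qed

text \<open>\<open>E\<close> bounds the weighted square distance of ramp(y) to the holomorphic F.
  Through \<open>small\<close> it also makes F close to 1 in L^2, so the mollified F is at least 1/2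
  on the smaller polydisk; then 4 |F|^2 <= 8 |ramp(y) - F|^2 + 8 ramp(y)^2 gives the two terms of
  the conclusion.\<close>

lemma density_integral_bound:
  fixes r R2 X \<kappa> \<eta> :: real
  assumes r: "r < R" "R < R2"
    and lb: "\<And>F s x. weak_hol F \<Longrightarrow> L2loc F \<Longrightarrow> (\<integral>z. indicator (polydisk R) z * (cmod (F z - 1))\<^sup>2 \<partial>lborel) \<le> \<kappa> \<Longrightarrow>
        s > 0 \<Longrightarrow> x \<in> polydisk r \<Longrightarrow> 1 / 2 \<le> cmod (mollify s F (x :: complex^'n))"
    and X: "\<And>z. z \<in> polydisk R2 \<Longrightarrow> x z \<le> X" "X \<ge> 0"
    and out: "(\<integral>z. indicator (- polydisk R2) z * (W z * ((ramp' (y z))\<^sup>2 * y z)) \<partial>lborel) \<le> \<eta>"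
    and E: "E = exp (X + 2 + real CARD('n)) * ((\<integral>z. indicator (polydisk R2) z * ((x z + \<epsilon>) powr (- \<delta> / 2) * ((ramp' (y z))\<^sup>2 * y z)) \<partial>lborel) + \<eta>)"
    and small: "2 * ((X + \<epsilon>) powr (\<delta> / 2) * E) + 2 * (\<integral>z. indicator (polydisk R2) z * (ramp (y z) - 1)\<^sup>2 \<partial>lborel) \<le> \<kappa>"
  shows "(\<integral>z. indicator (polydisk r) z * (x z + \<epsilon>) powr (- \<delta> / 2) \<partial>lborel)
     \<le> 8 * E + 8 * (\<integral>z. indicator (polydisk R2) z * ((x z + \<epsilon>) powr (- \<delta> / 2) * (ramp (y z))\<^sup>2) \<partial>lborel)"
proof -
  define w where "w z = (x z + \<epsilon>) powr (- \<delta> / 2)" for z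
  have wc: "continuous_on UNIV w" unfolding w_def[abs_def] by (rule density_cont)
  have w0: "0 \<le> w z" and wC: "w z \<le> \<epsilon> powr (- \<delta> / 2)" for z using density_le[of z] by (simp_all add: w_def)
  have wab: "\<bar>w z\<bar> \<le> \<epsilon> powr (- \<delta> / 2)" for z using w0[of z] wC[of z] by simp
  define p where "p z = (ramp' (y z))\<^sup>2 * y z" for z
  have p0: "p z \<ge> 0" for z unfolding p_def using y_pos[of z] by simp
  have pc: "continuous_on UNIV p"
    unfolding p_def[abs_def] ramp'_def pos_part_def by (intro continuous_intros y_cont)
  have Thc: "continuous_on UNIV (\<lambda>z. ramp (y z))" by (rule ramp_cont[OF y_cont])
  note [measurable] = borel_measurable_continuous_onI[OF wc] borel_measurable_continuous_onI[OF pc] borel_measurable_continuous_onI[OF Thc]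
  obtain F where F: "weak_hol F" "L2loc F"
    and i1: "integrable lborel (\<lambda>z. W z * (cmod (complex_of_real (ramp (y z)) - F z))\<^sup>2)"
    and i2: "integrable lborel (\<lambda>z. W z * p z)"
    and le: "(\<integral>z. W z * (cmod (complex_of_real (ramp (y z)) - F z))\<^sup>2 \<partial>lborel) \<le> (\<integral>z. W z * p z \<partial>lborel)"
    using dbar_solution[folded p_def] by (elim exE conjE) (rule that)
  note [measurable] = L2loc_measurable[OF F(2)]
  define G where "G z = complex_of_real (ramp (y z)) + (- 1) * F z" for z
  have Geq: "complex_of_real (ramp (y z)) - F z = G z" for z by (simp add: G_def)
  have G: "L2loc G" unfolding G_def[abs_def]
    by (intro L2loc_add L2loc_mult F L2loc_cont continuous_on_const continuous_on_of_real Thc)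
  note [measurable] = L2loc_measurable[OF G]
  define c where "c = exp (X + 2 + real CARD('n))"
  have c: "c > 0" by (simp add: c_def)
  \<comment> \<open>Inside radius R2 the weight is dominated by the density, and outside by the
    hypothesis \<open>out\<close>.\<close>
  have e1: "(\<integral>z. W z * p z \<partial>lborel) \<le> (\<integral>z. indicator (polydisk R2) z * (w z * p z) \<partial>lborel) + \<eta>"
  proof -
    have j1: "integrable lborel (\<lambda>z. indicator (polydisk R2) z * (w z * p z))"
      by (intro polydisk_cont_integrable continuous_on_mult wc pc)
    have j2: "integrable lborel (\<lambda>z. indicator (- polydisk R2) z * (W z * p z))"
      using integrable_real_mult_indicator[OF _ i2, of "- polydisk R2"] by (simp add: mult.commute)
    have "(\<integral>z. W z * p z \<partial>lborel) \<le> (\<integral>z. indicator (polydisk R2) z * (w z * p z) + indicator (- polydisk R2) z * (W z * p z) \<partial>lborel)"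
    proof (rule integral_mono[OF i2 Bochner_Integration.integrable_add[OF j1 j2]])
      fix z
      have "W z * p z \<le> w z * p z" using W_le_density[of z] p0[of z] by (intro mult_right_mono) (auto simp: w_def)
      then show "W z * p z \<le> indicator (polydisk R2) z * (w z * p z) + indicator (- polydisk R2) z * (W z * p z)"
        by (simp add: indicator_def)
    qed
    also have "\<dots> = (\<integral>z. indicator (polydisk R2) z * (w z * p z) \<partial>lborel) + (\<integral>z. indicator (- polydisk R2) z * (W z * p z) \<partial>lborel)"
      by (rule Bochner_Integration.integral_add[OF j1 j2])
    finally show ?thesis using out by (simp add: p_def)
  qed
  have sub: "polydisk R \<subseteq> (polydisk R2 :: (complex^'n) set)" "polydisk r \<subseteq> (polydisk R :: (complex^'n) set)"
    using r by (auto intro!: polydisk_mono)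
  have iwG: "integrable lborel (\<lambda>z. indicator (polydisk s) z * (w z * (cmod (G z))\<^sup>2))" for s
    by (rule L2loc_polydisk_integrable[OF G _ wab]) measurable
  have e2: "(\<integral>z. indicator (polydisk R) z * (w z * (cmod (G z))\<^sup>2) \<partial>lborel) \<le> E"
  proof -
    have "(\<integral>z. indicator (polydisk R) z * (w z * (cmod (G z))\<^sup>2) \<partial>lborel) \<le> (\<integral>z. c * (W z * (cmod (G z))\<^sup>2) \<partial>lborel)"
    proof (rule integral_mono[OF iwG])
      show "integrable lborel (\<lambda>z. c * (W z * (cmod (G z))\<^sup>2))" using i1 by (intro integrable_mult_right) (simp only: Geq)
      show "indicator (polydisk R) z * (w z * (cmod (G z))\<^sup>2) \<le> c * (W z * (cmod (G z))\<^sup>2)" for z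
      proof (cases "z \<in> polydisk R")
        case True
        then have "w z \<le> c * W z" unfolding w_def c_def using sub by (intro W_lower X) auto
        then have "w z * (cmod (G z))\<^sup>2 \<le> (c * W z) * (cmod (G z))\<^sup>2" by (intro mult_right_mono) auto
        then show ?thesis using True by (simp add: mult_ac)
      qed (use c W_nonneg[of z] in simp)
    qed
    also have "\<dots> = c * (\<integral>z. W z * (cmod (G z))\<^sup>2 \<partial>lborel)" by (rule integral_mult_right_zero)
    also have "\<dots> \<le> c * ((\<integral>z. indicator (polydisk R2) z * (w z * p z) \<partial>lborel) + \<eta>)"
      using le e1 c by (intro mult_left_mono) (auto simp: Geq)
    finally show ?thesis unfolding E c_def w_def p_def .
  qed
  have jTh: "integrable lborel (\<lambda>z. indicator (polydisk s) z * (ramp (y z) - 1)\<^sup>2)" for s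
    by (intro polydisk_cont_integrable continuous_intros Thc)
  have jwT: "integrable lborel (\<lambda>z. indicator (polydisk s) z * (w z * (ramp (y z))\<^sup>2))" for s
    by (intro polydisk_cont_integrable continuous_intros Thc wc)
  \<comment> \<open>An upper bound for 1/w on the polydisk, by which the weighted estimate of G
    becomes an unweighted one.\<close>
  define P where "P = (X + \<epsilon>) powr (\<delta> / 2)"
  have P: "P > 0" using X(2) e by (simp add: P_def)
  have "(\<integral>z. indicator (polydisk R) z * (cmod (F z - 1))\<^sup>2 \<partial>lborel)
      \<le> (\<integral>z. 2 * P * (indicator (polydisk R) z * (w z * (cmod (G z))\<^sup>2)) + 2 * (indicator (polydisk R2) z * (ramp (y z) - 1)\<^sup>2) \<partial>lborel)"
  proof (rule integral_mono)
    have "L2loc (\<lambda>z. F z + (- 1))" by (intro L2loc_add F L2loc_cont continuous_on_const)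
    from L2loc_polydisk_integrable[OF this, of "\<lambda>_. 1" 1 R]
    show "integrable lborel (\<lambda>z. indicator (polydisk R) z * (cmod (F z - 1))\<^sup>2)" by simp
    show "integrable lborel (\<lambda>z. 2 * P * (indicator (polydisk R) z * (w z * (cmod (G z))\<^sup>2)) + 2 * (indicator (polydisk R2) z * (ramp (y z) - 1)\<^sup>2))"
      by (intro Bochner_Integration.integrable_add integrable_mult_right iwG jTh)
    show "indicator (polydisk R) z * (cmod (F z - 1))\<^sup>2
       \<le> 2 * P * (indicator (polydisk R) z * (w z * (cmod (G z))\<^sup>2)) + 2 * (indicator (polydisk R2) z * (ramp (y z) - 1)\<^sup>2)" for z
    proof (cases "z \<in> polydisk R")
      case True
      then have z2: "z \<in> polydisk R2" using sub by blast
      have "1 \<le> P * w z"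
      proof -
        have "(X + \<epsilon>) powr (- \<delta> / 2) \<le> w z" unfolding w_def using X(1)[OF z2] x_nonneg[of z] e d by (intro powr_mono2') auto
        then have "P * (X + \<epsilon>) powr (- \<delta> / 2) \<le> P * w z" using P by (intro mult_left_mono) auto
        moreover have "P * (X + \<epsilon>) powr (- \<delta> / 2) = 1" using X(2) e by (simp add: P_def powr_add[symmetric])
        ultimately show ?thesis by simp
      qed
      then have a: "(cmod (G z))\<^sup>2 * 1 \<le> (cmod (G z))\<^sup>2 * (P * w z)" by (intro mult_left_mono) auto
      have "F z - 1 = - G z + complex_of_real (ramp (y z) - 1)" by (simp add: G_def)
      then have "(cmod (F z - 1))\<^sup>2 \<le> 2 * (cmod (G z))\<^sup>2 + 2 * (ramp (y z) - 1)\<^sup>2"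
        using norm_add_sq_le[of "- G z" "complex_of_real (ramp (y z) - 1)"] by (simp only: norm_minus_cancel norm_of_real power2_abs)
      then show ?thesis using True z2 a by (simp add: mult_ac)
    qed (simp add: P less_imp_le)
  qed
  also have "\<dots> = 2 * P * (\<integral>z. indicator (polydisk R) z * (w z * (cmod (G z))\<^sup>2) \<partial>lborel) + 2 * (\<integral>z. indicator (polydisk R2) z * (ramp (y z) - 1)\<^sup>2 \<partial>lborel)"
    by (subst Bochner_Integration.integral_add) (auto intro!: integrable_mult_right iwG jTh)
  also have "\<dots> \<le> 2 * P * E + 2 * (\<integral>z. indicator (polydisk R2) z * (ramp (y z) - 1)\<^sup>2 \<partial>lborel)"
    using e2 P by (intro add_right_mono mult_left_mono) auto
  also have "\<dots> \<le> \<kappa>" using small by (simp add: P_def mult_ac)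
  finally have sm: "(\<integral>z. indicator (polydisk R) z * (cmod (F z - 1))\<^sup>2 \<partial>lborel) \<le> \<kappa>" .
  have "(\<integral>z. indicator (polydisk r) z * w z \<partial>lborel) \<le> 4 * (\<integral>z. indicator (polydisk r) z * (w z * (cmod (F z))\<^sup>2) \<partial>lborel)"
    by (rule weak_hol_weight_bound[OF F(2) lb[OF F sm] wc w0 wC])
  also have "(\<integral>z. indicator (polydisk r) z * (w z * (cmod (F z))\<^sup>2) \<partial>lborel)
     \<le> (\<integral>z. 2 * (indicator (polydisk R) z * (w z * (cmod (G z))\<^sup>2)) + 2 * (indicator (polydisk R2) z * (w z * (ramp (y z))\<^sup>2)) \<partial>lborel)"
  proof (rule integral_mono)
    show "integrable lborel (\<lambda>z. indicator (polydisk r) z * (w z * (cmod (F z))\<^sup>2))"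
      by (rule L2loc_polydisk_integrable[OF F(2) _ wab]) measurable
    show "integrable lborel (\<lambda>z. 2 * (indicator (polydisk R) z * (w z * (cmod (G z))\<^sup>2)) + 2 * (indicator (polydisk R2) z * (w z * (ramp (y z))\<^sup>2)))"
      by (intro Bochner_Integration.integrable_add integrable_mult_right iwG jwT)
    show "indicator (polydisk r) z * (w z * (cmod (F z))\<^sup>2)
       \<le> 2 * (indicator (polydisk R) z * (w z * (cmod (G z))\<^sup>2)) + 2 * (indicator (polydisk R2) z * (w z * (ramp (y z))\<^sup>2))" for z
    proof (cases "z \<in> polydisk r")
      case True
      then have z2: "z \<in> polydisk R2" "z \<in> polydisk R" using sub by blast+
      have "F z = - G z + complex_of_real (ramp (y z))" by (simp add: G_def)
      then have "(cmod (F z))\<^sup>2 \<le> 2 * (cmod (G z))\<^sup>2 + 2 * (ramp (y z))\<^sup>2"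
        using norm_add_sq_le[of "- G z" "complex_of_real (ramp (y z))"] by (simp only: norm_minus_cancel norm_of_real power2_abs)
      then have "w z * (cmod (F z))\<^sup>2 \<le> w z * (2 * (cmod (G z))\<^sup>2 + 2 * (ramp (y z))\<^sup>2)" by (intro mult_left_mono w0)
      then show ?thesis using True z2 by (simp add: algebra_simps)
    qed (simp add: w0)
  qed
  also have "\<dots> = 2 * (\<integral>z. indicator (polydisk R) z * (w z * (cmod (G z))\<^sup>2) \<partial>lborel) + 2 * (\<integral>z. indicator (polydisk R2) z * (w z * (ramp (y z))\<^sup>2) \<partial>lborel)"
    by (subst Bochner_Integration.integral_add) (auto intro!: integrable_mult_right iwG jwT)
  finally show ?thesis using e2 unfolding w_def by simp
qed

end

text \<open>Outside the polydisk of radius R2 > R some (|z_j|/R)^2 exceeds 1 and its powers blow up,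
  so exp(-Ph) tends to zero there; the case M = 1 dominates up to the factor exp n. The resulting M
  depends on q, \<epsilon> and k.\<close>

lemma outer_integral_small:
  fixes q :: "'l::finite \<Rightarrow> complex^'n \<Rightarrow> complex"
  assumes q: "\<And>l. cpoly (q l)" and d: "\<delta> > 0" and e: "\<epsilon> > 0" and k: "k \<ge> 1" and R: "R > 0" "R < R2" and \<eta>: "\<eta> > 0"
  shows "\<exists>M\<ge>1. (\<integral>z. indicator (- polydisk R2) z * (poly_weight.W q \<delta> \<epsilon> R k M z * ((ramp' (poly_weight.y q k z))\<^sup>2 * poly_weight.y q k z)) \<partial>lborel) \<le> \<eta>"
proof -
  interpret P: poly_weight q \<delta> \<epsilon> R k 1 by unfold_locales (use assms in auto)
  have pw: "poly_weight q \<delta> \<epsilon> R k (Suc i)" for i by unfold_locales (use assms in auto)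
  define p where "p z = (ramp' (P.y z))\<^sup>2 * P.y z" for z
  have p0: "p z \<ge> 0" for z unfolding p_def using P.y_pos[of z] by simp
  define v where "v z = (P.x z + \<epsilon>) powr (- \<delta> / 2) * exp (- P.y z)" for z
  have v0: "v z \<ge> 0" for z by (simp add: v_def)
  define H where "H i z = (\<Sum>j\<in>UNIV. ((cmod (z $ j))\<^sup>2 / R\<^sup>2) ^ Suc i)" for i and z :: "complex^'n"
  have W: "poly_weight.W q \<delta> \<epsilon> R k (Suc i) z = v z * exp (- H i z)" for i z
    unfolding poly_weight.W_def[OF pw] poly_weight.Ph_def[OF pw] v_def H_def by simp
  have W1: "P.W z = v z * exp (- H 0 z)" for z
    using W[of 0 z] by simp
  have i1: "integrable lborel (\<lambda>z. P.W z * p z)" using P.dbar_solution[folded p_def] by (elim exE conjE)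
  have pc: "continuous_on UNIV p"
    unfolding p_def[abs_def] ramp'_def pos_part_def by (intro continuous_intros P.y_cont)
  have vc: "continuous_on UNIV v"
    unfolding v_def[abs_def] by (intro continuous_intros P.y_cont P.density_cont)
  have Hc: "continuous_on UNIV (H i)" for i
    unfolding H_def[abs_def] by (intro continuous_intros) (use R in auto)
  note [measurable] = borel_measurable_continuous_onI[OF pc] borel_measurable_continuous_onI[OF vc] borel_measurable_continuous_onI[OF Hc]
  have HH: "H 0 z - real CARD('n) \<le> H i z" for i z
  proof -
    have *: "s - 1 \<le> s ^ Suc i" if "s \<ge> 0" for s :: real
    proof (cases "s \<le> 1")
      case True
      moreover have "s ^ Suc i \<ge> 0" using that by simp
      ultimately show ?thesis by linarith
    next
      case False
      then have "s ^ 1 \<le> s ^ Suc i" by (intro power_increasing) auto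
      then show ?thesis by simp
    qed
    have "(\<Sum>j\<in>UNIV. (cmod (z $ j))\<^sup>2 / R\<^sup>2 - 1) \<le> H i z"
      unfolding H_def by (intro sum_mono *) simp
    then show ?thesis by (simp add: sum_subtractf H_def)
  qed
  have "(\<lambda>i. \<integral>z. indicator (- polydisk R2) z * (v z * exp (- H i z) * p z) \<partial>lborel) \<longlonglongrightarrow> integral\<^sup>L lborel (\<lambda>z::complex^'n. 0::real)"
  proof (rule integral_dominated_convergence[where w="\<lambda>z. exp (real CARD('n)) * (P.W z * p z)"])
    show "integrable lborel (\<lambda>z. exp (real CARD('n)) * (P.W z * p z))" by (intro integrable_mult_right i1)
    show "AE z in lborel. norm (indicator (- polydisk R2) z * (v z * exp (- H i z) * p z)) \<le> exp (real CARD('n)) * (P.W z * p z)" for i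
    proof (intro AE_I2)
      fix z
      have "exp (- H i z) \<le> exp (real CARD('n) + - H 0 z)" using HH[of z i] by simp
      then have "exp (- H i z) \<le> exp (real CARD('n)) * exp (- H 0 z)" by (simp only: exp_add)
      then have "(v z * p z) * exp (- H i z) \<le> (v z * p z) * (exp (real CARD('n)) * exp (- H 0 z))"
        by (intro mult_left_mono mult_nonneg_nonneg v0 p0)
      then have "v z * exp (- H i z) * p z \<le> exp (real CARD('n)) * (P.W z * p z)" unfolding W1 by (simp add: mult_ac)
      moreover have "0 \<le> v z * exp (- H i z) * p z" by (intro mult_nonneg_nonneg v0 p0) simp
      ultimately show "norm (indicator (- polydisk R2) z * (v z * exp (- H i z) * p z)) \<le> exp (real CARD('n)) * (P.W z * p z)"
        by (simp add: indicator_def)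
    qed
    show "AE z in lborel. (\<lambda>i. indicator (- polydisk R2) z * (v z * exp (- H i z) * p z)) \<longlonglongrightarrow> 0"
    proof (intro AE_I2)
      fix z :: "complex^'n"
      show "(\<lambda>i. indicator (- polydisk R2) z * (v z * exp (- H i z) * p z)) \<longlonglongrightarrow> 0"
      proof (cases "z \<in> polydisk R2")
        case False
        then obtain j where j: "cmod (z $ j) \<ge> R2" by (auto simp: polydisk_def not_less)
        define a where "a = (cmod (z $ j))\<^sup>2 / R\<^sup>2"
        have "R\<^sup>2 < (cmod (z $ j))\<^sup>2" using j R by (intro power_strict_mono) auto
        then have a: "a > 1" using R by (simp add: a_def)
        have Ha: "a ^ Suc i \<le> H i z" for i
          unfolding H_def a_def by (rule member_le_sum) auto
        have ub: "exp (- H i z) \<le> (1 / a) ^ Suc i" for i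
        proof -
          have "a ^ Suc i \<le> exp (a ^ Suc i)" using exp_ge_add_one_self[of "a ^ Suc i"] by linarith
          also have "\<dots> \<le> exp (H i z)" using Ha[of i] by simp
          finally have "inverse (exp (H i z)) \<le> inverse (a ^ Suc i)" using a by (intro le_imp_inverse_le) auto
          then show ?thesis by (simp only: exp_minus power_one_over inverse_eq_divide)
        qed
        have l0: "(\<lambda>i. (1 / a) ^ Suc i) \<longlonglongrightarrow> 0"
          using a by (intro LIMSEQ_Suc[OF LIMSEQ_realpow_zero]) auto
        have "(\<lambda>i. exp (- H i z)) \<longlonglongrightarrow> 0"
        proof (rule tendsto_sandwich[OF _ _ tendsto_const l0])
          show "\<forall>\<^sub>F i in sequentially. 0 \<le> exp (- H i z)" by simp
          show "\<forall>\<^sub>F i in sequentially. exp (- H i z) \<le> (1 / a) ^ Suc i" using ub by (intro always_eventually allI)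
        qed
        then have "(\<lambda>i. (indicator (- polydisk R2) z * v z * p z) * exp (- H i z)) \<longlonglongrightarrow> (indicator (- polydisk R2) z * v z * p z) * 0"
          by (intro tendsto_mult tendsto_const)
        then show ?thesis by (simp add: mult_ac)
      qed simp
    qed
  qed auto
  then have "(\<lambda>i. \<integral>z. indicator (- polydisk R2) z * (v z * exp (- H i z) * p z) \<partial>lborel) \<longlonglongrightarrow> 0" by simp
  from order_tendstoD(2)[OF this \<eta>] obtain i where "(\<integral>z. indicator (- polydisk R2) z * (v z * exp (- H i z) * p z) \<partial>lborel) < \<eta>"
    unfolding eventually_sequentially by blast
  then have "(\<integral>z. indicator (- polydisk R2) z * (poly_weight.W q \<delta> \<epsilon> R k (Suc i) z * p z) \<partial>lborel) \<le> \<eta>"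
    unfolding W by simp
  then show ?thesis unfolding p_def by (intro exI[of _ "Suc i"]) simp
qed

section \<open>Passage to the limit along the polynomials\<close>

lemma continuous_bounded_interval:
  fixes \<psi> :: "real \<Rightarrow> real"
  assumes "continuous_on UNIV \<psi>"
  shows "\<exists>C\<ge>0. \<forall>t\<in>{a..b}. \<bar>\<psi> t\<bar> \<le> C"
proof -
  have "compact (\<psi> ` {a..b})" by (intro compact_continuous_image continuous_on_subset[OF assms]) auto
  then obtain C where "\<And>t. t \<in> {a..b} \<Longrightarrow> \<bar>\<psi> t\<bar> \<le> C"
    using compact_imp_bounded[of "\<psi> ` {a..b}"] unfolding bounded_iff by (auto simp del: atLeastAtMost_iff)
  then show ?thesis by (intro exI[of _ "max C 0"]) (auto intro: le_max_iff_disj[THEN iffD2])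
qed

text \<open>The order of the choices is decisive: \<kappa> from the radii, then k from \<kappa>
  through integrals involving h alone, then \<open>\<eta>\<close>, then m large depending on k, and
  finally M for each m. The constants obtained do not see m because they are limits in m at fixed
  k.\<close>

lemma density_integrals_bounded:
  fixes h :: "complex^'n \<Rightarrow> real" and q :: "nat \<Rightarrow> 'l::finite \<Rightarrow> complex^'n \<Rightarrow> complex" and \<epsilon> d :: "nat \<Rightarrow> real"
  assumes \<delta>: "\<delta> > 0" and r: "0 < r" "r < R" "R < R2"
    and h [measurable]: "h \<in> borel_measurable borel" and h0: "\<And>z. h z \<ge> 0"
    and hint: "integrable lborel (\<lambda>z. indicator (polydisk R2) z * h z powr (- \<delta> / 2))"
    and hae: "AE z in lborel. z \<in> polydisk R2 \<longrightarrow> h z > 0"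
    and q: "\<And>m l. cpoly (q m l)" and X: "X \<ge> 0" "\<And>m z. z \<in> polydisk R2 \<Longrightarrow> (\<Sum>l\<in>UNIV. (cmod (q m l z))\<^sup>2) \<le> X"
    and ql: "\<And>z. z \<in> polydisk R2 \<Longrightarrow> (\<lambda>m. \<Sum>l\<in>UNIV. (cmod (q m l z))\<^sup>2) \<longlonglongrightarrow> h z"
    and \<epsilon>: "\<And>m. \<epsilon> m > 0" "\<And>m. \<epsilon> m \<le> 1" "\<epsilon> \<longlonglongrightarrow> 0"
    and d: "\<And>m. d m > 0" "\<And>m. d m \<le> \<delta> + 1" "d \<longlonglongrightarrow> \<delta>"
  shows "\<exists>C. \<forall>\<^sub>F m in sequentially. (\<integral>z. indicator (polydisk r) z * ((\<Sum>l\<in>UNIV. (cmod (q m l z))\<^sup>2) + \<epsilon> m) powr (- d m / 2) \<partial>lborel) \<le> C"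
proof -
  define x where "x m z = (\<Sum>l\<in>UNIV. (cmod (q m l z))\<^sup>2)" for m z
  have x0: "x m z \<ge> 0" for m z unfolding x_def by (intro sum_nonneg) simp
  have xX: "x m z \<le> X" if "z \<in> polydisk R2" for m z using X(2)[OF that] by (simp add: x_def)
  have xl: "(\<lambda>m. x m z) \<longlonglongrightarrow> h z" if "z \<in> polydisk R2" for z using ql[OF that] by (simp add: x_def)
  have hX: "h z \<le> X" if "z \<in> polydisk R2" for z
    using xX[OF that] by (intro LIMSEQ_le_const2[OF xl[OF that]]) auto
  have xc: "continuous_on UNIV (x m)" for m
    unfolding x_def[abs_def] using cpoly_cont[OF q] by (intro continuous_intros)
  note [measurable] = borel_measurable_continuous_onI[OF xc]
  \<comment> \<open>\<open>\<psi>\<close> is the price of the cut-off, \<open>\<phi>\<close> what it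
    keeps, and \<open>\<chi>'\<close> its distance from 1. The first two vanish for t <= 1/2, while
    \<open>\<psi>\<close> and \<open>\<chi>'\<close> vanish at t = 1.\<close>
  define \<psi> where "\<psi> t = (ramp' t)\<^sup>2 * t" for t
  have \<psi>c: "continuous_on UNIV \<psi>" unfolding \<psi>_def[abs_def] ramp'_def pos_part_def by (intro continuous_intros)
  define \<phi> where "\<phi> t = (ramp t)\<^sup>2" for t
  have \<phi>c: "continuous_on UNIV \<phi>" unfolding \<phi>_def[abs_def] ramp_def pos_part_def by (intro continuous_intros)
  define \<chi>' where "\<chi>' t = (ramp t - 1)\<^sup>2" for t
  have \<chi>c: "continuous_on UNIV \<chi>'" unfolding \<chi>'_def[abs_def] ramp_def pos_part_def by (intro continuous_intros)
  note [measurable] = borel_measurable_continuous_onI[OF \<psi>c] borel_measurable_continuous_onI[OF \<phi>c] borel_measurable_continuous_onI[OF \<chi>c]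
  have tl: "(\<lambda>m. g (a m)) \<longlonglongrightarrow> g t" if "continuous_on UNIV g" "a \<longlonglongrightarrow> t" for g :: "real \<Rightarrow> real" and a t
    using continuous_on_tendsto_compose[OF that] by simp
  have ykX: "yk k t \<in> {0..X + 2}" if "0 \<le> t" "t \<le> X" "k \<ge> 1" for k t
    using yk_pos[of t k] yk_le[of t k] that by simp
  obtain C\<psi> where C\<psi>: "C\<psi> \<ge> 0" "\<And>t. t \<in> {0..X + 2} \<Longrightarrow> \<bar>\<psi> t\<bar> \<le> C\<psi>" using continuous_bounded_interval[OF \<psi>c] by metis
  obtain C\<phi> where C\<phi>: "C\<phi> \<ge> 0" "\<And>t. t \<in> {0..X + 2} \<Longrightarrow> \<bar>\<phi> t\<bar> \<le> C\<phi>" using continuous_bounded_interval[OF \<phi>c] by metis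
  obtain C\<chi> where C\<chi>: "C\<chi> \<ge> 0" "\<And>t. t \<in> {0..X + 2} \<Longrightarrow> \<bar>\<chi>' t\<bar> \<le> C\<chi>" using continuous_bounded_interval[OF \<chi>c] by metis
  define A where "A k = (\<integral>z. indicator (polydisk R2) z * (h z powr (- \<delta> / 2) * \<psi> (yk k (h z))) \<partial>lborel)" for k
  define T where "T k = (\<integral>z. indicator (polydisk R2) z * (h z powr (- \<delta> / 2) * \<phi> (yk k (h z))) \<partial>lborel)" for k
  define J where "J k = (\<integral>z. indicator (polydisk R2) z * \<chi>' (yk k (h z)) \<partial>lborel)" for k
  \<comment> \<open>\<open>\<psi>\<close> is bounded on [0, X + 2] independently of k, so a multiple
    of h^(-\<delta>/2) dominates, and the pointwise limit contains the factor
    \<open>\<psi> 1\<close> = 0.\<close>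
  have Al: "(\<lambda>k. A (Suc k)) \<longlonglongrightarrow> 0"
  proof -
    have "(\<lambda>k. A (Suc k)) \<longlonglongrightarrow> integral\<^sup>L lborel (\<lambda>z::complex^'n. 0::real)"
      unfolding A_def
    proof (rule integral_dominated_convergence[where w="\<lambda>z. (indicator (polydisk R2) z * h z powr (- \<delta> / 2)) * C\<psi>"])
      show "integrable lborel (\<lambda>z. (indicator (polydisk R2) z * h z powr (- \<delta> / 2)) * C\<psi>)" by (intro integrable_mult_left hint)
      show "AE z in lborel. norm (indicator (polydisk R2) z * (h z powr (- \<delta> / 2) * \<psi> (yk (Suc k) (h z)))) \<le> (indicator (polydisk R2) z * h z powr (- \<delta> / 2)) * C\<psi>" for k
      proof (intro AE_I2)
        fix z
        show "norm (indicator (polydisk R2) z * (h z powr (- \<delta> / 2) * \<psi> (yk (Suc k) (h z)))) \<le> (indicator (polydisk R2) z * h z powr (- \<delta> / 2)) * C\<psi>"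
        proof (cases "z \<in> polydisk R2")
          case True
          have "\<bar>\<psi> (yk (Suc k) (h z))\<bar> \<le> C\<psi>" by (intro C\<psi> ykX h0 hX True) simp
          then show ?thesis using True by (simp add: abs_mult mult_left_mono)
        qed simp
      qed
      show "AE z in lborel. (\<lambda>k. indicator (polydisk R2) z * (h z powr (- \<delta> / 2) * \<psi> (yk (Suc k) (h z)))) \<longlonglongrightarrow> 0"
        using hae
      proof eventually_elim
        case (elim z)
        show ?case
        proof (cases "z \<in> polydisk R2")
          case True
          then have "(\<lambda>k. \<psi> (yk (Suc k) (h z))) \<longlonglongrightarrow> \<psi> 1" using elim by (intro tl[OF \<psi>c] yk_lim) auto
          then have "(\<lambda>k. h z powr (- \<delta> / 2) * \<psi> (yk (Suc k) (h z))) \<longlonglongrightarrow> h z powr (- \<delta> / 2) * \<psi> 1" by (intro tendsto_mult tendsto_const)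
          then show ?thesis using True by (simp add: \<psi>_def ramp_one)
        qed simp
      qed
    qed auto
    then show ?thesis by simp
  qed
  have Jl: "(\<lambda>k. J (Suc k)) \<longlonglongrightarrow> 0"
  proof -
    have "(\<lambda>k. J (Suc k)) \<longlonglongrightarrow> integral\<^sup>L lborel (\<lambda>z::complex^'n. indicator (polydisk R2) z * 0)"
      unfolding J_def
    proof (rule polydisk_bounded_convergence[where C=C\<chi>])
      show "\<bar>\<chi>' (yk (Suc k) (h z))\<bar> \<le> C\<chi>" if "z \<in> polydisk R2" for k z by (intro C\<chi> ykX h0 hX that) simp
      show "AE z in lborel. z \<in> polydisk R2 \<longrightarrow> (\<lambda>k. \<chi>' (yk (Suc k) (h z))) \<longlonglongrightarrow> 0"
        using hae
      proof eventually_elim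
        case (elim z)
        show ?case
        proof
          assume "z \<in> polydisk R2"
          then have "(\<lambda>k. \<chi>' (yk (Suc k) (h z))) \<longlonglongrightarrow> \<chi>' 1" using elim by (intro tl[OF \<chi>c] yk_lim) auto
          then show "(\<lambda>k. \<chi>' (yk (Suc k) (h z))) \<longlonglongrightarrow> 0" by (simp add: \<chi>'_def ramp_one)
        qed
      qed
    qed measurable
    then show ?thesis by simp
  qed
  \<comment> \<open>Where |q_m|^2 <= 4^(-k) the factor g vanishes, and elsewhere the density is at
    most a fixed power of 4^k, uniformly in m. Bounded convergence therefore applies whatever the
    densities do near the zeros of h.\<close>
  have ml: "(\<lambda>m. \<integral>z. indicator (polydisk R2) z * ((x m z + \<epsilon> m) powr (- d m / 2) * g (yk k (x m z))) \<partial>lborel)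
      \<longlonglongrightarrow> (\<integral>z. indicator (polydisk R2) z * (h z powr (- \<delta> / 2) * g (yk k (h z))) \<partial>lborel)"
    if gc: "continuous_on UNIV g" and g0: "\<And>t. t \<le> 1 / 2 \<Longrightarrow> g t = 0" and Cg: "Cg \<ge> 0" "\<And>t. t \<in> {0..X + 2} \<Longrightarrow> \<bar>g t\<bar> \<le> Cg" and k: "k \<ge> 1"
    for g :: "real \<Rightarrow> real" and Cg k
  proof -
    note [measurable] = borel_measurable_continuous_onI[OF gc]
    define b where "b = (1 / 4 :: real) ^ k"
    have b: "0 < b" "b \<le> 1" by (auto simp: b_def power_le_one)
    show ?thesis
    proof (rule polydisk_bounded_convergence[where C="b powr (- (\<delta> + 1)) * Cg"])
      fix m and z :: "complex^'n" assume z: "z \<in> polydisk R2"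
      show "\<bar>(x m z + \<epsilon> m) powr (- d m / 2) * g (yk k (x m z))\<bar> \<le> b powr (- (\<delta> + 1)) * Cg"
      proof (cases "x m z \<le> b")
        case True
        then have "g (yk k (x m z)) = 0" by (intro g0 yk_half x0 k) (simp add: b_def)
        then show ?thesis using Cg by simp
      next
        case False
        have "(x m z + \<epsilon> m) powr (- d m / 2) \<le> b powr (- d m / 2)"
          using False b \<epsilon>(1)[of m] d(1)[of m] by (intro powr_mono2') auto
        also have "\<dots> \<le> b powr (- (\<delta> + 1))"
          using b d(1)[of m] d(2)[of m] \<delta> by (intro powr_mono') auto
        finally have "(x m z + \<epsilon> m) powr (- d m / 2) \<le> b powr (- (\<delta> + 1))" .
        moreover have "\<bar>g (yk k (x m z))\<bar> \<le> Cg" by (intro Cg ykX x0 xX z k)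
        ultimately show ?thesis unfolding abs_mult by (intro mult_mono) auto
      qed
    next
      show "AE z in lborel. z \<in> polydisk R2 \<longrightarrow> (\<lambda>m. (x m z + \<epsilon> m) powr (- d m / 2) * g (yk k (x m z))) \<longlonglongrightarrow> h z powr (- \<delta> / 2) * g (yk k (h z))"
        using hae
      proof eventually_elim
        case (elim z)
        show ?case
        proof
          assume z: "z \<in> polydisk R2"
          have l1: "(\<lambda>m. x m z + \<epsilon> m) \<longlonglongrightarrow> h z" using tendsto_add[OF xl[OF z] \<epsilon>(3)] by simp
          have l2: "(\<lambda>m. - d m / 2) \<longlonglongrightarrow> - \<delta> / 2" by (intro tendsto_divide tendsto_minus d tendsto_const) simp
          have "(\<lambda>m. (x m z + \<epsilon> m) powr (- d m / 2)) \<longlonglongrightarrow> h z powr (- \<delta> / 2)"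
            by (rule tendsto_powr[OF l1 l2]) (use elim z in auto)
          moreover have "(\<lambda>m. g (yk k (x m z))) \<longlonglongrightarrow> g (yk k (h z))"
            by (intro tl[OF gc] yk_tendsto xl z h0)
          ultimately show "(\<lambda>m. (x m z + \<epsilon> m) powr (- d m / 2) * g (yk k (x m z))) \<longlonglongrightarrow> h z powr (- \<delta> / 2) * g (yk k (h z))"
            by (rule tendsto_mult)
        qed
      qed
    qed measurable
  qed
  obtain \<kappa> where \<kappa>: "\<kappa> > 0" "\<And>F s x. weak_hol F \<Longrightarrow> L2loc F \<Longrightarrow> (\<integral>z. indicator (polydisk R) z * (cmod (F z - 1))\<^sup>2 \<partial>lborel) \<le> \<kappa> \<Longrightarrow>
        s > 0 \<Longrightarrow> x \<in> polydisk r \<Longrightarrow> 1 / 2 \<le> cmod (mollify s F (x :: complex^'n))"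
    using weak_hol_lower_bound[OF r(1,2), where 'n='n] by (elim exE conjE) (rule that, auto)
  define c where "c = exp (X + 2 + real CARD('n))"
  have c: "c > 0" by (simp add: c_def)
  define P where "P = (X + 1) powr (\<delta> + 1)"
  have P: "P > 0" using X(1) by (simp add: P_def)
  have "(\<lambda>k. 2 * (P * (c * A (Suc k))) + 2 * J (Suc k)) \<longlonglongrightarrow> 2 * (P * (c * 0)) + 2 * 0"
    by (intro tendsto_add tendsto_mult tendsto_const Al Jl)
  then have "(\<lambda>k. 2 * (P * (c * A (Suc k))) + 2 * J (Suc k)) \<longlonglongrightarrow> 0" by simp
  \<comment> \<open>The limit quantities at k take less than \<kappa>/2 and \<open>\<eta>\<close>
    takes \<kappa>/4, so the total stays strictly below \<kappa> and the inequality persists for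
    large m.\<close>
  from order_tendstoD(2)[OF this, of "\<kappa> / 2"] \<kappa>(1) obtain k0 where k0: "2 * (P * (c * A (Suc k0))) + 2 * J (Suc k0) < \<kappa> / 2"
    unfolding eventually_sequentially by auto
  define k where "k = Suc k0"
  have k: "k \<ge> 1" by (simp add: k_def)
  define \<eta> where "\<eta> = \<kappa> / (8 * P * c)"
  have \<eta>: "\<eta> > 0" using \<kappa>(1) P c by (simp add: \<eta>_def)
  have P\<eta>: "2 * (P * (c * \<eta>)) = \<kappa> / 4" using P c by (simp add: \<eta>_def)
  define Am where "Am m = (\<integral>z. indicator (polydisk R2) z * ((x m z + \<epsilon> m) powr (- d m / 2) * \<psi> (yk k (x m z))) \<partial>lborel)" for m
  define Tm where "Tm m = (\<integral>z. indicator (polydisk R2) z * ((x m z + \<epsilon> m) powr (- d m / 2) * \<phi> (yk k (x m z))) \<partial>lborel)" for m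
  define Jm where "Jm m = (\<integral>z. indicator (polydisk R2) z * \<chi>' (yk k (x m z)) \<partial>lborel)" for m
  have Aml: "Am \<longlonglongrightarrow> A k" unfolding Am_def[abs_def] A_def
    by (rule ml[OF \<psi>c _ C\<psi> k]) (simp add: \<psi>_def ramp_zero)
  have Tml: "Tm \<longlonglongrightarrow> T k" unfolding Tm_def[abs_def] T_def
    by (rule ml[OF \<phi>c _ C\<phi> k]) (simp add: \<phi>_def ramp_zero)
  have Jml: "Jm \<longlonglongrightarrow> J k" unfolding Jm_def[abs_def] J_def
  proof (rule polydisk_bounded_convergence[where C=C\<chi>])
    show "\<bar>\<chi>' (yk k (x m z))\<bar> \<le> C\<chi>" if "z \<in> polydisk R2" for m z by (intro C\<chi> ykX x0 xX that k)
    show "AE z in lborel. z \<in> polydisk R2 \<longrightarrow> (\<lambda>m. \<chi>' (yk k (x m z))) \<longlonglongrightarrow> \<chi>' (yk k (h z))"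
      by (intro AE_I2 impI tl[OF \<chi>c] yk_tendsto xl h0)
  qed measurable
  have "(\<lambda>m. 2 * (P * (c * (Am m + \<eta>))) + 2 * Jm m) \<longlonglongrightarrow> 2 * (P * (c * (A k + \<eta>))) + 2 * J k"
    by (intro tendsto_add tendsto_mult tendsto_const Aml Jml)
  moreover have "2 * (P * (c * (A k + \<eta>))) + 2 * J k < \<kappa>"
    using k0 P\<eta> \<kappa>(1) by (simp add: k_def distrib_left)
  ultimately have ev1: "\<forall>\<^sub>F m in sequentially. 2 * (P * (c * (Am m + \<eta>))) + 2 * Jm m < \<kappa>" by (rule order_tendstoD(2))
  have ev2: "\<forall>\<^sub>F m in sequentially. Am m < A k + 1" by (rule order_tendstoD(2)[OF Aml]) simp
  have ev3: "\<forall>\<^sub>F m in sequentially. Tm m < T k + 1" by (rule order_tendstoD(2)[OF Tml]) simp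
  have "\<forall>\<^sub>F m in sequentially. (\<integral>z. indicator (polydisk r) z * (x m z + \<epsilon> m) powr (- d m / 2) \<partial>lborel) \<le> 8 * (c * (A k + 1 + \<eta>)) + 8 * (T k + 1)"
    using ev1 ev2 ev3
  proof eventually_elim
    case (elim m)
    have R0: "R > 0" using r by simp
    obtain M where M: "M \<ge> 1"
      "(\<integral>z. indicator (- polydisk R2) z * (poly_weight.W (q m) (d m) (\<epsilon> m) R k M z * ((ramp' (poly_weight.y (q m) k z))\<^sup>2 * poly_weight.y (q m) k z)) \<partial>lborel) \<le> \<eta>"
      using outer_integral_small[of "q m", OF q d(1) \<epsilon>(1) k R0 r(3) \<eta>] by blast
    interpret W: poly_weight "q m" "d m" "\<epsilon> m" R k M
      by unfold_locales (use q d(1) \<epsilon>(1) k R0 M(1) in auto)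
    have xx: "W.x z = x m z" for z by (simp add: W.x_def x_def)
    have yy: "W.y z = yk k (x m z)" for z by (simp add: W.y_yk xx)
    define E where "E = c * (Am m + \<eta>)"
    have E: "E = exp (X + 2 + real CARD('n)) * ((\<integral>z. indicator (polydisk R2) z * ((W.x z + \<epsilon> m) powr (- d m / 2) * ((ramp' (W.y z))\<^sup>2 * W.y z)) \<partial>lborel) + \<eta>)"
      unfolding E_def c_def Am_def xx yy \<psi>_def ..
    have Am0: "Am m \<ge> 0"
      unfolding Am_def \<psi>_def using less_imp_le[OF yk_pos[OF x0[of m], of k]] by (intro integral_nonneg_AE AE_I2) auto
    have E0: "E \<ge> 0" unfolding E_def using c \<eta> Am0 by (intro mult_nonneg_nonneg) auto
    have "(X + \<epsilon> m) powr (d m / 2) \<le> (X + 1) powr (d m / 2)"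
      using X(1) \<epsilon>(1)[of m] \<epsilon>(2)[of m] d(1)[of m] by (intro powr_mono2) auto
    also have "\<dots> \<le> P" unfolding P_def using X(1) d(1)[of m] d(2)[of m] \<delta> by (intro powr_mono) auto
    finally have "(X + \<epsilon> m) powr (d m / 2) * E \<le> P * E" using E0 by (intro mult_right_mono)
    moreover have "(\<integral>z. indicator (polydisk R2) z * (ramp (W.y z) - 1)\<^sup>2 \<partial>lborel) = Jm m"
      unfolding Jm_def yy \<chi>'_def ..
    ultimately have small: "2 * ((X + \<epsilon> m) powr (d m / 2) * E) + 2 * (\<integral>z. indicator (polydisk R2) z * (ramp (W.y z) - 1)\<^sup>2 \<partial>lborel) \<le> \<kappa>"
      using elim(1) unfolding E_def[symmetric] by simp
    have "(\<integral>z. indicator (polydisk r) z * (W.x z + \<epsilon> m) powr (- d m / 2) \<partial>lborel)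
       \<le> 8 * E + 8 * (\<integral>z. indicator (polydisk R2) z * ((W.x z + \<epsilon> m) powr (- d m / 2) * (ramp (W.y z))\<^sup>2) \<partial>lborel)"
      by (rule W.density_integral_bound[OF r(2,3) \<kappa>(2) _ X(1) M(2) E small]) (auto simp: xx intro: xX)
    also have "(\<integral>z. indicator (polydisk R2) z * ((W.x z + \<epsilon> m) powr (- d m / 2) * (ramp (W.y z))\<^sup>2) \<partial>lborel) = Tm m"
      unfolding Tm_def xx yy \<phi>_def ..
    finally have "(\<integral>z. indicator (polydisk r) z * (x m z + \<epsilon> m) powr (- d m / 2) \<partial>lborel) \<le> 8 * E + 8 * Tm m" unfolding xx .
    also have "E \<le> c * (A k + 1 + \<eta>)" unfolding E_def using c elim(2) by (intro mult_left_mono) auto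
    also have "Tm m \<le> T k + 1" using elim(3) by simp
    finally show ?case by simp
  qed
  then show ?thesis unfolding x_def by blast
qed

section \<open>Negative powers of holomorphic vectors\<close>

lemma holo_vec_cont: "holo_vec g U \<Longrightarrow> continuous_on U g"
  unfolding holo_vec_def
  using continuous_on_vec_lambda[of U "\<lambda>j z. g z $ j"] holo_n_cont by fastforce

lemma holo_vec_bounded:
  fixes g :: "complex^'n \<Rightarrow> complex^'j"
  assumes g: "holo_vec g (polydisk 1)" and R: "R < 1"
  shows "\<exists>S\<ge>0. \<forall>z\<in>polydisk R. norm (g z) \<le> S"
proof -
  define K where "K = {z::complex^'n. \<forall>i. cmod (z $ i) \<le> R}"
  have K: "K \<subseteq> polydisk 1" using R by (auto simp: K_def polydisk_def intro: le_less_trans)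
  have "compact (g ` K)"
    unfolding K_def by (intro compact_continuous_image compact_cpolydisk continuous_on_subset[OF holo_vec_cont[OF g] K[unfolded K_def]])
  then obtain S where S: "S > 0" "\<forall>x\<in>g ` K. norm x \<le> S"
    using compact_imp_bounded[of "g ` K"] unfolding bounded_pos by blast
  have "polydisk R \<subseteq> K" by (auto simp: K_def polydisk_def less_imp_le)
  then show ?thesis using S by (intro exI[of _ S]) auto
qed

text \<open>A vector holomorphic on the unit polydisk is arbitrary outside it; cutting its norm off makes
  it measurable on the whole space.\<close>

definition ext_norm :: "(complex^'n \<Rightarrow> complex^'j) \<Rightarrow> complex^'n \<Rightarrow> real" where
  "ext_norm g z = (if z \<in> polydisk 1 then norm (g z) else 0)"

lemma ext_norm_nonneg [simp]: "ext_norm g z \<ge> 0"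
  by (simp add: ext_norm_def)

lemma ext_norm_measurable:
  assumes "holo_vec g (polydisk 1)"
  shows "ext_norm g \<in> borel_measurable borel"
proof -
  have "(\<lambda>z. indicator (polydisk 1) z *\<^sub>R norm (g z)) \<in> borel_measurable borel"
    by (intro borel_measurable_continuous_on_indicator continuous_on_norm holo_vec_cont assms) auto
  moreover have "(\<lambda>z. indicator (polydisk 1) z *\<^sub>R norm (g z)) = ext_norm g" by (auto simp: ext_norm_def)
  ultimately show ?thesis by simp
qed

lemma negpow_measurable [measurable]: "negpow d \<in> borel_measurable borel"
  unfolding negpow_def[abs_def] by measurable

lemma negint_ext:
  assumes "r \<le> 1"
  shows "negint d r g = (\<integral>\<^sup>+ z. indicator (polydisk r) z * negpow d (ext_norm g z) \<partial>lborel)"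
proof -
  have "indicator (polydisk r) z * negpow d (norm (g z)) = indicator (polydisk r) z * negpow d (ext_norm g z)" for z
    using polydisk_mono[OF assms] by (auto simp: ext_norm_def indicator_def)
  then show ?thesis unfolding negint_def by (simp only:)
qed

text \<open>A finite integral excludes zeros on a set of positive measure. Hence the value infinity
  of \<open>negpow\<close> at 0 and the value 0 of \<open>0 powr (- d)\<close> differ on a null set
  only, and the integral becomes a Bochner integral.\<close>

lemma negint_finite:
  fixes g :: "complex^'n \<Rightarrow> complex^'j"
  assumes g: "holo_vec g (polydisk 1)" and r: "r \<le> 1" and fin: "negint d r g < \<infinity>"
  shows "AE z in lborel. z \<in> polydisk r \<longrightarrow> ext_norm g z > 0" (is ?A)
    and "integrable lborel (\<lambda>z. indicator (polydisk r) z * ext_norm g z powr (- d))" (is ?I)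
    and "negint d r g = ennreal (\<integral>z. indicator (polydisk r) z * ext_norm g z powr (- d) \<partial>lborel)" (is ?E)
proof -
  note [measurable] = ext_norm_measurable[OF g]
  have "AE z in lborel. indicator (polydisk r) z * negpow d (ext_norm g z) \<noteq> \<infinity>"
    by (rule nn_integral_noteq_infinite) (use fin negint_ext[OF r, of d g] in auto)
  then show A: ?A
  proof eventually_elim
    case (elim z)
    show ?case
    proof
      assume "z \<in> polydisk r"
      then have "ext_norm g z \<noteq> 0" using elim by (auto simp: negpow_def)
      then show "ext_norm g z > 0" using ext_norm_nonneg[of g z] by linarith
    qed
  qed
  have eq: "negint d r g = (\<integral>\<^sup>+ z. ennreal (indicator (polydisk r) z * ext_norm g z powr (- d)) \<partial>lborel)"
    unfolding negint_ext[OF r]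
  proof (rule nn_integral_cong_AE)
    show "AE z in lborel. indicator (polydisk r) z * negpow d (ext_norm g z) = ennreal (indicator (polydisk r) z * ext_norm g z powr (- d))"
      using A by eventually_elim (auto simp: negpow_def indicator_def)
  qed
  show I: ?I
    by (rule integrableI_nonneg) (use fin eq in \<open>auto simp: less_top[symmetric]\<close>)
  show ?E unfolding eq by (rule nn_integral_eq_integral[OF I]) simp
qed

lemma power2_powr_half:
  fixes x :: real
  assumes "x \<ge> 0"
  shows "x\<^sup>2 powr (- d / 2) = x powr (- d)"
proof (cases "x = 0")
  case False
  then have "x\<^sup>2 = x powr 2" using assms by simp
  then show ?thesis by (simp only: powr_powr) simp
qed simp

text \<open>By Fatou some regularised integral, with |g|^2 + 2 \<epsilon> in place of |g|^2, already
  exceeds \<open>c\<close>, even when the original one is infinite. One \<epsilon> absorbs the error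
  of replacing |g|^2 by |q|^2, and the other remains as regularisation of the polynomial
  density.\<close>

lemma poly_vec_approx:
  fixes g :: "complex^'n \<Rightarrow> complex^'j"
  assumes g: "holo_vec g (polydisk 1)" and R: "0 < R2" "R2 < 1" and r: "r \<le> R2" and d: "d > 0" and \<eta>: "\<eta> > 0"
    and c: "c \<ge> 0" and big: "ennreal c < negint d r g"
  shows "\<exists>q \<epsilon>. (\<forall>l::'j. cpoly (q l)) \<and> 0 < \<epsilon> \<and> \<epsilon> \<le> \<eta> \<and>
     (\<forall>z\<in>polydisk R2. \<bar>(\<Sum>l\<in>UNIV. (cmod (q l z))\<^sup>2) - (norm (g z))\<^sup>2\<bar> \<le> \<epsilon>) \<and>
     c < (\<integral>z. indicator (polydisk r) z * ((\<Sum>l\<in>UNIV. (cmod (q l z))\<^sup>2) + \<epsilon>) powr (- d / 2) \<partial>lborel)"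
proof -
  have r1: "r \<le> 1" using r R by simp
  note [measurable] = ext_norm_measurable[OF g]
  define e where "e i = \<eta> / real (Suc i)" for i
  have e: "e i > 0" "e i \<le> \<eta>" for i using \<eta> by (auto simp: e_def field_simps)
  have "(\<lambda>i. \<eta> * (1 / real (Suc i))) \<longlonglongrightarrow> \<eta> * 0"
    by (intro tendsto_mult tendsto_const LIMSEQ_inverse_real_of_nat[unfolded inverse_eq_divide])
  then have el: "(\<lambda>i. 2 * e i) \<longlonglongrightarrow> 0"
    using tendsto_mult[OF tendsto_const[of 2]] by (fastforce simp: e_def)
  define u where "u i z = indicator (polydisk r) z * ennreal (((ext_norm g z)\<^sup>2 + 2 * e i) powr (- d / 2))" for i z
  have [measurable]: "u i \<in> borel_measurable lborel" for i unfolding u_def[abs_def] by measurable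
  have ul: "(\<lambda>i. u i z) \<longlonglongrightarrow> indicator (polydisk r) z * negpow d (ext_norm g z)" for z
  proof (cases "z \<in> polydisk r")
    case True
    show ?thesis
    proof (cases "ext_norm g z = 0")
      case z0: True
      \<comment> \<open>At zeros of g the regularised integrand tends to infinity, in agreement with
        the value of \<open>negpow\<close> there.\<close>
      have "(\<lambda>i. ennreal ((2 * e i) powr (- d / 2))) \<longlonglongrightarrow> top"
        unfolding tendsto_top_iff_ennreal
      proof (intro allI impI)
        fix l :: real assume l: "0 \<le> l"
        have "(l + 1) powr (- 2 / d) > 0" using l by simp
        from order_tendstoD(2)[OF el this]
        show "\<forall>\<^sub>F i in sequentially. ennreal l < ennreal ((2 * e i) powr (- d / 2))"
        proof eventually_elim
          case (elim i)
          have "((l + 1) powr (- 2 / d)) powr (- d / 2) < (2 * e i) powr (- d / 2)"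
            using elim e(1)[of i] d by (intro powr_less_mono2_neg) auto
          moreover have "((l + 1) powr (- 2 / d)) powr (- d / 2) = l + 1" using d l by (simp add: powr_powr)
          ultimately show ?case using l by (simp add: ennreal_less_iff)
        qed
      qed
      then show ?thesis using True z0 by (simp add: u_def negpow_def)
    next
      case False
      have "(\<lambda>i. (ext_norm g z)\<^sup>2 + 2 * e i) \<longlonglongrightarrow> (ext_norm g z)\<^sup>2 + 0"
        by (intro tendsto_add tendsto_const el)
      from tendsto_powr[OF this tendsto_const[of "- d / 2"]] False
      have "(\<lambda>i. ((ext_norm g z)\<^sup>2 + 2 * e i) powr (- d / 2)) \<longlonglongrightarrow> (ext_norm g z)\<^sup>2 powr (- d / 2)" by simp
      moreover have "(ext_norm g z)\<^sup>2 powr (- d / 2) = ext_norm g z powr (- d)"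
        by (rule power2_powr_half[OF ext_norm_nonneg])
      ultimately show ?thesis using True False by (simp add: u_def negpow_def)
    qed
  qed (simp add: u_def)
  have "\<exists>i. ennreal c < (\<integral>\<^sup>+ z. u i z \<partial>lborel)"
  proof (rule ccontr)
    assume "\<not> ?thesis"
    then have le: "(\<integral>\<^sup>+ z. u i z \<partial>lborel) \<le> ennreal c" for i by (simp add: not_less)
    have "negint d r g = (\<integral>\<^sup>+ z. liminf (\<lambda>i. u i z) \<partial>lborel)"
      unfolding negint_ext[OF r1] using lim_imp_Liminf[OF _ ul] by simp
    also have "\<dots> \<le> liminf (\<lambda>i. \<integral>\<^sup>+ z. u i z \<partial>lborel)" by (rule nn_integral_liminf) simp
    also have "\<dots> \<le> liminf (\<lambda>i::nat. ennreal c)" by (intro Liminf_mono always_eventually allI le)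
    also have "\<dots> = ennreal c" by (simp add: Liminf_const)
    finally show False using big by simp
  qed
  then obtain i where i: "ennreal c < (\<integral>\<^sup>+ z. u i z \<partial>lborel)" by blast
  define \<epsilon> where "\<epsilon> = e i"
  obtain S where S: "S \<ge> 0" "\<And>z. z \<in> polydisk R2 \<Longrightarrow> norm (g z) \<le> S" using holo_vec_bounded[OF g R(2)] by blast
  define N where "N = real CARD('j)"
  have N: "N > 0" by (simp add: N_def)
  \<comment> \<open>If |q_l - g_l| <= e' <= 1 and |g_l| <= S, the squares of the moduli differ by at
    most e' (2 S + 1); the sum over all components has to stay below \<epsilon>.\<close>
  define e' where "e' = min 1 (\<epsilon> / (N * (2 * S + 1)))"
  have e': "0 < e'" "e' \<le> 1" using e(1)[of i] N S(1) by (auto simp: e'_def \<epsilon>_def)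
  have e'N: "N * (e' * (2 * S + 1)) \<le> \<epsilon>"
  proof -
    have "e' * (N * (2 * S + 1)) \<le> \<epsilon> / (N * (2 * S + 1)) * (N * (2 * S + 1))"
      using N S(1) by (intro mult_right_mono) (auto simp: e'_def)
    also have "\<dots> = \<epsilon>" using N S(1) by simp
    finally show ?thesis by (simp add: mult_ac)
  qed
  have "\<forall>l. \<exists>p. cpoly p \<and> (\<forall>z\<in>polydisk R2. cmod (g z $ l - p z) \<le> e')"
    using g holo_n_cpoly_approx[OF _ R e'(1)] unfolding holo_vec_def by blast
  from choice[OF this] obtain q where q: "\<And>l. cpoly (q l)" "\<And>l z. z \<in> polydisk R2 \<Longrightarrow> cmod (g z $ l - q l z) \<le> e'" by auto
  define x where "x z = (\<Sum>l\<in>UNIV. (cmod (q l z))\<^sup>2)" for z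
  have x0: "x z \<ge> 0" for z unfolding x_def by (intro sum_nonneg) simp
  have xc: "continuous_on UNIV x"
    unfolding x_def[abs_def] using cpoly_cont[OF q(1)] by (intro continuous_intros)
  have close: "\<bar>x z - (norm (g z))\<^sup>2\<bar> \<le> \<epsilon>" if z: "z \<in> polydisk R2" for z
  proof -
    have t: "\<bar>(cmod (q l z))\<^sup>2 - (cmod (g z $ l))\<^sup>2\<bar> \<le> e' * (2 * S + 1)" for l
    proof -
      have a: "\<bar>cmod (q l z) - cmod (g z $ l)\<bar> \<le> e'"
        using norm_triangle_ineq3[of "q l z" "g z $ l"] q(2)[OF z, of l] by (simp add: norm_minus_commute)
      have "cmod (g z $ l) \<le> S" using S(2)[OF z] Finite_Cartesian_Product.norm_nth_le[of "g z" l] by simp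
      then have b: "cmod (q l z) + cmod (g z $ l) \<le> 2 * S + 1" using a e'(2) by linarith
      have "\<bar>(cmod (q l z))\<^sup>2 - (cmod (g z $ l))\<^sup>2\<bar> = \<bar>cmod (q l z) - cmod (g z $ l)\<bar> * (cmod (q l z) + cmod (g z $ l))"
        by (simp add: power2_eq_square square_diff_square_factored abs_mult mult.commute)
      also have "\<dots> \<le> e' * (2 * S + 1)" using a b by (intro mult_mono) auto
      finally show ?thesis .
    qed
    have "x z - (norm (g z))\<^sup>2 = (\<Sum>l\<in>UNIV. (cmod (q l z))\<^sup>2 - (cmod (g z $ l))\<^sup>2)"
      by (simp add: x_def norm_vec_sq sum_subtractf)
    then have "\<bar>x z - (norm (g z))\<^sup>2\<bar> \<le> (\<Sum>l\<in>UNIV. \<bar>(cmod (q l z))\<^sup>2 - (cmod (g z $ l))\<^sup>2\<bar>)" by (simp only: sum_abs)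
    also have "\<dots> \<le> (\<Sum>l\<in>(UNIV::'j set). e' * (2 * S + 1))" by (intro sum_mono t)
    also have "\<dots> \<le> \<epsilon>" using e'N by (simp add: N_def)
    finally show ?thesis .
  qed
  have e0: "\<epsilon> > 0" "\<epsilon> \<le> \<eta>" using e[of i] by (auto simp: \<epsilon>_def)
  have wc: "continuous_on UNIV (\<lambda>z. (x z + \<epsilon>) powr (- d / 2))"
  proof (intro continuous_intros xc ballI)
    fix z show "x z + \<epsilon> \<noteq> 0" using x0[of z] e0 by simp
  qed
  have int: "integrable lborel (\<lambda>z. indicator (polydisk r) z * (x z + \<epsilon>) powr (- d / 2))"
    by (rule polydisk_cont_integrable[OF wc])
  have "u i z \<le> ennreal (indicator (polydisk r) z * (x z + \<epsilon>) powr (- d / 2))" for z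
  proof (cases "z \<in> polydisk r")
    case True
    then have z2: "z \<in> polydisk R2" "z \<in> polydisk 1" using polydisk_mono[OF r] polydisk_mono[OF r1] by auto
    have "((ext_norm g z)\<^sup>2 + 2 * e i) powr (- d / 2) \<le> (x z + \<epsilon>) powr (- d / 2)"
      using close[OF z2(1)] x0[of z] e0 d z2 by (intro powr_mono2') (auto simp: ext_norm_def \<epsilon>_def)
    then show ?thesis using True by (simp add: u_def ennreal_leI)
  qed (simp add: u_def)
  then have "(\<integral>\<^sup>+ z. u i z \<partial>lborel) \<le> (\<integral>\<^sup>+ z. ennreal (indicator (polydisk r) z * (x z + \<epsilon>) powr (- d / 2)) \<partial>lborel)"
    by (intro nn_integral_mono)
  also have "\<dots> = ennreal (\<integral>z. indicator (polydisk r) z * (x z + \<epsilon>) powr (- d / 2) \<partial>lborel)"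
    by (rule nn_integral_eq_integral[OF int]) simp
  finally have "ennreal c < ennreal (\<integral>z. indicator (polydisk r) z * (x z + \<epsilon>) powr (- d / 2) \<partial>lborel)" using i by (rule less_le_trans[rotated])
  then have "c < (\<integral>z. indicator (polydisk r) z * (x z + \<epsilon>) powr (- d / 2) \<partial>lborel)" using c by (simp add: ennreal_less_iff)
  then show ?thesis using q(1) e0 close unfolding x_def by (intro exI[of _ q] exI[of _ \<epsilon>] conjI ballI allI)
qed

lemma supdist_le:
  assumes "supdist g f < ennreal \<rho>" "z \<in> polydisk 1"
  shows "norm (g z - f z) < \<rho>"
proof -
  have "ennreal (norm (g z - f z)) \<le> supdist g f" unfolding supdist_def using assms(2) by (intro SUP_upper)
  then have "ennreal (norm (g z - f z)) < ennreal \<rho>" using assms(1) by simp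
  then show ?thesis by (simp add: ennreal_less_iff)
qed

lemma negint_uniform_bound:
  fixes f :: "complex^'n \<Rightarrow> complex^'j"
  assumes f: "holo_vec f (polydisk 1)" and \<delta>: "\<delta> > 0" and fin: "negint \<delta> 1 f < \<infinity>" and r: "0 < r" "r < 1"
  shows "\<exists>\<delta>'>\<delta>. \<exists>\<rho>>0. \<exists>C\<ge>0. \<forall>g. holo_vec g (polydisk 1) \<longrightarrow> supdist g f < ennreal \<rho> \<longrightarrow> negint \<delta>' r g \<le> ennreal C"
proof (rule ccontr)
  assume neg: "\<not> ?thesis"
  define a where "a m = 1 / real (Suc m)" for m
  have a: "a m > 0" "a m \<le> 1" for m by (auto simp: a_def)
  have al: "a \<longlonglongrightarrow> 0" using LIMSEQ_inverse_real_of_nat by (simp add: a_def[abs_def] inverse_eq_divide)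
  have "\<exists>g. holo_vec g (polydisk 1) \<and> supdist g f < ennreal (a m) \<and> ennreal (real m) < negint (\<delta> + a m) r g" for m
  proof (rule ccontr)
    assume "\<not> ?thesis"
    then have "\<forall>g. holo_vec g (polydisk 1) \<longrightarrow> supdist g f < ennreal (a m) \<longrightarrow> negint (\<delta> + a m) r g \<le> ennreal (real m)"
      by (auto simp: not_less)
    moreover have "\<delta> + a m > \<delta>" using a by simp
    ultimately show False using neg a(1)[of m] of_nat_0_le_iff[of m] by blast
  qed
  then have "\<forall>m. \<exists>g. holo_vec g (polydisk 1) \<and> supdist g f < ennreal (a m) \<and> ennreal (real m) < negint (\<delta> + a m) r g" by blast
  from choice[OF this] obtain G where G: "\<And>m. holo_vec (G m) (polydisk 1)" "\<And>m. supdist (G m) f < ennreal (a m)" "\<And>m. ennreal (real m) < negint (\<delta> + a m) r (G m)" by auto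
  define R where "R = (2 * r + 1) / 3"
  define R2 where "R2 = (r + 2) / 3"
  have R: "0 < r" "r < R" "R < R2" "R2 < 1" "0 < R2" "r \<le> R2" using r by (auto simp: R_def R2_def)
  define Q where "Q m p \<longleftrightarrow> (\<forall>l::'j. cpoly (fst p l)) \<and> 0 < snd p \<and> snd p \<le> a m \<and>
     (\<forall>z\<in>polydisk R2. \<bar>(\<Sum>l\<in>UNIV. (cmod (fst p l z))\<^sup>2) - (norm (G m z))\<^sup>2\<bar> \<le> snd p) \<and>
     real m < (\<integral>z. indicator (polydisk r) z * ((\<Sum>l\<in>UNIV. (cmod (fst p l z))\<^sup>2) + snd p) powr (- (\<delta> + a m) / 2) \<partial>lborel)" for m p
  have "\<exists>p. Q m p" for m
  proof -
    have da: "\<delta> + a m > 0" using \<delta> a(1)[of m] by simp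
    from poly_vec_approx[OF G(1) R(5,4,6) da a(1)[of m] of_nat_0_le_iff G(3)]
    obtain q \<epsilon> where "(\<forall>l::'j. cpoly (q l)) \<and> 0 < \<epsilon> \<and> \<epsilon> \<le> a m \<and>
     (\<forall>z\<in>polydisk R2. \<bar>(\<Sum>l\<in>UNIV. (cmod (q l z))\<^sup>2) - (norm (G m z))\<^sup>2\<bar> \<le> \<epsilon>) \<and>
     real m < (\<integral>z. indicator (polydisk r) z * ((\<Sum>l\<in>UNIV. (cmod (q l z))\<^sup>2) + \<epsilon>) powr (- (\<delta> + a m) / 2) \<partial>lborel)"
      by (elim exE) (rule that)
    then show ?thesis unfolding Q_def by (intro exI[of _ "(q, \<epsilon>)"]) (unfold fst_conv snd_conv)
  qed
  then have "\<forall>m. \<exists>p. Q m p" by blast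
  from choice[OF this] obtain p where Qp: "\<And>m. Q m (p m)" by blast
  then have p: "\<And>m l. cpoly (fst (p m) (l::'j))" "\<And>m. 0 < snd (p m)" "\<And>m. snd (p m) \<le> a m"
    and pc: "\<And>m z. z \<in> polydisk R2 \<Longrightarrow> \<bar>(\<Sum>l\<in>UNIV. (cmod (fst (p m) l z))\<^sup>2) - (norm (G m z))\<^sup>2\<bar> \<le> snd (p m)"
    and pI: "\<And>m. real m < (\<integral>z. indicator (polydisk r) z * ((\<Sum>l\<in>UNIV. (cmod (fst (p m) l z))\<^sup>2) + snd (p m)) powr (- (\<delta> + a m) / 2) \<partial>lborel)"
    unfolding Q_def by blast+
  define q where "q m = fst (p m)" for m
  define \<epsilon> where "\<epsilon> m = snd (p m)" for m
  define h where "h z = (ext_norm f z)\<^sup>2" for z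
  note [measurable] = ext_norm_measurable[OF f]
  have sub: "polydisk R2 \<subseteq> (polydisk 1 :: (complex^'n) set)" using R by (intro polydisk_mono) simp
  obtain S where S: "S \<ge> 0" "\<And>z. z \<in> polydisk R2 \<Longrightarrow> norm (f z) \<le> S" using holo_vec_bounded[OF f R(4)] by blast
  have Gf: "norm (G m z - f z) \<le> a m" if "z \<in> polydisk R2" for m z
    using supdist_le[OF G(2)] that sub by (intro less_imp_le) blast
  have \<epsilon>l: "\<epsilon> \<longlonglongrightarrow> 0"
    by (rule tendsto_sandwich[OF _ _ tendsto_const al]) (auto simp: \<epsilon>_def p less_imp_le intro!: always_eventually)
  have fz: "AE z in lborel. z \<in> polydisk 1 \<longrightarrow> ext_norm f z > 0" by (rule negint_finite(1)[OF f order_refl fin])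
  have "\<exists>C. \<forall>\<^sub>F m in sequentially. (\<integral>z. indicator (polydisk r) z * ((\<Sum>l\<in>UNIV. (cmod (q m l z))\<^sup>2) + \<epsilon> m) powr (- (\<delta> + a m) / 2) \<partial>lborel) \<le> C"
  \<comment> \<open>The choice of \<open>X\<close>: |G m| <= S + 1 because a m <= 1, and |q_m|^2
    differs from |G m|^2 by at most 1.\<close>
  proof (rule density_integrals_bounded[OF \<delta> R(1-3), where h=h and X="(S + 1)\<^sup>2 + 1"])
    show "h \<in> borel_measurable borel" unfolding h_def[abs_def] by measurable
    show "h z \<ge> 0" for z by (simp add: h_def)
    show "integrable lborel (\<lambda>z. indicator (polydisk R2) z * h z powr (- \<delta> / 2))"
    proof (rule Bochner_Integration.integrable_bound[OF negint_finite(2)[OF f order_refl fin]])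
      show "(\<lambda>z. indicator (polydisk R2) z * h z powr (- \<delta> / 2)) \<in> borel_measurable lborel" unfolding h_def[abs_def] by measurable
      have hp: "h z powr (- \<delta> / 2) = ext_norm f z powr (- \<delta>)" for z
        unfolding h_def by (rule power2_powr_half[OF ext_norm_nonneg])
      show "AE z in lborel. norm (indicator (polydisk R2) z * h z powr (- \<delta> / 2)) \<le> norm (indicator (polydisk 1) z * ext_norm f z powr (- \<delta>))"
        unfolding hp using sub by (intro AE_I2) (auto simp: indicator_def)
    qed
    show "AE z in lborel. z \<in> polydisk R2 \<longrightarrow> h z > 0"
      using fz by eventually_elim (use sub in \<open>auto simp: h_def\<close>)
    show "cpoly (q m l)" for m l unfolding q_def by (rule p(1))
    show "(S + 1)\<^sup>2 + 1 \<ge> 0" by simp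
    show "(\<Sum>l\<in>UNIV. (cmod (q m l z))\<^sup>2) \<le> (S + 1)\<^sup>2 + 1" if z: "z \<in> polydisk R2" for m z
    proof -
      have "norm (G m z) \<le> norm (f z) + norm (G m z - f z)" using norm_triangle_ineq[of "f z" "G m z - f z"] by simp
      then have "norm (G m z) \<le> S + 1" using S(2)[OF z] Gf[OF z, of m] a(2)[of m] by linarith
      then have "(norm (G m z))\<^sup>2 \<le> (S + 1)\<^sup>2" by (intro power_mono) auto
      then show ?thesis using pc[OF z, of m] p(3)[of m] a(2)[of m] unfolding q_def by linarith
    qed
    show "(\<lambda>m. \<Sum>l\<in>UNIV. (cmod (q m l z))\<^sup>2) \<longlonglongrightarrow> h z" if z: "z \<in> polydisk R2" for z
    proof -
      have "(\<lambda>m. G m z - f z) \<longlonglongrightarrow> 0" by (rule Lim_null_comparison[OF _ al]) (use Gf[OF z] in auto)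
      then have "(\<lambda>m. (norm (G m z))\<^sup>2) \<longlonglongrightarrow> (norm (f z))\<^sup>2"
        by (intro tendsto_power tendsto_norm) (simp only: LIM_zero_iff)
      moreover have "(\<lambda>m. (\<Sum>l\<in>UNIV. (cmod (q m l z))\<^sup>2) - (norm (G m z))\<^sup>2) \<longlonglongrightarrow> 0"
        by (rule Lim_null_comparison[OF _ \<epsilon>l]) (use pc[OF z] in \<open>auto simp: q_def \<epsilon>_def\<close>)
      ultimately have "(\<lambda>m. ((\<Sum>l\<in>UNIV. (cmod (q m l z))\<^sup>2) - (norm (G m z))\<^sup>2) + (norm (G m z))\<^sup>2) \<longlonglongrightarrow> 0 + (norm (f z))\<^sup>2"
        by (intro tendsto_add)
      then show ?thesis using z sub by (auto simp: h_def ext_norm_def)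
    qed
    show "\<epsilon> m > 0" for m by (simp add: \<epsilon>_def p)
    show "\<epsilon> m \<le> 1" for m using p(3)[of m] a(2)[of m] by (simp add: \<epsilon>_def)
    show "\<epsilon> \<longlonglongrightarrow> 0" by (rule \<epsilon>l)
    show "\<delta> + a m > 0" for m using \<delta> a(1)[of m] by simp
    show "\<delta> + a m \<le> \<delta> + 1" for m using a(2)[of m] by simp
    show "(\<lambda>m. \<delta> + a m) \<longlonglongrightarrow> \<delta>" using tendsto_add[OF tendsto_const[of \<delta>] al] by simp
  qed
  then obtain C m0 where C: "\<And>m. m \<ge> m0 \<Longrightarrow> (\<integral>z. indicator (polydisk r) z * ((\<Sum>l\<in>UNIV. (cmod (q m l z))\<^sup>2) + \<epsilon> m) powr (- (\<delta> + a m) / 2) \<partial>lborel) \<le> C"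
    unfolding eventually_sequentially by blast
  obtain m1 :: nat where m1: "C < real m1" using reals_Archimedean2 by blast
  have "real (max m0 m1) < C" using pI[of "max m0 m1"] C[of "max m0 m1"] unfolding q_def \<epsilon>_def by (rule_tac less_le_trans) auto
  then show False using m1 by simp
qed

text \<open>The full integral is compared with the truncated integral \<open>H\<close> of max(|g|,
  \<theta>)^(-\<delta>), for g and for f alike, through the uniform bound at exponent
  \<open>\<delta>'\<close>; truncated integrals are compared by uniform continuity. Each of the
  three errors is below \<tau>/4.\<close>

theorem theorem6:
  fixes f :: "complex^'n \<Rightarrow> complex^'j" and \<delta> r :: real
  assumes hol: "holo_vec f (polydisk 1)"
    and dpos: "\<delta> > 0"
    and fin: "negint \<delta> 1 f < \<infinity>"
    and cases: "CARD('n) = 1 \<or> CARD('n) = 2 \<or>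
                (CARD('n) = 3 \<and> (min_vanishing_order f = 0 \<or> \<delta> < 4 / real (min_vanishing_order f)))"
    and r: "0 < r" "r < 1"
  shows "\<forall>\<tau>>0. \<exists>\<rho>>0. \<forall>g. holo_vec g (polydisk 1) \<and> supdist g f < ennreal \<rho> \<longrightarrow>
            negint \<delta> r g < \<infinity> \<and>
            \<bar>enn2real (negint \<delta> r g) - enn2real (negint \<delta> r f)\<bar> < \<tau>"
proof (intro allI impI)
  fix \<tau> :: real assume \<tau>: "\<tau> > 0"
  obtain \<delta>' \<rho>0 C where d': "\<delta>' > \<delta>" and \<rho>0: "\<rho>0 > 0" and C: "C \<ge> 0"
    and bd: "\<And>g :: complex^'n \<Rightarrow> complex^'j. holo_vec g (polydisk 1) \<Longrightarrow> supdist g f < ennreal \<rho>0 \<Longrightarrow> negint \<delta>' r g \<le> ennreal C"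
    using negint_uniform_bound[OF hol dpos fin r] by blast
  define s where "s = \<delta>' - \<delta>"
  have s: "s > 0" using d' by (simp add: s_def)
  have r1: "r \<le> 1" using r by simp
  \<comment> \<open>\<open>\<theta>\<close> is chosen with \<theta>^s <= b, so that the truncation
    error \<theta>^s C is below \<tau>/4; C + 1 instead of C covers the case C = 0.\<close>
  define b where "b = \<tau> / (4 * (C + 1))"
  have b: "b > 0" using \<tau> C by (simp add: b_def)
  define \<theta> where "\<theta> = min 1 (b powr (1 / s))"
  have \<theta>: "0 < \<theta>" "\<theta> \<le> 1" using b by (auto simp: \<theta>_def)
  have "\<theta> powr s \<le> (b powr (1 / s)) powr s" using \<theta> s by (intro powr_mono2) (auto simp: \<theta>_def)
  also have "\<dots> = b" using s b by (simp add: powr_powr)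
  finally have "\<theta> powr s * C \<le> b * C" using C by (intro mult_right_mono)
  also have "\<dots> < \<tau> / 4" using \<tau> C by (simp add: b_def field_simps)
  finally have \<theta>C: "\<theta> powr s * C < \<tau> / 4" .
  define V where "V = integral\<^sup>L lborel (\<lambda>z::complex^'n. indicator (polydisk r) z :: real)"
  have V: "V \<ge> 0" unfolding V_def by (intro integral_nonneg_AE) auto
  define H where "H g = (\<integral>z. indicator (polydisk r) z * (max (ext_norm g z) \<theta>) powr (- \<delta>) \<partial>lborel)" for g :: "complex^'n \<Rightarrow> complex^'j"
  have iH: "integrable lborel (\<lambda>z. indicator (polydisk r) z * (max (ext_norm g z) \<theta>) powr (- \<delta>))"
    if "holo_vec g (polydisk 1)" for g :: "complex^'n \<Rightarrow> complex^'j"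
  proof (rule polydisk_integrable[where C="\<theta> powr (- \<delta>)"])
    note [measurable] = ext_norm_measurable[OF that]
    show "(\<lambda>z. (max (ext_norm g z) \<theta>) powr (- \<delta>)) \<in> borel_measurable borel" by measurable
    show "\<bar>(max (ext_norm g z) \<theta>) powr (- \<delta>)\<bar> \<le> \<theta> powr (- \<delta>)" for z
      using \<theta> dpos powr_mono2'[of "- \<delta>" \<theta> "max (ext_norm g z) \<theta>"] by simp
  qed
  have main: "negint \<delta> r g < \<infinity>" "\<bar>enn2real (negint \<delta> r g) - H g\<bar> < \<tau> / 4"
    if g: "holo_vec g (polydisk 1)" and sd: "supdist g f < ennreal \<rho>0" for g :: "complex^'n \<Rightarrow> complex^'j"
  proof -
    note [measurable] = ext_norm_measurable[OF g]
    have fin': "negint \<delta>' r g < \<infinity>" using bd[OF g sd] by (rule le_less_trans) simp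
    note nf = negint_finite[OF g r1 fin']
    \<comment> \<open>The cases t >= 1 and t < 1 are bounded by the two summands; on a set of finite
      measure, finiteness at the larger exponent gives it at the smaller one.\<close>
    have le1: "t powr (- \<delta>) \<le> 1 + t powr (- \<delta>')" if t: "t > 0" for t :: real
    proof (cases "t \<ge> 1")
      case True
      then have "t powr (- \<delta>) \<le> 1 powr (- \<delta>)" using dpos by (intro powr_mono2') auto
      then show ?thesis using powr_ge_zero[of t "- \<delta>'"] by (simp only: powr_one_eq_one)
    next
      case False
      then have "t powr (- \<delta>) \<le> t powr (- \<delta>')" using t d' by (intro powr_mono') auto
      then show ?thesis by simp
    qed
    have "negint \<delta> r g \<le> (\<integral>\<^sup>+ z. ennreal (indicator (polydisk r) z + indicator (polydisk r) z * ext_norm g z powr (- \<delta>')) \<partial>lborel)"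
      unfolding negint_ext[OF r1]
    proof (rule nn_integral_mono_AE)
      show "AE z in lborel. indicator (polydisk r) z * negpow \<delta> (ext_norm g z) \<le> ennreal (indicator (polydisk r) z + indicator (polydisk r) z * ext_norm g z powr (- \<delta>'))"
        using nf(1)
      proof eventually_elim
        case (elim z)
        show ?case
        proof (cases "z \<in> polydisk r")
          case True
          then have "ext_norm g z > 0" using elim by blast
          then show ?thesis using True ennreal_leI[OF le1[of "ext_norm g z"]] by (simp add: negpow_def)
        qed simp
      qed
    qed
    also have "\<dots> = ennreal (\<integral>z. indicator (polydisk r) z + indicator (polydisk r) z * ext_norm g z powr (- \<delta>') \<partial>lborel)"
      by (intro nn_integral_eq_integral Bochner_Integration.integrable_add polydisk_indicator_integrable nf(2)) simp
    finally show fin\<delta>: "negint \<delta> r g < \<infinity>" by (rule le_less_trans) simp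
    note nd = negint_finite[OF g r1 fin\<delta>]
    define I where "I = (\<integral>z. indicator (polydisk r) z * ext_norm g z powr (- \<delta>) \<partial>lborel)"
    have I0: "I \<ge> 0" unfolding I_def by (intro integral_nonneg_AE AE_I2) simp
    have eI: "enn2real (negint \<delta> r g) = I" unfolding nd(3) I_def[symmetric] using I0 by simp
    define I' where "I' = (\<integral>z. indicator (polydisk r) z * ext_norm g z powr (- \<delta>') \<partial>lborel)"
    have I'C: "I' \<le> C" using bd[OF g sd] C unfolding nf(3) I'_def[symmetric] by (simp add: ennreal_le_iff)
    have "\<bar>I - H g\<bar> = \<bar>\<integral>z. indicator (polydisk r) z * ext_norm g z powr (- \<delta>) - indicator (polydisk r) z * (max (ext_norm g z) \<theta>) powr (- \<delta>) \<partial>lborel\<bar>"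
      unfolding I_def H_def by (simp only: Bochner_Integration.integral_diff[OF nd(2) iH[OF g]])
    also have "\<dots> \<le> (\<integral>z. \<bar>indicator (polydisk r) z * ext_norm g z powr (- \<delta>) - indicator (polydisk r) z * (max (ext_norm g z) \<theta>) powr (- \<delta>)\<bar> \<partial>lborel)"
      by (rule integral_abs_bound)
    also have "\<dots> \<le> (\<integral>z. \<theta> powr s * (indicator (polydisk r) z * ext_norm g z powr (- \<delta>')) \<partial>lborel)"
    proof (rule integral_mono_AE)
      show "integrable lborel (\<lambda>z. \<bar>indicator (polydisk r) z * ext_norm g z powr (- \<delta>) - indicator (polydisk r) z * (max (ext_norm g z) \<theta>) powr (- \<delta>)\<bar>)"
        by (intro integrable_abs Bochner_Integration.integrable_diff nd(2) iH g)
      show "integrable lborel (\<lambda>z. \<theta> powr s * (indicator (polydisk r) z * ext_norm g z powr (- \<delta>')))"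
        by (intro integrable_mult_right nf(2))
      show "AE z in lborel. \<bar>indicator (polydisk r) z * ext_norm g z powr (- \<delta>) - indicator (polydisk r) z * (max (ext_norm g z) \<theta>) powr (- \<delta>)\<bar>
          \<le> \<theta> powr s * (indicator (polydisk r) z * ext_norm g z powr (- \<delta>'))"
        using nf(1)
      proof eventually_elim
        case (elim z)
        show ?case
        proof (cases "z \<in> polydisk r")
          case True
          define t where "t = ext_norm g z"
          have t: "t > 0" using elim True by (simp add: t_def)
          \<comment> \<open>The difference vanishes for t >= \<theta>; below \<theta> it is at most
            t^(-\<delta>) = t^s t^(-\<delta>'), and t^s <= \<theta>^s.\<close>
          have "\<bar>t powr (- \<delta>) - (max t \<theta>) powr (- \<delta>)\<bar> \<le> \<theta> powr s * t powr (- \<delta>')"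
          proof (cases "t \<ge> \<theta>")
            case True
            then have "max t \<theta> = t" by simp
            then show ?thesis by simp
          next
            case False
            have "(max t \<theta>) powr (- \<delta>) \<le> t powr (- \<delta>)" using t dpos by (intro powr_mono2') auto
            moreover have "(max t \<theta>) powr (- \<delta>) \<ge> 0" by simp
            moreover have "t powr (- \<delta>) = t powr s * t powr (- \<delta>')" using t by (simp add: powr_add[symmetric] s_def)
            moreover have "t powr s * t powr (- \<delta>') \<le> \<theta> powr s * t powr (- \<delta>')"
              using False t s by (intro mult_right_mono powr_mono2) auto
            ultimately show ?thesis by linarith
          qed
          then show ?thesis using True by (simp add: t_def)
        qed simp
      qed
    qed
    also have "\<dots> = \<theta> powr s * I'" unfolding I'_def by (rule integral_mult_right_zero)
    also have "\<dots> \<le> \<theta> powr s * C" using I'C by (intro mult_left_mono) auto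
    finally show "\<bar>enn2real (negint \<delta> r g) - H g\<bar> < \<tau> / 4" unfolding eI using \<theta>C by linarith
  qed
  obtain S where S: "S \<ge> 0" "\<And>z. z \<in> polydisk r \<Longrightarrow> norm (f z) \<le> S" using holo_vec_bounded[OF hol r(2)] by blast
  define e where "e = \<tau> / (4 * (V + 1))"
  have e: "e > 0" using \<tau> V by (simp add: e_def)
  have eV: "e * V < \<tau> / 4" using \<tau> V by (simp add: e_def field_simps)
  \<comment> \<open>The interval contains all truncated norms of f and of nearby g on the polydisk,
    and it stays away from the singularity at 0.\<close>
  have "uniformly_continuous_on {\<theta>..S + 1} (\<lambda>t. t powr (- \<delta>))"
    by (intro compact_uniformly_continuous continuous_intros) (use \<theta> in auto)
  then obtain \<rho>1 where \<rho>1: "\<rho>1 > 0"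
    and uc: "\<And>t t'. t \<in> {\<theta>..S + 1} \<Longrightarrow> t' \<in> {\<theta>..S + 1} \<Longrightarrow> dist t' t < \<rho>1 \<Longrightarrow> dist (t' powr (- \<delta>)) (t powr (- \<delta>)) < e"
    unfolding uniformly_continuous_on_def using e by meson
  define \<rho> where "\<rho> = min \<rho>0 (min \<rho>1 1)"
  have \<rho>: "\<rho> > 0" "\<rho> \<le> \<rho>0" "\<rho> \<le> \<rho>1" "\<rho> \<le> 1" using \<rho>0 \<rho>1 by (auto simp: \<rho>_def)
  \<comment> \<open>f lies in its own neighbourhood, so the truncation estimate applies to it as
    well.\<close>
  have "supdist f f \<le> 0" unfolding supdist_def by (intro SUP_least) simp
  then have ff: "supdist f f < ennreal \<rho>0" using \<rho>0 by (simp add: le_less_trans)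
  have "negint \<delta> r g < \<infinity> \<and> \<bar>enn2real (negint \<delta> r g) - enn2real (negint \<delta> r f)\<bar> < \<tau>"
    if g: "holo_vec g (polydisk 1)" and sd: "supdist g f < ennreal \<rho>" for g
  proof -
    have sd0: "supdist g f < ennreal \<rho>0" using sd ennreal_leI[OF \<rho>(2)] by (rule less_le_trans)
    have "\<bar>H g - H f\<bar> = \<bar>\<integral>z. indicator (polydisk r) z * (max (ext_norm g z) \<theta>) powr (- \<delta>) - indicator (polydisk r) z * (max (ext_norm f z) \<theta>) powr (- \<delta>) \<partial>lborel\<bar>"
      unfolding H_def by (simp only: Bochner_Integration.integral_diff[OF iH[OF g] iH[OF hol]])
    also have "\<dots> \<le> (\<integral>z. \<bar>indicator (polydisk r) z * (max (ext_norm g z) \<theta>) powr (- \<delta>) - indicator (polydisk r) z * (max (ext_norm f z) \<theta>) powr (- \<delta>)\<bar> \<partial>lborel)"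
      by (rule integral_abs_bound)
    also have "\<dots> \<le> integral\<^sup>L lborel (\<lambda>z::complex^'n. e * indicator (polydisk r) z)"
    proof (rule integral_mono)
      show "integrable lborel (\<lambda>z. \<bar>indicator (polydisk r) z * (max (ext_norm g z) \<theta>) powr (- \<delta>) - indicator (polydisk r) z * (max (ext_norm f z) \<theta>) powr (- \<delta>)\<bar>)"
        by (intro integrable_abs Bochner_Integration.integrable_diff iH g hol)
      show "integrable lborel (\<lambda>z::complex^'n. e * indicator (polydisk r) z)"
        by (intro integrable_mult_right polydisk_indicator_integrable)
      show "\<bar>indicator (polydisk r) z * (max (ext_norm g z) \<theta>) powr (- \<delta>) - indicator (polydisk r) z * (max (ext_norm f z) \<theta>) powr (- \<delta>)\<bar> \<le> e * indicator (polydisk r) z" for z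
      proof (cases "z \<in> polydisk r")
        case True
        then have z1: "z \<in> polydisk 1" using polydisk_mono[OF r1] by blast
        have n: "norm (g z - f z) < \<rho>" by (rule supdist_le[OF sd z1])
        have a: "\<bar>norm (g z) - norm (f z)\<bar> < \<rho>" using norm_triangle_ineq3[of "g z" "f z"] n by linarith
        have "dist ((max (norm (g z)) \<theta>) powr (- \<delta>)) ((max (norm (f z)) \<theta>) powr (- \<delta>)) < e"
        proof (rule uc)
          show "max (norm (f z)) \<theta> \<in> {\<theta>..S + 1}" using S(1) S(2)[OF True] \<theta> by auto
          have "norm (g z) \<le> S + 1" using a S(2)[OF True] \<rho> by linarith
          then show "max (norm (g z)) \<theta> \<in> {\<theta>..S + 1}" using S(1) \<theta> by auto
          have "\<bar>max (norm (g z)) \<theta> - max (norm (f z)) \<theta>\<bar> \<le> \<bar>norm (g z) - norm (f z)\<bar>" by (simp add: max_def)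
          then show "dist (max (norm (g z)) \<theta>) (max (norm (f z)) \<theta>) < \<rho>1" using a \<rho> by (simp add: dist_real_def)
        qed
        then show ?thesis using True z1 by (simp add: dist_real_def ext_norm_def)
      qed simp
    qed
    also have "\<dots> = e * V" unfolding V_def by (rule integral_mult_right_zero)
    finally have "\<bar>H g - H f\<bar> < \<tau> / 4" using eV by linarith
    then show ?thesis using main[OF g sd0] main(2)[OF hol ff] \<tau> by (intro conjI) linarith+
  qed
  then show "\<exists>\<rho>>0. \<forall>g. holo_vec g (polydisk 1) \<and> supdist g f < ennreal \<rho> \<longrightarrow>
            negint \<delta> r g < \<infinity> \<and> \<bar>enn2real (negint \<delta> r g) - enn2real (negint \<delta> r f)\<bar> < \<tau>"
    using \<rho>(1) by blast
qed

end
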